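(* Let $n\ge 2$, let $p\in[1,\infty)$, let $\Omega\subset\mathbb{R}^n$ be open, let $K\subset\Omega$ be compact with $\overline{\operatorname{int}(K)}=K\neq\emptyset$, and fix $\bar A\in\mathrm{Sym}^+(n)$. Let \[ Y_{p,K}=\{A\in L^p(\Omega,\mathrm{Sym}^+(n)) : \operatorname{div}(A)\in L^p(\Omega,\mathbb{R}^n),\ A\equiv \bar A \text{ outside } K\}, \] endowed with the (complete) metric $d(A,B)=\|A-B\|_{L^p}+\|\operatorname{div}(A-B)\|_{L^p}$. Let $p^*=\max\left\{0,\frac{p(n-1)-n}{p(n-1)}\right\}$. Then the set \[ D_{p,K}=\left\{A\in Y_{p,K} : \det(A)^{\frac{1}{n-1}}\in L^{\frac{1}{1-p^*}}(\Omega)\setminus L^{\frac{1}{1-p^*}+\varepsilon}(\Omega)\ \text{for every } \varepsilon>0\right\} \] is residual in $(Y_{p,K},d)$, i.e. its complement is a countable union of closed sets with empty interior.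
   Context: $\mathrm{Sym}^+(n)$ denotes the set of symmetric non-negative definite real $n\times n$ matrices. The divergence of a matrix field $A=(A_{ij})$ is the vector field with components $\sum_j \partial_j A_{ij}$, taken in the distributional sense. *)

theory Defs
  imports "HOL-Analysis.Analysis"
begin

definition Sym_plus :: "(real^'n^'n) set" where
  "Sym_plus = {M. transpose M = M \<and> (\<forall>v. 0 \<le> v \<bullet> (M *v v))}"

text \<open>Membership in L^p(Omega) (functions are representatives of classes).\<close>
definition Lp_on :: "real \<Rightarrow> 'a::euclidean_space set \<Rightarrow> ('a \<Rightarrow> 'b::euclidean_space) \<Rightarrow> bool" where
  "Lp_on p \<Omega> f \<longleftrightarrow> f \<in> borel_measurable (lebesgue_on \<Omega>) \<and>
      integrable (lebesgue_on \<Omega>) (\<lambda>x. norm (f x) powr p)"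

definition Lp_norm :: "real \<Rightarrow> 'a::euclidean_space set \<Rightarrow> ('a \<Rightarrow> 'b::euclidean_space) \<Rightarrow> real" where
  "Lp_norm p \<Omega> f = (\<integral>x. norm (f x) powr p \<partial>lebesgue_on \<Omega>) powr (1 / p)"

definition partial_deriv :: "'n::finite \<Rightarrow> (real^'n \<Rightarrow> real) \<Rightarrow> real^'n \<Rightarrow> real" where
  "partial_deriv j f x = (THE d. ((\<lambda>t. f (x + t *\<^sub>R axis j 1)) has_real_derivative d) (at 0))"

fun iter_partial :: "'n::finite list \<Rightarrow> (real^'n \<Rightarrow> real) \<Rightarrow> real^'n \<Rightarrow> real" where
  "iter_partial [] f = f"
| "iter_partial (j # js) f = partial_deriv j (iter_partial js f)"

definition smooth_fun :: "(real^'n::finite \<Rightarrow> real) \<Rightarrow> bool" where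
  "smooth_fun f \<longleftrightarrow> (\<forall>js. continuous_on UNIV (iter_partial js f) \<and>
      (\<forall>j x. \<exists>d. ((\<lambda>t. iter_partial js f (x + t *\<^sub>R axis j 1)) has_real_derivative d) (at 0)))"

definition test_fun :: "(real^'n::finite) set \<Rightarrow> (real^'n \<Rightarrow> real) \<Rightarrow> bool" where
  "test_fun \<Omega> \<phi> \<longleftrightarrow> smooth_fun \<phi> \<and> compact (closure {x. \<phi> x \<noteq> 0})
      \<and> closure {x. \<phi> x \<noteq> 0} \<subseteq> \<Omega>"

definition is_weak_div :: "(real^'n::finite) set \<Rightarrow> (real^'n \<Rightarrow> real^'n^'n) \<Rightarrow> (real^'n \<Rightarrow> real^'n) \<Rightarrow> bool" where
  "is_weak_div \<Omega> A g \<longleftrightarrow> (\<forall>\<phi>. test_fun \<Omega> \<phi> \<longrightarrow> (\<forall>i.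
      (\<integral>x. (\<Sum>j\<in>UNIV. A x $ i $ j * partial_deriv j \<phi> x) \<partial>lebesgue_on \<Omega>)
        = - (\<integral>x. g x $ i * \<phi> x \<partial>lebesgue_on \<Omega>)))"

text \<open>The divergence, chosen among L^p representatives (unique a.e.).\<close>
definition weak_div :: "real \<Rightarrow> (real^'n::finite) set \<Rightarrow> (real^'n \<Rightarrow> real^'n^'n) \<Rightarrow> real^'n \<Rightarrow> real^'n" where
  "weak_div p \<Omega> A = (SOME g. Lp_on p \<Omega> g \<and> is_weak_div \<Omega> A g)"

definition Y_space :: "real \<Rightarrow> (real^'n::finite) set \<Rightarrow> (real^'n) set \<Rightarrow> real^'n^'n
     \<Rightarrow> (real^'n \<Rightarrow> real^'n^'n) set" where
  "Y_space p \<Omega> K Abar = {A. Lp_on p \<Omega> A \<and> (AE x in lebesgue_on \<Omega>. A x \<in> Sym_plus)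
      \<and> (\<exists>g. Lp_on p \<Omega> g \<and> is_weak_div \<Omega> A g)
      \<and> (AE x in lebesgue_on \<Omega>. x \<notin> K \<longrightarrow> A x = Abar)}"

definition Y_dist :: "real \<Rightarrow> (real^'n::finite) set \<Rightarrow> (real^'n \<Rightarrow> real^'n^'n)
     \<Rightarrow> (real^'n \<Rightarrow> real^'n^'n) \<Rightarrow> real" where
  "Y_dist p \<Omega> A B = Lp_norm p \<Omega> (\<lambda>x. A x - B x) + Lp_norm p \<Omega> (weak_div p \<Omega> (\<lambda>x. A x - B x))"

definition closed_wrt :: "'a set \<Rightarrow> ('a \<Rightarrow> 'a \<Rightarrow> real) \<Rightarrow> 'a set \<Rightarrow> bool" where
  "closed_wrt Y d F \<longleftrightarrow> F \<subseteq> Y \<and>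
     (\<forall>A\<in>Y. (\<forall>e>0. \<exists>B\<in>F. d A B < e) \<longrightarrow> A \<in> F)"

definition empty_interior_wrt :: "'a set \<Rightarrow> ('a \<Rightarrow> 'a \<Rightarrow> real) \<Rightarrow> 'a set \<Rightarrow> bool" where
  "empty_interior_wrt Y d F \<longleftrightarrow> (\<forall>A\<in>F. \<forall>e>0. \<exists>B\<in>Y - F. d A B < e)"

definition residual_wrt :: "'a set \<Rightarrow> ('a \<Rightarrow> 'a \<Rightarrow> real) \<Rightarrow> 'a set \<Rightarrow> bool" where
  "residual_wrt Y d D \<longleftrightarrow> D \<subseteq> Y \<and> (\<exists>F :: nat \<Rightarrow> 'a set.
      Y - D = (\<Union>k. F k) \<and> (\<forall>k. closed_wrt Y d (F k) \<and> empty_interior_wrt Y d (F k)))"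

end

theory Submission
  imports Defs
begin

text \<open>The complement of the set is the union over \<open>m, l\<close> of the sublevel sets
  \<open>\<integral> (det A) powr ((q + 1/(m+1))/(n-1)) \<le> l\<close>, once every admissible field has
  \<open>(det A) powr (1/(n-1))\<close> in \<open>L\<^sup>q\<close>. For \<open>p \<ge> n/(n-1)\<close> this is the trivial bound of \<open>det A\<close> by
  \<open>norm A ^ n\<close>; for smaller \<open>p\<close>, where \<open>q = 1\<close>, it is Serre's compensated integrability, proved
  here by comparing the field with the Hessian of a convex potential that solves a semidiscrete
  optimal transport problem onto a cube. The sublevel sets are closed by Fatou's lemma. They have
  empty interior since one can add a small multiple of a cut-off, regularised version of a
  divergence-free field with a point singularity \<open>norm x powr (- \<alpha>)\<close>; the exponent \<open>\<alpha>\<close> is chosen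
  such that the field stays bounded in \<open>L\<^sup>p\<close> while its determinant integral diverges.\<close>

section \<open>Positive semidefinite matrices\<close>

text \<open>The classical proof of compensated integrability solves the Monge-Ampere equation det
  D^2 phi = (det A)^(1/(n-1)) and combines tr (A D^2 phi) >= n (det A)^(1/(n-1)), from the
  arithmetic-geometric mean inequality, with one integration by parts. There the gradient is bounded
  by the side R of the target cube, R^n being the integral F of (det A)^(1/(n-1)); the bound F <= C
  F^(1/n) |div A| is then solved for F. The obstacle is the regularity of phi. Discretised data
  avoid it: only lower bounds for volumes of subgradient cells and for second differences are kept,
  at the price of a non-sharp constant, and mollification supplies a C^2 function for the
  integration by parts. The exponents come from scaling. The singular field has determinant of order
  |x|^(-n \<alpha>), whose power s/(n-1) has infinite integral once \<alpha> s >= n-1; L^p asks for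
  \<alpha> p < n and positivity for \<alpha> < n-1. With \<alpha> = (n-1)/b this allows every b <= s
  above both 1 and p(n-1)/n.\<close>

lemma det_shear:
  fixes m n :: "'n::finite"
  assumes "m \<noteq> n"
  shows "det (matrix (\<lambda>x::real^'n. \<chi> i. if i = m then x$m + x$n else x$i)) = 1"
proof -
  have "matrix (\<lambda>x::real^'n. \<chi> i. if i = m then x$m + x$n else x$i)
      = (\<chi> k. if k = m then row m (mat 1) + 1 *s row n (mat 1) else row k (mat 1))"
    by (auto simp: vec_eq_iff matrix_def row_def mat_def axis_def)
  also have "det \<dots> = det (mat 1 :: real^'n^'n)" using assms by (rule det_row_operation)
  finally show ?thesis by simp
qed

lemma linear_shear: "linear (\<lambda>x::real^'n. \<chi> i. if i = m then x$m + x$n else x$i)"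
  by (rule linearI) (auto simp: algebra_simps plus_vec_def scaleR_vec_def vec_eq_iff)

lemma linear_stretch: "linear (\<lambda>x::real^'n. \<chi> i. c i * x$i)"
  by (rule linearI) (auto simp: algebra_simps plus_vec_def scaleR_vec_def vec_eq_iff)

lemma measure_shear_cbox:
  fixes a b :: "real^'n::finite"
  assumes "m \<noteq> n"
  defines "h \<equiv> (\<lambda>x::real^'n. \<chi> i. if i = m then x$m + x$n else x$i)"
  shows "measure lebesgue (h ` cbox a b) = measure lebesgue (cbox a b)"
proof (cases "cbox a b = {}")
  case False
  have lin: "linear h" unfolding h_def by (rule linear_shear)
  \<comment> \<open>Moving the lower corner to the origin meets the sign condition on the corner in
    \<open>measure_shear_interval\<close>.\<close>
  have box: "cbox a b = (+) a ` cbox 0 (b - a)" by (simp add: cbox_translation[symmetric])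
  have "h ` cbox a b = (+) (h a) ` h ` cbox 0 (b - a)"
    unfolding box image_comp o_def by (simp add: linear_add[OF lin])
  then have "measure lebesgue (h ` cbox a b) = measure lebesgue (h ` cbox 0 (b - a))"
    by (simp only: measure_translation)
  also have "\<dots> = measure lebesgue (cbox 0 (b - a))"
    unfolding h_def using assms False by (intro measure_shear_interval) (auto simp: box)
  also have "\<dots> = measure lebesgue (cbox a b)" unfolding box by (simp only: measure_translation)
  finally show ?thesis .
qed simp

text \<open>The library has this only for well-ordered index types. A transposition is written below
  as a product of shears and reflections, which spares its separate treatment.\<close>
lemma measure_linear_image_finite:
  fixes f :: "real^'n::finite \<Rightarrow> real^'n"
  assumes "linear f" "S \<in> lmeasurable"
  shows "f ` S \<in> lmeasurable" "measure lebesgue (f ` S) = \<bar>det (matrix f)\<bar> * measure lebesgue S"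
proof -
  define P where "P f \<longleftrightarrow> (\<forall>S\<in>lmeasurable. f ` S \<in> lmeasurable \<and>
      measure lebesgue (f ` S) = \<bar>det (matrix f)\<bar> * measure lebesgue S)" for f :: "real^'n \<Rightarrow> real^'n"
  have comp: "P (f \<circ> g)" if "linear f" "linear g" "P f" "P g" for f g
  proof -
    have "(f \<circ> g) ` S = f ` (g ` S)" for S by (rule image_comp[symmetric])
    moreover have "det (matrix (f \<circ> g)) = det (matrix f) * det (matrix g)"
      by (simp only: matrix_compose[OF that(2,1)] det_mul)
    ultimately show ?thesis using that(3,4) unfolding P_def by (simp add: abs_mult)
  qed
  have stretch: "P (\<lambda>x. \<chi> i. c i * x$i)" for c
  proof -
    have "det (matrix (\<lambda>x::real^'n. \<chi> i. c i * x$i)) = prod c UNIV"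
      by (subst det_diagonal) (simp_all add: matrix_def axis_def)
    then show ?thesis unfolding P_def by (simp add: measurable_stretch measure_stretch)
  qed
  have shear: "P (\<lambda>x. \<chi> i. if i = m then x$m + x$n else x$i)" if "m \<noteq> n" for m n
    unfolding P_def det_shear[OF that]
  proof
    fix S :: "(real^'n) set" assume "S \<in> lmeasurable"
    from measure_linear_sufficient[OF linear_shear this, of m n 1] measure_shear_cbox[OF that]
    show "(\<lambda>x. \<chi> i. if i = m then x$m + x$n else x$i) ` S \<in> lmeasurable \<and>
       measure lebesgue ((\<lambda>x. \<chi> i. if i = m then x$m + x$n else x$i) ` S) = \<bar>1\<bar> * measure lebesgue S"
      by simp
  qed
  have "P f" using \<open>linear f\<close>
  proof (rule induct_linear_elementary)
    fix f :: "real^'n \<Rightarrow> real^'n" and i assume f: "linear f" "\<And>x. f x $ i = 0"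
    then have "\<not> surj f" unfolding surj_def by (metis vec_component zero_neq_one)
    then have inj: "\<not> inj f" using f(1) linear_injective_imp_surjective by blast
    then have "det (matrix f) = 0" using det_nz_iff_inj[OF f(1)] by blast
    moreover have "negligible (f ` S)" for S
      by (rule negligible_linear_singular_image[OF f(1) inj])
    ultimately show "P f" by (auto simp: P_def negligible_iff_measure)
  next
    fix m n :: 'n assume mn: "m \<noteq> n"
    define T where "T m n = (\<lambda>x::real^'n. \<chi> i. if i = m then x$m + x$n else x$i)" for m n
    define N where "N m = (\<lambda>x::real^'n. \<chi> i. (if i = m then - 1 else 1) * x$i)" for m
    have l: "linear (T m n)" "linear (N m)" for m n
      unfolding T_def N_def by (rule linear_shear linear_stretch)+
    have p: "P (T m n)" "P (T n m)" "P (N m)" "P (N n)"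
      unfolding T_def N_def by (rule shear stretch mn mn[symmetric])+
    \<comment> \<open>On the coordinates (m, n) the factors act, from the innermost outwards, as (a,
      b) -> (a+b, b) -> (-a-b, b) -> (-a-b, -a) -> (a+b, -a) -> (b, -a) -> (b, a).\<close>
    have eq: "(\<lambda>x::real^'n. \<chi> i. x $ Transposition.transpose m n i)
        = N n \<circ> (T m n \<circ> (N m \<circ> (T n m \<circ> (N m \<circ> T m n))))"
      using mn by (auto simp: fun_eq_iff vec_eq_iff T_def N_def Transposition.transpose_def)
    show "P (\<lambda>x::real^'n. \<chi> i. x $ Transposition.transpose m n i)"
      unfolding eq by (intro comp l linear_compose p)
  next
    fix f g assume "linear f" "linear g" "P f" "P g" then show "P (f \<circ> g)" by (rule comp)
  qed (use stretch shear in blast)+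
  then show "f ` S \<in> lmeasurable" "measure lebesgue (f ` S) = \<bar>det (matrix f)\<bar> * measure lebesgue S"
    using assms(2) by (auto simp: P_def)
qed

lemma measure_matrix_image:
  fixes A :: "real^'n::finite^'n"
  assumes "S \<in> lmeasurable"
  shows "(*v) A ` S \<in> lmeasurable" "measure lebesgue ((*v) A ` S) = \<bar>det A\<bar> * measure lebesgue S"
  using measure_linear_image_finite[OF matrix_vector_mul_linear assms, of A] by simp_all

section \<open>Quadratic forms, factorisation and monotonicity of the determinant\<close>

lemma quadratic_form_sum:
  fixes M :: "real^'n^'n"
  shows "v \<bullet> (M *v w) = (\<Sum>i\<in>UNIV. \<Sum>j\<in>UNIV. M$i$j * v$i * w$j)"
  by (simp add: inner_vec_def matrix_vector_mult_def sum_distrib_left mult_ac)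

lemma symmetric_component: "M \<in> Sym_plus \<Longrightarrow> M$i$j = M$j$i"
  unfolding Sym_plus_def transpose_def by (auto simp: vec_eq_iff)

lemma symmetric_quadratic_form:
  fixes M :: "real^'n^'n"
  assumes "transpose M = M"
  shows "v \<bullet> (M *v w) = w \<bullet> (M *v v)"
  by (metis assms dot_lmul_matrix inner_commute transpose_matrix_vector)

lemma Sym_plusI:
  assumes "\<And>i j. M$i$j = M$j$i" "\<And>v. 0 \<le> v \<bullet> (M *v v)"
  shows "M \<in> Sym_plus"
  using assms unfolding Sym_plus_def transpose_def by (auto simp: vec_eq_iff)

text \<open>A quadratic polynomial in \<open>t\<close>. Its minimum, at
  \<open>t = (M *v v)$j / M$j$j\<close>, is the form of the Schur complement, which therefore
  inherits nonnegativity; for \<open>M$j$j = 0\<close> it becomes affine in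
  \<open>t\<close>.\<close>

lemma Sym_plus_form_shift:
  fixes M :: "real^'n^'n"
  assumes "M \<in> Sym_plus"
  shows "(v - t *\<^sub>R axis j 1) \<bullet> (M *v (v - t *\<^sub>R axis j 1))
        = v \<bullet> (M *v v) - 2 * t * (M *v v)$j + t^2 * M$j$j"
proof -
  have tr: "transpose M = M" using assms by (simp add: Sym_plus_def)
  have a: "axis j 1 \<bullet> (M *v w) = (M *v w)$j" for w :: "real^'n"
    by (simp add: inner_axis' )
  have b: "(M *v axis j 1)$j = M$j$j"
    by (simp add: matrix_vector_mult_basis column_def)
  have c: "v \<bullet> (M *v axis j 1) = (M *v v)$j"
    using symmetric_quadratic_form[OF tr, of v "axis j 1"] a by simp
  show ?thesis
    by (simp add: matrix_vector_mult_diff_distrib matrix_vector_mult_scaleR inner_diff_left inner_diff_right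
        a b c power2_eq_square algebra_simps)
qed

lemma Sym_plus_diag_nonneg: "M \<in> Sym_plus \<Longrightarrow> 0 \<le> M$j$j" for M :: "real^'n^'n"
proof -
  assume M: "M \<in> Sym_plus"
  then have "0 \<le> (0 - 1 *\<^sub>R axis j 1) \<bullet> (M *v (0 - 1 *\<^sub>R axis j (1::real)))"
    unfolding Sym_plus_def by blast
  then show ?thesis unfolding Sym_plus_form_shift[OF M] by simp
qed

text \<open>With a vanishing diagonal entry the form along
  \<open>axis k 1 - t *\<^sub>R axis j 1\<close> is affine in \<open>t\<close>, so a nonzero slope
  would make it negative somewhere; \<open>a\<close> is the parameter at which its value is
  -1.\<close>

lemma Sym_plus_zero_diag:
  fixes M :: "real^'n^'n"
  assumes "M \<in> Sym_plus" "M$j$j = 0"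
  shows "M$j$k = 0"
proof (rule ccontr)
  assume n: "M$j$k \<noteq> 0"
  define a where "a = (M$k$k + 1) / (2 * M$j$k)"
  have "(M *v axis k 1)$j = M$j$k" by (simp add: matrix_vector_mult_basis column_def)
  moreover have "(axis k 1 :: real^'n) \<bullet> (M *v axis k 1) = M$k$k"
    by (simp add: inner_axis' matrix_vector_mult_basis column_def)
  ultimately have "(axis k 1 - a *\<^sub>R axis j 1) \<bullet> (M *v (axis k 1 - a *\<^sub>R axis j 1)) = M$k$k - 2 * a * M$j$k"
    using Sym_plus_form_shift[OF assms(1), of "axis k 1" a j] assms(2) by simp
  also have "\<dots> = -1" using n by (simp add: a_def field_simps)
  finally show False using assms(1) unfolding Sym_plus_def by (smt (verit) mem_Collect_eq)
qed

text \<open>A Cholesky factorisation by induction on the set \<open>J\<close> of rows that may be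
  nonzero. Each step splits off the rank-one matrix \<open>s i * s k\<close> and leaves the Schur
  complement, whose row \<open>j\<close> vanishes. Keeping the columns of \<open>S\<close> outside
  \<open>J\<close> zero leaves column \<open>j\<close> free to hold \<open>s\<close>.\<close>

lemma Sym_plus_factor_aux:
  fixes M :: "real^'n^'n"
  assumes "finite J" "M \<in> Sym_plus" "\<And>i j. i \<notin> J \<Longrightarrow> M$i$j = 0"
  shows "\<exists>S. M = S ** transpose S \<and> (\<forall>i k. k \<notin> J \<longrightarrow> S$i$k = 0)"
  using assms
proof (induction J arbitrary: M rule: finite_induct)
  case empty
  then have "M = 0" by (simp add: vec_eq_iff)
  then show ?case by (intro exI[of _ 0]) (simp add: vec_eq_iff matrix_matrix_mult_def)
next
  case (insert j J)
  show ?case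
  proof (cases "M$j$j = 0")
    case True
    have "\<And>i k. i \<notin> J \<Longrightarrow> M$i$k = 0"
      using insert.prems Sym_plus_zero_diag[OF insert.prems(1) True] by (metis insertE)
    from insert.IH[OF insert.prems(1) this] show ?thesis by auto
  next
    case False
    then have pos: "M$j$j > 0" using Sym_plus_diag_nonneg[OF insert.prems(1), of j] by simp
    define s where "s i = M$i$j / sqrt (M$j$j)" for i
    have ss: "s i * s k = M$i$j * M$k$j / M$j$j" for i k
      using pos by (simp add: s_def)
    define M' where "M' = (\<chi> i k. M$i$k - s i * s k)"
    have form: "v \<bullet> (M' *v v) = v \<bullet> (M *v v) - (M *v v)$j^2 / M$j$j" for v :: "real^'n"
    proof -
      have "(M *v v)$j = (\<Sum>i\<in>UNIV. M$i$j * v$i)"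
        by (simp add: matrix_vector_mult_def symmetric_component[OF insert.prems(1), of j])
      then have "(M *v v)$j^2 / M$j$j = (\<Sum>i\<in>UNIV. \<Sum>k\<in>UNIV. s i * s k * v$i * v$k)"
        by (simp add: power2_eq_square sum_product sum_divide_distrib ss mult_ac)
      then show ?thesis
        by (simp add: quadratic_form_sum M'_def left_diff_distrib sum_subtractf)
    qed
    have "M' \<in> Sym_plus"
    proof (rule Sym_plusI)
      show "M'$i$k = M'$k$i" for i k
        by (simp add: M'_def symmetric_component[OF insert.prems(1), of i k])
      show "0 \<le> v \<bullet> (M' *v v)" for v :: "real^'n"
      proof -
        define t where "t = (M *v v)$j / M$j$j"
        have "0 \<le> (v - t *\<^sub>R axis j 1) \<bullet> (M *v (v - t *\<^sub>R axis j 1))"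
          using insert.prems(1) by (simp add: Sym_plus_def)
        also have "\<dots> = v \<bullet> (M' *v v)"
          unfolding Sym_plus_form_shift[OF insert.prems(1)] form t_def
          using pos by (simp add: power2_eq_square field_simps)
        finally show ?thesis .
      qed
    qed
    moreover have "M'$i$k = 0" if "i \<notin> J" for i k
    proof (cases "i = j")
      case True
      then show ?thesis using pos
        by (simp add: M'_def ss symmetric_component[OF insert.prems(1), of j k])
    next
      case False
      then show ?thesis using insert.prems(2)[of i] that by (simp add: M'_def s_def)
    qed
    ultimately obtain S where S: "M' = S ** transpose S" "\<forall>i k. k \<notin> J \<longrightarrow> S$i$k = 0"
      using insert.IH[of M'] by blast
    define T where "T = (\<chi> i k. if k = j then s i else S$i$k)"
    have "M = T ** transpose T"
    proof (simp add: vec_eq_iff, intro allI)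
      fix i k
      have "(T ** transpose T)$i$k = (\<Sum>l\<in>UNIV. T$i$l * T$k$l)"
        by (simp add: matrix_matrix_mult_def transpose_def)
      also have "\<dots> = T$i$j * T$k$j + (\<Sum>l\<in>UNIV-{j}. T$i$l * T$k$l)"
        by (rule sum.remove) auto
      also have "(\<Sum>l\<in>UNIV-{j}. T$i$l * T$k$l) = (\<Sum>l\<in>UNIV-{j}. S$i$l * S$k$l)"
        by (rule sum.cong) (auto simp: T_def)
      also have "\<dots> = (\<Sum>l\<in>UNIV. S$i$l * S$k$l)"
        by (rule sum.mono_neutral_left) (use S(2) insert.hyps in auto)
      also have "\<dots> = M'$i$k" by (simp add: S(1) matrix_matrix_mult_def transpose_def)
      finally show "M$i$k = (T ** transpose T)$i$k"
        by (simp add: T_def M'_def)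
    qed
    moreover have "\<forall>i k. k \<notin> insert j J \<longrightarrow> T$i$k = 0" using S(2) by (simp add: T_def)
    ultimately show ?thesis by blast
  qed
qed

lemma Sym_plus_factor:
  fixes M :: "real^'n^'n"
  assumes "M \<in> Sym_plus"
  obtains S :: "real^'n^'n" where "M = S ** transpose S"
  using Sym_plus_factor_aux[OF finite_class.finite_UNIV assms] that by auto

lemma form_factor: "v \<bullet> ((S ** transpose S) *v v) = (norm (transpose S *v v))^2" for v :: "real^'n"
  by (metis dot_lmul_matrix inner_commute matrix_vector_mul_assoc power2_norm_eq_inner transpose_matrix_vector)

lemma factor_in_Sym_plus: "S ** transpose S \<in> Sym_plus" for S :: "real^'n^'n"
  by (auto simp: Sym_plus_def form_factor matrix_transpose_mul)

lemma det_factor: "det (S ** transpose S) = (det S)^2" for S :: "real^'n^'n"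
  by (simp add: det_mul det_transpose power2_eq_square)

lemma det_Sym_plus_nonneg: "M \<in> Sym_plus \<Longrightarrow> 0 \<le> det M" for M :: "real^'n^'n"
  by (metis Sym_plus_factor det_factor zero_le_power2)

text \<open>For symmetric matrices the sum is the trace of \<open>A ** H\<close>. Splitting
  \<open>H\<close> into rank-one matrices built from the columns of a factor turns it into a sum of
  values of the form of \<open>A\<close>.\<close>

lemma Sym_plus_double_sum_nonneg:
  fixes A H :: "real^'n^'n"
  assumes "A \<in> Sym_plus" "H \<in> Sym_plus"
  shows "0 \<le> (\<Sum>i\<in>UNIV. \<Sum>j\<in>UNIV. A$i$j * H$i$j)"
proof -
  obtain S :: "real^'n^'n" where S: "H = S ** transpose S" using Sym_plus_factor[OF assms(2)] .
  have "(\<Sum>i\<in>UNIV. \<Sum>j\<in>UNIV. A$i$j * H$i$j) = (\<Sum>i\<in>UNIV. \<Sum>j\<in>UNIV. \<Sum>k\<in>UNIV. A$i$j * S$i$k * S$j$k)"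
    by (simp add: S matrix_matrix_mult_def transpose_def sum_distrib_left mult_ac)
  also have "\<dots> = (\<Sum>i\<in>UNIV. \<Sum>k\<in>UNIV. \<Sum>j\<in>UNIV. A$i$j * S$i$k * S$j$k)"
    by (intro sum.cong refl sum.swap)
  also have "\<dots> = (\<Sum>k\<in>UNIV. \<Sum>i\<in>UNIV. \<Sum>j\<in>UNIV. A$i$j * S$i$k * S$j$k)"
    by (rule sum.swap)
  also have "\<dots> = (\<Sum>k\<in>UNIV. column k S \<bullet> (A *v column k S))"
    by (simp add: quadratic_form_sum column_def)
  also have "\<dots> \<ge> 0" using assms(1) by (intro sum_nonneg) (simp add: Sym_plus_def)
  finally show ?thesis .
qed

lemma double_sum_mono:
  fixes A B H :: "real^'n^'n"
  assumes "A \<in> Sym_plus" "B \<in> Sym_plus" "H \<in> Sym_plus" "\<And>v. v \<bullet> (B *v v) \<le> v \<bullet> (A *v v)"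
  shows "(\<Sum>i\<in>UNIV. \<Sum>j\<in>UNIV. B$i$j * H$i$j) \<le> (\<Sum>i\<in>UNIV. \<Sum>j\<in>UNIV. A$i$j * H$i$j)"
proof -
  have "A - B \<in> Sym_plus"
    using assms by (intro Sym_plusI) (auto simp: symmetric_component[of A] symmetric_component[of B] 
      matrix_vector_mult_diff_rdistrib inner_diff_right intro!: arg_cong2[where f="(-)"] symmetric_component)
  from Sym_plus_double_sum_nonneg[OF this assms(3)] show ?thesis
    by (simp add: left_diff_distrib sum_subtractf)
qed

text \<open>The ellipsoid is the preimage of the unit ball under \<open>transpose S\<close>. Reading
  the determinant as a reciprocal volume reduces its monotonicity to an inclusion of sets, without
  recourse to eigenvalues.\<close>

lemma ellipsoid_measure:
  fixes S :: "real^'n^'n"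
  assumes "det S \<noteq> 0"
  shows "{v. v \<bullet> ((S ** transpose S) *v v) \<le> 1} \<in> lmeasurable"
    "\<bar>det S\<bar> * measure lebesgue {v. v \<bullet> ((S ** transpose S) *v v) \<le> 1} = measure lebesgue (cball (0::real^'n) 1)"
proof -
  let ?T = "transpose S"
  let ?E = "{v. v \<bullet> ((S ** transpose S) *v v) \<le> 1}"
  have inv: "invertible ?T" using assms by (simp add: invertible_det_nz)
  have E: "?E = {v. norm (?T *v v) \<le> 1}" by (simp add: form_factor power2_le_iff_abs_le abs_le_square_iff[symmetric, of _ 1, simplified])
  obtain U where U: "?T ** U = mat 1" "U ** ?T = mat 1" using inv unfolding invertible_def by blast
  have im: "(\<lambda>v. U *v v) ` cball 0 1 = ?E"
  proof -
    have "U *v w \<in> ?E" if "w \<in> cball 0 1" for w using that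
      unfolding E mem_Collect_eq matrix_vector_mul_assoc U by simp
    moreover have "v \<in> (\<lambda>v. U *v v) ` cball 0 1" if "v \<in> ?E" for v using that
      by (intro image_eqI[of _ _ "?T *v v"]) (unfold E mem_Collect_eq matrix_vector_mul_assoc U, simp_all)
    ultimately show ?thesis by auto
  qed
  show m: "?E \<in> lmeasurable" unfolding im[symmetric] by (rule measure_matrix_image) simp
  have im2: "(\<lambda>v. ?T *v v) ` ?E = cball 0 1" unfolding im[symmetric] image_comp
    by (simp only: o_def matrix_vector_mul_assoc U) simp
  have "measure lebesgue ((*v) ?T ` ?E) = \<bar>det ?T\<bar> * measure lebesgue ?E"
    using m by (rule measure_matrix_image)
  then show "\<bar>det S\<bar> * measure lebesgue ?E = measure lebesgue (cball (0::real^'n) 1)"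
    by (simp only: im2 det_transpose)
qed

text \<open>A larger form has a smaller unit ellipsoid, and \<open>ellipsoid_measure\<close>
  converts the inclusion into an inequality of determinants.\<close>

lemma det_mono:
  fixes A B :: "real^'n^'n"
  assumes "A \<in> Sym_plus" "B \<in> Sym_plus" and le: "\<And>v. v \<bullet> (B *v v) \<le> v \<bullet> (A *v v)"
  shows "det B \<le> det A"
proof (cases "det B = 0")
  case True
  then show ?thesis using det_Sym_plus_nonneg assms by simp
next
  case False
  obtain S :: "real^'n^'n" where S: "A = S ** transpose S" using Sym_plus_factor[OF assms(1)] .
  obtain T :: "real^'n^'n" where T: "B = T ** transpose T" using Sym_plus_factor[OF assms(2)] .
  have dT: "det T \<noteq> 0" using False T by (simp add: det_factor)
  \<comment> \<open>A kernel vector of \<open>transpose S\<close> would annihilate the form of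
    \<open>B\<close> too, contradicting the invertibility of \<open>T\<close>; so both ellipsoids
    have finite volume.\<close>
  have dS: "det S \<noteq> 0"
  proof
    assume "det S = 0"
    then have "\<not> invertible (transpose S)" by (simp add: invertible_det_nz)
    then obtain v where v: "v \<noteq> 0" "transpose S *v v = 0"
      by (auto simp: invertible_left_inverse matrix_left_invertible_ker)
    then have "norm (transpose T *v v) = 0" using le[of v] by (simp add: S T form_factor)
    then show False using v dT
      by (metis det_transpose invertible_det_nz invertible_left_inverse matrix_left_invertible_ker norm_eq_zero)
  qed
  let ?A = "{v. v \<bullet> (A *v v) \<le> 1}" and ?B = "{v. v \<bullet> (B *v v) \<le> 1}"
  note eA = ellipsoid_measure[OF dS, folded S] and eB = ellipsoid_measure[OF dT, folded T]
  have "measure lebesgue ?A \<le> measure lebesgue ?B"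
    by (rule measure_mono_fmeasurable) (use le eA eB in \<open>auto intro: order_trans\<close>)
  moreover have "measure lebesgue (cball (0::real^'n) 1) > 0" by (simp add: content_cball_pos)
  ultimately have ab: "measure lebesgue ?A \<le> measure lebesgue ?B" "measure lebesgue (cball (0::real^'n) 1) > 0"
    by auto
  have "\<bar>det T\<bar> * measure lebesgue ?A \<le> \<bar>det S\<bar> * measure lebesgue ?A"
    using eA(2) eB(2) mult_left_mono[OF ab(1), of "\<bar>det T\<bar>"] by simp
  moreover have "measure lebesgue ?A > 0"
    using eA(2) ab(2) measure_nonneg[of lebesgue ?A] by (metis less_eq_real_def mult_zero_right order_less_irrefl)
  ultimately have "\<bar>det T\<bar> \<le> \<bar>det S\<bar>" by simp
  then show ?thesis unfolding S T det_factor by (simp add: abs_le_square_iff)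
qed

lemma det_abs_le:
  fixes A :: "real^'n^'n"
  shows "\<bar>det A\<bar> \<le> fact CARD('n) * norm A ^ CARD('n)"
proof -
  have e: "\<bar>A$i$j\<bar> \<le> norm A" for i j
    by (meson component_le_norm_cart order_trans Finite_Cartesian_Product.norm_nth_le real_norm_def)
  have "\<bar>det A\<bar> \<le> (\<Sum>p\<in>{p. p permutes (UNIV::'n set)}. \<bar>of_int (sign p) * (\<Prod>i\<in>UNIV. A$i$p i)\<bar>)"
    unfolding det_def by (rule sum_abs)
  also have "\<dots> \<le> (\<Sum>p\<in>{p. p permutes (UNIV::'n set)}. norm A ^ CARD('n))"
  proof (rule sum_mono)
    fix p :: "'n \<Rightarrow> 'n"
    have "\<bar>of_int (sign p) * (\<Prod>i\<in>UNIV. A$i$p i)\<bar> = (\<Prod>i\<in>UNIV. \<bar>A$i$p i\<bar>)"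
      by (simp add: abs_mult sign_def abs_prod)
    also have "\<dots> \<le> (\<Prod>i\<in>(UNIV::'n set). norm A)" by (intro prod_mono) (use e in auto)
    finally show "\<bar>of_int (sign p) * (\<Prod>i\<in>UNIV. A$i$p i)\<bar> \<le> norm A ^ CARD('n)" by simp
  qed
  also have "\<dots> = fact CARD('n) * norm A ^ CARD('n)"
    by (simp add: card_permutations[of UNIV "CARD('n)"])
  finally show ?thesis .
qed

section \<open>Mollifiers and convolution\<close>

text \<open>\<open>bump_term 0 0\<close> is the standard bump \<open>exp (- 1 / (1 - t^2))\<close>.
  The additional powers of \<open>t\<close> and of \<open>1 / (1 - t^2)\<close> make the family
  closed under differentiation up to linear combinations, which \<open>bump_span\<close>
  collects.\<close>

definition bump_term :: "nat \<Rightarrow> nat \<Rightarrow> real \<Rightarrow> real" where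
  "bump_term a b t = (if \<bar>t\<bar> < 1 then t^b * (1 / (1 - t^2))^a * exp (- (1 / (1 - t^2))) else 0)"

inductive bump_span :: "(real \<Rightarrow> real) \<Rightarrow> bool" where
  base: "bump_span (bump_term a b)"
| scale: "bump_span f \<Longrightarrow> bump_span (\<lambda>t. c * f t)"
| add: "bump_span f \<Longrightarrow> bump_span g \<Longrightarrow> bump_span (\<lambda>t. f t + g t)"

lemma bump_span_support: "bump_span f \<Longrightarrow> 1 \<le> \<bar>t\<bar> \<Longrightarrow> f t = 0"
  by (induction rule: bump_span.induct) (auto simp: bump_term_def)

text \<open>Gives differentiability at the seams of piecewise definitions: the endpoints of the bump
  here and the edge of the radial cutoff in the singular fields.\<close>

lemma has_derivative_0_of_quadratic_bound:
  fixes f :: "real \<Rightarrow> real"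
  assumes "\<And>s. \<bar>f s - f t\<bar> \<le> C * (s - t)^2"
  shows "(f has_real_derivative 0) (at t)"
proof -
  have "((\<lambda>s. (f s - f t) / (s - t)) \<longlongrightarrow> 0) (at t)"
  proof (rule Lim_null_comparison)
    show "\<forall>\<^sub>F s in at t. norm ((f s - f t) / (s - t)) \<le> C * \<bar>s - t\<bar>"
      unfolding eventually_at_filter
    proof (rule always_eventually, intro allI impI)
      fix s assume "s \<noteq> t"
      then show "norm ((f s - f t) / (s - t)) \<le> C * \<bar>s - t\<bar>"
        using assms[of s] by (simp add: abs_divide divide_le_eq power2_eq_square abs_mult_self_eq mult.assoc)
    qed
    show "((\<lambda>s. C * \<bar>s - t\<bar>) \<longlongrightarrow> 0) (at t)"
      by (auto intro!: tendsto_eq_intros)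
  qed
  then show ?thesis by (simp add: has_field_derivative_iff)
qed

text \<open>The term of degree \<open>a + 2\<close> in the exponential series dominates
  \<open>u ^ a\<close> for \<open>u = 1 / (1 - s^2)\<close> and leaves a spare factor
  \<open>u^2\<close>. This is the quadratic decay at the endpoints that
  \<open>has_derivative_0_of_quadratic_bound\<close> asks for.\<close>

lemma bump_term_bound:
  assumes "\<bar>s\<bar> < 1"
  shows "\<bar>bump_term a b s\<bar> \<le> fact (a + 2) * (1 - s^2)^2"
proof -
  have w: "0 < 1 - s^2" using assms by (simp add: abs_square_less_1)
  define u where "u = 1 / (1 - s^2)"
  have u: "u > 0" using w by (simp add: u_def)
  have "u ^ (a + 2) / fact (a + 2) \<le> exp u"
  proof -
    have "(\<Sum>i\<in>{a+2}. u^i /\<^sub>R fact i) \<le> (\<Sum>i. u^i /\<^sub>R fact i)"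
      using u by (intro sum_le_suminf summable_exp_generic) auto
    then show ?thesis by (simp add: exp_def divide_inverse_commute)
  qed
  then have "u ^ a * u^2 \<le> fact (a + 2) * exp u"
    by (simp add: pos_divide_le_eq power_add power2_eq_square mult_ac del: fact_Suc)
  then have "u ^ a * u^2 * (exp (- u) / u^2) \<le> fact (a + 2) * exp u * (exp (- u) / u^2)"
    using u by (intro mult_right_mono) auto
  then have "u ^ a * exp (- u) \<le> fact (a + 2) / u^2"
    using u by (simp add: exp_minus field_simps del: fact_Suc)
  moreover have "\<bar>s ^ b\<bar> \<le> 1" using assms by (simp add: power_abs power_le_one)
  ultimately have "\<bar>s ^ b\<bar> * (u ^ a * exp (- u)) \<le> 1 * (fact (a + 2) / u^2)"
    using u by (intro mult_mono) auto
  also have "1 * (fact (a + 2) / u^2) = fact (a + 2) * (1 - s^2)^2"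
    by (simp add: u_def power_one_over)
  finally show ?thesis using assms u by (simp add: bump_term_def u_def[symmetric] abs_mult mult.assoc)
qed

text \<open>At \<open>b = 0\<close> the truncated subtraction \<open>b - 1\<close> is harmless
  because the coefficient \<open>real b\<close> is zero. On and beyond the endpoints all terms
  vanish, so a zero derivative has to be shown there.\<close>

lemma bump_term_deriv:
  "(bump_term a b has_real_derivative
     (- 2 * bump_term (a + 2) (b + 1) t + 2 * real a * bump_term (a + 1) (b + 1) t + real b * bump_term a (b - 1) t)) (at t)"
proof (cases "\<bar>t\<bar> < 1")
  case True
  then have w: "0 < 1 - t^2" by (simp add: abs_square_less_1)
  let ?f = "\<lambda>t. t^b * (1 / (1 - t^2))^a * exp (- (1 / (1 - t^2)))"
  let ?e = "exp (- (1 / (1 - t^2)))"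
  have "(?f has_real_derivative
     (- 2 * (t^(b+1) * (1 / (1 - t^2))^(a+2) * ?e) + 2 * real a * (t^(b+1) * (1 / (1 - t^2))^(a+1) * ?e)
       + real b * (t^(b-1) * (1 / (1 - t^2))^a * ?e))) (at t)"
  proof -
    define u where "u = 1 / (1 - t^2)"
    have du: "((\<lambda>t. 1 / (1 - t^2)) has_real_derivative 2 * t * u^2) (at t)"
      using w by (auto intro!: derivative_eq_intros simp: u_def power2_eq_square field_simps)
    have dp: "((\<lambda>t. (1 / (1 - t^2))^a) has_real_derivative real a * (2 * t * u^2) * u^(a-1)) (at t)"
      using DERIV_power[OF du, of a] by (simp add: u_def mult.assoc)
    have de: "((\<lambda>t. exp (- (1 / (1 - t^2)))) has_real_derivative exp (-u) * - (2 * t * u^2)) (at t)"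
      using DERIV_fun_exp[OF DERIV_minus[OF du]] by (simp add: u_def)
    have ua: "real a * u^(a-1) * u^2 = real a * u^(a+1)" by (cases a) (auto simp: power2_eq_square)
    have "(?f has_real_derivative
       (real b * t^(b-1) * u^a + (real a * (2 * t * u^2) * u^(a-1)) * t^b) * exp (-u)
         + (exp (-u) * - (2 * t * u^2)) * (t^b * u^a)) (at t)"
      using DERIV_mult[OF DERIV_mult[OF DERIV_pow dp] de, of b] by (simp add: u_def)
    also have "(real b * t^(b-1) * u^a + (real a * (2 * t * u^2) * u^(a-1)) * t^b) * exp (-u)
         + (exp (-u) * - (2 * t * u^2)) * (t^b * u^a) =
       (- 2 * (t^(b+1) * u^(a+2) * exp (-u)) + 2 * (real a * u^(a+1)) * t^(b+1) * exp (-u)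
       + real b * (t^(b-1) * u^a * exp (-u)))"
      unfolding ua[symmetric] by (simp add: algebra_simps power_add power2_eq_square)
    finally show ?thesis by (simp add: u_def algebra_simps)
  qed
  then have "(?f has_real_derivative
     (- 2 * bump_term (a + 2) (b + 1) t + 2 * real a * bump_term (a + 1) (b + 1) t + real b * bump_term a (b - 1) t)) (at t)"
    using True by (simp add: bump_term_def)
  then show ?thesis
    by (rule has_field_derivative_transform_within_open[where S = "{-1<..<1}"])
      (use True in \<open>auto simp: bump_term_def\<close>)
next
  case False
  have "\<bar>bump_term a b s - bump_term a b t\<bar> \<le> 4 * fact (a + 2) * (s - t)^2" for s
  proof (cases "\<bar>s\<bar> < 1")
    case True
    have "0 \<le> 1 - s^2" using True by (simp add: abs_square_le_1)
    moreover have "1 - s^2 = (1 - \<bar>s\<bar>) * (1 + \<bar>s\<bar>)" by (simp add: algebra_simps power2_eq_square)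
    moreover have "(1 - \<bar>s\<bar>) * (1 + \<bar>s\<bar>) \<le> \<bar>s - t\<bar> * 2" using True False by (intro mult_mono) auto
    ultimately have "(1 - s^2)^2 \<le> (\<bar>s - t\<bar> * 2)^2" by (intro power_mono) auto
    also have "\<dots> = 4 * (s - t)^2" by (simp add: power_mult_distrib)
    finally have "fact (a + 2) * (1 - s^2)^2 \<le> fact (a + 2) * (4 * (s - t)^2)" by (intro mult_left_mono) auto
    from order_trans[OF bump_term_bound[OF True, of a b] this] show ?thesis
      using False by (simp add: bump_term_def[of _ _ t] mult.assoc mult.left_commute del: fact_Suc)
  next
    case s: False
    then show ?thesis using False by (simp add: bump_term_def)
  qed
  then have "(bump_term a b has_real_derivative 0) (at t)"
    by (rule has_derivative_0_of_quadratic_bound)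
  moreover have "bump_term k l t = 0" for k l using False by (simp add: bump_term_def)
  ultimately show ?thesis by simp
qed

lemma bump_span_deriv:
  assumes "bump_span f"
  shows "\<exists>g. bump_span g \<and> (\<forall>t. (f has_real_derivative g t) (at t))"
  using assms
proof induction
  case (base a b)
  then show ?case
    using bump_term_deriv bump_span.add[OF bump_span.add[OF
      bump_span.scale[OF bump_span.base, of "- 2" "a + 2" "b + 1"]
      bump_span.scale[OF bump_span.base, of "2 * real a" "a + 1" "b + 1"]]
      bump_span.scale[OF bump_span.base, of "real b" a "b - 1"]] by blast
next
  case (scale f c)
  then obtain f' where "bump_span f'" "\<forall>t. (f has_real_derivative f' t) (at t)" by auto
  then show ?case by (intro exI[of _ "\<lambda>t. c * f' t"]) (auto intro: DERIV_cmult bump_span.scale)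
next
  case (add f g)
  then obtain f' g' where "bump_span f'" "bump_span g'" "\<forall>t. (f has_real_derivative f' t) (at t)"
     "\<forall>t. (g has_real_derivative g' t) (at t)" by auto
  then show ?case by (intro exI[of _ "\<lambda>t. f' t + g' t"]) (auto intro: DERIV_add bump_span.add)
qed

text \<open>Dependent choice selects each \<open>d (Suc l)\<close> as a derivative of
  \<open>d l\<close> inside \<open>bump_span\<close>, so smoothness and support are available
  without formulas for the higher derivatives.\<close>

lemma bump_sequence:
  obtains d :: "nat \<Rightarrow> real \<Rightarrow> real" where
    "\<And>l t. (d l has_real_derivative d (Suc l) t) (at t)" "\<And>l t. 1 \<le> \<bar>t\<bar> \<Longrightarrow> d l t = 0"
    "\<And>t. 0 \<le> d 0 t" "d 0 0 > 0"
proof -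
  have "\<exists>d. \<forall>l. (bump_span (d l) \<and> (l = 0 \<longrightarrow> d l = bump_term 0 0)) \<and>
      (\<forall>t. (d l has_real_derivative d (Suc l) t) (at t))"
    by (rule dependent_nat_choice) (use bump_span.base bump_span_deriv in auto)
  then obtain d where d: "\<And>l. bump_span (d l)" "d 0 = bump_term 0 0"
     "\<And>l t. (d l has_real_derivative d (Suc l) t) (at t)" by metis
  then show ?thesis using bump_span_support by (intro that[of d]) (auto simp: bump_term_def)
qed

section \<open>Tensor products of one-variable bumps\<close>

lemma partial_deriv_eq:
  assumes "((\<lambda>t. f (x + t *\<^sub>R axis j 1)) has_real_derivative d) (at 0)"
  shows "partial_deriv j f x = d"
  unfolding partial_deriv_def using assms by (blast intro: the_equality DERIV_unique)

lemma prod_line_derivative: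
  fixes b b' :: "'n::finite \<Rightarrow> real \<Rightarrow> real"
  assumes "\<And>i t. (b i has_real_derivative b' i t) (at t)"
  shows "((\<lambda>t. \<Prod>i\<in>UNIV. b i ((x + t *\<^sub>R v)$i)) has_real_derivative
     (\<Sum>j\<in>UNIV. v$j * (\<Prod>i\<in>UNIV. (if i = j then b' i else b i) ((x + t *\<^sub>R v)$i)))) (at t)"
proof -
  have "((\<lambda>t. b i (x$i + t * v$i)) has_real_derivative b' i (x$i + t * v$i) * v$i) (at t)" for i
    by (rule DERIV_chain2[OF assms]) (auto intro!: derivative_eq_intros)
  then have "((\<lambda>t. \<Prod>i\<in>UNIV. b i (x$i + t * v$i)) has_real_derivative
     (\<Sum>j\<in>UNIV. b' j (x$j + t * v$j) * v$j * (\<Prod>i\<in>UNIV - {j}. b i (x$i + t * v$i)))) (at t)"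
    by (rule has_field_derivative_prod)
  moreover have "b' j (x$j + t * v$j) * v$j * (\<Prod>i\<in>UNIV - {j}. b i (x$i + t * v$i))
     = v$j * (\<Prod>i\<in>UNIV. (if i = j then b' i else b i) ((x + t *\<^sub>R v)$i))" for j
    by (subst prod.remove[of UNIV j]) (auto simp: mult_ac intro!: prod.cong)
  ultimately show ?thesis by simp
qed

text \<open>Partial derivatives of a tensor product are tensor products: \<open>P m\<close> records
  one order of differentiation per coordinate, and differentiating in direction \<open>j\<close>
  raises \<open>m j\<close>. All iterated partials stay in one family of continuous
  functions.\<close>

lemma smooth_fun_prod:
  fixes b :: "'n::finite \<Rightarrow> nat \<Rightarrow> real \<Rightarrow> real"
  assumes d: "\<And>i l t. (b i l has_real_derivative b i (Suc l) t) (at t)"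
  shows "smooth_fun (\<lambda>z. c * (\<Prod>i\<in>UNIV. b i 0 (z$i)))"
    and "partial_deriv j (\<lambda>z. c * (\<Prod>i\<in>UNIV. b i 0 (z$i))) z
          = c * (\<Prod>i\<in>UNIV. b i (if i = j then 1 else 0) (z$i))"
proof -
  define P where "P m z = c * (\<Prod>i\<in>UNIV. b i (m i) (z$i))" for m and z :: "real^'n"
  have line: "((\<lambda>t. P m (z + t *\<^sub>R axis j 1)) has_real_derivative P (m(j := Suc (m j))) z) (at 0)" for m z j
  proof -
    have "((\<lambda>t. P m (z + t *\<^sub>R axis j 1)) has_real_derivative
      c * (\<Sum>k\<in>UNIV. axis j 1 $ k * (\<Prod>i\<in>UNIV. (if i = k then b i (Suc (m i)) else b i (m i)) ((z + 0 *\<^sub>R axis j 1)$i)))) (at 0)"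
      unfolding P_def by (intro DERIV_cmult prod_line_derivative d)
    also have "(\<Sum>k\<in>UNIV. axis j 1 $ k * (\<Prod>i\<in>UNIV. (if i = k then b i (Suc (m i)) else b i (m i)) ((z + 0 *\<^sub>R axis j 1)$i)))
       = (\<Sum>k\<in>UNIV. if k = j then (\<Prod>i\<in>UNIV. (if i = k then b i (Suc (m i)) else b i (m i)) (z$i)) else 0)"
      by (rule sum.cong) (auto simp: axis_def)
    also have "\<dots> = (\<Prod>i\<in>UNIV. b i ((m(j := Suc (m j))) i) (z$i))"
      by (auto intro!: prod.cong)
    finally show ?thesis by (simp add: P_def)
  qed
  have pd: "partial_deriv j (P m) = P (m(j := Suc (m j)))" for m j
    by (rule ext, rule partial_deriv_eq, rule line)
  have it: "\<exists>m. iter_partial js (P (\<lambda>_. 0)) = P m" for js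
    by (induction js) (auto simp: pd)
  have cont: "continuous_on UNIV (P m)" for m
  proof -
    have "continuous_on UNIV (b i l)" for i l
      using d DERIV_continuous_on by blast
    then have "continuous_on UNIV (\<lambda>z::real^'n. b i l (z$i))" for i l
      by (rule continuous_on_compose2) (auto intro: continuous_intros)
    then show ?thesis unfolding P_def by (intro continuous_intros) auto
  qed
  have "smooth_fun (P (\<lambda>_. 0))"
    unfolding smooth_fun_def using it cont line by metis
  then show "smooth_fun (\<lambda>z. c * (\<Prod>i\<in>UNIV. b i 0 (z$i)))" unfolding P_def .
  have "partial_deriv j (P (\<lambda>_. 0)) z = P (\<lambda>i. if i = j then 1 else 0) z"
    unfolding pd by (rule arg_cong2[where f = P]) auto
  then show "partial_deriv j (\<lambda>z. c * (\<Prod>i\<in>UNIV. b i 0 (z$i))) z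
          = c * (\<Prod>i\<in>UNIV. b i (if i = j then 1 else 0) (z$i))"
    unfolding P_def .
qed

text \<open>A mollifier kernel with all its partial derivatives, indexed by the multi-index of
  differentiation orders.\<close>
definition mollifier :: "real \<Rightarrow> (('n::finite \<Rightarrow> nat) \<Rightarrow> real^'n \<Rightarrow> real) \<Rightarrow> bool" where
  "mollifier e G \<longleftrightarrow> (\<forall>m. continuous_on UNIV (G m)) \<and> (\<forall>m w. e \<le> norm w \<longrightarrow> G m w = 0)
    \<and> (\<forall>w. 0 \<le> G (\<lambda>_. 0) w) \<and> integral\<^sup>L lborel (G (\<lambda>_. 0)) = 1
    \<and> (\<forall>m x v t. ((\<lambda>t. G m (x + t *\<^sub>R v)) has_real_derivative
         (\<Sum>j\<in>UNIV. v$j * G (m(j := Suc (m j))) (x + t *\<^sub>R v))) (at t))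
    \<and> (\<forall>x. smooth_fun (\<lambda>z. G (\<lambda>_. 0) (x - z)))
    \<and> (\<forall>x j z. partial_deriv j (\<lambda>z. G (\<lambda>_. 0) (x - z)) z = - G ((\<lambda>_. 0)(j := 1)) (x - z))"

lemma integral_pos_of_continuous:
  fixes f :: "real^'n \<Rightarrow> real"
  assumes "continuous_on UNIV f" "\<And>x. 0 \<le> f x" "f 0 > 0" "integrable lborel f"
  shows "0 < integral\<^sup>L lborel f"
proof -
  obtain r where r: "r > 0" "\<And>x. dist x 0 < r \<Longrightarrow> dist (f x) (f 0) < f 0 / 2"
    using assms(1,3) by (metis continuous_on_iff half_gt_zero UNIV_I)
  have le: "indicator (ball 0 r) x * (f 0 / 2) \<le> f x" for x
    using r(2)[of x] assms(2)[of x] by (auto simp: indicator_def dist_norm abs_if split: if_splits)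
  have "0 < measure lborel (ball (0::real^'n) r) * (f 0 / 2)"
    using r assms(3) by (simp add: content_ball_pos)
  also have "\<dots> = (\<integral>x. indicator (ball (0::real^'n) r) x * (f 0 / 2) \<partial>lborel)"
    using emeasure_lborel_ball_finite[of "0::real^'n" r] by simp
  also have "\<dots> \<le> integral\<^sup>L lborel f"
    using emeasure_lborel_ball_finite[of "0::real^'n" r]
    by (intro integral_mono le assms integrable_mult_left) (simp add: less_top)
  finally show ?thesis .
qed

lemma integrable_compact_support:
  fixes f :: "'a::euclidean_space \<Rightarrow> real"
  assumes "continuous_on UNIV f" "\<And>x. r \<le> norm x \<Longrightarrow> f x = 0"
  shows "integrable lborel f"
proof -
  have "set_integrable lborel (cball 0 r) f"
    unfolding set_integrable_def by (rule borel_integrable_compact) (auto intro: continuous_on_subset[OF assms(1)])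
  moreover have "(\<lambda>x. indicator (cball 0 r) x *\<^sub>R f x) = f"
    using assms(2) by (auto simp: indicator_def fun_eq_iff)
  ultimately show ?thesis by (simp add: set_integrable_def)
qed

lemma mollifier_exists:
  assumes "e > 0"
  obtains G :: "('n::finite \<Rightarrow> nat) \<Rightarrow> real^'n \<Rightarrow> real" where "mollifier e G"
proof -
  obtain d :: "nat \<Rightarrow> real \<Rightarrow> real" where
    d: "\<And>l t. (d l has_real_derivative d (Suc l) t) (at t)" "\<And>l t. 1 \<le> \<bar>t\<bar> \<Longrightarrow> d l t = 0"
    "\<And>t. 0 \<le> d 0 t" "d 0 0 > 0" using bump_sequence by blast
  \<comment> \<open>With this scaling each factor vanishes for arguments of modulus at least
    \<open>e / n\<close>. By the l1 bound on the norm every \<open>w\<close> of norm at least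
    \<open>e\<close> has a coordinate that large, so the product vanishes there.\<close>
  define a where "a = real CARD('n) / e"
  have a: "a > 0" using assms by (simp add: a_def)
  define b where "b l t = a^l * d l (a * t)" for l t
  have b: "(b l has_real_derivative b (Suc l) t) (at t)" for l t
  proof -
    have "((\<lambda>t. d l (a * t)) has_real_derivative d (Suc l) (a * t) * a) (at t)"
      by (rule DERIV_chain2[OF d(1)]) (auto intro!: derivative_eq_intros)
    from DERIV_cmult[OF this, of "a^l"] show ?thesis unfolding b_def by (simp add: mult_ac)
  qed
  have contb: "continuous_on UNIV (b l)" for l using b DERIV_continuous_on by blast
  define P where "P m w = (\<Prod>i\<in>UNIV. b (m i) (w$i))" for m and w :: "real^'n"
  have contP: "continuous_on UNIV (P m)" for m
  proof -
    have "continuous_on UNIV (\<lambda>z::real^'n. b l (z$i))" for i l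
      using contb by (rule continuous_on_compose2) (auto intro: continuous_intros)
    then show ?thesis unfolding P_def by (intro continuous_intros) auto
  qed
  have supp: "P m w = 0" if "e \<le> norm w" for m w
  proof -
    have "\<exists>i. 1 / a \<le> \<bar>w$i\<bar>"
    proof (rule ccontr)
      assume "\<not> ?thesis"
      then have "(\<Sum>i\<in>UNIV. \<bar>w$i\<bar>) < (\<Sum>i\<in>(UNIV::'n set). 1 / a)"
        by (intro sum_strict_mono) (auto simp: not_le)
      then show False using norm_le_l1_cart[of w] that assms by (simp add: a_def)
    qed
    then obtain i where "1 \<le> \<bar>a * w$i\<bar>" using a by (auto simp: abs_mult field_simps)
    then have "b (m i) (w$i) = 0" using d(2) by (simp add: b_def)
    then show ?thesis unfolding P_def by (metis UNIV_I finite_class.finite_UNIV prod_zero)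
  qed
  have intP: "integrable lborel (P m)" for m by (rule integrable_compact_support[OF contP supp])
  define I where "I = integral\<^sup>L lborel (P (\<lambda>_. 0))"
  have P0: "0 \<le> P (\<lambda>_. 0) w" for w using d(3) by (auto simp: P_def b_def intro: prod_nonneg)
  have I: "I > 0" unfolding I_def
    by (rule integral_pos_of_continuous[OF contP P0 _ intP]) (use d(4) in \<open>auto simp: P_def b_def\<close>)
  define G where "G m w = 1 / I * P m w" for m w
  have line: "((\<lambda>t. G m (x + t *\<^sub>R v)) has_real_derivative
         (\<Sum>j\<in>UNIV. v$j * G (m(j := Suc (m j))) (x + t *\<^sub>R v))) (at t)" for m x v t
  proof -
    have "((\<lambda>t. G m (x + t *\<^sub>R v)) has_real_derivative
      1 / I * (\<Sum>j\<in>UNIV. v$j * (\<Prod>i\<in>UNIV. (if i = j then b (Suc (m i)) else b (m i)) ((x + t *\<^sub>R v)$i)))) (at t)"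
      unfolding G_def P_def by (intro DERIV_cmult prod_line_derivative b)
    moreover have "(\<Prod>i\<in>UNIV. (if i = j then b (Suc (m i)) else b (m i)) (w$i)) = P (m(j := Suc (m j))) w" for j w
      by (auto simp: P_def intro!: prod.cong)
    ultimately have "((\<lambda>t. G m (x + t *\<^sub>R v)) has_real_derivative
      1 / I * (\<Sum>j\<in>UNIV. v$j * P (m(j := Suc (m j))) (x + t *\<^sub>R v))) (at t)"
      by (simp only:)
    then show ?thesis by (simp add: G_def sum_divide_distrib)
  qed
  \<comment> \<open>The kernel is used as the function \<open>G (x - z)\<close> of \<open>z\<close>.
    Each differentiation in \<open>z\<close> brings a factor -1, so the factors with sign
    \<open>(-1)^l\<close> again form a sequence of successive derivatives and
    \<open>smooth_fun_prod\<close> applies.\<close>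
  have refl: "((\<lambda>t. (-1)^l * b l (c - t)) has_real_derivative (-1)^Suc l * b (Suc l) (c - t)) (at t)" for l c t
  proof -
    have "((\<lambda>t. b l (c - t)) has_real_derivative b (Suc l) (c - t) * (-1)) (at t)"
      by (rule DERIV_chain2[OF b]) (auto intro!: derivative_eq_intros)
    from DERIV_cmult[OF this, of "(-1)^l"] show ?thesis by simp
  qed
  have G0: "(\<lambda>z. G (\<lambda>_. 0) (x - z)) = (\<lambda>z. 1 / I * (\<Prod>i\<in>UNIV. (-1)^0 * b 0 (x$i - z$i)))" for x
    by (simp add: G_def P_def)
  have sm: "smooth_fun (\<lambda>z. G (\<lambda>_. 0) (x - z))" for x
    unfolding G0 by (rule smooth_fun_prod(1)[where b = "\<lambda>i l t. (-1)^l * b l (x$i - t)"]) (rule refl)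
  have pd: "partial_deriv j (\<lambda>z. G (\<lambda>_. 0) (x - z)) z = - G ((\<lambda>_. 0)(j := 1)) (x - z)" for x j z
  proof -
    have "partial_deriv j (\<lambda>z. G (\<lambda>_. 0) (x - z)) z
       = 1 / I * (\<Prod>i\<in>UNIV. (-1)^(if i = j then 1 else 0) * b (if i = j then 1 else 0) (x$i - z$i))"
      unfolding G0 by (rule smooth_fun_prod(2)[where b = "\<lambda>i l t. (-1)^l * b l (x$i - t)"]) (rule refl)
    also have "(\<Prod>i\<in>UNIV. (-1)^(if i = j then 1 else 0) * b (if i = j then 1 else 0) (x$i - z$i))
       = (\<Prod>i\<in>UNIV. if i = j then - 1 else 1) * P ((\<lambda>_. 0)(j := 1)) (x - z)"
      unfolding P_def prod.distrib[symmetric] by (rule prod.cong) auto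
    finally show ?thesis by (simp add: G_def prod.delta)
  qed
  have "integral\<^sup>L lborel (G (\<lambda>_. 0)) = 1"
    using I unfolding G_def[abs_def] by (simp add: I_def[symmetric])
  then have "mollifier e G"
    unfolding mollifier_def using line sm pd I P0 supp contP
    by (auto simp: G_def I_def[symmetric] intro!: continuous_intros)
  then show ?thesis by (rule that)
qed

section \<open>Convolution with compactly supported kernels\<close>

definition loc_integrable :: "('a::euclidean_space \<Rightarrow> real) \<Rightarrow> bool" where
  "loc_integrable f \<longleftrightarrow> (\<forall>r. integrable lborel (\<lambda>x. indicator (cball 0 r) x * f x))"

definition conv :: "('a::euclidean_space \<Rightarrow> real) \<Rightarrow> ('a \<Rightarrow> real) \<Rightarrow> 'a \<Rightarrow> real" where
  "conv f k x = (\<integral>z. f z * k (x - z) \<partial>lborel)"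

lemma loc_integrable_measurable:
  assumes "loc_integrable f" shows "f \<in> borel_measurable borel"
proof -
  have m: "(\<lambda>x. indicator (cball 0 (real i)) x * f x) \<in> borel_measurable borel" for i
    using borel_measurable_integrable[of lborel "\<lambda>x. indicator (cball 0 (real i)) x * f x"] assms
    unfolding loc_integrable_def by simp
  show ?thesis
  proof (rule borel_measurable_LIMSEQ_real[OF _ m])
    fix x
    have "\<forall>\<^sub>F i in sequentially. f x = indicator (cball 0 (real i)) x * f x"
      using eventually_ge_at_top[of "nat \<lceil>norm x\<rceil>"] by eventually_elim (auto simp: indicator_def)
    then show "(\<lambda>i. indicator (cball 0 (real i)) x * f x) \<longlonglongrightarrow> f x"
      by (intro tendsto_eventually) (auto elim: eventually_mono)
  qed
qed

lemma loc_integrable_of_integrable: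
  assumes "integrable lborel f" shows "loc_integrable f"
  unfolding loc_integrable_def
  using integrable_mult_indicator[OF _ assms] by (simp add: borel_closed)

lemma loc_integrable_continuous:
  assumes "continuous_on UNIV f" shows "loc_integrable f"
  unfolding loc_integrable_def
  using borel_integrable_compact[OF compact_cball continuous_on_subset[OF assms subset_UNIV]] by simp

lemma kernel_bounded:
  fixes k :: "'a::euclidean_space \<Rightarrow> real"
  assumes "continuous_on UNIV k" "\<And>w. e \<le> norm w \<Longrightarrow> k w = 0"
  obtains B where "B > 0" "\<And>w. \<bar>k w\<bar> \<le> B"
proof -
  have "bounded (k ` cball 0 e)"
    by (intro compact_imp_bounded compact_continuous_image) (auto intro: continuous_on_subset[OF assms(1)])
  then obtain B where B: "\<And>w. w \<in> cball 0 e \<Longrightarrow> \<bar>k w\<bar> \<le> B" unfolding bounded_iff real_norm_def by blast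
  have "\<bar>k w\<bar> \<le> max B 1" for w using B[of w] assms(2)[of w] by (cases "norm w \<le> e") auto
  then show ?thesis by (intro that[of "max B 1"]) auto
qed

text \<open>One majorant for all \<open>x\<close> in the ball of radius \<open>R\<close>, because
  the kernel at such an \<open>x\<close> only sees points of norm at most \<open>R + e\<close>. It
  feeds the dominated convergence arguments.\<close>

lemma kernel_dominated:
  fixes k :: "'a::euclidean_space \<Rightarrow> real"
  assumes "\<And>w. e \<le> norm w \<Longrightarrow> k w = 0" "\<And>w. \<bar>k w\<bar> \<le> B" "norm x \<le> R" "0 \<le> B"
  shows "\<bar>f z * k (x - z)\<bar> \<le> B * \<bar>indicator (cball 0 (R + e)) z * f z\<bar>"
proof (cases "norm z \<le> R + e")
  case True
  then show ?thesis using mult_right_mono[OF assms(2)[of "x - z"] abs_ge_zero[of "f z"]]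
    by (simp add: abs_mult mult.commute)
next
  case False
  then have "e \<le> norm (x - z)" using norm_triangle_ineq2[of z x] assms(3) by (simp add: norm_minus_commute)
  then show ?thesis using assms by simp
qed

lemma conv_integrable:
  fixes k :: "'a::euclidean_space \<Rightarrow> real"
  assumes "loc_integrable f" "continuous_on UNIV k" "\<And>w. e \<le> norm w \<Longrightarrow> k w = 0"
  shows "integrable lborel (\<lambda>z. f z * k (x - z))"
proof -
  obtain B where B: "B > 0" "\<And>w. \<bar>k w\<bar> \<le> B" using kernel_bounded[OF assms(2,3)] by blast
  have [measurable]: "f \<in> borel_measurable borel" using assms(1) by (rule loc_integrable_measurable)
  have [measurable]: "k \<in> borel_measurable borel" using assms(2) by (rule borel_measurable_continuous_onI)
  show ?thesis
  proof (rule Bochner_Integration.integrable_bound)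
    show "integrable lborel (\<lambda>z. B * \<bar>indicator (cball 0 (norm x + e)) z * f z\<bar>)"
      using assms(1) unfolding loc_integrable_def by (intro integrable_mult_right integrable_abs) auto
    show "AE z in lborel. norm (f z * k (x - z)) \<le> norm (B * \<bar>indicator (cball 0 (norm x + e)) z * f z\<bar>)"
      using kernel_dominated[OF assms(3) B(2) order_refl, where f=f] B(1) by (auto intro!: AE_I2)
  qed simp
qed

lemma continuous_on_conv:
  fixes k :: "'a::euclidean_space \<Rightarrow> real"
  assumes "loc_integrable f" "continuous_on UNIV k" "\<And>w. e \<le> norm w \<Longrightarrow> k w = 0"
  shows "continuous_on UNIV (conv f k)"
proof -
  obtain B where B: "B > 0" "\<And>w. \<bar>k w\<bar> \<le> B" using kernel_bounded[OF assms(2,3)] by blast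
  have [measurable]: "f \<in> borel_measurable borel" using assms(1) by (rule loc_integrable_measurable)
  have [measurable]: "k \<in> borel_measurable borel" using assms(2) by (rule borel_measurable_continuous_onI)
  show ?thesis
  proof (rule continuous_on_sequentiallyI)
    fix u and a :: 'a assume u: "u \<longlonglongrightarrow> a"
    then obtain R where R: "\<And>i. norm (u i) \<le> R"
      using convergent_imp_Bseq[of u] by (auto simp: convergent_def Bseq_def)
    show "(\<lambda>n. conv f k (u n)) \<longlonglongrightarrow> conv f k a" unfolding conv_def
    proof (rule integral_dominated_convergence)
      show "integrable lborel (\<lambda>z. B * \<bar>indicator (cball 0 (R + e)) z * f z\<bar>)"
        using assms(1) unfolding loc_integrable_def by (intro integrable_mult_right integrable_abs) auto
      show "AE z in lborel. norm (f z * k (u i - z)) \<le> B * \<bar>indicator (cball 0 (R + e)) z * f z\<bar>" for i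
        using kernel_dominated[OF assms(3) B(2) R, where f=f] B(1) by (auto intro!: AE_I2)
      show "AE z in lborel. (\<lambda>i. f z * k (u i - z)) \<longlonglongrightarrow> f z * k (a - z)"
      proof (rule AE_I2)
        fix z
        have "(\<lambda>i. k (u i - z)) \<longlonglongrightarrow> k (a - z)"
          by (rule continuous_on_tendsto_compose[OF assms(2)]) (auto intro!: tendsto_intros u)
        then show "(\<lambda>i. f z * k (u i - z)) \<longlonglongrightarrow> f z * k (a - z)" by (intro tendsto_intros)
      qed
    qed simp_all
  qed
qed

lemma line_lipschitz:
  fixes k k' :: "'a::real_normed_vector \<Rightarrow> real"
  assumes "\<And>x t. ((\<lambda>t. k (x + t *\<^sub>R v)) has_real_derivative k' (x + t *\<^sub>R v)) (at t)" "\<And>w. \<bar>k' w\<bar> \<le> B"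
  shows "\<bar>k (x + s *\<^sub>R v) - k (x + t *\<^sub>R v)\<bar> \<le> B * \<bar>s - t\<bar>"
  using field_differentiable_bound[of UNIV "\<lambda>t. k (x + t *\<^sub>R v)" "\<lambda>t. k' (x + t *\<^sub>R v)" B s t] assms by auto

text \<open>All derivatives fall on the kernel, which suits a merely locally integrable
  \<open>f\<close>. The difference quotients of the kernel are bounded by the supremum of
  \<open>k'\<close>, so the integrands are dominated on a fixed ball.\<close>

lemma has_derivative_conv:
  fixes k k' :: "'a::euclidean_space \<Rightarrow> real"
  assumes f: "loc_integrable f" and k: "continuous_on UNIV k" "\<And>w. e \<le> norm w \<Longrightarrow> k w = 0"
    and k': "continuous_on UNIV k'" "\<And>w. e \<le> norm w \<Longrightarrow> k' w = 0"
    and d: "\<And>x t. ((\<lambda>t. k (x + t *\<^sub>R v)) has_real_derivative k' (x + t *\<^sub>R v)) (at t)"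
  shows "((\<lambda>t. conv f k (x + t *\<^sub>R v)) has_real_derivative conv f k' (x + t *\<^sub>R v)) (at t)"
proof -
  obtain B where B: "B > 0" "\<And>w. \<bar>k' w\<bar> \<le> B" using kernel_bounded[OF k'] by blast
  have [measurable]: "f \<in> borel_measurable borel" using f by (rule loc_integrable_measurable)
  have [measurable]: "k \<in> borel_measurable borel" "k' \<in> borel_measurable borel"
    using k(1) k'(1) by (auto intro: borel_measurable_continuous_onI)
  have int: "integrable lborel (\<lambda>z. f z * k (x - z))" for x using conv_integrable[OF f k] .
  show ?thesis unfolding has_field_derivative_iff tendsto_at_iff_sequentially o_def
  proof (intro allI impI)
    fix X assume X0: "\<forall>i. X i \<in> UNIV - {t}" and X: "X \<longlonglongrightarrow> t"
    from X obtain M where M: "\<And>i. \<bar>X i\<bar> \<le> M" 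
      using convergent_imp_Bseq[of X] by (auto simp: convergent_def Bseq_def)
    define R where "R = max (norm x + M * norm v) (norm (x + t *\<^sub>R v))"
    have R: "norm (x + X i *\<^sub>R v) \<le> R" "norm (x + t *\<^sub>R v) \<le> R" for i
    proof -
      have "norm (x + X i *\<^sub>R v) \<le> norm x + \<bar>X i\<bar> * norm v" by (metis norm_scaleR norm_triangle_ineq)
      also have "\<dots> \<le> norm x + M * norm v" using M[of i] by (intro add_left_mono mult_right_mono) auto
      finally show "norm (x + X i *\<^sub>R v) \<le> R" by (simp add: R_def)
    qed (simp add: R_def)
    define q where "q i z = f z * ((k (x + X i *\<^sub>R v - z) - k (x + t *\<^sub>R v - z)) / (X i - t))" for i z
    have eq: "(conv f k (x + X i *\<^sub>R v) - conv f k (x + t *\<^sub>R v)) / (X i - t) = (\<integral>z. q i z \<partial>lborel)" for i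
      unfolding conv_def q_def by (subst Bochner_Integration.integral_diff[symmetric, OF int int])
        (simp add: right_diff_distrib diff_divide_distrib flip: Bochner_Integration.integral_divide_zero)
    have "(\<lambda>i. \<integral>z. q i z \<partial>lborel) \<longlonglongrightarrow> (\<integral>z. f z * k' (x + t *\<^sub>R v - z) \<partial>lborel)"
    proof (rule integral_dominated_convergence)
      show "integrable lborel (\<lambda>z. B * \<bar>indicator (cball 0 (R + e)) z * f z\<bar>)"
        using f unfolding loc_integrable_def by (intro integrable_mult_right integrable_abs) auto
      show "AE z in lborel. norm (q i z) \<le> B * \<bar>indicator (cball 0 (R + e)) z * f z\<bar>" for i
      proof (rule AE_I2)
        fix z
        show "norm (q i z) \<le> B * \<bar>indicator (cball 0 (R + e)) z * f z\<bar>"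
        proof (cases "norm z \<le> R + e")
          case True
          have "\<bar>k ((x - z) + X i *\<^sub>R v) - k ((x - z) + t *\<^sub>R v)\<bar> \<le> B * \<bar>X i - t\<bar>"
            by (rule line_lipschitz[OF d B(2)])
          then have "\<bar>(k (x + X i *\<^sub>R v - z) - k (x + t *\<^sub>R v - z)) / (X i - t)\<bar> \<le> B"
            using X0 by (auto simp: abs_divide divide_le_eq algebra_simps)
          then have "\<bar>f z\<bar> * \<bar>(k (x + X i *\<^sub>R v - z) - k (x + t *\<^sub>R v - z)) / (X i - t)\<bar> \<le> \<bar>f z\<bar> * B"
            by (rule mult_left_mono) simp
          with True show ?thesis unfolding q_def real_norm_def abs_mult by (simp add: mult.commute)
        next
          case False
          have "e \<le> norm (x + X i *\<^sub>R v - z)" "e \<le> norm (x + t *\<^sub>R v - z)"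
            using False R(1)[of i] R(2) norm_triangle_ineq2[of z "x + X i *\<^sub>R v"] norm_triangle_ineq2[of z "x + t *\<^sub>R v"]
            by (simp_all add: norm_minus_commute)
          then show ?thesis using k(2) B by (simp add: q_def)
        qed
      qed
      show "AE z in lborel. (\<lambda>i. q i z) \<longlonglongrightarrow> f z * k' (x + t *\<^sub>R v - z)"
      proof (rule AE_I2)
        fix z
        have "(\<lambda>i. (k ((x - z) + X i *\<^sub>R v) - k ((x - z) + t *\<^sub>R v)) / (X i - t)) \<longlonglongrightarrow> k' ((x - z) + t *\<^sub>R v)"
          using d[of "x - z" t] X0 X unfolding has_field_derivative_iff tendsto_at_iff_sequentially o_def by blast
        moreover have "x - z + w = x + w - z" for w by simp
        ultimately show "(\<lambda>i. q i z) \<longlonglongrightarrow> f z * k' (x + t *\<^sub>R v - z)"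
          unfolding q_def by (intro tendsto_mult tendsto_const) simp
      qed
    qed (simp_all add: q_def)
    then show "(\<lambda>i. (conv f k (x + X i *\<^sub>R v) - conv f k (x + t *\<^sub>R v)) / (X i - t)) \<longlonglongrightarrow> conv f k' (x + t *\<^sub>R v)"
      unfolding eq unfolding conv_def .
  qed
qed

lemma lborel_distr_reflect: "distr lborel borel (\<lambda>z. x - z) = (lborel :: 'a::euclidean_space measure)"
  using lborel_affine[of "-1::real" x] by (simp add: density_1)

lemma integral_reflect:
  fixes f :: "'a::euclidean_space \<Rightarrow> real"
  assumes "f \<in> borel_measurable borel"
  shows "(\<integral>z. f (x - z) \<partial>lborel) = integral\<^sup>L lborel f"
  by (subst (2) lborel_distr_reflect[of x, symmetric], subst integral_distr) (use assms in auto)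

lemma integral_translate:
  fixes f :: "'a::euclidean_space \<Rightarrow> real"
  assumes "f \<in> borel_measurable borel"
  shows "(\<integral>z. f (z + c) \<partial>lborel) = integral\<^sup>L lborel f"
  by (subst (2) lborel_distr_plus[of c, symmetric], subst integral_distr) (use assms in \<open>auto simp: add.commute\<close>)

lemma integral_line_derivative_0:
  fixes f f' :: "'a::euclidean_space \<Rightarrow> real"
  assumes d: "\<And>x t. ((\<lambda>t. f (x + t *\<^sub>R v)) has_real_derivative f' (x + t *\<^sub>R v)) (at t)"
    and f: "continuous_on UNIV f" "continuous_on UNIV f'"
    and s: "\<And>x. r \<le> norm x \<Longrightarrow> f x = 0" "\<And>x. r \<le> norm x \<Longrightarrow> f' x = 0"
  shows "(\<integral>x. f' x \<partial>lborel) = 0"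
proof -
  text \<open>Convolving with a constant gives a constant function, whose derivative vanishes.\<close>
  have i: "loc_integrable (\<lambda>_::'a. 1::real)" by (rule loc_integrable_continuous) auto
  have m: "f \<in> borel_measurable borel" "f' \<in> borel_measurable borel"
    using f by (auto intro: borel_measurable_continuous_onI)
  have "((\<lambda>t. conv (\<lambda>_. 1) f (0 + t *\<^sub>R v)) has_real_derivative conv (\<lambda>_. 1) f' (0 + 0 *\<^sub>R v)) (at 0)"
    by (rule has_derivative_conv[OF i f(1) s(1) f(2) s(2) d])
  then have "((\<lambda>t. integral\<^sup>L lborel f) has_real_derivative integral\<^sup>L lborel f') (at 0)"
    using m by (simp add: conv_def integral_reflect integral_reflect[of f' 0, simplified])
  then show ?thesis using DERIV_unique DERIV_const by blast
qed

section \<open>Approximation in L1 by continuous functions and by mollification\<close>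

lemma AE_lborel_of_negligible:
  assumes "negligible N" "\<And>x. x \<notin> N \<Longrightarrow> P x"
  shows "AE x in lborel. P x"
proof -
  have "AE x in lebesgue. P x"
    using assms(1,2) by (auto simp: negligible_iff_null_sets intro: AE_I'[of N])
  then show ?thesis using AE_completion_iff[where M = lborel and P = P] by simp
qed

text \<open>Measurability supplies continuous \<open>g n\<close> converging to \<open>f\<close>
  outside a negligible set, but without control in L1. Clipping the values with \<open>cl M\<close>
  and the support with \<open>cut M\<close> provides majorants: \<open>M\<close> is fixed first, so
  that the clipped \<open>f\<close> is L1-close to \<open>f\<close>, and then
  \<open>n\<close>.\<close>

lemma integrable_approx_continuous:
  fixes f :: "'a::euclidean_space \<Rightarrow> real"
  assumes f: "integrable lborel f" and "0 < \<delta>"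
  obtains h r where "continuous_on UNIV h" "\<And>x. r \<le> norm x \<Longrightarrow> h x = 0" "(\<integral>x. \<bar>f x - h x\<bar> \<partial>lborel) < \<delta>"
proof -
  have [measurable]: "f \<in> borel_measurable borel" using f by auto
  have "f \<in> borel_measurable lebesgue" by (metis f borel_measurable_integrable measurable_completion)
  then have "f measurable_on UNIV"
    by (intro lebesgue_measurable_imp_measurable_on) auto
  then obtain N g where N: "negligible N" and g: "\<And>n. continuous_on UNIV (g n)"
    "\<And>x. x \<notin> N \<Longrightarrow> (\<lambda>n. g n x) \<longlonglongrightarrow> f x" unfolding measurable_on_def by auto
  define cut where "cut M x = max 0 (min 1 (real M + 1 - norm x))" for M and x :: 'a
  define cl where "cl M t = max (- real M) (min (real M) t)" for M t
  have cut: "0 \<le> cut M x" "cut M x \<le> 1" "real M + 1 \<le> norm x \<Longrightarrow> cut M x = 0" for M x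
    by (auto simp: cut_def)
  have cl: "\<bar>cl M t\<bar> \<le> \<bar>t\<bar>" "\<bar>cl M t\<bar> \<le> real M" for M t by (auto simp: cl_def)
  have ccut: "continuous_on UNIV (cut M)" and ccl: "continuous_on UNIV (cl M)" for M
    unfolding cut_def cl_def by (intro continuous_intros)+
  have [measurable]: "cut M \<in> borel_measurable borel" "cl M \<in> borel_measurable borel" "g n \<in> borel_measurable borel" for M n
    using ccut ccl g(1) by (auto intro: borel_measurable_continuous_onI)
  have b1: "\<bar>cl M t * cut M x\<bar> \<le> \<bar>t\<bar>" for M t x
    using mult_mono[OF cl(1)[of M t] cut(2)[of M x] _ cut(1)] cut(1)[of M x] by (simp add: abs_mult)
  have "(\<lambda>M. \<integral>x. \<bar>f x - cl M (f x) * cut M x\<bar> \<partial>lborel) \<longlonglongrightarrow> (\<integral>x. 0 \<partial>(lborel :: 'a measure))"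
  proof (rule integral_dominated_convergence)
    show "integrable lborel (\<lambda>x. 2 * \<bar>f x\<bar>)" using f by auto
    show "AE x in lborel. norm \<bar>f x - cl M (f x) * cut M x\<bar> \<le> 2 * \<bar>f x\<bar>" for M
    proof (rule AE_I2)
      fix x show "norm \<bar>f x - cl M (f x) * cut M x\<bar> \<le> 2 * \<bar>f x\<bar>"
        using b1[of M "f x" x] abs_triangle_ineq4[of "f x" "cl M (f x) * cut M x"] by simp
    qed
    show "AE x in lborel. (\<lambda>M. \<bar>f x - cl M (f x) * cut M x\<bar>) \<longlonglongrightarrow> 0"
    proof (rule AE_I2)
      fix x
      have "\<forall>\<^sub>F M in sequentially. \<bar>f x - cl M (f x) * cut M x\<bar> = 0"
        using eventually_ge_at_top[of "nat \<lceil>\<bar>f x\<bar>\<rceil>"] eventually_ge_at_top[of "nat \<lceil>norm x\<rceil>"]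
        by eventually_elim (auto simp: cl_def cut_def)
      then show "(\<lambda>M. \<bar>f x - cl M (f x) * cut M x\<bar>) \<longlonglongrightarrow> 0" by (rule tendsto_eventually)
    qed
  qed auto
  then have "\<forall>\<^sub>F M in sequentially. (\<integral>x. \<bar>f x - cl M (f x) * cut M x\<bar> \<partial>lborel) < \<delta> / 2"
    using \<open>0 < \<delta>\<close> by (intro order_tendstoD(2)[where a = "\<delta>/2"]) auto
  then obtain M where M: "(\<integral>x. \<bar>f x - cl M (f x) * cut M x\<bar> \<partial>lborel) < \<delta> / 2"
    by (auto simp: eventually_sequentially)
  have b2: "\<bar>cl M t * cut M x\<bar> \<le> real M * indicator (cball 0 (real M + 1)) x" for t x
    using mult_mono[OF cl(2)[of M t] cut(2)[of M x] _ cut(1)] cut(1)[of M x] cut(3)[of M x]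
    by (auto simp: abs_mult indicator_def)
  have iM: "integrable lborel (\<lambda>x::'a. real M * indicator (cball 0 (real M + 1)) x)"
    using emeasure_compact_finite[OF compact_cball] by (intro integrable_mult_right integrable_real_indicator) auto
  have "(\<lambda>n. \<integral>x. \<bar>cl M (f x) * cut M x - cl M (g n x) * cut M x\<bar> \<partial>lborel) \<longlonglongrightarrow> (\<integral>x. 0 \<partial>(lborel :: 'a measure))"
  proof (rule integral_dominated_convergence)
    show "integrable lborel (\<lambda>x::'a. 2 * (real M * indicator (cball 0 (real M + 1)) x))"
      using iM by (intro integrable_mult_right) auto
    show "AE x in lborel. norm \<bar>cl M (f x) * cut M x - cl M (g n x) * cut M x\<bar>
        \<le> 2 * (real M * indicator (cball 0 (real M + 1)) x)" for n
    proof (rule AE_I2)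
      fix x show "norm \<bar>cl M (f x) * cut M x - cl M (g n x) * cut M x\<bar>
        \<le> 2 * (real M * indicator (cball 0 (real M + 1)) x)"
        using b2[of "f x" x] b2[of "g n x" x]
          abs_triangle_ineq4[of "cl M (f x) * cut M x" "cl M (g n x) * cut M x"] by simp
    qed
    have lim: "(\<lambda>n. \<bar>cl M (f x) * cut M x - cl M (g n x) * cut M x\<bar>) \<longlonglongrightarrow> 0" if "x \<notin> N" for x
    proof -
      have "(\<lambda>n. cl M (g n x)) \<longlonglongrightarrow> cl M (f x)"
        by (rule continuous_on_tendsto_compose[OF ccl g(2)[OF that]]) auto
      then show ?thesis by (auto intro!: tendsto_eq_intros)
    qed
    show "AE x in lborel. (\<lambda>n. \<bar>cl M (f x) * cut M x - cl M (g n x) * cut M x\<bar>) \<longlonglongrightarrow> 0"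
      by (rule AE_lborel_of_negligible[OF N lim])
  qed auto
  then have "\<forall>\<^sub>F n in sequentially. (\<integral>x. \<bar>cl M (f x) * cut M x - cl M (g n x) * cut M x\<bar> \<partial>lborel) < \<delta> / 2"
    using \<open>0 < \<delta>\<close> by (intro order_tendstoD(2)[where a = "\<delta>/2"]) auto
  then obtain n where n: "(\<integral>x. \<bar>cl M (f x) * cut M x - cl M (g n x) * cut M x\<bar> \<partial>lborel) < \<delta> / 2"
    by (auto simp: eventually_sequentially)
  define h where "h x = cl M (g n x) * cut M x" for x
  have i1: "integrable lborel (\<lambda>x. cl M (u x) * cut M x)" if [measurable]: "u \<in> borel_measurable borel" for u
    by (rule Bochner_Integration.integrable_bound[OF iM]) (use b2 in \<open>auto intro!: AE_I2\<close>)
  note i2 = i1[of f] i1[of "g n"]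
  have "(\<integral>x. \<bar>f x - h x\<bar> \<partial>lborel) \<le> (\<integral>x. \<bar>f x - cl M (f x) * cut M x\<bar> + \<bar>cl M (f x) * cut M x - cl M (g n x) * cut M x\<bar> \<partial>lborel)"
    unfolding h_def using f i2 by (intro integral_mono Bochner_Integration.integrable_add integrable_abs Bochner_Integration.integrable_diff) auto
  also have "\<dots> = (\<integral>x. \<bar>f x - cl M (f x) * cut M x\<bar> \<partial>lborel) + (\<integral>x. \<bar>cl M (f x) * cut M x - cl M (g n x) * cut M x\<bar> \<partial>lborel)"
    using f i2 by (intro Bochner_Integration.integral_add integrable_abs Bochner_Integration.integrable_diff) auto
  also have "\<dots> < \<delta>" using M n by simp
  finally have "(\<integral>x. \<bar>f x - h x\<bar> \<partial>lborel) < \<delta>" .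
  moreover have "continuous_on UNIV h" unfolding h_def
    by (intro continuous_on_mult ccut continuous_on_compose2[OF ccl] g(1)) auto
  moreover have "h x = 0" if "real M + 1 \<le> norm x" for x using cut(3)[OF that] by (simp add: h_def)
  ultimately show ?thesis using that by blast
qed

definition averaging_kernel :: "real \<Rightarrow> ('a::euclidean_space \<Rightarrow> real) \<Rightarrow> bool" where
  "averaging_kernel e k \<longleftrightarrow> continuous_on UNIV k \<and> (\<forall>w. e \<le> norm w \<longrightarrow> k w = 0) \<and> (\<forall>w. 0 \<le> k w)
     \<and> integral\<^sup>L lborel k = 1"

lemma averaging_kernelD:
  assumes "averaging_kernel e k"
  shows "continuous_on UNIV k" "\<And>w. e \<le> norm w \<Longrightarrow> k w = 0" "\<And>w. 0 \<le> k w" "integral\<^sup>L lborel k = 1"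
    "k \<in> borel_measurable borel" "integrable lborel k"
  using assms by (auto simp: averaging_kernel_def borel_measurable_continuous_onI) (metis not_integrable_integral_eq zero_neq_one)

text \<open>Young's inequality for a kernel of unit mass, by exchanging the order of integration.
  This bound is what makes later estimates independent of the mollification radius.\<close>

lemma conv_L1:
  fixes f :: "'a::euclidean_space \<Rightarrow> real"
  assumes f: "integrable lborel f" and k: "averaging_kernel e k"
  shows "integrable lborel (conv f k)" "(\<integral>x. \<bar>conv f k x\<bar> \<partial>lborel) \<le> (\<integral>x. \<bar>f x\<bar> \<partial>lborel)"
proof -
  note kD = averaging_kernelD[OF k]
  have [measurable]: "f \<in> borel_measurable borel" "k \<in> borel_measurable borel" using f kD by auto
  have cont: "continuous_on UNIV (conv f k)"
    by (rule continuous_on_conv[OF loc_integrable_of_integrable[OF f] kD(1,2)])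
  then have [measurable]: "conv f k \<in> borel_measurable borel" by (rule borel_measurable_continuous_onI)
  have pos: "ennreal \<bar>conv f k x\<bar> \<le> (\<integral>\<^sup>+z. ennreal (\<bar>f z\<bar> * k (x - z)) \<partial>lborel)" for x
  proof -
    have i: "integrable lborel (\<lambda>z. f z * k (x - z))"
      by (rule conv_integrable[OF loc_integrable_of_integrable[OF f] kD(1,2)])
    have "\<bar>conv f k x\<bar> \<le> (\<integral>z. \<bar>f z * k (x - z)\<bar> \<partial>lborel)"
      unfolding conv_def by (rule integral_abs_bound)
    then have "ennreal \<bar>conv f k x\<bar> \<le> ennreal (\<integral>z. \<bar>f z * k (x - z)\<bar> \<partial>lborel)" by (rule ennreal_leI)
    also have "\<dots> = (\<integral>\<^sup>+z. ennreal \<bar>f z * k (x - z)\<bar> \<partial>lborel)"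
      using i by (intro nn_integral_eq_integral[symmetric] integrable_abs) auto
    finally show ?thesis using kD(3) by (simp add: abs_mult)
  qed
  have "(\<integral>\<^sup>+x. ennreal \<bar>conv f k x\<bar> \<partial>lborel) \<le> (\<integral>\<^sup>+x. \<integral>\<^sup>+z. ennreal (\<bar>f z\<bar> * k (x - z)) \<partial>lborel \<partial>lborel)"
    by (rule nn_integral_mono) (rule pos)
  also have "\<dots> = (\<integral>\<^sup>+z. \<integral>\<^sup>+x. ennreal (\<bar>f z\<bar> * k (x - z)) \<partial>lborel \<partial>lborel)"
    by (rule lborel_pair.Fubini') measurable
  also have "\<dots> = (\<integral>\<^sup>+z. ennreal \<bar>f z\<bar> \<partial>lborel)"
  proof (rule nn_integral_cong)
    fix z
    have "(\<integral>\<^sup>+x. ennreal (k (x - z)) \<partial>lborel) = (\<integral>\<^sup>+x. ennreal (k x) \<partial>lborel)"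
      by (subst (2) lborel_distr_plus[of "-z", symmetric], subst nn_integral_distr) (auto simp: algebra_simps)
    also have "\<dots> = ennreal 1" using kD by (subst nn_integral_eq_integral) auto
    finally show "(\<integral>\<^sup>+x. ennreal (\<bar>f z\<bar> * k (x - z)) \<partial>lborel) = ennreal \<bar>f z\<bar>"
      using kD(3) by (simp add: ennreal_mult nn_integral_cmult)
  qed
  finally have le: "(\<integral>\<^sup>+x. ennreal \<bar>conv f k x\<bar> \<partial>lborel) \<le> (\<integral>\<^sup>+z. ennreal \<bar>f z\<bar> \<partial>lborel)" .
  also have fin: "(\<integral>\<^sup>+z. ennreal \<bar>f z\<bar> \<partial>lborel) = ennreal (\<integral>z. \<bar>f z\<bar> \<partial>lborel)"
    using f by (intro nn_integral_eq_integral) auto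
  finally have le': "(\<integral>\<^sup>+x. ennreal \<bar>conv f k x\<bar> \<partial>lborel) \<le> ennreal (\<integral>z. \<bar>f z\<bar> \<partial>lborel)" .
  show int: "integrable lborel (conv f k)"
    unfolding integrable_iff_bounded using le' by (auto intro: le_less_trans)
  show "(\<integral>x. \<bar>conv f k x\<bar> \<partial>lborel) \<le> (\<integral>x. \<bar>f x\<bar> \<partial>lborel)"
    using le' int by (subst (asm) nn_integral_eq_integral) (auto simp: ennreal_le_iff)
qed

lemma conv_minus_self:
  fixes h :: "'a::euclidean_space \<Rightarrow> real"
  assumes h: "loc_integrable h" and k: "averaging_kernel e k" and osc: "\<And>z. norm (x - z) < e \<Longrightarrow> \<bar>h z - h x\<bar> \<le> \<eta>"
  shows "\<bar>conv h k x - h x\<bar> \<le> \<eta>"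
proof -
  note kD = averaging_kernelD[OF k]
  have [measurable]: "k \<in> borel_measurable borel" by fact
  have one: "(\<integral>z. k (x - z) \<partial>lborel) = 1" using integral_reflect[of k x] kD by simp
  have ik: "integrable lborel (\<lambda>z. k (x - z))" using one not_integrable_integral_eq by force
  have i: "integrable lborel (\<lambda>z. h z * k (x - z))" by (rule conv_integrable[OF h kD(1,2)])
  have "conv h k x - h x = (\<integral>z. h z * k (x - z) - h x * k (x - z) \<partial>lborel)"
    unfolding conv_def using i ik one by simp
  also have "\<bar>\<dots>\<bar> \<le> (\<integral>z. \<eta> * k (x - z) \<partial>lborel)"
  proof (intro integral_abs_bound_integral)
    fix z
    have "\<bar>h z - h x\<bar> * k (x - z) \<le> \<eta> * k (x - z)"
      using osc[of z] kD(2)[of "x - z"] kD(3)[of "x - z"] by (cases "norm (x - z) < e") (auto intro: mult_right_mono)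
    then show "\<bar>h z * k (x - z) - h x * k (x - z)\<bar> \<le> \<eta> * k (x - z)"
      using kD(3)[of "x - z"] by (simp add: left_diff_distrib[symmetric] abs_mult)
  qed (use i ik in auto)
  also have "\<dots> = \<eta>" using one by simp
  finally show ?thesis .
qed

lemma mollification_L1:
  fixes f :: "'a::euclidean_space \<Rightarrow> real"
  assumes f: "integrable lborel f" and k: "\<And>j. averaging_kernel (e j) (k j)" and e: "e \<longlonglongrightarrow> 0"
  shows "(\<lambda>j. \<integral>x. \<bar>conv f (k j) x - f x\<bar> \<partial>lborel) \<longlonglongrightarrow> 0"
proof (rule LIMSEQ_I)
  fix d :: real assume d: "0 < d"
  obtain h r where h: "continuous_on UNIV h" "\<And>x. r \<le> norm x \<Longrightarrow> h x = 0" "(\<integral>x. \<bar>f x - h x\<bar> \<partial>lborel) < d / 3"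
    using integrable_approx_continuous[OF f, of "d/3"] d by auto
  have ih: "integrable lborel h"
    using h(1,2) unfolding atomize_all
    by (intro integrable_compact_support) auto
  \<comment> \<open>Once the kernel radius is below 1, both \<open>h\<close> and its mollification
    vanish outside the ball of radius \<open>\<bar>r\<bar> + 1\<close>; on it the uniform error
    \<eta> contributes at most \<open>\<eta> * V < d / 3\<close>.\<close>
  define V where "V = measure lborel (cball (0::'a) (\<bar>r\<bar> + 1))"
  define \<eta> where "\<eta> = d / (3 * (V + 1))"
  have V: "V \<ge> 0" by (simp add: V_def)
  have \<eta>: "\<eta> > 0" "\<eta> * V < d / 3" using d V by (auto simp: \<eta>_def field_simps)
  have "uniformly_continuous_on (cball 0 (\<bar>r\<bar> + 2)) h"
    by (intro compact_uniformly_continuous continuous_on_subset[OF h(1)]) auto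
  then obtain s where s: "s > 0" "\<And>x z. x \<in> cball 0 (\<bar>r\<bar> + 2) \<Longrightarrow> z \<in> cball 0 (\<bar>r\<bar> + 2) \<Longrightarrow> dist z x < s \<Longrightarrow> dist (h z) (h x) < \<eta>"
    unfolding uniformly_continuous_on_def using \<eta>(1) by metis
  have "\<forall>\<^sub>F j in sequentially. e j < min s 1" using s(1) by (intro order_tendstoD(2)[OF e]) auto
  then obtain J where J: "\<And>j. j \<ge> J \<Longrightarrow> e j < min s 1" by (auto simp: eventually_sequentially)
  have "(\<integral>x. \<bar>conv f (k j) x - f x\<bar> \<partial>lborel) < d" if "j \<ge> J" for j
  proof -
    note kD = averaging_kernelD[OF k[of j]]
    note L = loc_integrable_of_integrable
    have b: "\<bar>conv h (k j) x - h x\<bar> \<le> \<eta> * indicator (cball 0 (\<bar>r\<bar> + 1)) x" for x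
    proof (cases "norm x \<le> \<bar>r\<bar> + 1")
      case True
      have "\<bar>conv h (k j) x - h x\<bar> \<le> \<eta>"
      proof (rule conv_minus_self[OF L[OF ih] k[of j]])
        fix z assume "norm (x - z) < e j"
        then have "norm (x - z) < s" "norm (x - z) < 1" using J[OF that] by auto
        moreover have "norm z \<le> norm x + norm (x - z)" using norm_triangle_ineq4[of x "x - z"] by simp
        ultimately show "\<bar>h z - h x\<bar> \<le> \<eta>" using s(2)[of x z] True by (simp add: dist_norm norm_minus_commute)
      qed
      then show ?thesis using True by simp
    next
      case False
      have "\<bar>conv h (k j) x - h x\<bar> \<le> 0"
      proof (rule conv_minus_self[OF L[OF ih] k[of j]])
        fix z assume "norm (x - z) < e j"
        then have "norm (x - z) < 1" using J[OF that] by auto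
        moreover have "norm x \<le> norm z + norm (x - z)" by (rule norm_triangle_sub)
        ultimately show "\<bar>h z - h x\<bar> \<le> 0" using h(2)[of z] h(2)[of x] False by simp
      qed
      then show ?thesis using \<eta> by simp
    qed
    have c: "conv f (k j) x = conv (\<lambda>x. f x - h x) (k j) x + conv h (k j) x" for x
      unfolding conv_def
      by (subst Bochner_Integration.integral_add[symmetric])
        (auto intro!: conv_integrable[OF L kD(1,2)] f ih simp: left_diff_distrib)
    have fh: "integrable lborel (\<lambda>x. f x - h x)" using f ih by auto
    note C = conv_L1[OF fh k[of j]] conv_L1(1)[OF ih k[of j]] conv_L1(1)[OF f k[of j]]
    have fin: "emeasure lborel (cball (0::'a) (\<bar>r\<bar> + 1)) < \<infinity>" by (rule emeasure_compact_finite) simp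
    have "(\<integral>x. \<bar>conv f (k j) x - f x\<bar> \<partial>lborel)
       \<le> (\<integral>x. \<bar>conv (\<lambda>x. f x - h x) (k j) x\<bar> + \<bar>conv h (k j) x - h x\<bar> + \<bar>f x - h x\<bar> \<partial>lborel)"
      using C f ih by (intro integral_mono) (auto simp: c)
    also have "\<dots> = (\<integral>x. \<bar>conv (\<lambda>x. f x - h x) (k j) x\<bar> \<partial>lborel) + (\<integral>x. \<bar>conv h (k j) x - h x\<bar> \<partial>lborel) + (\<integral>x. \<bar>f x - h x\<bar> \<partial>lborel)"
      using C f ih by simp
    also have "(\<integral>x. \<bar>conv h (k j) x - h x\<bar> \<partial>lborel) \<le> (\<integral>x. \<eta> * indicator (cball (0::'a) (\<bar>r\<bar> + 1)) x \<partial>lborel)"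
      using C ih fin b by (intro integral_mono) auto
    also have "(\<integral>x. \<eta> * indicator (cball (0::'a) (\<bar>r\<bar> + 1)) x \<partial>lborel) = \<eta> * V" by (simp add: V_def)
    finally show ?thesis using C(2) h(3) \<eta>(2) by linarith
  qed
  then show "\<exists>no. \<forall>n\<ge>no. norm ((\<integral>x. \<bar>conv f (k n) x - f x\<bar> \<partial>lborel) - 0) < d"
    by (intro exI[of _ J]) auto
qed

section \<open>Semidiscrete optimal transport\<close>

context
  fixes pt :: "'i \<Rightarrow> 'a::euclidean_space" and m :: "'i \<Rightarrow> real" and I :: "'i set" and T :: "'a set"
  assumes I: "finite I" "I \<noteq> {}" and m: "\<And>i. i \<in> I \<Longrightarrow> 0 < m i"
    and T: "compact T" and mT: "measure lborel T = (\<Sum>i\<in>I. m i)"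
begin

text \<open>The Legendre transform of the discrete function with value \<open>h i\<close> at
  \<open>pt i\<close>. The set of \<open>y\<close> at which index \<open>i\<close> attains the
  maximum is the cell transported to \<open>pt i\<close>.\<close>

definition ot_potential :: "('i \<Rightarrow> real) \<Rightarrow> 'a \<Rightarrow> real" where
  "ot_potential h y = Max ((\<lambda>i. pt i \<bullet> y - h i) ` I)"

text \<open>The Kantorovich dual functional, to be minimised. Formally its derivative in
  \<open>h i\<close> is \<open>m i\<close> minus the volume of the cell of \<open>i\<close>, so that
  minimisers have cells of the prescribed masses.\<close>

definition ot_functional :: "('i \<Rightarrow> real) \<Rightarrow> real" where
  "ot_functional h = (\<Sum>i\<in>I. m i * h i) + (\<integral>y. indicator T y * ot_potential h y \<partial>lborel)"

lemma ot_potential_ge: "i \<in> I \<Longrightarrow> pt i \<bullet> y - h i \<le> ot_potential h y"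
  unfolding ot_potential_def using I by simp

lemma ot_potential_attained: obtains i where "i \<in> I" "ot_potential h y = pt i \<bullet> y - h i"
proof -
  have "ot_potential h y \<in> (\<lambda>i. pt i \<bullet> y - h i) ` I"
    unfolding ot_potential_def using I by (intro Max_in) auto
  then show ?thesis using that by auto
qed

lemma ot_potential_le: "(\<And>i. i \<in> I \<Longrightarrow> pt i \<bullet> y - h i \<le> c) \<Longrightarrow> ot_potential h y \<le> c"
  by (rule ot_potential_attained[of h y]) auto

lemma ot_potential_diff: "\<bar>ot_potential h y - ot_potential h' y\<bar> \<le> (\<Sum>i\<in>I. \<bar>h i - h' i\<bar>)"
proof -
  have "ot_potential h y \<le> ot_potential h' y + (\<Sum>i\<in>I. \<bar>h i - h' i\<bar>)" for h h'
  proof (rule ot_potential_le)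
    fix i assume i: "i \<in> I"
    then have "\<bar>h i - h' i\<bar> \<le> (\<Sum>i\<in>I. \<bar>h i - h' i\<bar>)" using I by (intro member_le_sum) auto
    then show "pt i \<bullet> y - h i \<le> ot_potential h' y + (\<Sum>i\<in>I. \<bar>h i - h' i\<bar>)"
      using ot_potential_ge[OF i, of y h'] by linarith
  qed
  from this[of h h'] this[of h' h] show ?thesis by (simp add: abs_minus_commute abs_le_iff)
qed

lemma continuous_ot_potential: "continuous_on UNIV (ot_potential h)"
proof -
  define L where "L = (\<Sum>i\<in>I. norm (pt i))"
  have le: "ot_potential h y \<le> ot_potential h z + L * norm (y - z)" for y z
  proof (rule ot_potential_le)
    fix i assume i: "i \<in> I"
    have "pt i \<bullet> y - pt i \<bullet> z \<le> norm (pt i) * norm (y - z)"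
      by (metis inner_diff_right norm_cauchy_schwarz)
    also have "\<dots> \<le> L * norm (y - z)" unfolding L_def
      using I i by (intro mult_right_mono member_le_sum) auto
    finally show "pt i \<bullet> y - h i \<le> ot_potential h z + L * norm (y - z)"
      using ot_potential_ge[OF i, of z h] by linarith
  qed
  have "dist (ot_potential h y) (ot_potential h z) \<le> L * dist y z" for y z
    using le[of y z] le[of z y] by (simp add: dist_norm abs_le_iff norm_minus_commute)
  then have "L-lipschitz_on UNIV (ot_potential h)"
    unfolding lipschitz_on_def L_def by (auto intro: sum_nonneg)
  then show ?thesis by (rule lipschitz_on_continuous_on)
qed

lemma emeasure_T: "emeasure lborel T < \<infinity>" "T \<in> sets lborel"
  using emeasure_compact_finite[OF T] borel_closed[OF compact_imp_closed[OF T]] by simp_all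

lemma integrable_on_T: "continuous_on UNIV f \<Longrightarrow> integrable lborel (\<lambda>y. indicator T y * (f y::real))"
  using borel_integrable_compact[OF T continuous_on_subset[of UNIV f]] by simp

lemma integral_const_T: "(\<integral>y. indicator T y * c \<partial>lborel) = measure lborel T * c"
  using emeasure_T by simp

lemma ot_functional_diff:
  "ot_functional h - ot_functional h' = (\<Sum>i\<in>I. m i * (h i - h' i))
      + (\<integral>y. indicator T y * (ot_potential h y - ot_potential h' y) \<partial>lborel)"
  unfolding ot_functional_def
  by (simp add: right_diff_distrib sum_subtractf
      Bochner_Integration.integral_diff[OF integrable_on_T integrable_on_T] continuous_ot_potential)

lemma ot_functional_lipschitz:
  "\<bar>ot_functional h - ot_functional h'\<bar> \<le> (\<Sum>i\<in>I. (m i + measure lborel T) * \<bar>h i - h' i\<bar>)"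
proof -
  have "\<bar>\<integral>y. indicator T y * (ot_potential h y - ot_potential h' y) \<partial>lborel\<bar>
      \<le> (\<integral>y. indicator T y * (\<Sum>i\<in>I. \<bar>h i - h' i\<bar>) \<partial>lborel)"
    using ot_potential_diff[of h _ h'] continuous_ot_potential
    by (intro integral_abs_bound_integral integrable_on_T continuous_intros)
      (auto simp: indicator_def)
  also have "\<dots> = (\<Sum>i\<in>I. measure lborel T * \<bar>h i - h' i\<bar>)"
    by (subst integral_const_T) (simp add: sum_distrib_left)
  finally have 1: "\<bar>\<integral>y. indicator T y * (ot_potential h y - ot_potential h' y) \<partial>lborel\<bar>
     \<le> (\<Sum>i\<in>I. measure lborel T * \<bar>h i - h' i\<bar>)" .
  have "\<bar>\<Sum>i\<in>I. m i * (h i - h' i)\<bar> \<le> (\<Sum>i\<in>I. \<bar>m i * (h i - h' i)\<bar>)" by (rule sum_abs)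
  also have "\<dots> = (\<Sum>i\<in>I. m i * \<bar>h i - h' i\<bar>)"
    using m by (intro sum.cong) (auto simp: abs_mult less_imp_le)
  finally show ?thesis using 1 unfolding ot_functional_diff
    by (simp add: distrib_right sum.distrib)
qed

lemma ot_functional_continuous: "continuous_on UNIV ot_functional"
  unfolding continuous_on_def
proof (intro ballI)
  fix h :: "'i \<Rightarrow> real"
  have "((\<lambda>h'. ot_functional h' - ot_functional h) \<longlongrightarrow> 0) (at h)"
  proof (rule Lim_null_comparison)
    show "\<forall>\<^sub>F h' in at h. norm (ot_functional h' - ot_functional h)
        \<le> (\<Sum>i\<in>I. (m i + measure lborel T) * \<bar>h' i - h i\<bar>)"
      using ot_functional_lipschitz by (intro always_eventually) auto
    have "((\<lambda>h'. h' i) \<longlongrightarrow> h i) (at h)" for i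
      using continuous_on_product_coordinates[of i] unfolding continuous_on_def by auto
    then show "((\<lambda>h'. \<Sum>i\<in>I. (m i + measure lborel T) * \<bar>h' i - h i\<bar>) \<longlongrightarrow> 0) (at h)"
      by (auto intro!: tendsto_eq_intros)
  qed
  then show "(ot_functional \<longlongrightarrow> ot_functional h) (at h)" by (simp add: LIM_zero_iff)
qed

text \<open>The volume of \<open>T\<close> equals the total mass, so the changes of the linear part
  and of the integral cancel. This removes the one direction in which the functional fails to be
  coercive.\<close>

lemma ot_functional_shift: "ot_functional (\<lambda>i. h i - c) = ot_functional h"
proof -
  have "ot_potential (\<lambda>i. h i - c) y = ot_potential h y + c" for y
  proof (rule antisym)
    show "ot_potential (\<lambda>i. h i - c) y \<le> ot_potential h y + c"
      using ot_potential_ge[of _ y h] by (intro ot_potential_le) auto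
    show "ot_potential h y + c \<le> ot_potential (\<lambda>i. h i - c) y"
    proof -
      obtain i where i: "i \<in> I" "ot_potential h y = pt i \<bullet> y - h i" by (rule ot_potential_attained)
      show ?thesis using ot_potential_ge[OF i(1), of y "\<lambda>i. h i - c"] i(2) by simp
    qed
  qed
  then have "ot_functional (\<lambda>i. h i - c) - ot_functional h = - (\<Sum>i\<in>I. m i) * c + (\<integral>y. indicator T y * c \<partial>lborel)"
    unfolding ot_functional_diff by (simp add: sum_distrib_right sum_negf)
  then show ?thesis unfolding integral_const_T mT by simp
qed

lemma ot_functional_cong: "(\<And>i. i \<in> I \<Longrightarrow> h i = h' i) \<Longrightarrow> ot_functional h = ot_functional h'"
  unfolding ot_functional_def ot_potential_def by (simp cong: sum.cong image_cong)

text \<open>Normalising the least weight to 0 leaves a coercive problem: a weight above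
  \<open>M\<close> makes the linear part too large. The remaining weights form a compact box, and
  the minimum over it is global.\<close>

lemma ot_minimizer: obtains h where "\<And>h'. ot_functional h \<le> ot_functional h'"
proof -
  obtain X where X: "\<And>i y. i \<in> I \<Longrightarrow> y \<in> T \<Longrightarrow> \<bar>pt i \<bullet> y\<bar> \<le> X"
  proof -
    obtain B where B: "\<And>y. y \<in> T \<Longrightarrow> norm y \<le> B"
      using compact_imp_bounded[OF T] by (auto simp: bounded_iff)
    have "\<bar>pt i \<bullet> y\<bar> \<le> (\<Sum>i\<in>I. norm (pt i)) * max B 0" if "i \<in> I" "y \<in> T" for i y
    proof -
      have "\<bar>pt i \<bullet> y\<bar> \<le> norm (pt i) * norm y" by (rule Cauchy_Schwarz_ineq2)
      also have "\<dots> \<le> (\<Sum>i\<in>I. norm (pt i)) * max B 0"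
        using B[OF that(2)] I that(1) by (intro mult_mono member_le_sum sum_nonneg) auto
      finally show ?thesis .
    qed
    then show ?thesis using that by blast
  qed
  define a where "a = Min (m ` I)"
  have a: "a > 0" "\<And>i. i \<in> I \<Longrightarrow> a \<le> m i" unfolding a_def using I m by auto
  \<comment> \<open>If some normalised weight exceeds \<open>M\<close>, the linear part is at least
    \<open>a * M = 2 * \<bar>X\<bar> * measure lborel T\<close>, while the integral is at least
    \<open>- \<bar>X\<bar> * measure lborel T\<close> by the index of weight 0. The total is no
    smaller than the upper bound for the zero weights.\<close>
  define M where "M = 2 * \<bar>X\<bar> * measure lborel T / a"
  have M0: "M \<ge> 0" using a by (simp add: M_def)
  \<comment> \<open>Coordinates outside \<open>I\<close> are frozen at 0, so that the box is compact
    in the product topology on all functions on the index type.\<close>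
  define H where "H = PiE UNIV (\<lambda>i. if i \<in> I then {0..M} else {0})"
  have "compactin (product_topology (\<lambda>i::'i. euclidean) UNIV) H"
    unfolding H_def by (subst compactin_PiE) auto
  then have "compact H" unfolding euclidean_product_topology by simp
  moreover have z: "(\<lambda>_. 0) \<in> H" using M0 by (auto simp: H_def)
  ultimately obtain h where h: "h \<in> H" "\<And>h'. h' \<in> H \<Longrightarrow> ot_functional h \<le> ot_functional h'"
    using continuous_attains_inf[of H ot_functional] continuous_on_subset[OF ot_functional_continuous] by blast
  have bnd: "ot_functional (\<lambda>_. 0) \<le> \<bar>X\<bar> * measure lborel T"
  proof -
    have "ot_potential (\<lambda>_. 0) y \<le> \<bar>X\<bar>" if "y \<in> T" for y
      by (rule ot_potential_le) (use X[OF _ that] in force)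
    then have "(\<integral>y. indicator T y * ot_potential (\<lambda>_. 0) y \<partial>lborel) \<le> (\<integral>y. indicator T y * \<bar>X\<bar> \<partial>lborel)"
      by (intro integral_mono integrable_on_T continuous_ot_potential) (auto simp: indicator_def)
    then show ?thesis unfolding integral_const_T by (simp add: ot_functional_def mult.commute)
  qed
  have "ot_functional h \<le> ot_functional h'" for h'
  proof -
    define c where "c = Min (h' ` I)"
    have c: "\<And>i. i \<in> I \<Longrightarrow> c \<le> h' i" "\<exists>i\<in>I. h' i = c"
      unfolding c_def using I Min_in[of "h' ` I"] by (auto simp del: Min_in)
    define g where "g i = (if i \<in> I then h' i - c else 0)" for i
    have g: "ot_functional g = ot_functional h'"
      using ot_functional_shift[of h' c] ot_functional_cong[of g "\<lambda>i. h' i - c"] by (simp add: g_def)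
    show ?thesis
    proof (cases "\<forall>i\<in>I. h' i - c \<le> M")
      case True
      then have "g \<in> H" using c by (auto simp: H_def g_def)
      then show ?thesis using h(2) g by metis
    next
      case False
      then obtain i where i: "i \<in> I" "M < h' i - c" by auto
      obtain i0 where i0: "i0 \<in> I" "h' i0 = c" using c by auto
      have g0: "0 \<le> g i" for i using c by (simp add: g_def)
      have "a * M \<le> m i * g i" using a(1) a(2)[OF i(1)] i M0 m[OF i(1)] by (intro mult_mono) (auto simp: g_def)
      also have "\<dots> \<le> (\<Sum>i\<in>I. m i * g i)" using I i g0 m by (intro member_le_sum) (auto simp: less_imp_le)
      finally have 1: "a * M \<le> (\<Sum>i\<in>I. m i * g i)" .
      have "- \<bar>X\<bar> \<le> ot_potential g y" if "y \<in> T" for y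
        using ot_potential_ge[OF i0(1), of y g] X[OF i0(1) that] i0 by (simp add: g_def)
      then have "(\<integral>y. indicator T y * (- \<bar>X\<bar>) \<partial>lborel) \<le> (\<integral>y. indicator T y * ot_potential g y \<partial>lborel)"
        by (intro integral_mono integrable_on_T continuous_ot_potential) (auto simp: indicator_def)
      then have "- \<bar>X\<bar> * measure lborel T \<le> (\<integral>y. indicator T y * ot_potential g y \<partial>lborel)"
        unfolding integral_const_T by (simp add: mult.commute)
      with 1 have "a * M - \<bar>X\<bar> * measure lborel T \<le> ot_functional g"
        unfolding ot_functional_def by simp
      moreover have "a * M = 2 * \<bar>X\<bar> * measure lborel T" using a by (simp add: M_def)
      ultimately have "\<bar>X\<bar> * measure lborel T \<le> ot_functional g" by simp
      then show ?thesis using h(2)[OF z] bnd g by linarith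
    qed
  qed
  then show ?thesis by (rule that)
qed

text \<open>Lowering one dual weight by \<open>\<tau>\<close> raises the potential by at most \<open>\<tau>\<close>, and only on the slightly
  enlarged cell. Minimality therefore bounds the mass of that cell from below; let \<open>\<tau>\<close> tend to 0.\<close>
lemma ot_cells:
  obtains h where "\<And>i. i \<in> I \<Longrightarrow> m i \<le> measure lborel {y\<in>T. ot_potential h y \<le> pt i \<bullet> y - h i}"
proof -
  obtain h where h: "\<And>h'. ot_functional h \<le> ot_functional h'" using ot_minimizer by blast
  have "m i \<le> measure lborel {y\<in>T. ot_potential h y \<le> pt i \<bullet> y - h i}" if i: "i \<in> I" for i
  proof -
    define C where "C k = {y\<in>T. ot_potential h y \<le> pt i \<bullet> y - h i + 1 / real (Suc k)}" for k
    have closedC: "compact (C k)" for k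
    proof -
      have "C k = T \<inter> {y. ot_potential h y \<le> pt i \<bullet> y - h i + 1 / real (Suc k)}" by (auto simp: C_def)
      also have "compact \<dots>" using continuous_ot_potential
        by (intro compact_Int_closed T closed_Collect_le continuous_intros)
      finally show ?thesis .
    qed
    have fin: "emeasure lborel (C k) < \<infinity>" "C k \<in> sets lborel" for k
      using emeasure_compact_finite[OF closedC] borel_closed[OF compact_imp_closed[OF closedC]] by simp_all
    have "m i \<le> measure lborel (C k)" for k
    proof -
      define t where "t = 1 / real (Suc k)"
      have t: "t > 0" by (simp add: t_def)
      define h' where "h' = h(i := h i - t)"
      have "ot_potential h' y - ot_potential h y \<le> t" for y
      proof -
        have "ot_potential h' y \<le> ot_potential h y + t"
          by (rule ot_potential_le) (use ot_potential_ge[of _ y h] t in \<open>fastforce simp: h'_def\<close>)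
        then show ?thesis by simp
      qed
      moreover have le0: "ot_potential h' y \<le> ot_potential h y" if "\<not> ot_potential h y \<le> pt i \<bullet> y - h i + t" for y
        by (rule ot_potential_le) (use ot_potential_ge[of _ y h] that in \<open>auto simp: h'_def\<close>)
      ultimately have le: "indicator T y * (ot_potential h' y - ot_potential h y) \<le> indicator (C k) y * t" for y
        using le0[of y] by (cases "ot_potential h y \<le> pt i \<bullet> y - h i + t")
          (auto simp: C_def indicator_def t_def[symmetric] simp del: of_nat_Suc)
      have "(\<integral>y. indicator T y * (ot_potential h' y - ot_potential h y) \<partial>lborel) \<le> (\<integral>y. indicator (C k) y * t \<partial>lborel)"
        using fin continuous_ot_potential by (intro integral_mono le integrable_on_T continuous_intros) auto
      also have "\<dots> = measure lborel (C k) * t" using fin by simp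
      finally have "ot_functional h' - ot_functional h \<le> (\<Sum>j\<in>I. m j * (h' j - h j)) + measure lborel (C k) * t"
        unfolding ot_functional_diff by simp
      also have "(\<Sum>j\<in>I. m j * (h' j - h j)) = (\<Sum>j\<in>I. if j = i then - m i * t else 0)"
        by (rule sum.cong) (auto simp: h'_def)
      also have "\<dots> = - m i * t" using I i by simp
      finally have "m i * t \<le> measure lborel (C k) * t" using h[of h'] by simp
      then show ?thesis using t by simp
    qed
    moreover have "(\<lambda>k. measure lborel (C k)) \<longlonglongrightarrow> measure lborel (\<Inter>k. C k)"
    proof (rule Lim_measure_decseq)
      have "1 / real (Suc l) \<le> 1 / real (Suc k)" if "k \<le> l" for k l using that by (simp add: frac_le)
      then show "decseq C" unfolding decseq_def C_def by (fastforce intro: order_trans add_left_mono)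
    qed (use fin in \<open>auto simp: less_top\<close>)
    ultimately have "m i \<le> measure lborel (\<Inter>k. C k)"
      by (intro tendsto_lowerbound[of "\<lambda>k. measure lborel (C k)"]) auto
    also have "(\<Inter>k. C k) = {y\<in>T. ot_potential h y \<le> pt i \<bullet> y - h i}"
    proof (intro set_eqI iffI)
      fix y assume y: "y \<in> (\<Inter>k. C k)"
      then have "ot_potential h y \<le> pt i \<bullet> y - h i + 1 / real (Suc k)" "y \<in> T" for k by (auto simp: C_def)
      moreover have "(\<lambda>k. pt i \<bullet> y - h i + 1 / real (Suc k)) \<longlonglongrightarrow> pt i \<bullet> y - h i + 0"
        by (intro tendsto_intros LIMSEQ_Suc[OF lim_1_over_n])
      ultimately show "y \<in> {y\<in>T. ot_potential h y \<le> pt i \<bullet> y - h i}"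
        by (auto intro: tendsto_lowerbound)
    next
      fix y assume y: "y \<in> {y\<in>T. ot_potential h y \<le> pt i \<bullet> y - h i}"
      have "0 \<le> 1 / real (Suc k)" for k by simp
      with y show "y \<in> (\<Inter>k. C k)" unfolding C_def by (auto intro: order_trans simp del: of_nat_Suc) 
    qed
    finally show ?thesis .
  qed
  then show ?thesis by (rule that)
qed

end

text \<open>\<phi> is the Legendre transform of \<open>U h\<close> restricted to \<open>T\<close>,
  so a maximiser \<open>p x\<close> is a subgradient at \<open>x\<close> that lies in
  \<open>T\<close>. With \<open>T\<close> a cube this will bound the gradient.\<close>

lemma semidiscrete_transport:
  fixes pt :: "'i \<Rightarrow> 'a::euclidean_space"
  assumes I: "finite I" "I \<noteq> {}" and m: "\<And>i. i \<in> I \<Longrightarrow> 0 < m i"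
    and T: "compact T" and mT: "measure lborel T = (\<Sum>i\<in>I. m i)"
  obtains \<phi> :: "'a \<Rightarrow> real" and C where
    "\<And>x. \<exists>p\<in>T. \<forall>z. \<phi> x + p \<bullet> (z - x) \<le> \<phi> z"
    "\<And>i. i \<in> I \<Longrightarrow> compact (C i) \<and> m i \<le> measure lborel (C i)"
    "\<And>i y z. i \<in> I \<Longrightarrow> y \<in> C i \<Longrightarrow> \<phi> (pt i) + y \<bullet> (z - pt i) \<le> \<phi> z"
proof -
  note ctx = I m T mT
  define U where "U = ot_potential pt I"
  obtain h where h: "\<And>i. i \<in> I \<Longrightarrow> m i \<le> measure lborel {y\<in>T. U h y \<le> pt i \<bullet> y - h i}"
    using ot_cells[OF ctx] unfolding U_def by blast
  have cont: "continuous_on UNIV (U h)" unfolding U_def by (rule continuous_ot_potential[OF ctx])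
  have "measure lborel T > 0" using I m mT by (simp add: sum_pos)
  then have Tne: "T \<noteq> {}" by auto
  have ex: "\<exists>p\<in>T. \<forall>y\<in>T. x \<bullet> y - U h y \<le> x \<bullet> p - U h p" for x
    by (rule continuous_attains_sup[OF T Tne])
      (intro continuous_intros continuous_on_subset[OF cont], auto)
  then obtain p where p: "\<And>x. p x \<in> T" "\<And>x y. y \<in> T \<Longrightarrow> x \<bullet> y - U h y \<le> x \<bullet> p x - U h (p x)" by metis
  define \<phi> where "\<phi> x = x \<bullet> p x - U h (p x)" for x
  have \<phi>: "x \<bullet> y - U h y \<le> \<phi> x" if "y \<in> T" for x y using p(2)[OF that] by (simp add: \<phi>_def)
  define C where "C i = {y\<in>T. U h y \<le> pt i \<bullet> y - h i}" for i
  show ?thesis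
  proof (rule that[of \<phi> C])
    show "\<exists>p\<in>T. \<forall>z. \<phi> x + p \<bullet> (z - x) \<le> \<phi> z" for x
      using \<phi>[OF p(1)[of x]] p(1)[of x] by (intro bexI[of _ "p x"]) (auto simp: \<phi>_def[of x] inner_diff_right inner_commute)
    show "compact (C i) \<and> m i \<le> measure lborel (C i)" if "i \<in> I" for i
    proof
      have "C i = T \<inter> {y. U h y \<le> pt i \<bullet> y - h i}" by (auto simp: C_def)
      also have "compact \<dots>" using cont
        by (intro compact_Int_closed T closed_Collect_le continuous_intros)
      finally show "compact (C i)" .
    qed (use h[OF that] in \<open>simp add: C_def\<close>)
    show "\<phi> (pt i) + y \<bullet> (z - pt i) \<le> \<phi> z" if "i \<in> I" "y \<in> C i" for i y z
    proof -
      \<comment> \<open>\<open>U h\<close> dominates the affine function of index \<open>i\<close>,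
        hence \<phi> does not exceed \<open>h i\<close> at \<open>pt i\<close>. On the cell of
        \<open>i\<close> that affine function equals \<open>U h\<close>, which makes every
        \<open>y\<close> there a subgradient at \<open>pt i\<close>.\<close>
      have "\<phi> (pt i) \<le> h i"
        unfolding \<phi>_def U_def using ot_potential_ge[OF ctx \<open>i \<in> I\<close>, where pt = pt and y = "p (pt i)" and h = h] by simp
      then show ?thesis using \<phi>[of y z] that(2) by (auto simp: C_def inner_diff_right inner_commute)
    qed
  qed
qed

section \<open>Subgradient cells and second differences\<close>

text \<open>A common upper bound for all subgradients at a point of the half-sized cross-polytope:
  the excess of \<open>\<phi>\<close> over its tangent plane at \<open>x\<close> is at most \<open>V\<close> on the full cross-polytope.\<close>
lemma subgradient_cell_measure:
  fixes S :: "real^'n^'n" and \<phi> :: "real^'n \<Rightarrow> real"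
  assumes sub: "\<And>x. \<exists>p. \<forall>z. \<phi> x + p \<bullet> (z - x) \<le> \<phi> z"
    and r: "r > 0" and \<theta>: "(\<Sum>k\<in>UNIV. \<bar>\<theta>$k\<bar>) \<le> r / 2"
    and C: "compact C" "\<And>y z. y \<in> C \<Longrightarrow> \<phi> (x + S *v \<theta>) + y \<bullet> (z - (x + S *v \<theta>)) \<le> \<phi> z"
    and V: "V = (\<Sum>k\<in>UNIV. \<phi> (x + r *\<^sub>R column k S) + \<phi> (x - r *\<^sub>R column k S) - 2 * \<phi> x)"
  shows "\<bar>det S\<bar> * measure lborel C \<le> (4 * V / r) ^ CARD('n)" "0 \<le> V"
proof -
  obtain p where p: "\<And>z. \<phi> x + p \<bullet> (z - x) \<le> \<phi> z" using sub by blast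
  define \<psi> where "\<psi> w = \<phi> (x + w) - \<phi> x - p \<bullet> w" for w
  have \<psi>0: "0 \<le> \<psi> w" for w using p[of "x + w"] by (simp add: \<psi>_def)
  have V\<psi>: "V = (\<Sum>k\<in>UNIV. \<psi> (r *\<^sub>R column k S) + \<psi> (- (r *\<^sub>R column k S)))"
    unfolding V \<psi>_def by (rule sum.cong) auto
  then show V0: "0 \<le> V" using \<psi>0 by (auto intro!: sum_nonneg add_nonneg_nonneg)
  \<comment> \<open>Convexity is used through a subgradient \<open>q\<close> at the point in
    question: \<open>S *v \<alpha>\<close> is a convex combination of 0 and the vertices
    \<open>w k\<close>, with weights \<open>\<bar>\<alpha>$k\<bar> / r\<close> on the latter, and
    \<psi> at \<open>w k\<close> is at most its own summand of \<open>V\<close>.\<close>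
  have le: "\<psi> (S *v \<alpha>) \<le> V" if \<alpha>: "(\<Sum>k\<in>UNIV. \<bar>\<alpha>$k\<bar>) \<le> r" for \<alpha>
  proof -
    obtain q where q: "\<And>z. \<phi> (x + S *v \<alpha>) + q \<bullet> (z - (x + S *v \<alpha>)) \<le> \<phi> z" using sub by blast
    have q\<psi>: "\<psi> (S *v \<alpha>) + (q - p) \<bullet> (w - S *v \<alpha>) \<le> \<psi> w" for w
      using q[of "x + w"] by (simp add: \<psi>_def inner_diff_left inner_diff_right)
    define wt where "wt k = \<bar>\<alpha>$k\<bar> / r" for k
    define w where "w k = sgn (\<alpha>$k) *\<^sub>R (r *\<^sub>R column k S)" for k
    have wt: "0 \<le> wt k" for k using r by (simp add: wt_def)
    have wt1: "(\<Sum>k\<in>UNIV. wt k) \<le> 1" using \<alpha> r by (simp add: wt_def sum_divide_distrib[symmetric])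
    have wtk: "wt k \<le> 1" for k
      using member_le_sum[of k UNIV wt] wt wt1 by fastforce
    have S\<alpha>: "(\<Sum>k\<in>UNIV. wt k *\<^sub>R w k) = S *v \<alpha>"
    proof -
      have "wt k *\<^sub>R w k = \<alpha>$k *s column k S" for k
        using r by (simp add: wt_def w_def vec_eq_iff abs_sgn_eq sgn_if)
      then show ?thesis by (simp add: matrix_mult_sum)
    qed
    have "\<psi> (S *v \<alpha>) * (\<Sum>k\<in>UNIV. wt k) + (q - p) \<bullet> (S *v \<alpha> - (\<Sum>k\<in>UNIV. wt k) *\<^sub>R (S *v \<alpha>))
        = (\<Sum>k\<in>UNIV. wt k * (\<psi> (S *v \<alpha>) + (q - p) \<bullet> (w k - S *v \<alpha>)))"
    proof -
      have F1: "(q - p) \<bullet> (S *v \<alpha>) = (\<Sum>k\<in>UNIV. wt k * ((q - p) \<bullet> w k))"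
        by (simp add: S\<alpha>[symmetric] inner_sum_right)
      have F2: "(\<Sum>k\<in>UNIV. wt k * (a + (b k - c))) = (\<Sum>k\<in>UNIV. wt k) * (a - c) + (\<Sum>k\<in>UNIV. wt k * b k)" for a b c
        by (simp add: algebra_simps sum.distrib sum_subtractf sum_distrib_left[symmetric])
      show ?thesis
        by (simp only: inner_diff_right inner_scaleR_right F2 F1[symmetric]) (simp add: algebra_simps)
    qed
    also have "\<dots> \<le> (\<Sum>k\<in>UNIV. wt k * \<psi> (w k))"
      by (intro sum_mono mult_left_mono q\<psi> wt)
    also have "\<dots> \<le> (\<Sum>k\<in>UNIV. \<psi> (r *\<^sub>R column k S) + \<psi> (- (r *\<^sub>R column k S)))"
    proof (rule sum_mono)
      fix k
      have "\<psi> (w k) \<le> \<psi> (r *\<^sub>R column k S) + \<psi> (- (r *\<^sub>R column k S))"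
        using \<psi>0[of "r *\<^sub>R column k S"] \<psi>0[of "- (r *\<^sub>R column k S)"]
        by (auto simp: w_def sgn_if \<psi>_def[of 0])
      then show "wt k * \<psi> (w k) \<le> \<psi> (r *\<^sub>R column k S) + \<psi> (- (r *\<^sub>R column k S))"
        using mult_mono[OF wtk[of k] _ _ \<psi>0, of "w k" "\<psi> (w k)"] \<psi>0[of "w k"] mult_right_mono[OF wtk[of k] \<psi>0[of "w k"]] by simp
    qed
    also have "\<dots> = V" by (simp add: V\<psi>)
    finally have 1: "\<psi> (S *v \<alpha>) * (\<Sum>k\<in>UNIV. wt k) + (q - p) \<bullet> (S *v \<alpha> - (\<Sum>k\<in>UNIV. wt k) *\<^sub>R (S *v \<alpha>)) \<le> V" .
    \<comment> \<open>The missing weight is placed at the origin, where \<psi> vanishes.\<close>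
    have "(1 - (\<Sum>k\<in>UNIV. wt k)) * (\<psi> (S *v \<alpha>) + (q - p) \<bullet> (0 - S *v \<alpha>)) \<le> (1 - (\<Sum>k\<in>UNIV. wt k)) * \<psi> 0"
      by (intro mult_left_mono q\<psi>) (use wt1 in auto)
    also have "\<psi> 0 = 0" by (simp add: \<psi>_def)
    finally show ?thesis using 1 by (simp add: algebra_simps inner_diff_right)
  qed
  define b where "b = 2 * V / r"
  have b0: "0 \<le> b" using V0 r by (simp add: b_def)
  have cell: "\<bar>(y - p) \<bullet> column j S\<bar> \<le> b" if y: "y \<in> C" for y j
  proof -
    \<comment> \<open>From \<open>x + S *v \<theta>\<close> one can move by \<open>r / 2\<close>
      along any column in either direction without leaving the cross-polytope of radius
      \<open>r\<close>, where \<psi> \<le> V. The subgradient inequality at the start, together with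
      \<psi> \<ge> 0 there, bounds the increment by \<open>V\<close>.\<close>
    have step: "(y - p) \<bullet> (\<sigma> *\<^sub>R column j S) \<le> V" if \<sigma>: "\<bar>\<sigma>\<bar> = r / 2" for \<sigma>
    proof -
      have e: "S *v (\<theta> + \<sigma> *\<^sub>R axis j 1) = S *v \<theta> + \<sigma> *\<^sub>R column j S"
        by (simp add: matrix_vector_right_distrib matrix_vector_mult_scaleR matrix_vector_mult_basis)
      have "(\<Sum>k\<in>UNIV. \<bar>(\<theta> + \<sigma> *\<^sub>R axis j 1)$k\<bar>) \<le> (\<Sum>k\<in>UNIV. \<bar>\<theta>$k\<bar> + (if k = j then \<bar>\<sigma>\<bar> else 0))"
        by (intro sum_mono) (auto simp: axis_def)
      also have "\<dots> \<le> r" using \<theta> \<sigma> by (simp add: sum.distrib)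
      finally have "\<psi> (S *v \<theta> + \<sigma> *\<^sub>R column j S) \<le> V" using le[of "\<theta> + \<sigma> *\<^sub>R axis j 1"] by (simp only: e)
      moreover have "\<phi> (x + S *v \<theta>) + y \<bullet> (\<sigma> *\<^sub>R column j S) \<le> \<phi> (x + S *v \<theta> + \<sigma> *\<^sub>R column j S)"
        using C(2)[OF y, of "x + S *v \<theta> + \<sigma> *\<^sub>R column j S"] by simp
      ultimately show ?thesis using \<psi>0[of "S *v \<theta>"]
        unfolding \<psi>_def by (simp add: inner_diff_left inner_add_right add.assoc right_diff_distrib)
    qed
    have "(y - p) \<bullet> column j S * (r / 2) \<le> V" "- ((y - p) \<bullet> column j S * (r / 2)) \<le> V"
      using step[of "r/2"] step[of "- (r/2)"] r by (simp_all add: mult.commute)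
    then show ?thesis using r by (simp add: b_def abs_le_iff field_simps)
  qed
  define z where "z = transpose S *v p"
  define X where "X = cbox (z - (\<chi> i. b)) (z + (\<chi> i. b))"
  \<comment> \<open>In the coordinates given by the columns of \<open>S\<close> the subgradients in
    \<open>C\<close> lie in a cube of side \<open>2 * b = 4 * V / r\<close>; the linear map
    contributes the factor \<open>\<bar>det S\<bar>\<close>.\<close>
  have sub: "(*v) (transpose S) ` C \<subseteq> X"
  proof
    fix u assume "u \<in> (*v) (transpose S) ` C"
    then obtain y where y: "y \<in> C" "u = transpose S *v y" by auto
    have "(transpose S *v w)$j = w \<bullet> column j S" for w j
      by (simp add: matrix_vector_mult_def transpose_def inner_vec_def column_def mult.commute)
    then have "\<bar>u$j - z$j\<bar> \<le> b" for j using cell[OF y(1), of j] by (simp add: y(2) z_def inner_diff_left)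
    then show "u \<in> X" unfolding X_def mem_box_cart by (auto simp: abs_le_iff algebra_simps)
  qed
  have Cm: "C \<in> lmeasurable" using C(1) by (rule lmeasurable_compact)
  have "\<bar>det S\<bar> * measure lebesgue C = measure lebesgue ((*v) (transpose S) ` C)"
    using measure_matrix_image[OF Cm, of "transpose S"] by (simp add: det_transpose)
  also have "\<dots> \<le> measure lebesgue X"
    using measure_matrix_image(1)[OF Cm, of "transpose S"] sub
    by (intro measure_mono_fmeasurable) (auto simp: X_def)
  also have "\<dots> = (2 * b) ^ CARD('n)"
  proof -
    have "X \<noteq> {}" using b0 unfolding X_def interval_ne_empty_cart by auto
    then show ?thesis unfolding X_def by (simp add: content_cbox_cart)
  qed
  finally show "\<bar>det S\<bar> * measure lborel C \<le> (4 * V / r) ^ CARD('n)"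
    using C(1) by (simp add: b_def measure_completion borel_closed compact_imp_closed)
qed

text \<open>Differentiation under the integral over a fixed bounded set. It lets an integrated
  second difference be treated as the second difference of a function of one real variable.\<close>

lemma has_derivative_integral_line:
  fixes \<Phi> \<Phi>' :: "'a::euclidean_space \<Rightarrow> real"
  assumes d: "\<And>x t. ((\<lambda>t. \<Phi> (x + t *\<^sub>R v)) has_real_derivative \<Phi>' (x + t *\<^sub>R v)) (at t)"
    and c: "continuous_on UNIV \<Phi>" "continuous_on UNIV \<Phi>'"
    and Q: "bounded Q" "Q \<in> sets borel"
  shows "((\<lambda>t. \<integral>x. indicator Q x * \<Phi> (x + t *\<^sub>R v) \<partial>lborel) has_real_derivative
    (\<integral>x. indicator Q x * \<Phi>' (x + t *\<^sub>R v) \<partial>lborel)) (at t)"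
    and "continuous_on UNIV f \<Longrightarrow> integrable lborel (\<lambda>x. indicator Q x * (f x::real))"
proof -
  obtain \<rho> where \<rho>: "Q \<subseteq> cball 0 \<rho>" using Q(1) by (meson bounded_subset_ballD ball_subset_cball order_trans)
  have int: "integrable lborel (\<lambda>x. indicator Q x * (f x::real))" if "continuous_on UNIV f" for f
  proof -
    have "integrable lborel (\<lambda>x. indicator Q x *\<^sub>R (indicator (cball 0 \<rho>) x * f x))"
      using loc_integrable_continuous[OF that] Q(2) unfolding loc_integrable_def
      by (intro integrable_mult_indicator) auto
    also have "(\<lambda>x. indicator Q x *\<^sub>R (indicator (cball 0 \<rho>) x * f x)) = (\<lambda>x. indicator Q x * f x)"
    proof
      fix x show "indicator Q x *\<^sub>R (indicator (cball 0 \<rho>) x * f x) = indicator Q x * f x"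
        using \<rho> by (cases "x \<in> Q") auto
    qed
    finally show ?thesis .
  qed
  then show "continuous_on UNIV f \<Longrightarrow> integrable lborel (\<lambda>x. indicator Q x * (f x::real))" .
  have shift: "continuous_on UNIV (\<lambda>x. F (x + t *\<^sub>R v))" if "continuous_on UNIV F" for F :: "'a \<Rightarrow> real" and t
    by (rule continuous_on_compose2[OF that]) (auto intro: continuous_intros)
  show "((\<lambda>t. \<integral>x. indicator Q x * \<Phi> (x + t *\<^sub>R v) \<partial>lborel) has_real_derivative
    (\<integral>x. indicator Q x * \<Phi>' (x + t *\<^sub>R v) \<partial>lborel)) (at t)"
    unfolding has_field_derivative_iff tendsto_at_iff_sequentially o_def
  proof (intro allI impI)
    fix X assume X0: "\<forall>i. X i \<in> UNIV - {t}" and X: "X \<longlonglongrightarrow> t"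
    from X obtain M0 where "\<And>i. \<bar>X i\<bar> \<le> M0"
      using convergent_imp_Bseq[of X] by (auto simp: convergent_def Bseq_def)
    then obtain M where M: "\<And>i. X i \<in> {-M..M}" "t \<in> {-M..M}"
      by (intro that[of "max M0 \<bar>t\<bar>"]) (auto simp: abs_le_iff le_max_iff_disj, smt+)
    have "bounded (\<Phi>' ` cball 0 (\<bar>\<rho>\<bar> + \<bar>M\<bar> * norm v))"
      by (intro compact_imp_bounded compact_continuous_image) (auto intro: continuous_on_subset[OF c(2)])
    then obtain B where B: "\<And>x. x \<in> cball 0 (\<bar>\<rho>\<bar> + \<bar>M\<bar> * norm v) \<Longrightarrow> \<bar>\<Phi>' x\<bar> \<le> B"
      unfolding bounded_iff real_norm_def by blast
    define q where "q i x = indicator Q x * ((\<Phi> (x + X i *\<^sub>R v) - \<Phi> (x + t *\<^sub>R v)) / (X i - t))" for i x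
    have eq: "((\<integral>x. indicator Q x * \<Phi> (x + X i *\<^sub>R v) \<partial>lborel) - (\<integral>x. indicator Q x * \<Phi> (x + t *\<^sub>R v) \<partial>lborel)) / (X i - t)
       = (\<integral>x. q i x \<partial>lborel)" for i
      unfolding q_def by (subst Bochner_Integration.integral_diff[symmetric, OF int[OF shift[OF c(1)]] int[OF shift[OF c(1)]]])
        (simp add: right_diff_distrib diff_divide_distrib flip: Bochner_Integration.integral_divide_zero)
    have [measurable]: "(\<lambda>x. \<Phi> (x + s *\<^sub>R v)) \<in> borel_measurable borel" "(\<lambda>x. \<Phi>' (x + s *\<^sub>R v)) \<in> borel_measurable borel" for s
      using shift c by (auto intro: borel_measurable_continuous_onI)
    have [measurable]: "Q \<in> sets borel" by fact
    have "(\<lambda>i. \<integral>x. q i x \<partial>lborel) \<longlonglongrightarrow> (\<integral>x. indicator Q x * \<Phi>' (x + t *\<^sub>R v) \<partial>lborel)"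
    proof (rule integral_dominated_convergence)
      show "integrable lborel (\<lambda>x. indicator Q x * B)" by (rule int) auto
      show "AE x in lborel. norm (q i x) \<le> indicator Q x * B" for i
      proof (rule AE_I2)
        fix x
        show "norm (q i x) \<le> indicator Q x * B"
        proof (cases "x \<in> Q")
          case True
          have "\<bar>\<Phi> (x + X i *\<^sub>R v) - \<Phi> (x + t *\<^sub>R v)\<bar> \<le> B * \<bar>X i - t\<bar>"
          proof (rule field_differentiable_bound[of "{-M..M}" "\<lambda>t. \<Phi> (x + t *\<^sub>R v)" "\<lambda>t. \<Phi>' (x + t *\<^sub>R v)" B "X i" t, unfolded real_norm_def])
            fix s assume s: "s \<in> {-M..M}"
            show "((\<lambda>t. \<Phi> (x + t *\<^sub>R v)) has_field_derivative \<Phi>' (x + s *\<^sub>R v)) (at s within {-M..M})"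
              using d by (rule has_field_derivative_at_within)
            have "norm (x + s *\<^sub>R v) \<le> norm x + \<bar>s\<bar> * norm v" by (metis norm_scaleR norm_triangle_ineq)
            also have "\<dots> \<le> \<bar>\<rho>\<bar> + \<bar>M\<bar> * norm v"
              using True \<rho> s by (intro add_mono mult_right_mono) auto
            finally show "\<bar>\<Phi>' (x + s *\<^sub>R v)\<bar> \<le> B" by (intro B) simp
          qed (use M in auto)
          then show ?thesis using True X0 by (auto simp: q_def abs_divide divide_le_eq)
        qed (simp add: q_def)
      qed
      show "AE x in lborel. (\<lambda>i. q i x) \<longlonglongrightarrow> indicator Q x * \<Phi>' (x + t *\<^sub>R v)"
      proof (rule AE_I2)
        fix x
        have "(\<lambda>i. (\<Phi> (x + X i *\<^sub>R v) - \<Phi> (x + t *\<^sub>R v)) / (X i - t)) \<longlonglongrightarrow> \<Phi>' (x + t *\<^sub>R v)"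
          using d[of x t] X0 X unfolding has_field_derivative_iff tendsto_at_iff_sequentially o_def by blast
        then show "(\<lambda>i. q i x) \<longlonglongrightarrow> indicator Q x * \<Phi>' (x + t *\<^sub>R v)"
          unfolding q_def by (intro tendsto_mult tendsto_const)
      qed
    qed (simp_all add: q_def)
    then show "(\<lambda>i. ((\<integral>x. indicator Q x * \<Phi> (x + X i *\<^sub>R v) \<partial>lborel) - (\<integral>x. indicator Q x * \<Phi> (x + t *\<^sub>R v) \<partial>lborel)) / (X i - t))
        \<longlonglongrightarrow> (\<integral>x. indicator Q x * \<Phi>' (x + t *\<^sub>R v) \<partial>lborel)"
      unfolding eq .
  qed
qed

text \<open>\<open>G t + G (- t) - M * t^2\<close> has zero derivative at 0 and nonpositive second
  derivative on [0, r], hence it does not increase there.\<close>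

lemma second_difference_le:
  fixes G :: "real \<Rightarrow> real"
  assumes G: "\<And>t. (G has_real_derivative G' t) (at t)" "\<And>t. (G' has_real_derivative G'' t) (at t)"
    and M: "\<And>t. \<bar>t\<bar> \<le> r \<Longrightarrow> G'' t \<le> M" and r: "0 \<le> r"
  shows "G r + G (- r) - 2 * G 0 \<le> M * r^2"
proof -
  have neg: "((\<lambda>t. F (- t)) has_real_derivative - F' (- t)) (at t)"
    if "\<And>t. (F has_real_derivative F' t) (at t)" for F F' :: "real \<Rightarrow> real" and t
  proof -
    have "((\<lambda>t. F (- t)) has_real_derivative F' (- t) * (- 1)) (at t)"
      by (rule DERIV_chain2[where f = F, OF that]) (auto intro!: derivative_eq_intros)
    then show ?thesis by simp
  qed
  define K where "K t = G t + G (- t) - M * t^2" for t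
  define K' where "K' t = G' t - G' (- t) - 2 * M * t" for t
  have K: "(K has_real_derivative K' t) (at t)" for t
    unfolding K_def[abs_def] K'_def by (auto intro!: derivative_eq_intros G(1) neg)
  have K': "(K' has_real_derivative G'' t + G'' (- t) - 2 * M) (at t)" for t
    unfolding K'_def[abs_def] by (auto intro!: derivative_eq_intros G(2) neg)
  have K'0: "K' t \<le> 0" if "0 \<le> t" "t \<le> r" for t
  proof -
    have "K' t \<le> K' 0"
    proof (rule DERIV_nonpos_imp_nonincreasing[OF that(1)])
      fix s assume "0 \<le> s" "s \<le> t"
      then have "G'' s + G'' (- s) - 2 * M \<le> 0" using M[of s] M[of "- s"] that by simp
      then show "\<exists>y. (K' has_real_derivative y) (at s) \<and> y \<le> 0" using K' by blast
    qed
    then show ?thesis by (simp add: K'_def)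
  qed
  have "K r \<le> K 0"
    by (rule DERIV_nonpos_imp_nonincreasing[OF r]) (use K K'0 in blast)
  then show ?thesis by (simp add: K_def)
qed

text \<open>If \<open>g'' 0\<close> were negative, continuity would keep \<open>g''\<close> below
  half that value nearby, and \<open>second_difference_le\<close> would produce a negative second
  difference.\<close>

lemma second_derivative_nonneg:
  fixes g :: "real \<Rightarrow> real"
  assumes G: "\<And>t. (g has_real_derivative g' t) (at t)" "\<And>t. (g' has_real_derivative g'' t) (at t)"
    and c: "continuous_on UNIV g''" and nn: "\<And>t. 0 \<le> g t + g (- t) - 2 * g 0"
  shows "0 \<le> g'' 0"
proof (rule ccontr)
  assume n: "\<not> 0 \<le> g'' 0"
  then obtain d where d: "d > 0" "\<And>t. dist t 0 < d \<Longrightarrow> dist (g'' t) (g'' 0) < - g'' 0 / 2"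
    using c unfolding continuous_on_iff by (metis UNIV_I half_gt_zero neg_0_less_iff_less not_le)
  have "g (d/2) + g (- (d/2)) - 2 * g 0 \<le> g'' 0 / 2 * (d/2)^2"
  proof (rule second_difference_le[OF G])
    fix t assume "\<bar>t\<bar> \<le> d / 2"
    then have "\<bar>g'' t - g'' 0\<bar> < - g'' 0 / 2" using d(1) d(2)[of t] by (simp add: dist_real_def)
    then show "g'' t \<le> g'' 0 / 2" by (simp add: abs_less_iff)
  qed (use d in auto)
  also have "\<dots> < 0" using n d by (simp add: mult_neg_pos)
  finally show False using nn[of "d/2"] by simp
qed

section \<open>Compensated integrability\<close>

lemma sum_axis: "(\<Sum>l\<in>UNIV. axis j 1 $ l * f l) = (f j :: real)" for j :: "'n::finite"
proof -
  have "(\<Sum>l\<in>UNIV. axis j 1 $ l * f l) = (\<Sum>l\<in>UNIV. if l = j then f l else 0)"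
    by (rule sum.cong) (auto simp: axis_def)
  then show ?thesis by simp
qed

text \<open>\<open>D\<close> and \<open>H\<close> stand for gradient and Hessian. Derivatives are
  prescribed along all lines, the form in which convolution delivers them and second differences use
  them.\<close>

definition convex_C2 :: "(real^'n::finite \<Rightarrow> real) \<Rightarrow> ('n \<Rightarrow> real^'n \<Rightarrow> real) \<Rightarrow> ('n \<Rightarrow> 'n \<Rightarrow> real^'n \<Rightarrow> real) \<Rightarrow> bool" where
  "convex_C2 \<Phi> D H \<longleftrightarrow>
    (\<forall>x v t. ((\<lambda>t. \<Phi> (x + t *\<^sub>R v)) has_real_derivative (\<Sum>i\<in>UNIV. v$i * D i (x + t *\<^sub>R v))) (at t)) \<and>
    (\<forall>i x v t. ((\<lambda>t. D i (x + t *\<^sub>R v)) has_real_derivative (\<Sum>j\<in>UNIV. v$j * H i j (x + t *\<^sub>R v))) (at t)) \<and>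
    continuous_on UNIV \<Phi> \<and> (\<forall>i. continuous_on UNIV (D i)) \<and> (\<forall>i j. continuous_on UNIV (H i j)) \<and>
    (\<forall>x. (\<chi> i j. H i j x) \<in> Sym_plus)"

text \<open>A discrete counterpart of \<open>r^2\<close> times the trace of
  \<open>S ** transpose S\<close> against the Hessian, meaningful also for the nonsmooth potential
  that transport provides.\<close>

definition second_diff :: "(real^'n::finite \<Rightarrow> real) \<Rightarrow> real^'n^'n \<Rightarrow> real \<Rightarrow> real^'n \<Rightarrow> real" where
  "second_diff \<phi> S r x = (\<Sum>k\<in>UNIV. \<phi> (x + r *\<^sub>R column k S) + \<phi> (x - r *\<^sub>R column k S) - 2 * \<phi> x)"

lemma hessian_factor_sum:
  fixes S :: "real^'n::finite^'n"
  shows "(\<Sum>k\<in>UNIV. \<Sum>i\<in>UNIV. \<Sum>j\<in>UNIV. column k S $ i * (column k S $ j * h i j))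
       = (\<Sum>i\<in>UNIV. \<Sum>j\<in>UNIV. (S ** transpose S)$i$j * h i j)"
proof -
  have "(\<Sum>k\<in>UNIV. \<Sum>i\<in>UNIV. \<Sum>j\<in>UNIV. column k S $ i * (column k S $ j * h i j))
      = (\<Sum>i\<in>UNIV. \<Sum>k\<in>UNIV. \<Sum>j\<in>UNIV. column k S $ i * (column k S $ j * h i j))"
    by (rule sum.swap)
  also have "\<dots> = (\<Sum>i\<in>UNIV. \<Sum>j\<in>UNIV. \<Sum>k\<in>UNIV. column k S $ i * (column k S $ j * h i j))"
    by (intro sum.cong refl sum.swap)
  also have "\<dots> = (\<Sum>i\<in>UNIV. \<Sum>j\<in>UNIV. (S ** transpose S)$i$j * h i j)"
    by (simp add: matrix_matrix_mult_def transpose_def column_def sum_distrib_left mult_ac)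
  finally show ?thesis .
qed

text \<open>Along each column, the second derivative of the integral over \<open>Q'\<close> is an
  integral over a translate of \<open>Q'\<close> inside \<open>Q\<close>; as the Hessian form is
  nonnegative, extending it to \<open>Q\<close> gives an upper bound. Summing over the columns
  yields the trace against \<open>S ** transpose S\<close>, which lies below \<open>B\<close> on
  \<open>Q\<close>.\<close>

lemma cube_second_diff_le:
  fixes S :: "real^'n::finite^'n" and B :: "real^'n \<Rightarrow> real^'n^'n"
  assumes C2: "convex_C2 \<Phi> D H"
    and Q: "bounded Q" "Q \<in> sets borel" "bounded Q'" "Q' \<in> sets borel" and r: "0 \<le> r"
    and QQ: "\<And>x k t. x \<in> Q' \<Longrightarrow> \<bar>t\<bar> \<le> r \<Longrightarrow> x + t *\<^sub>R column k S \<in> Q"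
    and B: "\<And>i j. continuous_on UNIV (\<lambda>x. B x $ i $ j)" "\<And>y. y \<in> Q \<Longrightarrow> B y \<in> Sym_plus"
      "\<And>y v. y \<in> Q \<Longrightarrow> v \<bullet> ((S ** transpose S) *v v) \<le> v \<bullet> (B y *v v)"
  shows "(\<integral>x. indicator Q' x * second_diff \<Phi> S r x \<partial>lborel)
     \<le> r^2 * (\<integral>x. indicator Q x * (\<Sum>i\<in>UNIV. \<Sum>j\<in>UNIV. B x $ i $ j * H i j x) \<partial>lborel)"
proof -
  note C = C2[unfolded convex_C2_def]
  have int: "integrable lborel (\<lambda>x. indicator X x * (f x::real))"
    if "continuous_on UNIV f" "bounded X" "X \<in> sets borel" for f and X :: "(real^'n) set"
  proof -
    have 0: "((\<lambda>t. (\<lambda>_. 0) (x + t *\<^sub>R v)) has_real_derivative (\<lambda>_. 0) (x + t *\<^sub>R v)) (at t)" for x v :: "real^'n" and t by simp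
    show ?thesis
      by (rule has_derivative_integral_line(2)[OF 0 continuous_on_const continuous_on_const that(2,3,1)])
  qed
  have shift: "continuous_on UNIV (\<lambda>x. F (x + t *\<^sub>R v))" if "continuous_on UNIV F" for F :: "real^'n \<Rightarrow> real" and t v
    by (rule continuous_on_compose2[OF that]) (auto intro: continuous_intros)
  define P where "P k x = (\<Sum>i\<in>UNIV. column k S $ i * D i x)" for k x
  define P' where "P' k x = (\<Sum>i\<in>UNIV. \<Sum>j\<in>UNIV. column k S $ i * (column k S $ j * H i j x))" for k x
  have cP: "continuous_on UNIV (P k)" "continuous_on UNIV (P' k)" for k
    unfolding P_def P'_def using C by (intro continuous_intros; simp)+
  have dP: "((\<lambda>t. \<Phi> (x + t *\<^sub>R column k S)) has_real_derivative P k (x + t *\<^sub>R column k S)) (at t)" for x k t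
    using C unfolding P_def by simp
  have dP': "((\<lambda>t. P k (x + t *\<^sub>R column k S)) has_real_derivative P' k (x + t *\<^sub>R column k S)) (at t)" for x k t
    unfolding P_def P'_def sum_distrib_left[symmetric] using C by (intro DERIV_sum DERIV_cmult) simp
  have P'0: "0 \<le> P' k x" for k x
  proof -
    have "0 \<le> column k S \<bullet> ((\<chi> i j. H i j x) *v column k S)" using C unfolding Sym_plus_def by blast
    also have "\<dots> = P' k x" unfolding quadratic_form_sum P'_def by (simp add: mult_ac)
    finally show ?thesis .
  qed
  have one: "(\<integral>x. indicator Q' x * (\<Phi> (x + r *\<^sub>R column k S) + \<Phi> (x - r *\<^sub>R column k S) - 2 * \<Phi> x) \<partial>lborel)
     \<le> (\<integral>x. indicator Q x * P' k x \<partial>lborel) * r^2" (is "?L \<le> ?M * r^2") for k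
  proof -
    define G where "G t = (\<integral>x. indicator Q' x * \<Phi> (x + t *\<^sub>R column k S) \<partial>lborel)" for t
    define G' where "G' t = (\<integral>x. indicator Q' x * P k (x + t *\<^sub>R column k S) \<partial>lborel)" for t
    define G'' where "G'' t = (\<integral>x. indicator Q' x * P' k (x + t *\<^sub>R column k S) \<partial>lborel)" for t
    have "G r + G (- r) - 2 * G 0 \<le> ?M * r^2"
    proof (rule second_difference_le)
      show "(G has_real_derivative G' t) (at t)" for t unfolding G_def[abs_def] G'_def
        by (rule has_derivative_integral_line(1)[OF dP _ cP(1) Q(3,4)]) (use C in simp)
      show "(G' has_real_derivative G'' t) (at t)" for t unfolding G''_def G'_def[abs_def]
        by (rule has_derivative_integral_line(1)[OF dP' cP Q(3,4)])
      show "G'' t \<le> ?M" if "\<bar>t\<bar> \<le> r" for t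
      proof -
        have "G'' t \<le> (\<integral>x. indicator Q (x + t *\<^sub>R column k S) * P' k (x + t *\<^sub>R column k S) \<partial>lborel)"
          unfolding G''_def
        proof (rule integral_mono)
          show "integrable lborel (\<lambda>x. indicator Q' x * P' k (x + t *\<^sub>R column k S))"
            by (rule int[OF shift[OF cP(2)] Q(3,4)])
          have "integrable (distr lborel borel ((+) (t *\<^sub>R column k S))) (\<lambda>x. indicator Q x * P' k x)"
            unfolding lborel_distr_plus by (rule int[OF cP(2) Q(1,2)])
          then show "integrable lborel (\<lambda>x. indicator Q (x + t *\<^sub>R column k S) * P' k (x + t *\<^sub>R column k S))"
            by (subst (asm) integrable_distr_eq) (use Q borel_measurable_continuous_onI[OF cP(2)] in \<open>auto simp: add.commute\<close>)
          show "indicator Q' x * P' k (x + t *\<^sub>R column k S) \<le> indicator Q (x + t *\<^sub>R column k S) * P' k (x + t *\<^sub>R column k S)" for x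
            using QQ[of x t k] that P'0[of k "x + t *\<^sub>R column k S"] by (auto simp: indicator_def)
        qed
        also have "\<dots> = ?M"
          using integral_translate[of "\<lambda>x. indicator Q x * P' k x" "t *\<^sub>R column k S"] Q
            borel_measurable_continuous_onI[OF cP(2)] by auto
        finally show ?thesis .
      qed
    qed (rule r)
    moreover have "?L = G r + G (- r) - 2 * G 0"
    proof -
      have i: "integrable lborel (\<lambda>x. indicator Q' x * \<Phi> (x + t *\<^sub>R column k S))" for t
        using C by (intro int shift Q) simp
      have "?L = (\<integral>x. indicator Q' x * \<Phi> (x + r *\<^sub>R column k S) + indicator Q' x * \<Phi> (x + (- r) *\<^sub>R column k S)
         - 2 * (indicator Q' x * \<Phi> (x + 0 *\<^sub>R column k S)) \<partial>lborel)"
        by (simp add: algebra_simps)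
      also have "\<dots> = G r + G (- r) - 2 * G 0"
        unfolding G_def using i by (simp del: scaleR_minus_left scaleR_zero_left)
      finally show ?thesis .
    qed
    ultimately show ?thesis by simp
  qed
  have cV: "continuous_on UNIV (\<lambda>x. \<Phi> (x + r *\<^sub>R column k S) + \<Phi> (x - r *\<^sub>R column k S) - 2 * \<Phi> x)" for k
  proof -
    have "continuous_on UNIV \<Phi>" using C by simp
    from shift[OF this, of r "column k S"] shift[OF this, of "- r" "column k S"] this
    show ?thesis by (intro continuous_intros) simp_all
  qed
  have "(\<integral>x. indicator Q' x * second_diff \<Phi> S r x \<partial>lborel)
     = (\<Sum>k\<in>UNIV. \<integral>x. indicator Q' x * (\<Phi> (x + r *\<^sub>R column k S) + \<Phi> (x - r *\<^sub>R column k S) - 2 * \<Phi> x) \<partial>lborel)"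
    unfolding second_diff_def sum_distrib_left by (intro Bochner_Integration.integral_sum int cV Q)
  also have "\<dots> \<le> (\<Sum>k\<in>UNIV. (\<integral>x. indicator Q x * P' k x \<partial>lborel) * r^2)" by (intro sum_mono one)
  also have "\<dots> = r^2 * (\<integral>x. indicator Q x * (\<Sum>k\<in>UNIV. P' k x) \<partial>lborel)"
    unfolding sum_distrib_left sum_distrib_right[symmetric]
    by (subst Bochner_Integration.integral_sum) (auto intro!: int cP Q simp: sum_distrib_left mult.commute)
  also have "\<dots> \<le> r^2 * (\<integral>x. indicator Q x * (\<Sum>i\<in>UNIV. \<Sum>j\<in>UNIV. B x $ i $ j * H i j x) \<partial>lborel)"
  proof (rule mult_left_mono[OF integral_mono])
    show "integrable lborel (\<lambda>x. indicator Q x * (\<Sum>k\<in>UNIV. P' k x))"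
      by (intro int Q continuous_intros cP)
    show "integrable lborel (\<lambda>x. indicator Q x * (\<Sum>i\<in>UNIV. \<Sum>j\<in>UNIV. B x $ i $ j * H i j x))"
      using C by (intro int Q continuous_intros B) simp
    fix x
    show "indicator Q x * (\<Sum>k\<in>UNIV. P' k x) \<le> indicator Q x * (\<Sum>i\<in>UNIV. \<Sum>j\<in>UNIV. B x $ i $ j * H i j x)"
    proof (cases "x \<in> Q")
      case True
      have "(\<Sum>k\<in>UNIV. P' k x) = (\<Sum>i\<in>UNIV. \<Sum>j\<in>UNIV. (S ** transpose S)$i$j * (\<chi> i j. H i j x)$i$j)"
        unfolding P'_def hessian_factor_sum by simp
      also have "\<dots> \<le> (\<Sum>i\<in>UNIV. \<Sum>j\<in>UNIV. B x $ i $ j * (\<chi> i j. H i j x)$i$j)"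
        using C by (intro double_sum_mono B True factor_in_Sym_plus) simp
      finally show ?thesis using True by simp
    qed simp
  qed simp
  finally show ?thesis .
qed

lemma subgradients_in_cube_lipschitz:
  fixes \<phi> :: "real^'n::finite \<Rightarrow> real"
  assumes sub: "\<And>x. \<exists>p\<in>cbox 0 (\<chi> i. R). \<forall>z. \<phi> x + p \<bullet> (z - x) \<le> \<phi> z"
  shows "continuous_on UNIV \<phi>" "\<bar>\<phi> (x + t *\<^sub>R axis i 1) - \<phi> x\<bar> \<le> R * \<bar>t\<bar>"
proof -
  have up: "\<exists>p\<in>cbox 0 (\<chi> i. R). \<phi> z - \<phi> x \<le> p \<bullet> (z - x)" for x z
  proof -
    obtain p where p: "p \<in> cbox 0 (\<chi> i. R)" "\<forall>w. \<phi> z + p \<bullet> (w - z) \<le> \<phi> w" using sub by blast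
    from p(2)[rule_format, of x] p(1) show ?thesis by (intro bexI[of _ p]) (simp_all add: inner_diff_right)
  qed
  have low: "\<exists>p\<in>cbox 0 (\<chi> i. R). p \<bullet> (z - x) \<le> \<phi> z - \<phi> x" for x z
  proof -
    obtain p where p: "p \<in> cbox 0 (\<chi> i. R)" "\<forall>w. \<phi> x + p \<bullet> (w - x) \<le> \<phi> w" using sub by blast
    from p(2)[rule_format, of z] p(1) show ?thesis by (intro bexI[of _ p]) simp_all
  qed
  obtain b where b: "\<And>p. p \<in> cbox 0 (\<chi> i. R) \<Longrightarrow> norm (p::real^'n) \<le> b" "b \<ge> 0"
    using bounded_cbox[of "0::real^'n" "\<chi> i. R"] unfolding bounded_pos by (meson less_imp_le)
  have le: "\<phi> z - \<phi> x \<le> b * norm (z - x)" for x z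
  proof -
    obtain p where p: "p \<in> cbox 0 (\<chi> i. R)" "\<phi> z - \<phi> x \<le> p \<bullet> (z - x)" using up by blast
    then show ?thesis using norm_cauchy_schwarz[of p "z - x"] mult_right_mono[OF b(1)[OF p(1)], of "norm (z - x)"] by simp
  qed
  have "dist (\<phi> z) (\<phi> x) \<le> b * dist z x" for z x
    using le[of z x] le[of x z] by (simp add: dist_norm abs_le_iff norm_minus_commute)
  then have "b-lipschitz_on UNIV \<phi>" using b(2) by (auto simp: lipschitz_on_def)
  then show "continuous_on UNIV \<phi>" by (rule lipschitz_on_continuous_on)
  have c: "\<bar>p$i * t\<bar> \<le> R * \<bar>t\<bar>" if "p \<in> cbox 0 (\<chi> i. R)" for p :: "real^'n"
    using that by (auto simp: mem_box_cart abs_mult intro!: mult_right_mono)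
  obtain p where p: "p \<in> cbox 0 (\<chi> i. R)" "\<phi> (x + t *\<^sub>R axis i 1) - \<phi> x \<le> p \<bullet> (t *\<^sub>R axis i 1)"
    using up[of "x + t *\<^sub>R axis i 1" x] by auto
  obtain q where q: "q \<in> cbox 0 (\<chi> i. R)" "q \<bullet> (t *\<^sub>R axis i 1) \<le> \<phi> (x + t *\<^sub>R axis i 1) - \<phi> x"
    using low[of "x + t *\<^sub>R axis i 1" x] by auto
  show "\<bar>\<phi> (x + t *\<^sub>R axis i 1) - \<phi> x\<bar> \<le> R * \<bar>t\<bar>"
    using p(2) q(2) c[OF p(1)] c[OF q(1)] by (simp add: inner_axis mult.commute abs_le_iff)
qed

lemma conv_reflect:
  fixes k :: "'a::euclidean_space \<Rightarrow> real"
  assumes "f \<in> borel_measurable borel" "k \<in> borel_measurable borel"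
  shows "conv f k x = (\<integral>u. f (x - u) * k u \<partial>lborel)"
  unfolding conv_def using integral_reflect[of "\<lambda>u. f (x - u) * k u" x] assms by simp

lemma conv_integrable_reflect:
  fixes k :: "'a::euclidean_space \<Rightarrow> real"
  assumes "continuous_on UNIV f" "averaging_kernel e k"
  shows "integrable lborel (\<lambda>u. f (x - u) * k u)"
  using averaging_kernelD[OF assms(2)]
  by (intro integrable_compact_support[of _ e] continuous_on_mult continuous_on_compose2[OF assms(1)])
    (auto intro: continuous_intros)

lemma derivative_bound_of_lipschitz:
  fixes g :: "real \<Rightarrow> real"
  assumes "(g has_real_derivative d) (at 0)" "\<And>t. \<bar>g t - g 0\<bar> \<le> R * \<bar>t\<bar>"
  shows "\<bar>d\<bar> \<le> R"
proof -
  have "((\<lambda>t. \<bar>(g t - g 0) / (t - 0)\<bar>) \<longlongrightarrow> \<bar>d\<bar>) (at 0)"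
    using assms(1) unfolding has_field_derivative_iff by (rule tendsto_rabs)
  moreover have "\<forall>\<^sub>F t in at 0. \<bar>(g t - g 0) / (t - 0)\<bar> \<le> R"
    unfolding eventually_at_filter using assms(2) by (intro always_eventually) (auto simp: abs_divide divide_le_eq)
  ultimately show ?thesis by (rule tendsto_upperbound) simp
qed

text \<open>Mollification averages translates. Convexity, the bound on the gradient components and
  lower bounds for second differences are translation invariant and survive averaging; the last one
  is asked on the whole \<open>e\<close>-ball because that is what the kernel sees.\<close>

lemma mollified_convex:
  fixes \<phi> :: "real^'n::finite \<Rightarrow> real"
  assumes sub: "\<And>x. \<exists>p\<in>cbox 0 (\<chi> i. R). \<forall>z. \<phi> x + p \<bullet> (z - x) \<le> \<phi> z" and e: "e > 0"
  obtains \<Phi> D H where "convex_C2 \<Phi> D H" "\<And>i x. \<bar>D i x\<bar> \<le> R"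
    "\<And>S r x c. (\<And>x'. norm (x' - x) < e \<Longrightarrow> c \<le> second_diff \<phi> S r x') \<Longrightarrow> c \<le> second_diff \<Phi> S r x"
proof -
  note lip = subgradients_in_cube_lipschitz[OF sub]
  obtain G :: "('n \<Rightarrow> nat) \<Rightarrow> real^'n \<Rightarrow> real" where G: "mollifier e G" using mollifier_exists[OF e] .
  note Gd = G[unfolded mollifier_def]
  have ak: "averaging_kernel e (G (\<lambda>_. 0))" using Gd by (simp add: averaging_kernel_def)
  note kD = averaging_kernelD[OF ak]
  have [measurable]: "\<phi> \<in> borel_measurable borel" "G (\<lambda>_. 0) \<in> borel_measurable borel"
    using lip(1) kD by (auto intro: borel_measurable_continuous_onI)
  have L: "loc_integrable \<phi>" using lip(1) by (rule loc_integrable_continuous)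
  have Gc: "continuous_on UNIV (G m)" "\<And>w. e \<le> norm w \<Longrightarrow> G m w = 0" for m using Gd by auto
  define \<Phi> where "\<Phi> = conv \<phi> (G (\<lambda>_. 0))"
  define D where "D i = conv \<phi> (G ((\<lambda>_. 0)(i := 1)))" for i
  define H where "H i j = conv \<phi> (G (((\<lambda>_. 0)(i := 1))(j := Suc (((\<lambda>_. 0)(i := 1)) j))))" for i j
  have line: "((\<lambda>t. conv \<phi> (G m) (x + t *\<^sub>R v)) has_real_derivative
     (\<Sum>j\<in>UNIV. v$j * conv \<phi> (G (m(j := Suc (m j)))) (x + t *\<^sub>R v))) (at t)" for m x v t
  proof -
    define k' where "k' = (\<lambda>w. \<Sum>j\<in>UNIV. v$j * G (m(j := Suc (m j))) w)"
    have "((\<lambda>t. conv \<phi> (G m) (x + t *\<^sub>R v)) has_real_derivative conv \<phi> k' (x + t *\<^sub>R v)) (at t)"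
    proof (rule has_derivative_conv[where e = e])
      show "continuous_on UNIV k'" unfolding k'_def by (intro continuous_intros Gc)
      show "k' w = 0" if "e \<le> norm w" for w unfolding k'_def using Gc(2)[OF that] by simp
      show "((\<lambda>t. G m (x + t *\<^sub>R v)) has_real_derivative k' (x + t *\<^sub>R v)) (at t)" for x t
        using Gd unfolding k'_def by blast
    qed (use L Gc in auto)
    also have "conv \<phi> k' y = (\<Sum>j\<in>UNIV. v$j * conv \<phi> (G (m(j := Suc (m j)))) y)" for y
    proof -
      have i: "integrable lborel (\<lambda>z. \<phi> z * G (m(j := Suc (m j))) (y - z))" for j
        by (rule conv_integrable[OF L Gc])
      have "conv \<phi> k' y = (\<integral>z. (\<Sum>j\<in>UNIV. v$j * (\<phi> z * G (m(j := Suc (m j))) (y - z))) \<partial>lborel)"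
        unfolding conv_def k'_def by (simp add: sum_distrib_left mult_ac)
      also have "\<dots> = (\<Sum>j\<in>UNIV. \<integral>z. v$j * (\<phi> z * G (m(j := Suc (m j))) (y - z)) \<partial>lborel)"
        using i by (intro Bochner_Integration.integral_sum integrable_mult_right) auto
      finally show ?thesis unfolding conv_def by simp
    qed
    finally show ?thesis .
  qed
  have d1: "((\<lambda>t. \<Phi> (x + t *\<^sub>R v)) has_real_derivative (\<Sum>i\<in>UNIV. v$i * D i (x + t *\<^sub>R v))) (at t)" for x v t
    using line[of "\<lambda>_. 0" x v t] unfolding \<Phi>_def D_def by simp
  have d2: "((\<lambda>t. D i (x + t *\<^sub>R v)) has_real_derivative (\<Sum>j\<in>UNIV. v$j * H i j (x + t *\<^sub>R v))) (at t)" for i x v t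
    unfolding D_def H_def by (rule line)
  have cc: "continuous_on UNIV (conv \<phi> (G m))" for m by (rule continuous_on_conv[OF L Gc])
  have cont: "continuous_on UNIV \<Phi>" "continuous_on UNIV (D i)" "continuous_on UNIV (H i j)" for i j
    unfolding \<Phi>_def D_def H_def by (simp_all only: cc)
  have \<Phi>r: "\<Phi> x = (\<integral>u. \<phi> (x - u) * G (\<lambda>_. 0) u \<partial>lborel)" for x
    unfolding \<Phi>_def by (rule conv_reflect) auto
  have ir: "integrable lborel (\<lambda>u. \<phi> (x - u) * G (\<lambda>_. 0) u)" for x
    by (rule conv_integrable_reflect[OF lip(1) ak])
  have sd: "\<Phi> (x + w) + \<Phi> (x - w) - 2 * \<Phi> x
     = (\<integral>u. (\<phi> (x - u + w) + \<phi> (x - u - w) - 2 * \<phi> (x - u)) * G (\<lambda>_. 0) u \<partial>lborel)" for x w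
  proof -
    have "\<Phi> (x + w) + \<Phi> (x - w) - 2 * \<Phi> x = (\<integral>u. \<phi> (x + w - u) * G (\<lambda>_. 0) u + \<phi> (x - w - u) * G (\<lambda>_. 0) u
       - 2 * (\<phi> (x - u) * G (\<lambda>_. 0) u) \<partial>lborel)" unfolding \<Phi>r using ir by simp
    then show ?thesis by (simp add: algebra_simps)
  qed
  have isd: "integrable lborel (\<lambda>u. (\<phi> (x - u + w) + \<phi> (x - u - w) - 2 * \<phi> (x - u)) * G (\<lambda>_. 0) u)" for x w
  proof -
    have "integrable lborel (\<lambda>u. \<phi> (x + w - u) * G (\<lambda>_. 0) u + \<phi> (x - w - u) * G (\<lambda>_. 0) u
       - 2 * (\<phi> (x - u) * G (\<lambda>_. 0) u))" using ir by simp
    then show ?thesis by (simp add: algebra_simps)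
  qed
  have conv0: "0 \<le> \<phi> (x + w) + \<phi> (x - w) - 2 * \<phi> x" for x w
  proof -
    obtain p where "\<forall>z. \<phi> x + p \<bullet> (z - x) \<le> \<phi> z" using sub by blast
    from this[rule_format, of "x + w"] this[rule_format, of "x - w"] show ?thesis by simp
  qed
  have psd: "(\<chi> i j. H i j x) \<in> Sym_plus" for x
  proof (rule Sym_plusI)
    have "((\<lambda>_. 0)(i := 1))(j := Suc (((\<lambda>_. 0)(i := 1)) j)) = ((\<lambda>_. 0)(j := 1))(i := Suc (((\<lambda>_. 0)(j := 1)) i))" for i j :: 'n
      by (auto simp: fun_eq_iff)
    then show "(\<chi> i j. H i j x)$i$j = (\<chi> i j. H i j x)$j$i" for i j by (simp add: H_def)
    fix v
    define g'' where "g'' t = (\<Sum>i\<in>UNIV. v$i * (\<Sum>j\<in>UNIV. v$j * H i j (x + t *\<^sub>R v)))" for t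
    have "0 \<le> g'' 0"
    proof (rule second_derivative_nonneg)
      show "((\<lambda>t. \<Phi> (x + t *\<^sub>R v)) has_real_derivative (\<Sum>i\<in>UNIV. v$i * D i (x + t *\<^sub>R v))) (at t)" for t by (rule d1)
      show "((\<lambda>t. \<Sum>i\<in>UNIV. v$i * D i (x + t *\<^sub>R v)) has_real_derivative g'' t) (at t)" for t
        unfolding g''_def by (intro DERIV_sum DERIV_cmult d2)
      have "continuous_on UNIV (\<lambda>t. H i j (x + t *\<^sub>R v))" for i j
        by (rule continuous_on_compose2[OF cont(3)]) (intro continuous_intros, simp)
      then show "continuous_on UNIV g''" unfolding g''_def by (intro continuous_intros) auto
      show "0 \<le> \<Phi> (x + t *\<^sub>R v) + \<Phi> (x + (- t) *\<^sub>R v) - 2 * \<Phi> (x + 0 *\<^sub>R v)" for t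
      proof -
        have "0 \<le> (\<integral>u. (\<phi> (x - u + t *\<^sub>R v) + \<phi> (x - u - t *\<^sub>R v) - 2 * \<phi> (x - u)) * G (\<lambda>_. 0) u \<partial>lborel)"
          using conv0 kD(3) by (intro integral_nonneg_AE AE_I2 mult_nonneg_nonneg) auto
        then show ?thesis using sd[of x "t *\<^sub>R v"] by simp
      qed
    qed
    then show "0 \<le> v \<bullet> ((\<chi> i j. H i j x) *v v)"
      unfolding quadratic_form_sum g''_def by (simp add: sum_distrib_left mult_ac)
  qed
  have C2: "convex_C2 \<Phi> D H" unfolding convex_C2_def using d1 d2 cont psd by auto
  have Dle: "\<bar>D i x\<bar> \<le> R" for i x
  proof (rule derivative_bound_of_lipschitz)
    have "(\<Sum>l\<in>UNIV. (axis i 1 :: real^'n)$l * D l y) = D i y" for y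
      by (rule sum_axis)
    then show "((\<lambda>t. \<Phi> (x + t *\<^sub>R axis i 1)) has_real_derivative D i x) (at 0)"
      using d1[of x "axis i 1" 0] by simp
    fix t
    have "\<Phi> (x + t *\<^sub>R axis i 1) - \<Phi> x = (\<integral>u. \<phi> (x + t *\<^sub>R axis i 1 - u) * G (\<lambda>_. 0) u - \<phi> (x - u) * G (\<lambda>_. 0) u \<partial>lborel)"
      unfolding \<Phi>r using ir by simp
    also have "\<bar>\<dots>\<bar> \<le> (\<integral>u. R * \<bar>t\<bar> * G (\<lambda>_. 0) u \<partial>lborel)"
    proof (intro integral_abs_bound_integral)
      fix u
      have "\<bar>\<phi> (x - u + t *\<^sub>R axis i 1) - \<phi> (x - u)\<bar> * G (\<lambda>_. 0) u \<le> R * \<bar>t\<bar> * G (\<lambda>_. 0) u"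
        by (intro mult_right_mono lip(2) kD(3))
      then show "\<bar>\<phi> (x + t *\<^sub>R axis i 1 - u) * G (\<lambda>_. 0) u - \<phi> (x - u) * G (\<lambda>_. 0) u\<bar> \<le> R * \<bar>t\<bar> * G (\<lambda>_. 0) u"
        using kD(3)[of u] unfolding left_diff_distrib[symmetric] abs_mult by (simp add: add_diff_eq diff_add_eq)
    qed (use ir kD in auto)
    also have "\<dots> = R * \<bar>t\<bar>" using kD by simp
    finally show "\<bar>\<Phi> (x + t *\<^sub>R axis i 1) - \<Phi> (x + 0 *\<^sub>R axis i 1)\<bar> \<le> R * \<bar>t\<bar>" by simp
  qed
  have "c \<le> second_diff \<Phi> S r x" if c: "\<And>x'. norm (x' - x) < e \<Longrightarrow> c \<le> second_diff \<phi> S r x'" for S r x c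
  proof -
    have eq: "second_diff \<Phi> S r x = (\<integral>u. second_diff \<phi> S r (x - u) * G (\<lambda>_. 0) u \<partial>lborel)"
      unfolding second_diff_def sd sum_distrib_right using isd by (intro Bochner_Integration.integral_sum[symmetric])
    have i: "integrable lborel (\<lambda>u. second_diff \<phi> S r (x - u) * G (\<lambda>_. 0) u)"
      unfolding second_diff_def sum_distrib_right using isd by (intro Bochner_Integration.integrable_sum)
    have "c = (\<integral>u. c * G (\<lambda>_. 0) u \<partial>lborel)" using kD by simp
    also have "\<dots> \<le> second_diff \<Phi> S r x" unfolding eq
    proof (intro integral_mono i)
      fix u show "c * G (\<lambda>_. 0) u \<le> second_diff \<phi> S r (x - u) * G (\<lambda>_. 0) u"
        using c[of "x - u"] kD(2)[of u] kD(3)[of u] by (cases "norm u < e") (auto intro: mult_right_mono)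
    qed (use kD in auto)
    finally show ?thesis .
  qed
  with C2 Dle that show ?thesis by blast
qed

text \<open>One integration by parts replaces the Hessian by the gradient and leaves only the row
  divergences of \<open>B\<close>. In the application \<open>R\<close> is the side of the cube that
  contains the subgradients.\<close>

lemma hessian_pairing_le:
  fixes B :: "real^'n::finite \<Rightarrow> real^'n^'n"
  assumes C2: "convex_C2 \<Phi> D H" and D: "\<And>i x. \<bar>D i x\<bar> \<le> R"
    and dB: "\<And>i j x t. ((\<lambda>t. B (x + t *\<^sub>R axis j 1) $ i $ j) has_real_derivative Bd i j (x + t *\<^sub>R axis j 1)) (at t)"
    and cB: "\<And>i j. continuous_on UNIV (\<lambda>x. B x $ i $ j)" "\<And>i j. continuous_on UNIV (Bd i j)"
    and sB: "\<And>x. \<rho> \<le> norm x \<Longrightarrow> B x = 0" "\<And>i j x. \<rho> \<le> norm x \<Longrightarrow> Bd i j x = 0"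
  shows "(\<integral>x. (\<Sum>i\<in>UNIV. \<Sum>j\<in>UNIV. B x $ i $ j * H i j x) \<partial>lborel)
     \<le> R * (\<Sum>i\<in>UNIV. \<integral>x. \<bar>\<Sum>j\<in>UNIV. Bd i j x\<bar> \<partial>lborel)"
    "integrable lborel (\<lambda>x. \<Sum>i\<in>UNIV. \<Sum>j\<in>UNIV. B x $ i $ j * H i j x)"
proof -
  note C = C2[unfolded convex_C2_def]
  have cD: "continuous_on UNIV (D i)" "continuous_on UNIV (H i j)" for i j using C by auto
  have iBH: "integrable lborel (\<lambda>x. B x $ i $ j * H i j x)" for i j
    using sB(1) by (intro integrable_compact_support[of _ \<rho>] continuous_on_mult cB cD) auto
  have iBD: "integrable lborel (\<lambda>x. Bd i j x * D i x)" for i j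
    using sB(2) by (intro integrable_compact_support[of _ \<rho>] continuous_on_mult cB cD) auto
  have z: "(\<integral>x. Bd i j x * D i x + B x $ i $ j * H i j x \<partial>lborel) = 0" for i j
  proof (rule integral_line_derivative_0)
    fix x t
    have "((\<lambda>t. D i (x + t *\<^sub>R axis j 1)) has_real_derivative
        (\<Sum>l\<in>UNIV. axis j 1 $ l * H i l (x + t *\<^sub>R axis j 1))) (at t)"
      using C by blast
    then have dD: "((\<lambda>t. D i (x + t *\<^sub>R axis j 1)) has_real_derivative H i j (x + t *\<^sub>R axis j 1)) (at t)"
      by (simp only: sum_axis)
    show "((\<lambda>t. B (x + t *\<^sub>R axis j 1) $ i $ j * D i (x + t *\<^sub>R axis j 1)) has_real_derivative
      Bd i j (x + t *\<^sub>R axis j 1) * D i (x + t *\<^sub>R axis j 1) + B (x + t *\<^sub>R axis j 1) $ i $ j * H i j (x + t *\<^sub>R axis j 1)) (at t)"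
      using DERIV_mult[OF dB dD] by (simp add: mult.commute add.commute)
  next
    fix x :: "real^'n" assume "\<rho> \<le> norm x"
    then show "B x $ i $ j * D i x = 0" "Bd i j x * D i x + B x $ i $ j * H i j x = 0" using sB by simp_all
  qed (intro continuous_intros cB cD)+
  have "(\<integral>x. (\<Sum>i\<in>UNIV. \<Sum>j\<in>UNIV. B x $ i $ j * H i j x) \<partial>lborel)
      = (\<Sum>i\<in>UNIV. \<Sum>j\<in>UNIV. \<integral>x. B x $ i $ j * H i j x \<partial>lborel)"
    using iBH by (subst Bochner_Integration.integral_sum | simp)+
  also have "\<dots> = (\<Sum>i\<in>UNIV. \<Sum>j\<in>UNIV. - (\<integral>x. Bd i j x * D i x \<partial>lborel))"
    using z iBH iBD by (intro sum.cong refl) (simp add: eq_neg_iff_add_eq_0 add.commute)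
  also have "\<dots> = (\<Sum>i\<in>UNIV. - (\<integral>x. (\<Sum>j\<in>UNIV. Bd i j x) * D i x \<partial>lborel))"
    using iBD by (simp add: sum_distrib_right sum_negf)
  also have "\<dots> \<le> (\<Sum>i\<in>UNIV. R * (\<integral>x. \<bar>\<Sum>j\<in>UNIV. Bd i j x\<bar> \<partial>lborel))"
  proof (rule sum_mono)
    fix i
    have ib: "integrable lborel (\<lambda>x. \<bar>\<Sum>j\<in>UNIV. Bd i j x\<bar>)"
      using sB(2) by (intro integrable_compact_support[of _ \<rho>] continuous_intros cB) auto
    have "- (\<integral>x. (\<Sum>j\<in>UNIV. Bd i j x) * D i x \<partial>lborel) \<le> \<bar>\<integral>x. (\<Sum>j\<in>UNIV. Bd i j x) * D i x \<partial>lborel\<bar>" by simp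
    also have "\<dots> \<le> (\<integral>x. R * \<bar>\<Sum>j\<in>UNIV. Bd i j x\<bar> \<partial>lborel)"
    proof (intro integral_abs_bound_integral)
      show "integrable lborel (\<lambda>x. (\<Sum>j\<in>UNIV. Bd i j x) * D i x)"
        unfolding sum_distrib_right by (intro Bochner_Integration.integrable_sum iBD)
      fix x show "\<bar>(\<Sum>j\<in>UNIV. Bd i j x) * D i x\<bar> \<le> R * \<bar>\<Sum>j\<in>UNIV. Bd i j x\<bar>"
        using mult_left_mono[OF D[of i x] abs_ge_zero[of "\<Sum>j\<in>UNIV. Bd i j x"]] by (simp add: abs_mult mult.commute)
    qed (use ib in auto)
    finally show "- (\<integral>x. (\<Sum>j\<in>UNIV. Bd i j x) * D i x \<partial>lborel) \<le> R * (\<integral>x. \<bar>\<Sum>j\<in>UNIV. Bd i j x\<bar> \<partial>lborel)" by simp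
  qed
  finally show "(\<integral>x. (\<Sum>i\<in>UNIV. \<Sum>j\<in>UNIV. B x $ i $ j * H i j x) \<partial>lborel)
     \<le> R * (\<Sum>i\<in>UNIV. \<integral>x. \<bar>\<Sum>j\<in>UNIV. Bd i j x\<bar> \<partial>lborel)" by (simp add: sum_distrib_left)
  show "integrable lborel (\<lambda>x. \<Sum>i\<in>UNIV. \<Sum>j\<in>UNIV. B x $ i $ j * H i j x)"
    using iBH by (intro Bochner_Integration.integrable_sum)
qed

text \<open>Open unit cubes centred at integer points are pairwise disjoint, and their images under
  \<open>S\<close> all have volume \<open>\<bar>det S\<bar>\<close>. The resulting bound on every
  finite subset of \<open>J\<close> also shows that \<open>J\<close> is finite.\<close>

lemma tile_count:
  fixes S :: "real^'n::finite^'n"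
  assumes S: "det S \<noteq> 0" and Q: "Q \<in> lmeasurable"
  defines "J \<equiv> {\<kappa>. (\<forall>i. \<kappa>$i \<in> \<int>) \<and> (*v) S ` box (\<kappa> - (\<chi> i. 1/2)) (\<kappa> + (\<chi> i. 1/2)) \<subseteq> Q}"
  shows "finite J" "real (card J) * \<bar>det S\<bar> \<le> measure lebesgue Q"
proof -
  define W where "W \<kappa> = box (\<kappa> - (\<chi> i. 1/2)) (\<kappa> + (\<chi> i. 1/2))" for \<kappa> :: "real^'n"
  have Wm: "measure lebesgue (W \<kappa>) = 1" for \<kappa>
  proof -
    have "measure lborel (W \<kappa>) = (\<Prod>b\<in>Basis. ((\<chi> i. 1/2) + (\<chi> i. 1/2) :: real^'n) \<bullet> b)"
      unfolding W_def by (subst measure_lborel_box) (auto simp: inner_diff_left inner_add_left Basis_vec_def inner_axis)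
    also have "\<dots> = 1" by (rule prod.neutral) (auto simp: Basis_vec_def inner_axis)
    finally show ?thesis by (simp add: W_def)
  qed
  have disjW: "W \<kappa> \<inter> W \<kappa>' = {}" if "\<forall>i. \<kappa>$i \<in> \<int>" "\<forall>i. \<kappa>'$i \<in> \<int>" "\<kappa> \<noteq> \<kappa>'" for \<kappa> \<kappa>'
  proof -
    note K = that
    obtain i where i: "\<kappa>$i \<noteq> \<kappa>'$i" using \<open>\<kappa> \<noteq> \<kappa>'\<close> by (auto simp: vec_eq_iff)
    obtain a where a: "\<kappa>$i = of_int a" by (rule Ints_cases[OF K(1)[rule_format, of i]])
    obtain b where b: "\<kappa>'$i = of_int b" by (rule Ints_cases[OF K(2)[rule_format, of i]])
    note ab = a b
    then have "1 \<le> \<bar>\<kappa>$i - \<kappa>'$i\<bar>" using i by (simp flip: of_int_diff of_int_abs)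
    then have False if "w \<in> W \<kappa>" "w \<in> W \<kappa>'" for w
      using that unfolding W_def mem_box_cart by (auto simp: abs_le_iff dest!: spec[of _ i])
    then show ?thesis by auto
  qed
  have inj: "inj ((*v) S)" using S by (simp add: inj_matrix_vector_mult invertible_det_nz)
  have bound: "real (card F) * \<bar>det S\<bar> \<le> measure lebesgue Q" if F: "F \<subseteq> J" "finite F" for F
  proof -
    have m: "(*v) S ` W \<kappa> \<in> lmeasurable" "measure lebesgue ((*v) S ` W \<kappa>) = \<bar>det S\<bar>" for \<kappa>
      using measure_matrix_image[of "W \<kappa>" S] Wm[of \<kappa>] by (simp_all add: W_def)
    have "real (card F) * \<bar>det S\<bar> = (\<Sum>\<kappa>\<in>F. measure lebesgue ((*v) S ` W \<kappa>))" by (simp add: m)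
    also have "\<dots> = measure lebesgue (\<Union>\<kappa>\<in>F. (*v) S ` W \<kappa>)"
    proof (rule measure_UNION'[symmetric])
      show "pairwise (\<lambda>\<kappa> \<kappa>'. disjnt ((*v) S ` W \<kappa>) ((*v) S ` W \<kappa>')) F"
      proof (rule pairwiseI)
        fix \<kappa> \<kappa>' assume "\<kappa> \<in> F" "\<kappa>' \<in> F" "\<kappa> \<noteq> \<kappa>'"
        then have "W \<kappa> \<inter> W \<kappa>' = {}" using F(1) by (intro disjW) (auto simp: J_def)
        then show "disjnt ((*v) S ` W \<kappa>) ((*v) S ` W \<kappa>')"
          unfolding disjnt_def by (metis image_Int[OF inj] image_empty)
      qed
    qed (use F m in auto)
    also have "\<dots> \<le> measure lebesgue Q"
      using F Q m by (intro measure_mono_fmeasurable fmeasurable.finite_UN) (auto simp: J_def W_def)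
    finally show ?thesis .
  qed
  have "card F \<le> nat \<lfloor>measure lebesgue Q / \<bar>det S\<bar>\<rfloor>" if "F \<subseteq> J" "finite F" for F
    using bound[OF that] S by (simp add: le_nat_floor pos_le_divide_eq)
  then show fin: "finite J" using finite_if_finite_subsets_card_bdd[of J] by blast
  show "real (card J) * \<bar>det S\<bar> \<le> measure lebesgue Q" by (rule bound[OF order_refl fin])
qed

lemma int_rounding: obtains \<kappa> :: "real^'n::finite" where "\<And>i. \<kappa>$i \<in> \<int>" "\<And>i. \<bar>w$i - \<kappa>$i\<bar> \<le> 1/2"
proof (rule that[of "\<chi> i. of_int (round (w$i))"])
  show "\<bar>w$i - (\<chi> i. of_int (round (w$i)))$i\<bar> \<le> 1/2" for i
    using of_int_round_abs_le[of "w$i"] by (simp add: abs_minus_commute)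
qed simp

text \<open>The relation f^n = f * s behind the exponent \<open>1 / (n - 1)\<close>: it lets the
  mass assigned to a lattice point be compared with the n-th power of a second difference.\<close>

lemma powr_pow_identity:
  fixes s :: real
  assumes "2 \<le> n" "0 < s"
  shows "(s powr (1 / (real n - 1))) ^ n = s powr (1 / (real n - 1)) * s"
proof -
  obtain m where m: "n = Suc m" "m > 0" using assms(1) by (cases n) auto
  have "(s powr (1 / (real n - 1))) ^ m = s"
    using assms m by (simp add: powr_realpow[symmetric] powr_powr)
  then show ?thesis by (simp add: m)
qed

section \<open>The discretised inequality on grid cubes\<close>

text \<open>The mass of each grid cube is spread over the points of a lattice adapted to the matrix \<open>S c\<close>
  which approximates the field on that cube; each lattice point then has a subgradient cell of
  the prescribed volume.\<close>
lemma serre_cubes: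
  fixes B :: "real^'n::finite \<Rightarrow> real^'n^'n" and CC :: "(real^'n) set"
  defines "N \<equiv> CARD('n)"
  assumes N2: "2 \<le> N"
    and dB: "\<And>i j x t. ((\<lambda>t. B (x + t *\<^sub>R axis j 1) $ i $ j) has_real_derivative Bd i j (x + t *\<^sub>R axis j 1)) (at t)"
    and cB: "\<And>i j. continuous_on UNIV (\<lambda>x. B x $ i $ j)" "\<And>i j. continuous_on UNIV (Bd i j)"
    and sB: "\<And>x. \<rho> \<le> norm x \<Longrightarrow> B x = 0" "\<And>i j x. \<rho> \<le> norm x \<Longrightarrow> Bd i j x = 0"
    and psd: "\<And>x. B x \<in> Sym_plus"
    and CC: "finite CC" "CC \<noteq> {}" and l: "0 < l"
  defines "Q \<equiv> (\<lambda>c. {x::real^'n. \<forall>i. c$i \<le> x$i \<and> x$i < c$i + l})"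
  assumes disj: "\<And>c c'. c \<in> CC \<Longrightarrow> c' \<in> CC \<Longrightarrow> c \<noteq> c' \<Longrightarrow> Q c \<inter> Q c' = {}"
    and S: "\<And>c. c \<in> CC \<Longrightarrow> det (S c) \<noteq> 0"
      "\<And>c y v. c \<in> CC \<Longrightarrow> y \<in> Q c \<Longrightarrow> v \<bullet> ((S c ** transpose (S c)) *v v) \<le> v \<bullet> (B y *v v)"
  defines "F \<equiv> (\<Sum>c\<in>CC. l ^ N * (det (S c))\<^sup>2 powr (1 / (real N - 1)))"
  shows "F \<le> 4 * real N * 2 ^ N * F powr (1 / real N) * (\<Sum>i\<in>UNIV. \<integral>x. \<bar>\<Sum>j\<in>UNIV. Bd i j x\<bar> \<partial>lborel)"
proof -
  have N0: "N > 0" using N2 by simp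
  define f where "f c = (det (S c))\<^sup>2 powr (1 / (real N - 1))" for c
  have f: "0 < f c" "f c ^ N = f c * (det (S c))\<^sup>2" if "c \<in> CC" for c
    using S(1)[OF that] powr_pow_identity[OF N2, of "(det (S c))\<^sup>2"] by (auto simp: f_def)
  define sm where "sm = (\<Sum>c\<in>CC. \<Sum>i\<in>UNIV. \<Sum>k\<in>UNIV. \<bar>S c $ i $ k\<bar>) + 1"
  have sm0: "sm > 0" unfolding sm_def by (intro add_nonneg_pos sum_nonneg) auto
  have sm: "(\<Sum>k\<in>UNIV. \<bar>S c $ i $ k\<bar>) \<le> sm" if "c \<in> CC" for c i
  proof -
    have "(\<Sum>k\<in>UNIV. \<bar>S c $ i $ k\<bar>) \<le> (\<Sum>i\<in>UNIV. \<Sum>k\<in>UNIV. \<bar>S c $ i $ k\<bar>)"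
      by (rule member_le_sum) (auto intro: sum_nonneg)
    also have "\<dots> \<le> (\<Sum>c\<in>CC. \<Sum>i\<in>UNIV. \<Sum>k\<in>UNIV. \<bar>S c $ i $ k\<bar>)"
      by (rule member_le_sum) (use CC that in \<open>auto intro: sum_nonneg\<close>)
    finally show ?thesis by (simp add: sm_def)
  qed
  have smul: "\<bar>(S c *v w)$i\<bar> \<le> sm * b" if "c \<in> CC" "\<And>k. \<bar>w$k\<bar> \<le> b" for c w i b
  proof -
    have b0: "0 \<le> b" using that(2) by (meson abs_ge_zero order_trans)
    have "\<bar>(S c *v w)$i\<bar> \<le> (\<Sum>k\<in>UNIV. \<bar>S c $ i $ k * w$k\<bar>)"
      unfolding matrix_vector_mult_def by (simp add: sum_abs)
    also have "\<dots> \<le> (\<Sum>k\<in>UNIV. \<bar>S c $ i $ k\<bar> * b)"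
      by (intro sum_mono) (auto simp: abs_mult intro!: mult_left_mono that)
    also have "\<dots> \<le> sm * b" using sm[OF that(1)] b0 by (simp add: sum_distrib_right[symmetric] mult_right_mono)
    finally show ?thesis .
  qed
  \<comment> \<open>The lattice spacing. A vector with coordinates at most \<open>r = N * t\<close>
    is moved by \<open>S c\<close> into one with coordinates at most \<open>sm * r = l / 8\<close>;
    together with the radius \<open>l / 16\<close> this stays within the margin \<open>l / 4\<close>
    around \<open>Q'\<close>.\<close>
  define t where "t = l / (8 * real N * sm)"
  have t: "t > 0" using l N0 sm0 by (simp add: t_def)
  \<comment> \<open>Rounding in lattice coordinates costs at most \<open>t / 2\<close> per
    coordinate, so the remainder \<theta> has l1 norm at most \<open>N * t / 2 = r / 2\<close>, as
    \<open>subgradient_cell_measure\<close> demands.\<close>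
  define r where "r = real N * t"
  have r: "r > 0" "sm * r = l / 8" using t N0 sm0 by (auto simp: r_def t_def field_simps)
  have tsm: "sm * t \<le> l / 8"
  proof -
    have "sm * t \<le> sm * r" using t N0 sm0 unfolding r_def by simp
    then show ?thesis using r by simp
  qed
  define Q' where "Q' c = cbox (c + (\<chi> i. l/4)) (c + (\<chi> i. 3*l/4))" for c :: "real^'n"
  have Qmem: "x \<in> Q c \<longleftrightarrow> (\<forall>i. c$i \<le> x$i \<and> x$i < c$i + l)" for x c by (simp add: Q_def)
  have Q'mem: "x \<in> Q' c \<longleftrightarrow> (\<forall>i. c$i + l/4 \<le> x$i \<and> x$i \<le> c$i + 3*l/4)" for x c by (simp add: Q'_def mem_box_cart)
  have Qb: "bounded (Q c)" "Q c \<in> sets borel" "measure lebesgue (Q c) \<le> l ^ N" "Q c \<in> lmeasurable" for c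
  proof -
    have sub: "Q c \<subseteq> cbox c (c + (\<chi> i. l))" by (auto simp: Qmem mem_box_cart) (meson less_imp_le)
    then show "bounded (Q c)" by (rule bounded_subset[OF bounded_cbox])
    have "Q c = (\<Inter>i\<in>UNIV. {x. c$i \<le> x$i} \<inter> {x. x$i < c$i + l})" by (auto simp: Qmem)
    also have "\<dots> \<in> sets borel"
      by (intro sets.countable_INT'' sets.Int borel_closed borel_open closed_Collect_le open_Collect_less continuous_intros) auto
    finally show b: "Q c \<in> sets borel" .
    show lm: "Q c \<in> lmeasurable" by (rule fmeasurableI2[OF lmeasurable_cbox sub]) (use b in auto)
    have "measure lebesgue (Q c) \<le> measure lebesgue (cbox c (c + (\<chi> i. l)))"
      using sub b by (intro measure_mono_fmeasurable) auto
    also have "\<dots> = l ^ N"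
    proof -
      have "cbox c (c + (\<chi> i. l)) \<noteq> {}" using l unfolding interval_ne_empty_cart by auto
      then show ?thesis by (simp add: content_cbox_cart N_def)
    qed
    finally show "measure lebesgue (Q c) \<le> l ^ N" .
  qed
  have Q'b: "bounded (Q' c)" "Q' c \<in> sets borel" "measure lborel (Q' c) = (l/2) ^ N" for c
  proof -
    have "Q' c \<noteq> {}" unfolding Q'_def interval_ne_empty_cart using l by auto
    then have "measure lborel (Q' c) = (\<Prod>i\<in>(UNIV::'n set). l/2)"
      unfolding Q'_def by (subst content_cbox_cart) (auto intro!: prod.cong simp: field_simps)
    then show "measure lborel (Q' c) = (l/2) ^ N" by (simp add: N_def)
  qed (auto simp: Q'_def)
  define T where "T c = t *\<^sub>R S c" for c
  have Tv: "T c *v w = t *\<^sub>R (S c *v w)" for c w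
    unfolding T_def by (simp add: scaleR_matrix_vector_assoc)
  have Tv2: "T c *v w = S c *v (t *\<^sub>R w)" for c w
    unfolding Tv by (simp add: matrix_vector_mult_scaleR)
  have detT: "\<bar>det (T c)\<bar> = t ^ N * \<bar>det (S c)\<bar>" for c
  proof -
    have "T c = (t *\<^sub>R mat 1) ** S c" by (simp add: T_def scalar_matrix_assoc[symmetric])
    moreover have "det (t *\<^sub>R mat 1 :: real^'n^'n) = t ^ N"
      by (subst det_diagonal) (auto simp: mat_def N_def)
    ultimately show ?thesis using t by (simp add: det_mul abs_mult)
  qed
  \<comment> \<open>Only lattice points whose whole tile lies in \<open>Q c\<close> are kept. The
    tiles then fill at most the volume of the cube, so the masses in it add up to at most
    \<open>f c * l ^ N\<close>.\<close>
  define J where "J c = {\<kappa>. (\<forall>i. \<kappa>$i \<in> \<int>) \<and> (*v) (T c) ` box (\<kappa> - (\<chi> i. 1/2)) (\<kappa> + (\<chi> i. 1/2)) \<subseteq> Q c}" for c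
  have J: "finite (J c)" "real (card (J c)) * (t ^ N * \<bar>det (S c)\<bar>) \<le> l ^ N" if "c \<in> CC" for c
  proof -
    have "det (T c) \<noteq> 0" using detT[of c] S(1)[OF that] t by auto
    from tile_count[OF this Qb(4)[of c]] show "finite (J c)" "real (card (J c)) * (t ^ N * \<bar>det (S c)\<bar>) \<le> l ^ N"
      unfolding J_def[symmetric] detT using Qb(3)[of c] by auto
  qed
  have lattice: "\<exists>\<kappa>\<in>J c. \<exists>\<theta>. T c *v \<kappa> = x' + S c *v \<theta> \<and> (\<Sum>k\<in>UNIV. \<bar>\<theta>$k\<bar>) \<le> r / 2"
    if c: "c \<in> CC" and x: "x \<in> Q' c" "norm (x' - x) < l / 16" for c x x'
  proof -
    have "invertible (T c)" using detT[of c] S(1)[OF c] t by (auto simp: invertible_det_nz)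
    then obtain U where U: "T c ** U = mat 1" by (auto simp: invertible_def)
    define w where "w = U *v x'"
    have w: "T c *v w = x'" by (simp add: w_def matrix_vector_mul_assoc U)
    obtain \<kappa> :: "real^'n" where \<kappa>: "\<And>i. \<kappa>$i \<in> \<int>" "\<And>i. \<bar>w$i - \<kappa>$i\<bar> \<le> 1/2" using int_rounding[of w] by blast
    have "T c *v u \<in> Q c" if u: "u \<in> box (\<kappa> - (\<chi> i. 1/2)) (\<kappa> + (\<chi> i. 1/2))" for u
    proof -
      have "\<bar>u$i - w$i\<bar> \<le> 1" for i
      proof -
        have "\<kappa>$i - 1/2 < u$i" "u$i < \<kappa>$i + 1/2" using u by (auto simp: mem_box_cart)
        with \<kappa>(2)[of i] show ?thesis unfolding abs_le_iff by linarith
      qed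
      then have "\<bar>(t *\<^sub>R (u - w))$k\<bar> \<le> t" for k using t by (simp add: abs_mult)
      then have "\<bar>(S c *v (t *\<^sub>R (u - w)))$i\<bar> \<le> sm * t" for i by (rule smul[OF c])
      moreover have "S c *v (t *\<^sub>R (u - w)) = T c *v u - x'"
        unfolding Tv2[symmetric] by (simp add: matrix_vector_mult_diff_distrib w)
      ultimately have h1: "\<bar>(T c *v u)$i - x'$i\<bar> \<le> l / 8" for i using tsm by (metis order_trans vector_minus_component)
      have h2: "\<bar>x'$i - x$i\<bar> < l / 16" for i
        using x(2) component_le_norm_cart[of "x' - x" i] by simp
      have "c$i \<le> (T c *v u)$i \<and> (T c *v u)$i < c$i + l" for i
      proof -
        have "c$i + l/4 \<le> x$i" "x$i \<le> c$i + 3*l/4" using x(1) by (auto simp: Q'mem)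
        with h1[of i] h2[of i] l show ?thesis unfolding abs_le_iff abs_less_iff by linarith
      qed
      then show ?thesis unfolding Qmem by blast
    qed
    then have "\<kappa> \<in> J c" using \<kappa>(1) by (auto simp: J_def)
    moreover define \<theta> where "\<theta> = t *\<^sub>R (\<kappa> - w)"
    have "T c *v \<kappa> = x' + S c *v \<theta>"
      unfolding \<theta>_def Tv2[symmetric] by (simp add: matrix_vector_mult_diff_distrib w)
    moreover have "(\<Sum>k\<in>UNIV. \<bar>\<theta>$k\<bar>) \<le> (\<Sum>k\<in>(UNIV::'n set). t * (1/2))"
      unfolding \<theta>_def using t \<kappa>(2) by (intro sum_mono) (simp add: abs_mult abs_minus_commute)
    ultimately show ?thesis by (auto simp: r_def N_def)
  qed
  define I where "I = Sigma CC J"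
  define pt where "pt = (\<lambda>(c, \<kappa>). T c *v \<kappa>)"
  \<comment> \<open>Density \<open>f c\<close> times the volume \<open>\<bar>det (T c)\<bar>\<close>
    of one tile.\<close>
  define m where "m = (\<lambda>(c::real^'n, \<kappa>::real^'n). f c * (t ^ N * \<bar>det (S c)\<bar>))"
  have I: "finite I" unfolding I_def using CC J by auto
  have Ine: "I \<noteq> {}"
  proof -
    obtain c where c: "c \<in> CC" using CC by auto
    have "c + (\<chi> i. l/2) \<in> Q' c" using l by (auto simp: Q'mem)
    from lattice[OF c this, of "c + (\<chi> i. l/2)"] l c show ?thesis by (auto simp: I_def)
  qed
  have m0: "0 < m i" if "i \<in> I" for i using that f(1) S(1) t by (auto simp: I_def m_def)
  define mm where "mm = (\<Sum>i\<in>I. m i)"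
  have mm0: "mm > 0" unfolding mm_def using I Ine m0 by (simp add: sum_pos)
  have mmF: "mm \<le> F"
  proof -
    have "mm = (\<Sum>c\<in>CC. \<Sum>\<kappa>\<in>J c. m (c, \<kappa>))"
      unfolding mm_def I_def using CC J by (subst sum.Sigma) auto
    also have "\<dots> = (\<Sum>c\<in>CC. f c * (real (card (J c)) * (t ^ N * \<bar>det (S c)\<bar>)))"
      by (simp add: m_def mult_ac)
    also have "\<dots> \<le> (\<Sum>c\<in>CC. f c * l ^ N)"
      using J f by (intro sum_mono mult_left_mono) (auto simp: less_imp_le)
    also have "\<dots> = F" by (simp add: F_def f_def mult.commute)
    finally show ?thesis .
  qed
  \<comment> \<open>The target is a cube whose volume is the total mass; its side bounds the
    gradient of the potential and is the source of the factor \<open>F powr (1 / N)\<close>.\<close>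
  define R where "R = mm powr (1 / real N)"
  have R0: "R > 0" using mm0 by (simp add: R_def)
  have RN: "R ^ N = mm" using mm0 N0 by (simp add: R_def powr_realpow[symmetric] powr_powr)
  have mT: "measure lborel (cbox 0 (\<chi> i. R) :: (real^'n) set) = (\<Sum>i\<in>I. m i)"
  proof -
    have "cbox 0 (\<chi> i. R) \<noteq> ({} :: (real^'n) set)" unfolding interval_ne_empty_cart using R0 by auto
    then show ?thesis by (simp add: content_cbox_cart RN[symmetric, unfolded mm_def] N_def)
  qed
  obtain \<phi> C where \<phi>: "\<And>x. \<exists>p\<in>cbox 0 (\<chi> i. R). \<forall>z. \<phi> x + p \<bullet> (z - x) \<le> \<phi> z"
    and C: "\<And>i. i \<in> I \<Longrightarrow> compact (C i) \<and> m i \<le> measure lborel (C i)"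
      "\<And>i y z. i \<in> I \<Longrightarrow> y \<in> C i \<Longrightarrow> \<phi> (pt i) + y \<bullet> (z - pt i) \<le> \<phi> z"
    using semidiscrete_transport[OF I Ine m0 compact_cbox mT, of pt] by blast
  have lower: "real N * t\<^sup>2 * f c / 4 \<le> second_diff \<phi> (S c) r x'"
    if c: "c \<in> CC" and x: "x \<in> Q' c" "norm (x' - x) < l / 16" for c x x'
  proof -
    obtain \<kappa> \<theta> where k: "\<kappa> \<in> J c" "T c *v \<kappa> = x' + S c *v \<theta>" "(\<Sum>k\<in>UNIV. \<bar>\<theta>$k\<bar>) \<le> r / 2"
      using lattice[OF c x] by blast
    have i: "(c, \<kappa>) \<in> I" using c k by (simp add: I_def)
    define V where "V = second_diff \<phi> (S c) r x'"
    have sub: "\<exists>p. \<forall>z. \<phi> x + p \<bullet> (z - x) \<le> \<phi> z" for x using \<phi> by blast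
    have pti: "pt (c, \<kappa>) = x' + S c *v \<theta>" by (simp add: pt_def k(2))
    note cell = subgradient_cell_measure[OF sub r(1) k(3) C(1)[OF i, THEN conjunct1]
        C(2)[OF i, unfolded pti] V_def[unfolded second_diff_def], folded N_def]
    \<comment> \<open>The identity for \<open>f c\<close> turns the cell volume bound into
      \<open>(f c * t) ^ N \<le> (4 * V / r) ^ N\<close>. Taking roots here plays the part of the
      arithmetic-geometric mean inequality.\<close>
    have "(f c * t) ^ N = \<bar>det (S c)\<bar> * m (c, \<kappa>)"
      using f(2)[OF c] by (simp add: m_def power_mult_distrib power2_eq_square abs_mult_self_eq mult_ac)
    also have "\<dots> \<le> \<bar>det (S c)\<bar> * measure lborel (C (c, \<kappa>))"
      using C(1)[OF i] by (intro mult_left_mono) auto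
    also have "\<dots> \<le> (4 * V / r) ^ N" by (rule cell(1))
    finally have "f c * t \<le> 4 * V / r"
      by (subst (asm) power_mono_iff) (use cell(2) r N0 f(1)[OF c] t in auto)
    then show ?thesis using r(1) unfolding V_def[symmetric]
      by (simp add: pos_le_divide_eq r_def power2_eq_square mult_ac)
  qed
  \<comment> \<open>The estimate \<open>lower\<close> holds at all points within
    \<open>l / 16\<close> of \<open>Q'\<close>, so mollifying at this radius preserves it on
    \<open>Q'\<close>.\<close>
  obtain \<Phi> D H where C2: "convex_C2 \<Phi> D H" and D: "\<And>i x. \<bar>D i x\<bar> \<le> R"
    and tr: "\<And>S r x c. (\<And>x'. norm (x' - x) < l / 16 \<Longrightarrow> c \<le> second_diff \<phi> S r x') \<Longrightarrow> c \<le> second_diff \<Phi> S r x"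
    by (rule mollified_convex[OF \<phi>, of "l/16"]) (use l in auto)
  define P where "P x = (\<Sum>i\<in>UNIV. \<Sum>j\<in>UNIV. B x $ i $ j * H i j x)" for x
  note pair = hessian_pairing_le[OF C2 D dB cB sB, folded P_def]
  have P0: "0 \<le> P x" for x
    using Sym_plus_double_sum_nonneg[OF psd[of x], of "\<chi> i j. H i j x"] C2 by (simp add: P_def convex_C2_def)
  define M where "M c = (\<integral>x. indicator (Q c) x * P x \<partial>lborel)" for c
  have iQ: "integrable lborel (\<lambda>x. indicator (Q c) x * P x)" for c
    using integrable_mult_indicator[OF _ pair(2), of "Q c"] Qb(2)[of c] by simp
  have cube: "f c * l ^ N \<le> 4 * real N * 2 ^ N * M c" if c: "c \<in> CC" for c
  proof -
    have c\<Phi>: "continuous_on UNIV \<Phi>" using C2 by (simp add: convex_C2_def)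
    have "continuous_on UNIV (second_diff \<Phi> (S c) r)"
      unfolding second_diff_def[abs_def]
      by (intro continuous_intros continuous_on_compose2[OF c\<Phi>]) auto
    from borel_integrable_compact[OF compact_cbox continuous_on_subset[OF this subset_UNIV]]
    have isd: "integrable lborel (\<lambda>x. indicator (Q' c) x * second_diff \<Phi> (S c) r x)"
      by (simp add: Q'_def)
    have "measure lborel (Q' c) * (real N * t\<^sup>2 * f c / 4) = (\<integral>x. indicator (Q' c) x * (real N * t\<^sup>2 * f c / 4) \<partial>lborel)"
      by (simp add: Q'_def)
    also have "\<dots> \<le> (\<integral>x. indicator (Q' c) x * second_diff \<Phi> (S c) r x \<partial>lborel)"
    proof (intro integral_mono isd)
      show "integrable lborel (\<lambda>x. indicator (Q' c) x * (real N * t\<^sup>2 * f c / 4))"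
        unfolding Q'_def by (intro integrable_mult_left integrable_real_indicator) (auto simp: emeasure_lborel_cbox_eq)
      show "indicator (Q' c) x * (real N * t\<^sup>2 * f c / 4) \<le> indicator (Q' c) x * second_diff \<Phi> (S c) r x" for x
        using tr[OF lower[OF c]] by (auto simp: indicator_def)
    qed
    also have "\<dots> \<le> r\<^sup>2 * M c" unfolding M_def P_def
    proof (rule cube_second_diff_le[OF C2 Qb(1,2) Q'b(1,2)])
      show "x + s *\<^sub>R column k (S c) \<in> Q c" if "x \<in> Q' c" "\<bar>s\<bar> \<le> r" for x k s
      proof -
        have "s *\<^sub>R column k (S c) = S c *v (s *\<^sub>R axis k 1)"
          by (simp add: matrix_vector_mult_scaleR matrix_vector_mult_basis)
        moreover have "\<bar>(s *\<^sub>R axis k 1 :: real^'n)$j\<bar> \<le> r" for j using that r by (auto simp: axis_def)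
        ultimately have "\<bar>(s *\<^sub>R column k (S c))$i\<bar> \<le> l / 8" for i using smul[OF c, of "s *\<^sub>R axis k 1" r i] r by simp
        then have h: "\<bar>(x + s *\<^sub>R column k (S c))$i - x$i\<bar> \<le> l / 8" for i by simp
        have "c$i \<le> (x + s *\<^sub>R column k (S c))$i \<and> (x + s *\<^sub>R column k (S c))$i < c$i + l" for i
        proof -
          have "c$i + l/4 \<le> x$i" "x$i \<le> c$i + 3*l/4" using that(1) by (auto simp: Q'mem)
          with h[of i] l show ?thesis unfolding abs_le_iff by linarith
        qed
        then show ?thesis unfolding Qmem by blast
      qed
    qed (use r cB psd S(2)[OF c] in auto)
    finally have "(l/2) ^ N * (real N * t\<^sup>2 * f c / 4) \<le> (real N * t)\<^sup>2 * M c" by (simp add: Q'b r_def)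
    \<comment> \<open>The factor \<open>N * t^2\<close> cancels, so the lattice spacing leaves no
      trace in the constant. What remains is \<open>4 * N\<close> from the cell estimate and
      \<open>2 ^ N\<close> from shrinking \<open>Q\<close> to \<open>Q'\<close>.\<close>
    then have "(real N * t\<^sup>2) * ((l/2) ^ N * f c / 4) \<le> (real N * t\<^sup>2) * (real N * M c)"
      by (simp add: power2_eq_square mult_ac)
    then have "(l/2) ^ N * f c / 4 \<le> real N * M c" using N0 t by (simp add: mult_le_cancel_left_pos)
    then show ?thesis by (simp add: power_divide field_simps)
  qed
  have "F = (\<Sum>c\<in>CC. f c * l ^ N)" by (simp add: F_def f_def mult.commute)
  also have "\<dots> \<le> (\<Sum>c\<in>CC. 4 * real N * 2 ^ N * M c)" by (intro sum_mono cube)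
  also have "\<dots> = 4 * real N * 2 ^ N * (\<Sum>c\<in>CC. M c)" by (simp add: sum_distrib_left)
  also have "(\<Sum>c\<in>CC. M c) = (\<integral>x. (\<Sum>c\<in>CC. indicator (Q c) x * P x) \<partial>lborel)"
    unfolding M_def using iQ by (subst Bochner_Integration.integral_sum) auto
  also have "\<dots> \<le> (\<integral>x. P x \<partial>lborel)"
  proof (intro integral_mono Bochner_Integration.integrable_sum iQ pair)
    fix x
    have "(\<Sum>c\<in>CC. indicator (Q c) x :: real) = indicator (\<Union>c\<in>CC. Q c) x"
      using disj by (intro indicator_UN_disjoint[symmetric] CC) (auto simp: disjoint_family_on_def)
    then have "(\<Sum>c\<in>CC. indicator (Q c) x * P x) = indicator (\<Union>c\<in>CC. Q c) x * P x"
      by (simp add: sum_distrib_right[symmetric])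
    then show "(\<Sum>c\<in>CC. indicator (Q c) x * P x) \<le> P x" using P0[of x] by (auto simp: indicator_def)
  qed
  also have "\<dots> \<le> R * (\<Sum>i\<in>UNIV. \<integral>x. \<bar>\<Sum>j\<in>UNIV. Bd i j x\<bar> \<partial>lborel)" by (rule pair(1))
  also have "\<dots> \<le> F powr (1 / real N) * (\<Sum>i\<in>UNIV. \<integral>x. \<bar>\<Sum>j\<in>UNIV. Bd i j x\<bar> \<partial>lborel)"
    unfolding R_def using mmF mm0 by (intro mult_right_mono powr_mono2 sum_nonneg) auto
  finally show ?thesis by (simp add: mult_left_mono mult.assoc)
qed

lemma det_scaleR: "det (c *\<^sub>R M) = c ^ CARD('n) * det M" for M :: "real^'n::finite^'n"
proof -
  have "c *\<^sub>R M = (c *\<^sub>R mat 1) ** M" by (simp add: scalar_matrix_assoc[symmetric])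
  moreover have "det (c *\<^sub>R mat 1 :: real^'n^'n) = c ^ CARD('n)"
    by (subst det_diagonal) (auto simp: mat_def)
  ultimately show ?thesis by (simp add: det_mul)
qed

lemma Sym_plus_scaleR: "M \<in> Sym_plus \<Longrightarrow> 0 \<le> c \<Longrightarrow> c *\<^sub>R M \<in> Sym_plus" for M :: "real^'n::finite^'n"
  by (rule Sym_plusI) (auto simp: symmetric_component[of M] Sym_plus_def scaleR_matrix_vector_assoc[symmetric])

lemma mat_1_Sym_plus: "(mat 1 :: real^'n::finite^'n) \<in> Sym_plus"
  by (simp add: Sym_plus_def transpose_mat)

lemma Sym_plus_add: "A \<in> Sym_plus \<Longrightarrow> B \<in> Sym_plus \<Longrightarrow> A + B \<in> Sym_plus" for A :: "real^'n::finite^'n"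
  by (rule Sym_plusI) (auto simp: symmetric_component[of A] symmetric_component[of B] Sym_plus_def
    matrix_vector_mult_add_rdistrib inner_add_right intro!: arg_cong2[where f="(+)"] symmetric_component)

lemma det_ge_power:
  fixes M :: "real^'n::finite^'n"
  assumes "M \<in> Sym_plus" "0 \<le> c" "\<And>v. c * (norm v)\<^sup>2 \<le> v \<bullet> (M *v v)"
  shows "c ^ CARD('n) \<le> det M"
proof -
  have "det (c *\<^sub>R mat 1 :: real^'n^'n) \<le> det M"
    using assms by (intro det_mono Sym_plus_scaleR mat_1_Sym_plus)
      (auto simp: scaleR_matrix_vector_assoc[symmetric] power2_norm_eq_inner)
  then show ?thesis by (simp add: det_scaleR)
qed

lemma quadratic_form_bound:
  fixes M :: "real^'n::finite^'n"
  assumes "\<And>i j. \<bar>M$i$j\<bar> \<le> e"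
  shows "\<bar>v \<bullet> (M *v v)\<bar> \<le> e * real CARD('n) ^ 2 * (norm v)\<^sup>2"
proof -
  have "\<bar>v \<bullet> (M *v v)\<bar> \<le> (\<Sum>i\<in>UNIV. \<Sum>j\<in>UNIV. \<bar>M$i$j * v$i * v$j\<bar>)"
    unfolding quadratic_form_sum by (rule order_trans[OF sum_abs]) (intro sum_mono sum_abs)
  also have "\<dots> \<le> (\<Sum>i\<in>(UNIV::'n set). \<Sum>j\<in>(UNIV::'n set). e * (norm v)\<^sup>2)"
  proof (intro sum_mono)
    fix i j
    have "\<bar>M$i$j\<bar> * (\<bar>v$i\<bar> * \<bar>v$j\<bar>) \<le> e * (norm v * norm v)"
      using assms[of i j] by (intro mult_mono component_le_norm_cart) auto
    then show "\<bar>M$i$j * v$i * v$j\<bar> \<le> e * (norm v)\<^sup>2" by (simp add: abs_mult power2_eq_square mult.assoc)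
  qed
  also have "\<dots> = e * real CARD('n) ^ 2 * (norm v)\<^sup>2" by (simp add: power2_eq_square)
  finally show ?thesis .
qed

lemma matrix_entry_le_norm: "\<bar>A$i$j\<bar> \<le> norm A" for A :: "real^'n::finite^'m::finite"
  by (meson component_le_norm_cart order_trans Finite_Cartesian_Product.norm_nth_le)

lemma continuous_on_matrix:
  fixes B :: "'a::topological_space \<Rightarrow> real^'n::finite^'m::finite"
  assumes "\<And>i j. continuous_on S (\<lambda>x. B x $ i $ j)"
  shows "continuous_on S B"
proof -
  have "continuous_on S (\<lambda>x. \<chi> i. \<chi> j. B x $ i $ j)"
    by (intro continuous_on_vec_lambda assms)
  then show ?thesis by (simp add: vec_lambda_eta)
qed

text \<open>Compensated integrability: the lower bound \<open>B \<ge> 1\<close> near \<open>E\<close> does not enter the constant.\<close>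
lemma serre_classical:
  fixes B :: "real^'n::finite \<Rightarrow> real^'n^'n"
  defines "N \<equiv> CARD('n)"
  assumes N2: "2 \<le> N"
    and dB: "\<And>i j x t. ((\<lambda>t. B (x + t *\<^sub>R axis j 1) $ i $ j) has_real_derivative Bd i j (x + t *\<^sub>R axis j 1)) (at t)"
    and cB: "\<And>i j. continuous_on UNIV (\<lambda>x. B x $ i $ j)" "\<And>i j. continuous_on UNIV (Bd i j)"
    and sB: "\<And>x. \<rho> \<le> norm x \<Longrightarrow> B x = 0" "\<And>i j x. \<rho> \<le> norm x \<Longrightarrow> Bd i j x = 0"
    and psd: "\<And>x. B x \<in> Sym_plus"
    and E: "compact E" and d: "0 < d" "\<And>x y v. x \<in> E \<Longrightarrow> dist x y < d \<Longrightarrow> (norm v)\<^sup>2 \<le> v \<bullet> (B y *v v)"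
  shows "(\<integral>\<^sup>+x. ennreal (indicator E x * det (B x) powr (1 / (real N - 1))) \<partial>lborel)
    \<le> ennreal ((4 ^ N) powr (1 / (real N - 1)) * (4 * real N * 2 ^ N *
         (\<Sum>i\<in>UNIV. \<integral>x. \<bar>\<Sum>j\<in>UNIV. Bd i j x\<bar> \<partial>lborel)) powr (real N / (real N - 1)))"
proof (cases "E = {}")
  case False
  have N0: "real N > 0" "N > 0" using N2 by auto
  obtain \<rho>E where \<rho>E: "\<And>x. x \<in> E \<Longrightarrow> norm x \<le> \<rho>E" using compact_imp_bounded[OF E] by (auto simp: bounded_iff)
  \<comment> \<open>The tolerance \<open>1 / (2 * N^2)\<close> becomes half the squared norm after
    \<open>quadratic_form_bound\<close>. Since the form of \<open>B\<close> at a grid corner is at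
    least the squared norm, this is a relative error of at most one half.\<close>
  have "uniformly_continuous_on (cball 0 (\<rho>E + 1)) B"
    by (intro compact_uniformly_continuous continuous_on_matrix continuous_on_subset[OF cB(1)]) auto
  then obtain \<delta> where \<delta>: "\<delta> > 0" "\<And>x y. x \<in> cball 0 (\<rho>E + 1) \<Longrightarrow> y \<in> cball 0 (\<rho>E + 1) \<Longrightarrow> dist y x < \<delta> \<Longrightarrow>
      dist (B y) (B x) < 1 / (2 * real N ^ 2)"
    unfolding uniformly_continuous_on_def using N0 by (metis divide_pos_pos zero_less_one zero_less_numeral mult_pos_pos zero_less_power)
  define mu where "mu = min (min d \<delta>) 1"
  have mu: "0 < mu" "mu \<le> d" "mu \<le> \<delta>" "mu \<le> 1" using d \<delta> by (auto simp: mu_def)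
  \<comment> \<open>A cube of side \<open>l\<close> has diameter at most
    \<open>N * l = mu / 4\<close>, below both the radius \<open>d\<close> of the lower bound and the
    modulus of continuity \<delta>.\<close>
  define l where "l = mu / (4 * real N)"
  have l: "l > 0" using mu N0 by (simp add: l_def)
  define Q where "Q = (\<lambda>c. {x::real^'n. \<forall>i. c$i \<le> x$i \<and> x$i < c$i + l})"
  \<comment> \<open>Half-open cubes with corners in a scaled integer lattice partition space, so the
    corner labels its cube uniquely.\<close>
  define corner where "corner x = (\<chi> i. l * of_int \<lfloor>x$i / l\<rfloor>)" for x :: "real^'n"
  have corner: "x \<in> Q (corner x)" for x
  proof -
    have "l * of_int \<lfloor>x$i / l\<rfloor> \<le> x$i" "x$i < l * of_int \<lfloor>x$i / l\<rfloor> + l" for i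
    proof -
      have "of_int \<lfloor>x$i / l\<rfloor> \<le> x$i / l" "x$i / l < of_int \<lfloor>x$i / l\<rfloor> + 1" by linarith+
      then show "l * of_int \<lfloor>x$i / l\<rfloor> \<le> x$i" "x$i < l * of_int \<lfloor>x$i / l\<rfloor> + l"
        unfolding pos_le_divide_eq[OF l] pos_divide_less_eq[OF l] by (simp_all add: distrib_right distrib_left mult.commute)
    qed
    then show ?thesis by (simp add: Q_def corner_def)
  qed
  have corner_unique: "corner z = corner x" if "z \<in> Q (corner x)" for x z
  proof -
    have "\<lfloor>z$i / l\<rfloor> = \<lfloor>x$i / l\<rfloor>" for i
    proof (rule floor_unique)
      have "l * of_int \<lfloor>x$i / l\<rfloor> \<le> z$i" "z$i < l * of_int \<lfloor>x$i / l\<rfloor> + l"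
        using that by (auto simp: Q_def corner_def)
      then show "of_int \<lfloor>x$i / l\<rfloor> \<le> z$i / l" "z$i / l < of_int \<lfloor>x$i / l\<rfloor> + 1"
        unfolding pos_le_divide_eq[OF l] pos_divide_less_eq[OF l] by (simp_all add: distrib_right distrib_left mult.commute)
    qed
    then show ?thesis by (simp add: corner_def)
  qed
  have Qdist: "dist y z < mu" if "y \<in> Q c" "z \<in> Q c" for c y z
  proof -
    have "dist y z \<le> (\<Sum>i\<in>UNIV. \<bar>(y - z)$i\<bar>)" unfolding dist_norm by (rule norm_le_l1_cart)
    also have "\<dots> \<le> (\<Sum>i\<in>(UNIV::'n set). l)"
    proof (rule sum_mono)
      fix i have "c$i \<le> y$i \<and> y$i < c$i + l" "c$i \<le> z$i \<and> z$i < c$i + l" using that by (auto simp: Q_def)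
      then show "\<bar>(y - z)$i\<bar> \<le> l" by (auto simp: abs_le_iff)
    qed
    also have "\<dots> < mu" using mu N0 by (simp add: l_def N_def[symmetric])
    finally show ?thesis .
  qed
  define CC where "CC = corner ` E"
  have cQ: "c \<in> Q c" for c using l by (simp add: Q_def)
  have finCC: "finite CC"
  proof -
    define M where "M = \<lceil>(\<bar>\<rho>E\<bar> + 1) / l\<rceil>"
    have "CC \<subseteq> (\<lambda>f. \<chi> i. l * of_int (f i)) ` (PiE UNIV (\<lambda>_::'n. {- M - 1..M}))"
    proof
      fix c assume "c \<in> CC"
      then obtain x where x: "x \<in> E" "c = corner x" by (auto simp: CC_def)
      have "\<lfloor>x$i / l\<rfloor> \<in> {- M - 1..M}" for i
      proof -
        have "x$i \<le> \<bar>\<rho>E\<bar> + 1" "- (\<bar>\<rho>E\<bar> + 1) \<le> x$i" using component_le_norm_cart[of x i] \<rho>E[OF x(1)] by linarith+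
        then have "x$i / l \<le> (\<bar>\<rho>E\<bar> + 1) / l" "- ((\<bar>\<rho>E\<bar> + 1) / l) \<le> x$i / l"
          unfolding minus_divide_left using l by (auto intro!: divide_right_mono)
        then show ?thesis unfolding M_def by (auto simp: floor_le_iff le_floor_iff) linarith+
      qed
      then show "c \<in> (\<lambda>f. \<chi> i. l * of_int (f i)) ` (PiE UNIV (\<lambda>_::'n. {- M - 1..M}))"
        unfolding x(2) corner_def by (intro image_eqI[of _ _ "\<lambda>i. \<lfloor>x$i / l\<rfloor>"]) auto
    qed
    then show ?thesis by (rule finite_subset) (intro finite_imageI finite_PiE, auto)
  qed
  have disj: "Q c \<inter> Q c' = {}" if "c \<in> CC" "c' \<in> CC" "c \<noteq> c'" for c c'
  proof (rule ccontr)
    assume "Q c \<inter> Q c' \<noteq> {}"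
    then obtain z where "z \<in> Q c" "z \<in> Q c'" by auto
    then have "corner z = c" "corner z = c'" using that(1,2) corner_unique by (auto simp: CC_def)
    with that(3) show False by simp
  qed
  have near: "\<bar>v \<bullet> (B y *v v) - v \<bullet> (B c *v v)\<bar> \<le> 1/2 * (norm v)\<^sup>2" "(norm v)\<^sup>2 \<le> v \<bullet> (B c *v v)"
    if c: "c \<in> CC" and y: "y \<in> Q c" for c y v
  proof -
    obtain x where x: "x \<in> E" "c = corner x" using c by (auto simp: CC_def)
    have xc: "x \<in> Q c" using corner x by simp
    have "dist x c < d" using Qdist[OF xc cQ] mu by simp
    then show "(norm v)\<^sup>2 \<le> v \<bullet> (B c *v v)" using d(2)[OF x(1)] by simp
    have "norm u \<le> \<rho>E + 1" if "u \<in> Q c" for u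
      using Qdist[OF that xc] mu \<rho>E[OF x(1)] norm_triangle_ineq2[of u x] by (simp add: dist_norm)
    then have "dist (B y) (B c) < 1 / (2 * real N ^ 2)"
      using \<delta>(2)[of c y] Qdist[OF y cQ] mu y cQ[of c] by auto
    then have "\<bar>(B y - B c)$i$j\<bar> \<le> 1 / (2 * real N ^ 2)" for i j
      using matrix_entry_le_norm[of "B y - B c" i j] by (simp add: dist_norm)
    then have "\<bar>v \<bullet> ((B y - B c) *v v)\<bar> \<le> 1 / (2 * real N ^ 2) * real N ^ 2 * (norm v)\<^sup>2"
      unfolding N_def by (rule quadratic_form_bound)
    then show "\<bar>v \<bullet> (B y *v v) - v \<bullet> (B c *v v)\<bar> \<le> 1/2 * (norm v)\<^sup>2"
      using N0 by (simp add: matrix_vector_mult_diff_rdistrib inner_diff_right)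
  qed
  \<comment> \<open>Half of \<open>B c\<close> is factored, so that it lies below \<open>B y\<close>
    on the whole cube. Conversely \<open>B y\<close> stays below \<open>2 * B c\<close>, four times
    the factored matrix, whence the factor \<open>4 ^ N\<close> for determinants.\<close>
  have "\<exists>S::real^'n^'n. (1/2) *\<^sub>R B c = S ** transpose S" for c
  proof -
    have "(1/2) *\<^sub>R B c \<in> Sym_plus" by (intro Sym_plus_scaleR psd) simp
    then show ?thesis by (rule Sym_plus_factor) blast
  qed
  then obtain S :: "real^'n \<Rightarrow> real^'n^'n" where S: "\<And>c. S c ** transpose (S c) = (1/2) *\<^sub>R B c" by metis
  have Sform: "v \<bullet> ((S c ** transpose (S c)) *v v) = 1/2 * (v \<bullet> (B c *v v))" for v c
    unfolding S by (simp add: scaleR_matrix_vector_assoc[symmetric])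
  have detS: "det (S c) \<noteq> 0" if "c \<in> CC" for c
  proof -
    have "(1/2) ^ CARD('n) \<le> det (S c ** transpose (S c))"
      using near(2)[OF that cQ] by (intro det_ge_power factor_in_Sym_plus) (auto simp: Sform)
    moreover have "(0::real) < (1/2) ^ CARD('n)" by simp
    ultimately show ?thesis unfolding det_factor by (metis not_le zero_eq_power2)
  qed
  have Sle: "v \<bullet> ((S c ** transpose (S c)) *v v) \<le> v \<bullet> (B y *v v)" if "c \<in> CC" "y \<in> Q c" for c y v
    using near[OF that, of v] unfolding Sform abs_le_iff by linarith
  have detB: "det (B y) \<le> 4 ^ N * (det (S c))\<^sup>2" if "c \<in> CC" "y \<in> Q c" for c y
  proof -
    have "det (B y) \<le> det (4 *\<^sub>R (S c ** transpose (S c)))"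
    proof (intro det_mono psd Sym_plus_scaleR factor_in_Sym_plus)
      show "v \<bullet> (B y *v v) \<le> v \<bullet> ((4 *\<^sub>R (S c ** transpose (S c))) *v v)" for v
        using near[OF that, of v] Sform[of v c] unfolding abs_le_iff scaleR_matrix_vector_assoc[symmetric] inner_scaleR_right
        by linarith
    qed simp
    then show ?thesis by (simp only: det_scaleR det_factor N_def)
  qed
  define a where "a = 1 / (real N - 1)"
  have a: "a > 0" using N2 by (simp add: a_def)
  define L where "L = (\<Sum>i\<in>UNIV. \<integral>x. \<bar>\<Sum>j\<in>UNIV. Bd i j x\<bar> \<partial>lborel)"
  define F where "F = (\<Sum>c\<in>CC. l ^ N * (det (S c))\<^sup>2 powr a)"
  have CCne: "CC \<noteq> {}" using False by (simp add: CC_def)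
  have main: "F \<le> 4 * real N * 2 ^ N * F powr (1 / real N) * L"
    unfolding F_def a_def L_def N_def
    by (rule serre_cubes[OF N2[unfolded N_def] dB cB sB psd finCC CCne l disj[unfolded Q_def] detS Sle[unfolded Q_def]])
  have F0: "F > 0" unfolding F_def using finCC CCne detS l by (intro sum_pos) auto
  have L0: "0 \<le> L" unfolding L_def by (intro sum_nonneg) auto
  \<comment> \<open>\<open>F\<close> is a finite positive sum, so dividing by
    \<open>F powr (1 / N)\<close> is legitimate; the remaining exponent \<open>1 - 1 / N\<close> is
    inverted by \<open>N / (N - 1)\<close>.\<close>
  have Fle: "F \<le> (4 * real N * 2 ^ N * L) powr (real N / (real N - 1))"
  proof -
    have "F powr (1 - 1 / real N) * F powr (1 / real N) \<le> 4 * real N * 2 ^ N * L * F powr (1 / real N)"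
      using main F0 by (simp add: powr_add[symmetric] mult_ac)
    then have "F powr (1 - 1 / real N) \<le> 4 * real N * 2 ^ N * L" using F0 by simp
    then have "(F powr (1 - 1 / real N)) powr (real N / (real N - 1)) \<le> (4 * real N * 2 ^ N * L) powr (real N / (real N - 1))"
      using N2 by (intro powr_mono2) auto
    moreover have e: "(1 - 1 / real N) * (real N / (real N - 1)) = 1" using N2 by (simp add: field_simps)
    have "(F powr (1 - 1 / real N)) powr (real N / (real N - 1)) = F"
      unfolding powr_powr e using F0 by simp
    ultimately show ?thesis by (simp only:)
  qed
  have Qm: "emeasure lborel (Q c) \<le> ennreal (l ^ N)" "Q c \<in> sets lborel" for c
  proof -
    have sub: "Q c \<subseteq> cbox c (c + (\<chi> i. l))" by (auto simp: Q_def mem_box_cart) (meson less_imp_le)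
    have "Q c = (\<Inter>i\<in>UNIV. {x. c$i \<le> x$i} \<inter> {x. x$i < c$i + l})" by (auto simp: Q_def)
    also have "\<dots> \<in> sets borel"
      by (intro sets.countable_INT'' sets.Int borel_closed borel_open closed_Collect_le open_Collect_less continuous_intros) auto
    finally show b: "Q c \<in> sets lborel" by simp
    have "emeasure lborel (Q c) \<le> emeasure lborel (cbox c (c + (\<chi> i. l)))"
      using sub by (intro emeasure_mono) auto
    also have "\<dots> = ennreal (measure lborel (cbox c (c + (\<chi> i. l))))"
      by (rule emeasure_eq_ennreal_measure) (use emeasure_compact_finite[OF compact_cbox] in \<open>auto simp: less_top\<close>)
    also have "measure lborel (cbox c (c + (\<chi> i. l))) = l ^ N"
    proof -
      have "cbox c (c + (\<chi> i. l)) \<noteq> {}" using l unfolding interval_ne_empty_cart by auto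
      then show ?thesis by (simp add: content_cbox_cart N_def)
    qed
    finally show "emeasure lborel (Q c) \<le> ennreal (l ^ N)" .
  qed
  have "(\<integral>\<^sup>+x. ennreal (indicator E x * det (B x) powr a) \<partial>lborel)
     \<le> (\<integral>\<^sup>+x. (\<Sum>c\<in>CC. ennreal ((4 ^ N) powr a * (det (S c))\<^sup>2 powr a) * indicator (Q c) x) \<partial>lborel)"
  proof (rule nn_integral_mono)
    fix x
    show "ennreal (indicator E x * det (B x) powr a) \<le> (\<Sum>c\<in>CC. ennreal ((4 ^ N) powr a * (det (S c))\<^sup>2 powr a) * indicator (Q c) x)"
    proof (cases "x \<in> E")
      case True
      define c where "c = corner x"
      have c: "c \<in> CC" "x \<in> Q c" using True corner by (auto simp: CC_def c_def)
      have "det (B x) powr a \<le> (4 ^ N * (det (S c))\<^sup>2) powr a"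
        using detB[OF c] det_Sym_plus_nonneg[OF psd] a by (intro powr_mono2) auto
      also have "\<dots> = (4 ^ N) powr a * (det (S c))\<^sup>2 powr a" by (rule powr_mult)
      finally have "ennreal (indicator E x * det (B x) powr a) \<le> ennreal ((4 ^ N) powr a * (det (S c))\<^sup>2 powr a) * indicator (Q c) x"
        using True c by (simp add: ennreal_leI)
      also have "\<dots> \<le> (\<Sum>c\<in>CC. ennreal ((4 ^ N) powr a * (det (S c))\<^sup>2 powr a) * indicator (Q c) x)"
        by (rule member_le_sum) (use c finCC in auto)
      finally show ?thesis .
    qed simp
  qed
  also have "\<dots> = (\<Sum>c\<in>CC. ennreal ((4 ^ N) powr a * (det (S c))\<^sup>2 powr a) * emeasure lborel (Q c))"
    using Qm by (subst nn_integral_sum) (auto simp: nn_integral_cmult)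
  also have "\<dots> \<le> (\<Sum>c\<in>CC. ennreal ((4 ^ N) powr a * (det (S c))\<^sup>2 powr a) * ennreal (l ^ N))"
    by (intro sum_mono mult_left_mono Qm) auto
  also have "\<dots> = ennreal ((4 ^ N) powr a * F)"
    using l by (simp add: ennreal_mult[symmetric] F_def sum_distrib_left mult_ac)
  also have "\<dots> \<le> ennreal ((4 ^ N) powr a * (4 * real N * 2 ^ N * L) powr (real N / (real N - 1)))"
    using Fle by (intro ennreal_leI mult_left_mono) auto
  finally show ?thesis unfolding a_def L_def .
qed simp

section \<open>Passage to integrable fields by mollification and cutoff\<close>

lemma mollifier_averaging: "mollifier e G \<Longrightarrow> averaging_kernel e (G (\<lambda>_. 0))"
  by (simp add: mollifier_def averaging_kernel_def)

lemma mollifier_conv: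
  assumes G: "mollifier e G" and f: "loc_integrable f"
  shows "continuous_on UNIV (conv f (G m))"
    "((\<lambda>t. conv f (G m) (x + t *\<^sub>R axis j 1)) has_real_derivative
       conv f (G (m(j := Suc (m j)))) (x + t *\<^sub>R axis j 1)) (at t)"
proof -
  note Gd = G[unfolded mollifier_def]
  have Gc: "continuous_on UNIV (G m)" "\<And>w. e \<le> norm w \<Longrightarrow> G m w = 0" for m using Gd by auto
  show "continuous_on UNIV (conv f (G m))" by (rule continuous_on_conv[OF f Gc])
  show "((\<lambda>t. conv f (G m) (x + t *\<^sub>R axis j 1)) has_real_derivative
       conv f (G (m(j := Suc (m j)))) (x + t *\<^sub>R axis j 1)) (at t)"
  proof (rule has_derivative_conv[where e = e])
    fix x t
    have "((\<lambda>t. G m (x + t *\<^sub>R axis j 1)) has_real_derivative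
       (\<Sum>l\<in>UNIV. axis j 1 $ l * G (m(l := Suc (m l))) (x + t *\<^sub>R axis j 1))) (at t)" using Gd by blast
    then show "((\<lambda>t. G m (x + t *\<^sub>R axis j 1)) has_real_derivative G (m(j := Suc (m j))) (x + t *\<^sub>R axis j 1)) (at t)"
      by (simp only: sum_axis)
  qed (use f Gc in auto)
qed

lemma norm_matrix_le_sum: "norm M \<le> (\<Sum>i\<in>UNIV. \<Sum>j\<in>UNIV. \<bar>M$i$j\<bar>)" for M :: "real^'n::finite^'m::finite"
proof -
  have "norm M \<le> (\<Sum>i\<in>UNIV. norm (M$i))" by (simp add: norm_vec_def L2_set_le_sum)
  also have "\<dots> \<le> (\<Sum>i\<in>UNIV. \<Sum>j\<in>UNIV. \<bar>M$i$j\<bar>)" by (intro sum_mono norm_le_l1_cart)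
  finally show ?thesis .
qed

lemma tendsto_det:
  fixes A :: "'a \<Rightarrow> real^'n::finite^'n"
  assumes "(A \<longlongrightarrow> L) F"
  shows "((\<lambda>x. det (A x)) \<longlongrightarrow> det L) F"
  unfolding det_def by (intro tendsto_sum tendsto_mult tendsto_const tendsto_prod tendsto_vec_nth assms)

lemma borel_measurable_det [measurable (raw)]:
  fixes A :: "'a \<Rightarrow> real^'n::finite^'n"
  assumes [measurable]: "A \<in> borel_measurable M"
  shows "(\<lambda>x. det (A x)) \<in> borel_measurable M"
proof -
  have "isCont det A" for A :: "real^'n^'n" unfolding isCont_def by (rule tendsto_det) (rule tendsto_ident_at)
  then have "continuous_on UNIV (det :: real^'n^'n \<Rightarrow> real)" by (simp add: continuous_on_eq_continuous_at)
  from measurable_compose[OF assms borel_measurable_continuous_onI[OF this]] show ?thesis .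
qed

lemma borel_measurable_matrix:
  fixes a :: "'a \<Rightarrow> real^'n::finite^'m::finite"
  assumes "\<And>i j. (\<lambda>x. a x $ i $ j) \<in> borel_measurable M"
  shows "a \<in> borel_measurable M"
proof (subst borel_measurable_euclidean_space, intro ballI)
  fix b :: "real^'n^'m" assume "b \<in> Basis"
  then obtain i j where "b = axis i (axis j 1)" by (auto simp: Basis_vec_def)
  then show "(\<lambda>x. a x \<bullet> b) \<in> borel_measurable M" using assms[of i j] by (simp add: inner_axis)
qed

text \<open>Positive semidefiniteness and the lower bound are convex conditions, hence stable under
  averaging. The kernel reaches less than \<open>d\<close> from \<open>x\<close>, and
  \<open>x\<close> is within \<open>2 * d\<close> of \<open>K\<close>, so only points within
  \<open>3 * d\<close> of \<open>K\<close> enter.\<close>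

lemma serre_mollified:
  fixes a :: "real^'n::finite \<Rightarrow> real^'n^'n"
  assumes ia: "\<And>i j. integrable lborel (\<lambda>x. a x $ i $ j)"
    and G: "mollifier e G" "e < d"
    and P: "AE z in lborel. (\<exists>y\<in>K. dist y z < 3 * d) \<longrightarrow> a z \<in> Sym_plus \<and> (\<forall>v. (norm v)\<^sup>2 \<le> v \<bullet> (a z *v v))"
    and x: "y \<in> K" "dist y x < 2 * d"
  defines "A \<equiv> (\<chi> i j. conv (\<lambda>z. a z $ i $ j) (G (\<lambda>_. 0)) x)"
  shows "A \<in> Sym_plus" "(norm v)\<^sup>2 \<le> v \<bullet> (A *v v)"
proof -
  note ak = mollifier_averaging[OF G(1)]
  note kD = averaging_kernelD[OF ak]
  have near: "AE z in lborel. G (\<lambda>_. 0) (x - z) \<noteq> 0 \<longrightarrow> a z \<in> Sym_plus \<and> (\<forall>v. (norm v)\<^sup>2 \<le> v \<bullet> (a z *v v))"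
    using P
  proof eventually_elim
    fix z assume z: "(\<exists>y\<in>K. dist y z < 3 * d) \<longrightarrow> a z \<in> Sym_plus \<and> (\<forall>v. (norm v)\<^sup>2 \<le> v \<bullet> (a z *v v))"
    show "G (\<lambda>_. 0) (x - z) \<noteq> 0 \<longrightarrow> a z \<in> Sym_plus \<and> (\<forall>v. (norm v)\<^sup>2 \<le> v \<bullet> (a z *v v))"
    proof
      assume "G (\<lambda>_. 0) (x - z) \<noteq> 0"
      then have "dist x z < d" using kD(2)[of "x - z"] G(2) by (force simp: dist_norm)
      then have "dist y z < 3 * d" using x(2) dist_triangle[of y z x] by simp
      then show "a z \<in> Sym_plus \<and> (\<forall>v. (norm v)\<^sup>2 \<le> v \<bullet> (a z *v v))" using z x(1) by blast
    qed
  qed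
  have int: "integrable lborel (\<lambda>z. a z $ i $ j * G (\<lambda>_. 0) (x - z))" for i j
    by (rule conv_integrable[OF loc_integrable_of_integrable[OF ia] kD(1,2)])
  have iG: "integrable lborel (\<lambda>z. G (\<lambda>_. 0) (x - z))" "(\<integral>z. G (\<lambda>_. 0) (x - z) \<partial>lborel) = 1"
  proof -
    show "(\<integral>z. G (\<lambda>_. 0) (x - z) \<partial>lborel) = 1" using integral_reflect[of "G (\<lambda>_. 0)" x] kD by simp
    then show "integrable lborel (\<lambda>z. G (\<lambda>_. 0) (x - z))" using not_integrable_integral_eq by force
  qed
  have sym: "A$i$j = A$j$i" for i j
    unfolding A_def vec_lambda_beta conv_def
  proof (rule integral_cong_AE)
    show "(\<lambda>z. a z $ i $ j * G (\<lambda>_. 0) (x - z)) \<in> borel_measurable lborel"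
      "(\<lambda>z. a z $ j $ i * G (\<lambda>_. 0) (x - z)) \<in> borel_measurable lborel" using int by auto
    show "AE z in lborel. a z $ i $ j * G (\<lambda>_. 0) (x - z) = a z $ j $ i * G (\<lambda>_. 0) (x - z)"
      using near by eventually_elim (auto simp: symmetric_component)
  qed
  have form: "v \<bullet> (A *v v) = (\<integral>z. (v \<bullet> (a z *v v)) * G (\<lambda>_. 0) (x - z) \<partial>lborel)"
    and iform: "integrable lborel (\<lambda>z. (v \<bullet> (a z *v v)) * G (\<lambda>_. 0) (x - z))" for v
  proof -
    have e: "(v \<bullet> (a z *v v)) * G (\<lambda>_. 0) (x - z) = (\<Sum>i\<in>UNIV. \<Sum>j\<in>UNIV. (v$i * v$j) * (a z $ i $ j * G (\<lambda>_. 0) (x - z)))" for z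
      unfolding quadratic_form_sum by (simp add: sum_distrib_left sum_distrib_right mult_ac)
    show "integrable lborel (\<lambda>z. (v \<bullet> (a z *v v)) * G (\<lambda>_. 0) (x - z))"
      unfolding e using int by (intro Bochner_Integration.integrable_sum integrable_mult_right) auto
    have "(\<integral>z. (v \<bullet> (a z *v v)) * G (\<lambda>_. 0) (x - z) \<partial>lborel)
      = (\<Sum>i\<in>UNIV. \<Sum>j\<in>UNIV. (v$i * v$j) * (\<integral>z. a z $ i $ j * G (\<lambda>_. 0) (x - z) \<partial>lborel))"
      unfolding e using int by (subst Bochner_Integration.integral_sum | simp)+
    then show "v \<bullet> (A *v v) = (\<integral>z. (v \<bullet> (a z *v v)) * G (\<lambda>_. 0) (x - z) \<partial>lborel)"
      unfolding quadratic_form_sum A_def by (simp add: conv_def mult_ac)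
  qed
  have ge: "(norm v)\<^sup>2 \<le> v \<bullet> (A *v v)" for v
  proof -
    have "(norm v)\<^sup>2 = (\<integral>z. (norm v)\<^sup>2 * G (\<lambda>_. 0) (x - z) \<partial>lborel)" using iG by simp
    also have "\<dots> \<le> (\<integral>z. (v \<bullet> (a z *v v)) * G (\<lambda>_. 0) (x - z) \<partial>lborel)"
    proof (rule integral_mono_AE[OF integrable_mult_right iform])
      show "AE z in lborel. (norm v)\<^sup>2 * G (\<lambda>_. 0) (x - z) \<le> (v \<bullet> (a z *v v)) * G (\<lambda>_. 0) (x - z)"
        using near
      proof eventually_elim
        case (elim z) then show ?case using kD(3)[of "x - z"] by (cases "G (\<lambda>_. 0) (x - z) = 0") (auto intro!: mult_right_mono)
      qed
    qed (use iG in auto)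
    finally show ?thesis using form by simp
  qed
  then show "(norm v)\<^sup>2 \<le> v \<bullet> (A *v v)" .
  show "A \<in> Sym_plus" by (rule Sym_plusI[OF sym]) (use ge in \<open>meson order_trans zero_le_power2\<close>)
qed

text \<open>Mollified and cut-off fields obey the classical bound with a constant independent of the
  radius; L1 convergence gives an almost everywhere convergent subsequence, and Fatou's lemma passes
  to the limit. Hypothesis \<open>W\<close> says that near \<open>K\<close> the divergence of the
  mollified field is the mollified \<open>g\<close>.\<close>

lemma serre_local:
  fixes a :: "real^'n::finite \<Rightarrow> real^'n^'n" and K :: "(real^'n) set"
  defines "N \<equiv> CARD('n)"
  assumes N2: "2 \<le> N" and K: "compact K"
    and ia: "\<And>i j. integrable lborel (\<lambda>x. a x $ i $ j)" and ig: "\<And>i. integrable lborel (g i)" and d: "0 < d"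
    and P: "AE z in lborel. (\<exists>y\<in>K. dist y z < 3 * d) \<longrightarrow> a z \<in> Sym_plus \<and> (\<forall>v. (norm v)\<^sup>2 \<le> v \<bullet> (a z *v v))"
    and W: "\<And>e G x y i. mollifier e G \<Longrightarrow> 0 < e \<Longrightarrow> e < d \<Longrightarrow> y \<in> K \<Longrightarrow> dist y x < 2 * d \<Longrightarrow>
       (\<Sum>j\<in>UNIV. conv (\<lambda>z. a z $ i $ j) (G ((\<lambda>_. 0)(j := 1))) x) = conv (g i) (G (\<lambda>_. 0)) x"
  shows "(\<integral>\<^sup>+x. ennreal (indicator K x * det (a x) powr (1 / (real N - 1))) \<partial>lborel) < \<infinity>"
proof -
  have p: "1 / (real N - 1) > 0" using N2 by simp
  obtain rK where rK: "\<And>y. y \<in> K \<Longrightarrow> norm y \<le> rK" using compact_imp_bounded[OF K] by (auto simp: bounded_iff)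
  have [measurable]: "K \<in> sets borel" using K by (auto intro: borel_closed compact_imp_closed)
  \<comment> \<open>Smoothing the indicator of the \<open>3/2 * d\<close> neighbourhood at radius
    \<open>d / 2\<close> gives a cutoff that is 1 within \<open>d\<close> of \<open>K\<close> and 0
    beyond \<open>2 * d\<close>.\<close>
  define E1 where "E1 = (\<Union>y\<in>K. ball y (3/2 * d))"
  have E1: "open E1" "E1 \<subseteq> cball 0 (rK + 2 * d)"
  proof -
    show "open E1" by (auto simp: E1_def)
    show "E1 \<subseteq> cball 0 (rK + 2 * d)"
    proof
      fix x assume "x \<in> E1"
      then obtain y where "y \<in> K" "dist y x < 3/2 * d" by (auto simp: E1_def)
      then show "x \<in> cball 0 (rK + 2 * d)" using rK[of y] norm_triangle_ineq2[of x y] d by (simp add: dist_norm norm_minus_commute)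
    qed
  qed
  have iE1: "integrable lborel (indicator E1 :: _ \<Rightarrow> real)"
    using E1 emeasure_mono[OF E1(2), of lborel] emeasure_compact_finite[OF compact_cball, of 0 "rK + 2 * d"]
    by (intro integrable_real_indicator) (auto simp: top.not_eq_extremum intro: le_less_trans)
  note lE1 = loc_integrable_of_integrable[OF iE1]
  obtain \<Gamma> :: "('n \<Rightarrow> nat) \<Rightarrow> real^'n \<Rightarrow> real" where \<Gamma>: "mollifier (d/2) \<Gamma>" using mollifier_exists[of "d/2"] d by auto
  note \<Gamma>d = averaging_kernelD[OF mollifier_averaging[OF \<Gamma>]]
  have \<Gamma>s: "d/2 \<le> norm w \<Longrightarrow> \<Gamma> m w = 0" for m w using \<Gamma> by (auto simp: mollifier_def)
  define \<omega> where "\<omega> m = conv (indicator E1) (\<Gamma> m)" for m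
  have \<omega>c: "continuous_on UNIV (\<omega> m)" for m unfolding \<omega>_def by (rule mollifier_conv(1)[OF \<Gamma> lE1])
  have \<omega>d: "((\<lambda>t. \<omega> m (x + t *\<^sub>R axis j 1)) has_real_derivative \<omega> (m(j := Suc (m j))) (x + t *\<^sub>R axis j 1)) (at t)" for m x j t
    unfolding \<omega>_def by (rule mollifier_conv(2)[OF \<Gamma> lE1])
  have \<omega>0: "\<omega> m x = 0" if "\<not> (\<exists>y\<in>K. dist y x < 2 * d)" for m x
  proof -
    have "indicator E1 z * \<Gamma> m (x - z) = 0" for z
    proof (cases "z \<in> E1 \<and> norm (x - z) < d/2")
      case True
      then obtain y where "y \<in> K" "dist y z < 3/2 * d" by (auto simp: E1_def)
      then have "dist y x < 2 * d" using True dist_triangle[of y x z] by (simp add: dist_norm norm_minus_commute)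
      then show ?thesis using that \<open>y \<in> K\<close> by blast
    qed (use \<Gamma>s in \<open>auto simp: indicator_def\<close>)
    then show ?thesis unfolding \<omega>_def conv_def by (simp only: integral_zero)
  qed
  have \<omega>s: "\<omega> m x = 0" if "rK + 2 * d \<le> norm x" for m x
  proof (rule \<omega>0, rule notI)
    assume "\<exists>y\<in>K. dist y x < 2 * d"
    then obtain y where y: "y \<in> K" "dist y x < 2 * d" by blast
    show False using that rK[OF y(1)] y(2) norm_triangle_ineq2[of x y] by (simp add: dist_norm norm_minus_commute)
  qed
  have \<omega>1: "\<omega> (\<lambda>_. 0) x = 1" if "y \<in> K" "dist y x < d" for x y
  proof -
    have "indicator E1 z * \<Gamma> (\<lambda>_. 0) (x - z) = \<Gamma> (\<lambda>_. 0) (x - z)" for z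
    proof (cases "norm (x - z) < d/2")
      case True
      then have "dist y z < 3/2 * d" using that dist_triangle[of y z x] by (simp add: dist_norm)
      then show ?thesis using that by (auto simp: E1_def indicator_def)
    qed (use \<Gamma>s in auto)
    then show ?thesis unfolding \<omega>_def conv_def using integral_reflect[of "\<Gamma> (\<lambda>_. 0)" x] \<Gamma>d by (simp only:)
  qed
  have \<omega>nn: "0 \<le> \<omega> (\<lambda>_. 0) x" for x
    unfolding \<omega>_def conv_def using \<Gamma>d by (intro integral_nonneg_AE AE_I2 mult_nonneg_nonneg) auto
  have "\<exists>b>0. \<forall>x. \<bar>\<omega> m x\<bar> \<le> b" for m using kernel_bounded[OF \<omega>c \<omega>s] by metis
  then obtain b where b: "\<And>m. 0 < b m" "\<And>m x. \<bar>\<omega> m x\<bar> \<le> b m" by metis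
  \<comment> \<open>By the product rule the divergence of the cut-off field is the field applied to
    the gradient of the cutoff plus the cutoff times the divergence. Mollification does not increase
    L1 norms, so \<open>L\<close> is a bound for every radius.\<close>
  define L where "L = (\<Sum>i\<in>UNIV. (\<Sum>j\<in>UNIV. b ((\<lambda>_. 0)(j := 1)) * (\<integral>x. \<bar>a x $ i $ j\<bar> \<partial>lborel))
      + b (\<lambda>_. 0) * (\<integral>x. \<bar>g i x\<bar> \<partial>lborel))"
  define M where "M = (4 ^ N) powr (1 / (real N - 1)) * (4 * real N * 2 ^ N * L) powr (real N / (real N - 1))"
  define A where "A G x = (\<chi> i j. conv (\<lambda>z. a z $ i $ j) (G (\<lambda>_. 0)) x)" for G :: "('n \<Rightarrow> nat) \<Rightarrow> real^'n \<Rightarrow> real" and x :: "real^'n"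
  have bound: "(\<integral>\<^sup>+x. ennreal (indicator K x * det (A G x) powr (1 / (real N - 1))) \<partial>lborel) \<le> ennreal M"
    if G: "mollifier e G" "0 < e" "e < d" for e G
  proof -
    note la = loc_integrable_of_integrable[OF ia]
    note ak = mollifier_averaging[OF G(1)]
    define B where "B x = \<omega> (\<lambda>_. 0) x *\<^sub>R A G x" for x
    define Bd where "Bd i j x = \<omega> ((\<lambda>_. 0)(j := 1)) x * A G x $ i $ j
       + \<omega> (\<lambda>_. 0) x * conv (\<lambda>z. a z $ i $ j) (G ((\<lambda>_. 0)(j := 1))) x" for i j x
    have Ac: "continuous_on UNIV (\<lambda>x. A G x $ i $ j)" for i j
      unfolding A_def using mollifier_conv(1)[OF G(1) la] by simp
    have psdA: "A G x \<in> Sym_plus" "(norm v)\<^sup>2 \<le> v \<bullet> (A G x *v v)" if "y \<in> K" "dist y x < 2 * d" for y x v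
      unfolding A_def by (rule serre_mollified[OF ia G(1,3) P that])+
    have dB: "((\<lambda>t. B (x + t *\<^sub>R axis j 1) $ i $ j) has_real_derivative Bd i j (x + t *\<^sub>R axis j 1)) (at t)" for i j x t
    proof -
      have "((\<lambda>t. A G (x + t *\<^sub>R axis j 1) $ i $ j) has_real_derivative
         conv (\<lambda>z. a z $ i $ j) (G ((\<lambda>_. 0)(j := 1))) (x + t *\<^sub>R axis j 1)) (at t)"
        unfolding A_def using mollifier_conv(2)[OF G(1) la, of i j "\<lambda>_. 0" x j t] by simp
      from DERIV_mult[OF \<omega>d[of "\<lambda>_. 0" x j t] this] show ?thesis
        by (simp add: B_def Bd_def mult.commute)
    qed
    have Bc: "continuous_on UNIV (\<lambda>x. B x $ i $ j)" "continuous_on UNIV (Bd i j)" for i j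
    proof -
      show "continuous_on UNIV (\<lambda>x. B x $ i $ j)" unfolding B_def by (simp add: continuous_on_mult \<omega>c Ac)
      show "continuous_on UNIV (Bd i j)" unfolding Bd_def
        by (intro continuous_on_add continuous_on_mult \<omega>c Ac mollifier_conv(1)[OF G(1) la])
    qed
    have Bs: "rK + 2 * d \<le> norm x \<Longrightarrow> B x = 0" "rK + 2 * d \<le> norm x \<Longrightarrow> Bd i j x = 0" for i j x
      by (simp_all add: B_def Bd_def \<omega>s)
    have Bpsd: "B x \<in> Sym_plus" for x
    proof (cases "\<exists>y\<in>K. dist y x < 2 * d")
      case True
      then show ?thesis unfolding B_def using psdA \<omega>nn by (auto intro: Sym_plus_scaleR)
    next
      case False
      then have "B x = 0" by (simp add: B_def \<omega>0)
      moreover have "(0 :: real^'n^'n) \<in> Sym_plus" using Sym_plus_scaleR[OF mat_1_Sym_plus, of 0] by simp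
      ultimately show ?thesis by simp
    qed
    have BA: "B x = A G x" if "y \<in> K" "dist y x < d" for x y using \<omega>1[OF that] by (simp add: B_def)
    have Bge: "(norm v)\<^sup>2 \<le> v \<bullet> (B y *v v)" if "x \<in> K" "dist x y < d" for x y v
      unfolding BA[OF that] using that d by (intro psdA[of x]) auto
    have L1: "(\<integral>x. \<bar>\<Sum>j\<in>UNIV. Bd i j x\<bar> \<partial>lborel) \<le> (\<Sum>j\<in>UNIV. b ((\<lambda>_. 0)(j := 1)) * (\<integral>x. \<bar>a x $ i $ j\<bar> \<partial>lborel))
      + b (\<lambda>_. 0) * (\<integral>x. \<bar>g i x\<bar> \<partial>lborel)" for i
    proof -
      have ca: "integrable lborel (conv (\<lambda>z. a z $ i $ j) (G (\<lambda>_. 0)))"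
        "(\<integral>x. \<bar>conv (\<lambda>z. a z $ i $ j) (G (\<lambda>_. 0)) x\<bar> \<partial>lborel) \<le> (\<integral>x. \<bar>a x $ i $ j\<bar> \<partial>lborel)" for j
        by (rule conv_L1[OF ia ak])+
      have cg: "integrable lborel (conv (g i) (G (\<lambda>_. 0)))"
        "(\<integral>x. \<bar>conv (g i) (G (\<lambda>_. 0)) x\<bar> \<partial>lborel) \<le> (\<integral>x. \<bar>g i x\<bar> \<partial>lborel)"
        by (rule conv_L1[OF ig ak])+
      have pw: "\<bar>\<Sum>j\<in>UNIV. Bd i j x\<bar> \<le> (\<Sum>j\<in>UNIV. b ((\<lambda>_. 0)(j := 1)) * \<bar>conv (\<lambda>z. a z $ i $ j) (G (\<lambda>_. 0)) x\<bar>)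
         + b (\<lambda>_. 0) * \<bar>conv (g i) (G (\<lambda>_. 0)) x\<bar>" for x
      proof -
        have "(\<Sum>j\<in>UNIV. Bd i j x) = (\<Sum>j\<in>UNIV. \<omega> ((\<lambda>_. 0)(j := 1)) x * conv (\<lambda>z. a z $ i $ j) (G (\<lambda>_. 0)) x)
           + \<omega> (\<lambda>_. 0) x * (\<Sum>j\<in>UNIV. conv (\<lambda>z. a z $ i $ j) (G ((\<lambda>_. 0)(j := 1))) x)"
          unfolding Bd_def A_def by (simp add: sum.distrib sum_distrib_left)
        also have "\<omega> (\<lambda>_. 0) x * (\<Sum>j\<in>UNIV. conv (\<lambda>z. a z $ i $ j) (G ((\<lambda>_. 0)(j := 1))) x) = \<omega> (\<lambda>_. 0) x * conv (g i) (G (\<lambda>_. 0)) x"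
        proof (cases "\<exists>y\<in>K. dist y x < 2 * d")
          case True
          then obtain y where "y \<in> K" "dist y x < 2 * d" by blast
          then show ?thesis by (simp only: W[OF G])
        next
          case False
          then show ?thesis by (simp only: \<omega>0[OF False] mult_zero_left)
        qed
        finally have eq: "(\<Sum>j\<in>UNIV. Bd i j x) = (\<Sum>j\<in>UNIV. \<omega> ((\<lambda>_. 0)(j := 1)) x * conv (\<lambda>z. a z $ i $ j) (G (\<lambda>_. 0)) x)
           + \<omega> (\<lambda>_. 0) x * conv (g i) (G (\<lambda>_. 0)) x" .
        have "\<bar>\<Sum>j\<in>UNIV. Bd i j x\<bar> \<le> (\<Sum>j\<in>UNIV. \<bar>\<omega> ((\<lambda>_. 0)(j := 1)) x * conv (\<lambda>z. a z $ i $ j) (G (\<lambda>_. 0)) x\<bar>)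
           + \<bar>\<omega> (\<lambda>_. 0) x * conv (g i) (G (\<lambda>_. 0)) x\<bar>"
          unfolding eq by (rule order_trans[OF abs_triangle_ineq add_right_mono[OF sum_abs]])
        also have "\<dots> \<le> (\<Sum>j\<in>UNIV. b ((\<lambda>_. 0)(j := 1)) * \<bar>conv (\<lambda>z. a z $ i $ j) (G (\<lambda>_. 0)) x\<bar>)
         + b (\<lambda>_. 0) * \<bar>conv (g i) (G (\<lambda>_. 0)) x\<bar>"
          unfolding abs_mult by (intro add_mono sum_mono mult_right_mono b) auto
        finally show ?thesis .
      qed
      have "(\<integral>x. \<bar>\<Sum>j\<in>UNIV. Bd i j x\<bar> \<partial>lborel) \<le> (\<integral>x. (\<Sum>j\<in>UNIV. b ((\<lambda>_. 0)(j := 1)) * \<bar>conv (\<lambda>z. a z $ i $ j) (G (\<lambda>_. 0)) x\<bar>)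
         + b (\<lambda>_. 0) * \<bar>conv (g i) (G (\<lambda>_. 0)) x\<bar> \<partial>lborel)"
        by (rule integral_mono'[OF _ pw]) (use ca cg b in \<open>auto intro!: sum_nonneg add_nonneg_nonneg mult_nonneg_nonneg simp: less_imp_le\<close>)
      also have "\<dots> = (\<Sum>j\<in>UNIV. b ((\<lambda>_. 0)(j := 1)) * (\<integral>x. \<bar>conv (\<lambda>z. a z $ i $ j) (G (\<lambda>_. 0)) x\<bar> \<partial>lborel))
         + b (\<lambda>_. 0) * (\<integral>x. \<bar>conv (g i) (G (\<lambda>_. 0)) x\<bar> \<partial>lborel)"
        using ca cg by (subst Bochner_Integration.integral_add, auto)
      also have "\<dots> \<le> (\<Sum>j\<in>UNIV. b ((\<lambda>_. 0)(j := 1)) * (\<integral>x. \<bar>a x $ i $ j\<bar> \<partial>lborel))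
      + b (\<lambda>_. 0) * (\<integral>x. \<bar>g i x\<bar> \<partial>lborel)"
        by (intro add_mono sum_mono mult_left_mono ca cg) (auto simp: b less_imp_le)
      finally show ?thesis .
    qed
    have "(\<integral>\<^sup>+x. ennreal (indicator K x * det (A G x) powr (1 / (real N - 1))) \<partial>lborel)
      = (\<integral>\<^sup>+x. ennreal (indicator K x * det (B x) powr (1 / (real N - 1))) \<partial>lborel)"
      by (rule nn_integral_cong) (use BA d in \<open>auto simp: indicator_def\<close>)
    also have "\<dots> \<le> ennreal ((4 ^ N) powr (1 / (real N - 1)) * (4 * real N * 2 ^ N *
         (\<Sum>i\<in>UNIV. \<integral>x. \<bar>\<Sum>j\<in>UNIV. Bd i j x\<bar> \<partial>lborel)) powr (real N / (real N - 1)))"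
      unfolding N_def by (rule serre_classical[OF N2[unfolded N_def] dB Bc Bs Bpsd K d Bge])
    also have "\<dots> \<le> ennreal M"
      unfolding M_def using N2 L1
      by (intro ennreal_leI mult_left_mono powr_mono2) (auto simp: L_def intro!: sum_mono mult_nonneg_nonneg sum_nonneg)
    finally show ?thesis .
  qed
  \<comment> \<open>The offset 2 keeps \<open>e k < d\<close> already at
    \<open>k = 0\<close>.\<close>
  define e where "e k = d / (real k + 2)" for k
  have e: "0 < e k" "e k < d" for k using d by (auto simp: e_def divide_less_eq)
  have e0: "e \<longlonglongrightarrow> 0"
  proof -
    have "(\<lambda>k. d * (1 / real (k + 2))) \<longlonglongrightarrow> d * 0"
      by (intro tendsto_mult tendsto_const LIMSEQ_ignore_initial_segment[OF lim_1_over_n])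
    then show ?thesis by (simp add: e_def[abs_def] add.commute)
  qed
  have "\<exists>G::('n \<Rightarrow> nat) \<Rightarrow> real^'n \<Rightarrow> real. mollifier (e k) G" for k using mollifier_exists[OF e(1)] by blast
  then obtain G :: "nat \<Rightarrow> ('n \<Rightarrow> nat) \<Rightarrow> real^'n \<Rightarrow> real" where G: "\<And>k. mollifier (e k) (G k)" by metis
  note ak = mollifier_averaging[OF G]
  have ua: "integrable lborel (\<lambda>x. \<bar>conv (\<lambda>z. a z $ i $ j) (G k (\<lambda>_. 0)) x - a x $ i $ j\<bar>)" for k i j
    using conv_L1(1)[OF ia ak] ia by auto
  have [measurable]: "a \<in> borel_measurable borel"
    using ia by (intro borel_measurable_matrix) auto
  have [measurable]: "A (G k) \<in> borel_measurable borel" for k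
    using conv_L1(1)[OF ia ak] by (intro borel_measurable_matrix) (auto simp: A_def)
  define u where "u k x = A (G k) x - a x" for k x
  have [measurable]: "u k \<in> borel_measurable borel" for k unfolding u_def by measurable
  have ule: "norm (u k x) \<le> (\<Sum>i\<in>UNIV. \<Sum>j\<in>UNIV. \<bar>conv (\<lambda>z. a z $ i $ j) (G k (\<lambda>_. 0)) x - a x $ i $ j\<bar>)" for k x
    using norm_matrix_le_sum[of "u k x"] by (simp add: u_def A_def)
  have isum: "integrable lborel (\<lambda>x. \<Sum>i\<in>UNIV. \<Sum>j\<in>UNIV. \<bar>conv (\<lambda>z. a z $ i $ j) (G k (\<lambda>_. 0)) x - a x $ i $ j\<bar>)" for k
    by (intro Bochner_Integration.integrable_sum ua)
  have iu: "integrable lborel (u k)" for k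
    by (rule Bochner_Integration.integrable_bound[OF isum[of k]]) (use ule in \<open>auto intro!: AE_I2 intro: order_trans[OF _ abs_ge_self]\<close>)
  have "(\<lambda>k. \<integral>x. norm (u k x) \<partial>lborel) \<longlonglongrightarrow> 0"
  proof (rule tendsto_sandwich[OF _ _ tendsto_const])
    show "\<forall>\<^sub>F k in sequentially. (\<integral>x. norm (u k x) \<partial>lborel)
       \<le> (\<Sum>i\<in>UNIV. \<Sum>j\<in>UNIV. \<integral>x. \<bar>conv (\<lambda>z. a z $ i $ j) (G k (\<lambda>_. 0)) x - a x $ i $ j\<bar> \<partial>lborel)"
    proof (rule always_eventually, intro allI)
      fix k
      have "(\<integral>x. norm (u k x) \<partial>lborel) \<le> (\<integral>x. (\<Sum>i\<in>UNIV. \<Sum>j\<in>UNIV. \<bar>conv (\<lambda>z. a z $ i $ j) (G k (\<lambda>_. 0)) x - a x $ i $ j\<bar>) \<partial>lborel)"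
        by (intro integral_mono integrable_norm iu isum ule)
      also have "\<dots> = (\<Sum>i\<in>UNIV. \<Sum>j\<in>UNIV. \<integral>x. \<bar>conv (\<lambda>z. a z $ i $ j) (G k (\<lambda>_. 0)) x - a x $ i $ j\<bar> \<partial>lborel)"
        using ua by (subst Bochner_Integration.integral_sum | simp)+
      finally show "(\<integral>x. norm (u k x) \<partial>lborel)
       \<le> (\<Sum>i\<in>UNIV. \<Sum>j\<in>UNIV. \<integral>x. \<bar>conv (\<lambda>z. a z $ i $ j) (G k (\<lambda>_. 0)) x - a x $ i $ j\<bar> \<partial>lborel)" .
    qed
    show "(\<lambda>k. \<Sum>i\<in>UNIV. \<Sum>j\<in>UNIV. \<integral>x. \<bar>conv (\<lambda>z. a z $ i $ j) (G k (\<lambda>_. 0)) x - a x $ i $ j\<bar> \<partial>lborel) \<longlonglongrightarrow> 0"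
      by (intro tendsto_null_sum mollification_L1[OF ia ak e0])
  qed auto
  from tendsto_L1_AE_subseq[OF iu this] obtain r where r: "strict_mono r" "AE x in lborel. (\<lambda>k. u (r k) x) \<longlonglongrightarrow> 0" by auto
  have "(\<integral>\<^sup>+x. ennreal (indicator K x * det (a x) powr (1 / (real N - 1))) \<partial>lborel)
     \<le> (\<integral>\<^sup>+x. liminf (\<lambda>k. ennreal (indicator K x * det (A (G (r k)) x) powr (1 / (real N - 1)))) \<partial>lborel)"
  proof (rule nn_integral_mono_AE)
    show "AE x in lborel. ennreal (indicator K x * det (a x) powr (1 / (real N - 1)))
       \<le> liminf (\<lambda>k. ennreal (indicator K x * det (A (G (r k)) x) powr (1 / (real N - 1))))"
      using r(2)
    proof eventually_elim
      fix x assume x: "(\<lambda>k. u (r k) x) \<longlonglongrightarrow> 0"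
      show "ennreal (indicator K x * det (a x) powr (1 / (real N - 1)))
       \<le> liminf (\<lambda>k. ennreal (indicator K x * det (A (G (r k)) x) powr (1 / (real N - 1))))"
      proof (cases "x \<in> K")
        case True
        from tendsto_add[OF x tendsto_const[of "a x"]]
        have "(\<lambda>k. det (A (G (r k)) x)) \<longlonglongrightarrow> det (a x)" by (intro tendsto_det) (simp add: u_def)
        moreover have "0 \<le> det (A (G k) x)" for k
          unfolding A_def using d True by (intro det_Sym_plus_nonneg serre_mollified(1)[OF ia G e(2) P True]) simp
        ultimately have "(\<lambda>k. det (A (G (r k)) x) powr (1 / (real N - 1))) \<longlonglongrightarrow> det (a x) powr (1 / (real N - 1))"
          using p by (intro tendsto_powr'[OF _ tendsto_const]) auto
        then have lim: "(\<lambda>k. ennreal (indicator K x * det (A (G (r k)) x) powr (1 / (real N - 1)))) \<longlonglongrightarrow>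
           ennreal (indicator K x * det (a x) powr (1 / (real N - 1)))" using True by (intro tendsto_ennrealI) simp
        show ?thesis using lim_imp_Liminf[OF trivial_limit_sequentially lim] by simp
      qed simp
    qed
  qed
  also have "\<dots> \<le> liminf (\<lambda>k. \<integral>\<^sup>+x. ennreal (indicator K x * det (A (G (r k)) x) powr (1 / (real N - 1))) \<partial>lborel)"
    by (rule nn_integral_liminf) measurable
  also have "\<dots> \<le> liminf (\<lambda>_::nat. ennreal M)"
    by (intro Liminf_mono always_eventually allI bound[OF G e])
  also have "\<dots> < \<infinity>" by (simp add: Liminf_const)
  finally show ?thesis .
qed

section \<open>Weak divergences\<close>

text \<open>Fields are measurable for \<open>lebesgue_on \<Omega>\<close>, whereas convolution lives
  on \<open>lborel\<close>. On a Borel set \<open>U\<close> inside \<Omega> a function is replaced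
  by a Borel one that vanishes almost everywhere outside \<open>U\<close> and has the same integrals
  against functions supported in \<open>U\<close>.\<close>

lemma borel_representative:
  fixes f :: "'a::euclidean_space \<Rightarrow> real"
  assumes \<Omega>: "\<Omega> \<in> sets lebesgue" and U: "U \<in> sets borel" "U \<subseteq> \<Omega>"
    and f: "integrable (lebesgue_on \<Omega>) (\<lambda>x. indicator U x * f x)"
  obtains f' where "integrable lborel f'" "AE x in lborel. f' x = indicator U x * f x"
    "\<And>\<psi>. \<psi> \<in> borel_measurable borel \<Longrightarrow> (\<And>x. x \<notin> U \<Longrightarrow> \<psi> x = 0) \<Longrightarrow>
       (\<integral>x. f x * \<psi> x \<partial>lebesgue_on \<Omega>) = (\<integral>x. f' x * \<psi> x \<partial>lborel)"
proof -
  have 1: "(\<lambda>x. indicator \<Omega> x *\<^sub>R (indicator U x * f x)) = (\<lambda>x. indicator U x * f x)"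
  proof
    fix x show "indicator \<Omega> x *\<^sub>R (indicator U x * f x) = indicator U x * f x"
      using U(2) by (cases "x \<in> U") auto
  qed
  have i: "integrable lebesgue (\<lambda>x. indicator U x * f x)"
    using f integrable_restrict_space[of \<Omega> lebesgue "\<lambda>x. indicator U x * f x"] \<Omega>
    unfolding set_integrable_def 1 by simp
  then obtain f' where f': "f' \<in> borel_measurable lborel" "AE x in lborel. indicator U x * f x = f' x"
    using completion_ex_borel_measurable_real[of "\<lambda>x. indicator U x * f x" lborel] by blast
  have ae: "AE x in lebesgue. f' x = indicator U x * f x"
    using f'(2) unfolding AE_completion_iff by eventually_elim simp
  have m': "f' \<in> borel_measurable lebesgue" by (rule measurable_completion[OF f'(1)])
  have "integrable lebesgue f'"
    by (rule integrable_cong_AE_imp[OF i m']) (use ae in eventually_elim, simp)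
  then have i': "integrable lborel f'" using f'(1) by (simp add: integrable_completion)
  show ?thesis
  proof (rule that[OF i'])
    show "AE x in lborel. f' x = indicator U x * f x" using f'(2) by eventually_elim simp
    fix \<psi> :: "'a \<Rightarrow> real" assume \<psi>: "\<psi> \<in> borel_measurable borel" "\<And>x. x \<notin> U \<Longrightarrow> \<psi> x = 0"
    have "(\<integral>x. f x * \<psi> x \<partial>lebesgue_on \<Omega>) = (\<integral>x. indicator \<Omega> x *\<^sub>R (f x * \<psi> x) \<partial>lebesgue)"
      using \<Omega> by (intro integral_restrict_space) simp
    also have "\<dots> = (\<integral>x. (indicator U x * f x) * \<psi> x \<partial>lebesgue)"
    proof (rule Bochner_Integration.integral_cong[OF refl])
      fix x show "indicator \<Omega> x *\<^sub>R (f x * \<psi> x) = (indicator U x * f x) * \<psi> x"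
        using \<psi>(2)[of x] U(2) by (cases "x \<in> U") auto
    qed
    also have "\<dots> = (\<integral>x. f' x * \<psi> x \<partial>lebesgue)"
    proof (rule integral_cong_AE)
      have "\<psi> \<in> borel_measurable lebesgue" using \<psi>(1) by (intro measurable_completion) simp
      with i m' show "(\<lambda>x. (indicator U x * f x) * \<psi> x) \<in> borel_measurable lebesgue" "(\<lambda>x. f' x * \<psi> x) \<in> borel_measurable lebesgue"
        by (auto intro!: borel_measurable_times dest: borel_measurable_integrable)
      show "AE x in lebesgue. indicator U x * f x * \<psi> x = f' x * \<psi> x" using ae by eventually_elim simp
    qed
    also have "\<dots> = (\<integral>x. f' x * \<psi> x \<partial>lborel)"
      using f'(1) \<psi>(1) by (intro integral_completion) simp
    finally show "(\<integral>x. f x * \<psi> x \<partial>lebesgue_on \<Omega>) = (\<integral>x. f' x * \<psi> x \<partial>lborel)" .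
  qed
qed

text \<open>From \<open>t \<le> 1 + t powr p\<close> for \<open>t \<ge> 0\<close>, where both terms
  are integrable over a bounded set. In the applications \<open>c\<close> is a coordinate
  projection.\<close>

lemma Lp_on_locally_integrable:
  fixes f :: "'a::euclidean_space \<Rightarrow> 'b::euclidean_space" and c :: "'b \<Rightarrow> real"
  assumes f: "Lp_on p \<Omega> f" "1 \<le> p" and U: "U \<in> sets borel" "bounded U"
    and \<Omega>: "\<Omega> \<in> sets lebesgue" and c: "c \<in> borel_measurable borel" "\<And>v. \<bar>c v\<bar> \<le> norm v"
  shows "integrable (lebesgue_on \<Omega>) (\<lambda>x. indicator U x * c (f x))"
proof (rule Bochner_Integration.integrable_bound)
  have [measurable]: "f \<in> borel_measurable (lebesgue_on \<Omega>)" using f by (simp add: Lp_on_def)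
  have [measurable]: "c \<in> borel_measurable borel" by fact
  have U': "U \<in> sets lebesgue" using U by auto
  have Um: "U \<inter> space (lebesgue_on \<Omega>) \<in> sets (lebesgue_on \<Omega>)"
    using U' by (auto simp: space_restrict_space sets_restrict_space)
  have iU: "integrable (lebesgue_on \<Omega>) (indicator U :: _ \<Rightarrow> real)"
  proof -
    have "integrable lebesgue (\<lambda>x. indicator \<Omega> x *\<^sub>R (indicator U x :: real))"
    proof (rule Bochner_Integration.integrable_bound)
      have "U \<in> lmeasurable" by (rule bounded_set_imp_lmeasurable[OF U(2) U'])
      then show "integrable lebesgue (indicator U :: _ \<Rightarrow> real)"
        by (intro integrable_real_indicator) (auto simp: fmeasurable_def)
      show "(\<lambda>x. indicator \<Omega> x *\<^sub>R (indicator U x :: real)) \<in> borel_measurable lebesgue"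
        using \<Omega> U' by auto
    qed (auto simp: indicator_def)
    then show ?thesis using integrable_restrict_space[of \<Omega> lebesgue "indicator U :: _ \<Rightarrow> real"] \<Omega>
      by (simp add: set_integrable_def)
  qed
  show "integrable (lebesgue_on \<Omega>) (\<lambda>x. indicator U x + norm (f x) powr p)"
    using iU f by (auto simp: Lp_on_def)
  have "(indicator U :: _ \<Rightarrow> real) \<in> borel_measurable (lebesgue_on \<Omega>)" using iU by auto
  then show "(\<lambda>x. indicator U x * c (f x)) \<in> borel_measurable (lebesgue_on \<Omega>)" by measurable
  show "AE x in lebesgue_on \<Omega>. norm (indicator U x * c (f x)) \<le> norm (indicator U x + norm (f x) powr p)"
  proof (rule AE_I2)
    fix x
    have "norm (f x) \<le> 1 + norm (f x) powr p"
    proof (cases "norm (f x) \<le> 1")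
      case False
      then have "norm (f x) powr 1 \<le> norm (f x) powr p" using f(2) by (intro powr_mono) auto
      then show ?thesis using False by simp
    qed (simp add: add_increasing2)
    with c(2)[of "f x"] have 1: "\<bar>c (f x)\<bar> \<le> 1 + norm (f x) powr p" by linarith
    have 2: "0 \<le> norm (f x) powr p" by simp
    show "norm (indicator U x * c (f x)) \<le> norm (indicator U x + norm (f x) powr p)"
    proof (cases "x \<in> U")
      case True
      then have "norm (indicator U x * c (f x)) = \<bar>c (f x)\<bar>" by simp
      also note 1
      also have "1 + norm (f x) powr p \<le> norm (indicator U x + norm (f x) powr p)" using True by simp
      finally show ?thesis .
    qed simp
  qed
qed

text \<open>Makes the weak divergence identity available for the kernels, which turns it into a
  pointwise identity for mollified fields.\<close>

lemma mollifier_test_fun: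
  fixes G :: "('n::finite \<Rightarrow> nat) \<Rightarrow> real^'n \<Rightarrow> real"
  assumes G: "mollifier e G" and x: "cball x e \<subseteq> \<Omega>"
  shows "test_fun \<Omega> (\<lambda>z. G (\<lambda>_. 0) (x - z))"
proof -
  have "{z. G (\<lambda>_. 0) (x - z) \<noteq> 0} \<subseteq> cball x e"
  proof
    fix z assume "z \<in> {z. G (\<lambda>_. 0) (x - z) \<noteq> 0}"
    then have "\<not> e \<le> norm (x - z)" using averaging_kernelD(2)[OF mollifier_averaging[OF G]] by blast
    then show "z \<in> cball x e" by (simp add: dist_norm)
  qed
  then have s: "closure {z. G (\<lambda>_. 0) (x - z) \<noteq> 0} \<subseteq> cball x e" by (rule closure_minimal) auto
  moreover have "compact (closure {z. G (\<lambda>_. 0) (x - z) \<noteq> 0})"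
    unfolding compact_closure by (rule bounded_subset[OF bounded_cball order_trans[OF closure_subset s]])
  moreover have "smooth_fun (\<lambda>z. G (\<lambda>_. 0) (x - z))" using G unfolding mollifier_def by blast
  ultimately show ?thesis using x unfolding test_fun_def by blast
qed

text \<open>The fundamental lemma of the calculus of variations. With mollifier kernels as test
  functions, the mollifications of \<open>h\<close> vanish at points whose kernel ball lies in
  \<Omega>, and they converge to \<open>h\<close> almost everywhere along a subsequence.\<close>

lemma weak_null_AE_zero:
  fixes h :: "real^'n::finite \<Rightarrow> real"
  assumes \<Omega>: "open \<Omega>" and h: "\<And>U. U \<in> sets borel \<Longrightarrow> bounded U \<Longrightarrow> integrable (lebesgue_on \<Omega>) (\<lambda>x. indicator U x * h x)"
    and z: "\<And>\<psi>. test_fun \<Omega> \<psi> \<Longrightarrow> (\<integral>x. h x * \<psi> x \<partial>lebesgue_on \<Omega>) = 0"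
  shows "AE x in lebesgue_on \<Omega>. h x = 0"
proof -
  have \<Omega>m: "\<Omega> \<in> sets lebesgue" using \<Omega> by auto
  define r where "r k = 1 / (real k + 1)" for k
  have r: "r k > 0" "r k \<le> 1" for k by (auto simp: r_def)
  \<comment> \<open>Countably many pieces exhaust \<Omega>; on each of them kernels of radius less
    than \<open>r k\<close> are admissible at all points at once.\<close>
  have local: "AE x in lborel. norm x \<le> real k \<and> cball x (r k) \<subseteq> \<Omega> \<longrightarrow> h x = 0" for k
  proof -
    define U where "U = \<Omega> \<inter> ball 0 (real k + 2)"
    have U: "U \<in> sets borel" "U \<subseteq> \<Omega>" "bounded U" "open U" using \<Omega> by (auto simp: U_def)
    obtain f where f: "integrable lborel f" "AE x in lborel. f x = indicator U x * h x"
      "\<And>\<psi>. \<psi> \<in> borel_measurable borel \<Longrightarrow> (\<And>x. x \<notin> U \<Longrightarrow> \<psi> x = 0) \<Longrightarrow>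
       (\<integral>x. h x * \<psi> x \<partial>lebesgue_on \<Omega>) = (\<integral>x. f x * \<psi> x \<partial>lborel)"
      using borel_representative[OF \<Omega>m U(1,2) h[OF U(1,3)]] by blast
    define e where "e j = 1 / (real j + 1)" for j
    have e0: "e \<longlonglongrightarrow> 0"
    proof -
      have "(\<lambda>j. 1 / real (Suc j)) \<longlonglongrightarrow> 0" by (rule LIMSEQ_Suc[OF lim_1_over_n])
      moreover have "e = (\<lambda>j. 1 / real (Suc j))" by (simp add: e_def fun_eq_iff add.commute)
      ultimately show ?thesis by simp
    qed
    have "\<exists>G::('n \<Rightarrow> nat) \<Rightarrow> real^'n \<Rightarrow> real. mollifier (e j) G" for j
    proof -
      have "e j > 0" by (simp add: e_def)
      from mollifier_exists[OF this] show ?thesis by blast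
    qed
    then obtain G :: "nat \<Rightarrow> ('n \<Rightarrow> nat) \<Rightarrow> real^'n \<Rightarrow> real" where G: "\<And>j. mollifier (e j) (G j)" by metis
    note ak = mollifier_averaging[OF G]
    have T1: "integrable lborel (\<lambda>x. conv f (G j (\<lambda>_. 0)) x - f x)" for j
      using conv_L1(1)[OF f(1) ak] f(1) by auto
    have T2: "(\<lambda>j. \<integral>x. norm (conv f (G j (\<lambda>_. 0)) x - f x) \<partial>lborel) \<longlonglongrightarrow> 0"
      using mollification_L1[OF f(1) ak e0] by simp
    from tendsto_L1_AE_subseq[OF T1 T2]
    obtain s where s: "strict_mono s" "AE x in lborel. (\<lambda>j. conv f (G (s j) (\<lambda>_. 0)) x - f x) \<longlonglongrightarrow> 0" by auto
    show ?thesis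
      using f(2) s(2)
    proof eventually_elim
      case (elim x)
      show ?case
      proof
        assume x: "norm x \<le> real k \<and> cball x (r k) \<subseteq> \<Omega>"
        have zero: "conv f (G j (\<lambda>_. 0)) x = 0" if "e j < r k" for j
        proof -
          have sub: "cball x (e j) \<subseteq> U"
          proof
            fix z assume z: "z \<in> cball x (e j)"
            then have "dist x z < r k" using that by auto
            moreover have "norm z \<le> norm x + dist x z" by (metis dist_norm norm_minus_commute norm_triangle_sub)
            ultimately show "z \<in> U" using x r(2)[of k] by (auto simp: U_def)
          qed
          note Gd = averaging_kernelD[OF ak[of j]]
          have "(\<integral>z. f z * G j (\<lambda>_. 0) (x - z) \<partial>lborel) = (\<integral>z. h z * G j (\<lambda>_. 0) (x - z) \<partial>lebesgue_on \<Omega>)"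
          proof (rule f(3)[symmetric])
            show "(\<lambda>z. G j (\<lambda>_. 0) (x - z)) \<in> borel_measurable borel" using Gd by measurable
            fix z assume "z \<notin> U"
            then have "e j \<le> norm (x - z)" using sub by (force simp: dist_norm)
            then show "G j (\<lambda>_. 0) (x - z) = 0" by (rule Gd(2))
          qed
          also have "\<dots> = 0" using sub U by (intro z mollifier_test_fun[OF G]) auto
          finally show ?thesis by (simp add: conv_def)
        qed
        have "(\<lambda>j. e (s j)) \<longlonglongrightarrow> 0" using LIMSEQ_subseq_LIMSEQ[OF e0 s(1)] by (simp add: o_def)
        then have "\<forall>\<^sub>F j in sequentially. e (s j) < r k" using r(1) by (rule order_tendstoD(2))
        then have "\<forall>\<^sub>F j in sequentially. conv f (G (s j) (\<lambda>_. 0)) x - f x = - f x"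
          by eventually_elim (simp add: zero)
        then have "(\<lambda>j. conv f (G (s j) (\<lambda>_. 0)) x - f x) \<longlonglongrightarrow> - f x" by (rule tendsto_eventually)
        with elim(2) have "- f x = 0" by (rule LIMSEQ_unique[rotated])
        moreover have "x \<in> U" using x r(1)[of k] by (auto simp: U_def)
        ultimately show "h x = 0" using elim(1) by simp
      qed
    qed
  qed
  have "AE x in lborel. \<forall>k. norm x \<le> real k \<and> cball x (r k) \<subseteq> \<Omega> \<longrightarrow> h x = 0"
    unfolding AE_all_countable using local by blast
  then have "AE x in lborel. x \<in> \<Omega> \<longrightarrow> h x = 0"
  proof eventually_elim
    case (elim x)
    show ?case
    proof
      assume "x \<in> \<Omega>"
      then obtain d where d: "d > 0" "cball x d \<subseteq> \<Omega>" using \<Omega> open_contains_cball by blast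
      obtain k where k: "max (norm x) (1 / d) \<le> real k" using real_arch_simple by blast
      have "r k \<le> d" using k d by (auto simp: r_def field_simps)
      then show "h x = 0" using elim k d(2) by force
    qed
  qed
  then show ?thesis using \<Omega>m by (simp add: AE_restrict_space_iff AE_completion_iff)
qed

section \<open>Test functions and integrability of the determinant on compact sets\<close>

lemma test_fun_measurable:
  assumes "test_fun \<Omega> \<psi>"
  shows "\<psi> \<in> borel_measurable borel" "partial_deriv j \<psi> \<in> borel_measurable borel"
    "\<exists>b. \<forall>x. \<bar>\<psi> x\<bar> \<le> b" "\<exists>b. \<forall>x. \<bar>partial_deriv j \<psi> x\<bar> \<le> b"
    "x \<notin> closure {x. \<psi> x \<noteq> 0} \<Longrightarrow> \<psi> x = 0" "x \<notin> closure {x. \<psi> x \<noteq> 0} \<Longrightarrow> partial_deriv j \<psi> x = 0"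
    "compact (closure {x. \<psi> x \<noteq> 0})" "closure {x. \<psi> x \<noteq> 0} \<subseteq> \<Omega>"
    "((\<lambda>t. \<psi> (x + t *\<^sub>R axis j 1)) has_real_derivative partial_deriv j \<psi> (x + t *\<^sub>R axis j 1)) (at t)"
    "continuous_on UNIV \<psi>" "continuous_on UNIV (partial_deriv j \<psi>)"
proof -
  let ?C = "closure {x. \<psi> x \<noteq> 0}"
  have sm: "smooth_fun \<psi>" and C: "compact ?C" "?C \<subseteq> \<Omega>" using assms by (auto simp: test_fun_def)
  then show "compact ?C" "?C \<subseteq> \<Omega>" by auto
  from sm have c: "continuous_on UNIV (iter_partial js \<psi>)" for js by (auto simp: smooth_fun_def)
  show c0: "continuous_on UNIV \<psi>" using c[of "[]"] by simp
  show c1: "continuous_on UNIV (partial_deriv j \<psi>)" using c[of "[j]"] by simp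
  show "\<psi> \<in> borel_measurable borel" "partial_deriv j \<psi> \<in> borel_measurable borel"
    by (rule borel_measurable_continuous_onI[OF c0], rule borel_measurable_continuous_onI[OF c1])
  show z0: "\<psi> x = 0" if "x \<notin> ?C" for x
    using that closure_subset[of "{x. \<psi> x \<noteq> 0}"] by blast
  show z1: "partial_deriv j \<psi> x = 0" if x: "x \<notin> ?C" for x
  proof (rule partial_deriv_eq)
    have "open ((\<lambda>t::real. x + t *\<^sub>R axis j 1) -` (- ?C))"
      by (intro open_vimage continuous_intros) simp
    moreover have "0 \<in> (\<lambda>t::real. x + t *\<^sub>R axis j 1) -` (- ?C)" using x by simp
    moreover have "0 = \<psi> (x + t *\<^sub>R axis j 1)" if "t \<in> (\<lambda>t::real. x + t *\<^sub>R axis j 1) -` (- ?C)" for t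
      using that unfolding vimage_eq Compl_iff by (rule z0[symmetric])
    ultimately show "((\<lambda>t. \<psi> (x + t *\<^sub>R axis j 1)) has_real_derivative 0) (at 0)"
      by (rule has_field_derivative_transform_within_open[OF DERIV_const])
  qed
  obtain \<rho> where \<rho>: "?C \<subseteq> cball 0 \<rho>" using compact_imp_bounded[OF C(1)] by (meson bounded_subset_ballD ball_subset_cball order_trans)
  have out: "x \<notin> ?C" if "\<rho> + 1 \<le> norm x" for x using that \<rho> by auto
  show "\<exists>b. \<forall>x. \<bar>\<psi> x\<bar> \<le> b" using kernel_bounded[OF c0 z0[OF out]] by metis
  show "\<exists>b. \<forall>x. \<bar>partial_deriv j \<psi> x\<bar> \<le> b" using kernel_bounded[OF c1 z1[OF out]] by metis
  show "((\<lambda>t. \<psi> (x + t *\<^sub>R axis j 1)) has_real_derivative partial_deriv j \<psi> (x + t *\<^sub>R axis j 1)) (at t)"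
  proof -
    obtain d where d: "((\<lambda>s. \<psi> ((x + t *\<^sub>R axis j 1) + s *\<^sub>R axis j 1)) has_real_derivative d) (at 0)"
      using sm unfolding smooth_fun_def by (metis iter_partial.simps(1))
    then have "partial_deriv j \<psi> (x + t *\<^sub>R axis j 1) = d" by (rule partial_deriv_eq)
    moreover have "((\<lambda>s. \<psi> ((x + t *\<^sub>R axis j 1) + (s - t) *\<^sub>R axis j 1)) has_real_derivative d * 1) (at t)"
      by (rule DERIV_chain2[where f = "\<lambda>s. \<psi> ((x + t *\<^sub>R axis j 1) + s *\<^sub>R axis j 1)"]) (use d in \<open>auto intro!: derivative_eq_intros\<close>)
    ultimately show ?thesis by (simp add: algebra_simps)
  qed
qed

lemma borel_measurable_powr_const:
  fixes f :: "'a \<Rightarrow> real"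
  assumes [measurable]: "f \<in> borel_measurable M"
  shows "(\<lambda>x. f x powr s) \<in> borel_measurable M"
  unfolding powr_def by measurable

lemma borel_measurable_det_powr:
  fixes A :: "'a \<Rightarrow> real^'n::finite^'n"
  assumes "A \<in> borel_measurable M"
  shows "(\<lambda>x. det (A x) powr s) \<in> borel_measurable M"
  by (rule borel_measurable_powr_const[OF borel_measurable_det[OF assms]])

lemma compact_in_open_neighbourhood:
  fixes K :: "'a::euclidean_space set"
  assumes "compact K" "open \<Omega>" "K \<subseteq> \<Omega>"
  obtains d where "d > 0" "\<And>y x. y \<in> K \<Longrightarrow> dist y x < 3 * d \<Longrightarrow> x \<in> \<Omega>"
proof -
  obtain e where e: "e > 0" "(\<Union>x\<in>K. cball x e) \<subseteq> \<Omega>"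
    using compact_subset_open_imp_cball_epsilon_subset[OF assms] by blast
  show ?thesis
  proof (rule that[of "e/3"])
    fix y x assume "y \<in> K" "dist y x < 3 * (e / 3)"
    then have "x \<in> (\<Union>x\<in>K. cball x e)" by (auto intro!: bexI[of _ y])
    then show "x \<in> \<Omega>" using e(2) by blast
  qed (use e in simp)
qed

text \<open>The classical inequality is applied to \<open>A + 1\<close>, cut off near \<open>K\<close>, which makes the field
  uniformly positive.\<close>
lemma det_integrable_on_compact:
  fixes A :: "real^'n::finite \<Rightarrow> real^'n^'n"
  assumes n2: "2 \<le> CARD('n)" and p: "1 \<le> p" and \<Omega>: "open \<Omega>" and K: "compact K" "K \<subseteq> \<Omega>"
    and A: "Lp_on p \<Omega> A" "AE x in lebesgue_on \<Omega>. A x \<in> Sym_plus"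
    and g: "Lp_on p \<Omega> g" "is_weak_div \<Omega> A g"
  shows "integrable (lebesgue_on \<Omega>) (\<lambda>x. indicator K x * det (A x) powr (1 / (real CARD('n) - 1)))"
proof -
  let ?M = "lebesgue_on \<Omega>"
  have \<Omega>m: "\<Omega> \<in> sets lebesgue" using \<Omega> by auto
  obtain d where d: "d > 0" "\<And>y x. y \<in> K \<Longrightarrow> dist y x < 3 * d \<Longrightarrow> x \<in> \<Omega>"
    using compact_in_open_neighbourhood[OF K(1) \<Omega> K(2)] by blast
  define U where "U = (\<Union>y\<in>K. ball y (3 * d))"
  have U: "open U" "U \<subseteq> \<Omega>" using d by (auto simp: U_def)
  note U = borel_open[OF U(1)] U(2) U(1)
  have Ub: "bounded U"
  proof -
    obtain r where r: "\<And>y. y \<in> K \<Longrightarrow> norm y \<le> r" using compact_imp_bounded[OF K(1)] by (auto simp: bounded_iff)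
    have "U \<subseteq> cball 0 (r + 3 * d)"
    proof
      fix x assume "x \<in> U"
      then obtain y where "y \<in> K" "dist y x < 3 * d" by (auto simp: U_def)
      then show "x \<in> cball 0 (r + 3 * d)" using r[of y] norm_triangle_ineq2[of x y] by (simp add: dist_norm norm_minus_commute)
    qed
    then show ?thesis by (rule bounded_subset[OF bounded_cball])
  qed
  have mA: "(\<lambda>M::real^'n^'n. M $ i $ j) \<in> borel_measurable borel" "(\<lambda>v::real^'n. v $ i) \<in> borel_measurable borel" for i j
    by (intro borel_measurable_continuous_onI continuous_intros)+
  have locA: "integrable ?M (\<lambda>x. indicator U x * A x $ i $ j)" for i j
    by (rule Lp_on_locally_integrable[where c = "\<lambda>M::real^'n^'n. M $ i $ j", OF A(1) p U(1) Ub \<Omega>m mA(1) matrix_entry_le_norm])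
  have locg: "integrable ?M (\<lambda>x. indicator U x * g x $ i)" for i
    by (rule Lp_on_locally_integrable[where c = "\<lambda>v::real^'n. v $ i", OF g(1) p U(1) Ub \<Omega>m mA(2) component_le_norm_cart])
  define rep where "rep f f' \<longleftrightarrow> integrable lborel f' \<and> (AE x in lborel. f' x = indicator U x * f x) \<and>
    (\<forall>\<psi>. \<psi> \<in> borel_measurable borel \<longrightarrow> (\<forall>x. x \<notin> U \<longrightarrow> \<psi> x = 0) \<longrightarrow>
       (\<integral>x. f x * \<psi> x \<partial>?M) = (\<integral>x. f' x * \<psi> x \<partial>lborel))" for f f' :: "real^'n \<Rightarrow> real"
  have rep: "\<exists>f'. rep f f'" if f: "integrable ?M (\<lambda>x. indicator U x * f x)" for f
  proof -
    obtain f' where f': "integrable lborel f'" "AE x in lborel. f' x = indicator U x * f x"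
      "\<And>\<psi>. \<psi> \<in> borel_measurable borel \<Longrightarrow> (\<And>x. x \<notin> U \<Longrightarrow> \<psi> x = 0) \<Longrightarrow>
       (\<integral>x. f x * \<psi> x \<partial>?M) = (\<integral>x. f' x * \<psi> x \<partial>lborel)"
      using borel_representative[OF \<Omega>m U(1,2) f] by blast
    then show ?thesis unfolding rep_def by blast
  qed
  obtain a0 where ra: "\<And>i j. rep (\<lambda>x. A x $ i $ j) (a0 i j)"
  proof -
    have "\<exists>f. \<forall>i. rep (\<lambda>x. A x $ fst i $ snd i) (f i)" using rep[OF locA] by (intro choice allI)
    then obtain f where f: "\<And>i. rep (\<lambda>x. A x $ fst i $ snd i) (f i)" by blast
    show ?thesis using that[of "\<lambda>i j. f (i, j)"] f[of "(i, j)" for i j] by simp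
  qed
  have a0: "integrable lborel (a0 i j)" "AE x in lborel. a0 i j x = indicator U x * A x $ i $ j"
    "\<psi> \<in> borel_measurable borel \<Longrightarrow> (\<And>x. x \<notin> U \<Longrightarrow> \<psi> x = 0) \<Longrightarrow>
       (\<integral>x. A x $ i $ j * \<psi> x \<partial>?M) = (\<integral>x. a0 i j x * \<psi> x \<partial>lborel)" for i j \<psi>
    using ra[of i j] unfolding rep_def by simp_all
  obtain g0 where rg: "\<And>i. rep (\<lambda>x. g x $ i) (g0 i)"
    using choice[of "\<lambda>i. rep (\<lambda>x. g x $ i)"] rep[OF locg] by blast
  have g0: "integrable lborel (g0 i)"
    "\<psi> \<in> borel_measurable borel \<Longrightarrow> (\<And>x. x \<notin> U \<Longrightarrow> \<psi> x = 0) \<Longrightarrow>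
       (\<integral>x. g x $ i * \<psi> x \<partial>?M) = (\<integral>x. g0 i x * \<psi> x \<partial>lborel)" for i \<psi>
    using rg[of i] unfolding rep_def by simp_all
  have iU: "integrable lborel (indicator U :: real^'n \<Rightarrow> real)"
    using U(1) emeasure_bounded_finite[OF Ub] by (intro integrable_real_indicator) auto
  \<comment> \<open>The identity matrix is added only on \<open>U\<close>, which keeps the entries
    integrable over the whole space.\<close>
  define a where "a x = (\<chi> i j. a0 i j x + (mat 1 :: real^'n^'n) $ i $ j * indicator U x)" for x
  have ia: "integrable lborel (\<lambda>x. a x $ i $ j)" for i j
    unfolding a_def using a0(1) iU by simp
  have aA: "AE x in lborel. x \<in> U \<longrightarrow> a x = A x + mat 1"
  proof -
    have "AE x in lborel. \<forall>i\<in>UNIV. \<forall>j\<in>UNIV. a0 i j x = indicator U x * A x $ i $ j"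
      by (intro AE_finite_allI a0(2)) auto
    then show ?thesis by eventually_elim (auto simp: a_def vec_eq_iff)
  qed
  have As: "AE x in lborel. x \<in> \<Omega> \<longrightarrow> A x \<in> Sym_plus"
    using A(2) \<Omega>m by (simp add: AE_restrict_space_iff AE_completion_iff)
  have P: "AE z in lborel. (\<exists>y\<in>K. dist y z < 3 * d) \<longrightarrow> a z \<in> Sym_plus \<and> (\<forall>v. (norm v)\<^sup>2 \<le> v \<bullet> (a z *v v))"
    using aA As
  proof eventually_elim
    case (elim z)
    show ?case
    proof
      assume "\<exists>y\<in>K. dist y z < 3 * d"
      then have "z \<in> U" by (auto simp: U_def)
      then have az: "a z = A z + mat 1" and s: "A z \<in> Sym_plus" using elim U(2) by auto
      have "(norm v)\<^sup>2 \<le> v \<bullet> (a z *v v)" for v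
        using s unfolding az by (simp add: Sym_plus_def matrix_vector_mult_add_rdistrib inner_add_right power2_norm_eq_inner)
      then show "a z \<in> Sym_plus \<and> (\<forall>v. (norm v)\<^sup>2 \<le> v \<bullet> (a z *v v))"
        using s by (simp add: az Sym_plus_add mat_1_Sym_plus)
    qed
  qed
  have W: "(\<Sum>j\<in>UNIV. conv (\<lambda>z. a z $ i $ j) (G ((\<lambda>_. 0)(j := 1))) x) = conv (g0 i) (G (\<lambda>_. 0)) x"
    if G: "mollifier e G" and e: "0 < e" "e < d" and y: "y \<in> K" "dist y x < 2 * d" for e G x y i
  proof -
    note kD = averaging_kernelD[OF mollifier_averaging[OF G]]
    have Gm: "continuous_on UNIV (G m)" "\<And>w. e \<le> norm w \<Longrightarrow> G m w = 0" for m using G by (auto simp: mollifier_def)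
    have Gb: "G m \<in> borel_measurable borel" for m by (rule borel_measurable_continuous_onI[OF Gm(1)])
    have inU: "z \<in> U" if "norm (x - z) \<le> e" for z
    proof -
      have "dist y z \<le> dist y x + norm (x - z)" by (metis dist_norm dist_triangle)
      then have "dist y z < 3 * d" using that y e by simp
      then show ?thesis using y by (auto simp: U_def)
    qed
    have outU: "G m (x - z) = 0" if "z \<notin> U" for m z
    proof (rule Gm(2), rule ccontr)
      assume "\<not> e \<le> norm (x - z)" then show False using inU[of z] that by simp
    qed
    have sub: "cball x e \<subseteq> \<Omega>" using inU U(2) by (auto simp: dist_norm)
    define G1 where "G1 j = G ((\<lambda>_. 0)(j := 1))" for j
    have G1m: "(\<lambda>z. G1 j (x - z)) \<in> borel_measurable borel" for j
      unfolding G1_def by (rule measurable_compose[OF _ Gb]) simp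
    have G0m: "(\<lambda>z. G (\<lambda>_. 0) (x - z)) \<in> borel_measurable borel"
      by (rule measurable_compose[OF _ Gb]) simp
    have G1out: "G1 j (x - z) = 0" if "z \<notin> U" for j z unfolding G1_def by (rule outU[OF that])
    \<comment> \<open>The derivative of a compactly supported kernel has integral zero, so the added
      identity contributes nothing to the mollified divergence.\<close>
    have G1int: "(\<integral>z. G1 j (x - z) \<partial>lborel) = 0" for j
    proof -
      have "(\<integral>z. G1 j z \<partial>lborel) = 0"
      proof (rule integral_line_derivative_0)
        fix x t
        have "((\<lambda>t. G (\<lambda>_. 0) (x + t *\<^sub>R axis j 1)) has_real_derivative
          (\<Sum>l\<in>UNIV. axis j 1 $ l * G ((\<lambda>_. 0)(l := Suc 0)) (x + t *\<^sub>R axis j 1))) (at t)"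
          using G unfolding mollifier_def by blast
        then show "((\<lambda>t. G (\<lambda>_. 0) (x + t *\<^sub>R axis j 1)) has_real_derivative G1 j (x + t *\<^sub>R axis j 1)) (at t)"
          by (simp only: sum_axis G1_def One_nat_def)
      qed (use Gm G1_def in auto)
      then show ?thesis using integral_reflect[of "G1 j" x] Gb by (simp add: G1_def)
    qed
    have i1: "integrable lborel (\<lambda>z. a0 i j z * G1 j (x - z))" for j
      unfolding G1_def by (rule conv_integrable[OF loc_integrable_of_integrable[OF a0(1)] Gm])
    have iM: "integrable ?M (\<lambda>z. A z $ i $ j * G1 j (x - z))" for j
    proof -
      obtain B where B: "\<And>w. \<bar>G1 j w\<bar> \<le> B" using kernel_bounded[OF Gm] unfolding G1_def by metis
      have "integrable ?M (\<lambda>z. (indicator U z * A z $ i $ j) * G1 j (x - z))"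
      proof (rule Bochner_Integration.integrable_bound)
        show "integrable ?M (\<lambda>z. B * \<bar>indicator U z * A z $ i $ j\<bar>)"
          using locA by (intro integrable_mult_right integrable_abs) auto
        have "(\<lambda>z. G1 j (x - z)) \<in> borel_measurable ?M"
          using measurable_completion[of "\<lambda>z. G1 j (x - z)" lborel borel] G1m by (intro measurable_restrict_space1) simp
        from borel_measurable_times[OF borel_measurable_integrable[OF locA] this]
        show "(\<lambda>z. (indicator U z * A z $ i $ j) * G1 j (x - z)) \<in> borel_measurable ?M" .
        have B0: "0 \<le> B" using B[of 0] by (rule order_trans[OF abs_ge_zero])
        have "\<bar>c * G1 j w\<bar> \<le> B * \<bar>c\<bar>" for c w using mult_right_mono[OF B[of w] abs_ge_zero[of c]] by (simp add: abs_mult mult.commute)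
        moreover have "B * \<bar>c\<bar> \<le> norm (B * \<bar>c\<bar>)" for c by simp
        ultimately show "AE z in ?M. norm ((indicator U z * A z $ i $ j) * G1 j (x - z)) \<le> norm (B * \<bar>indicator U z * A z $ i $ j\<bar>)"
          unfolding real_norm_def by (intro AE_I2) (meson order_trans)
      qed
      moreover have "(indicator U z * A z $ i $ j) * G1 j (x - z) = A z $ i $ j * G1 j (x - z)" for z
        using G1out[of z j] by (cases "z \<in> U") auto
      ultimately show ?thesis by simp
    qed
    have c1: "conv (\<lambda>z. a z $ i $ j) (G ((\<lambda>_. 0)(j := 1))) x = (\<integral>z. A z $ i $ j * G1 j (x - z) \<partial>?M)" for j
    proof -
      have ig1: "integrable lborel (\<lambda>z. G1 j (x - z))"
      proof -
        have "integrable lborel (\<lambda>z. 1 * G1 j (x - z))" unfolding G1_def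
          by (rule conv_integrable[OF loc_integrable_continuous[OF continuous_on_const] Gm])
        then show ?thesis by simp
      qed
      have e1: "a z $ i $ j * G1 j (x - z) = a0 i j z * G1 j (x - z) + (mat 1 :: real^'n^'n) $ i $ j * G1 j (x - z)" for z
        using G1out[of z j] by (cases "z \<in> U") (auto simp: a_def algebra_simps)
      have "conv (\<lambda>z. a z $ i $ j) (G ((\<lambda>_. 0)(j := 1))) x = (\<integral>z. a z $ i $ j * G1 j (x - z) \<partial>lborel)"
        by (simp only: conv_def G1_def)
      also have "\<dots> = (\<integral>z. a0 i j z * G1 j (x - z) \<partial>lborel) + (mat 1 :: real^'n^'n) $ i $ j * (\<integral>z. G1 j (x - z) \<partial>lborel)"
        unfolding e1 using i1 ig1 by (subst Bochner_Integration.integral_add) auto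
      also have "\<dots> = (\<integral>z. a0 i j z * G1 j (x - z) \<partial>lborel)" by (simp add: G1int)
      also have "\<dots> = (\<integral>z. A z $ i $ j * G1 j (x - z) \<partial>?M)" by (rule a0(3)[OF G1m G1out, symmetric])
      finally show ?thesis .
    qed
    \<comment> \<open>The minus sign from differentiating \<open>x - z\<close> cancels the one in
      the definition of the weak divergence.\<close>
    have pd: "partial_deriv j (\<lambda>z. G (\<lambda>_. 0) (x - z)) z = - G1 j (x - z)" for j z
      using G unfolding mollifier_def G1_def by blast
    have "(\<integral>z. (\<Sum>j\<in>UNIV. A z $ i $ j * partial_deriv j (\<lambda>z. G (\<lambda>_. 0) (x - z)) z) \<partial>?M)
       = - (\<integral>z. g z $ i * G (\<lambda>_. 0) (x - z) \<partial>?M)"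
      using g(2) mollifier_test_fun[OF G sub] unfolding is_weak_div_def by blast
    moreover have "(\<Sum>j\<in>UNIV. A z $ i $ j * partial_deriv j (\<lambda>z. G (\<lambda>_. 0) (x - z)) z) = - (\<Sum>j\<in>UNIV. A z $ i $ j * G1 j (x - z))" for z
      unfolding pd by (simp add: sum_negf)
    ultimately have "(\<integral>z. (\<Sum>j\<in>UNIV. A z $ i $ j * G1 j (x - z)) \<partial>?M) = (\<integral>z. g z $ i * G (\<lambda>_. 0) (x - z) \<partial>?M)" by simp
    then have "(\<Sum>j\<in>UNIV. \<integral>z. A z $ i $ j * G1 j (x - z) \<partial>?M) = (\<integral>z. g0 i z * G (\<lambda>_. 0) (x - z) \<partial>lborel)"
      using g0(2)[OF G0m outU] iM by simp
    then show ?thesis by (simp only: c1) (simp only: conv_def)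
  qed
  define s where "s = 1 / (real CARD('n) - 1)"
  have s: "s > 0" using n2 by (simp add: s_def)
  have fin: "(\<integral>\<^sup>+x. ennreal (indicator K x * det (a x) powr s) \<partial>lborel) < \<infinity>"
    unfolding s_def by (rule serre_local[OF n2 K(1) ia g0(1) d(1) P W])
  have mAM: "A \<in> borel_measurable ?M" using A(1) by (simp add: Lp_on_def)
  have KM: "indicator K \<in> borel_measurable ?M"
  proof -
    have "indicator K \<in> borel_measurable lborel" using borel_closed[OF compact_imp_closed[OF K(1)]] by simp
    from measurable_completion[OF this] show ?thesis by (rule measurable_restrict_space1)
  qed
  have "(\<integral>\<^sup>+x. ennreal (indicator K x * det (A x) powr s) \<partial>?M) = (\<integral>\<^sup>+x. ennreal (indicator K x * det (A x) powr s) * indicator \<Omega> x \<partial>lebesgue)"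
    using \<Omega>m by (intro nn_integral_restrict_space) simp
  also have "\<dots> \<le> (\<integral>\<^sup>+x. ennreal (indicator K x * det (a x) powr s) \<partial>lebesgue)"
  proof (rule nn_integral_mono_AE)
    show "AE x in lebesgue. ennreal (indicator K x * det (A x) powr s) * indicator \<Omega> x \<le> ennreal (indicator K x * det (a x) powr s)"
      unfolding AE_completion_iff using aA As
    proof eventually_elim
      case (elim x)
      show ?case
      proof (cases "x \<in> K")
        case True
        then have xU: "x \<in> U" using d(1) by (auto simp: U_def intro!: bexI[of _ x])
        then have ax: "a x = A x + mat 1" and sx: "A x \<in> Sym_plus" using elim U by auto
        have "det (A x) \<le> det (a x)" unfolding ax
          using sx by (intro det_mono Sym_plus_add mat_1_Sym_plus) (simp_all add: matrix_vector_mult_add_rdistrib inner_add_right)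
        then have "det (A x) powr s \<le> det (a x) powr s" using det_Sym_plus_nonneg[OF sx] s by (intro powr_mono2) auto
        then show ?thesis using True xU U(2) by (auto simp: ennreal_leI)
      qed simp
    qed
  qed
  also have "\<dots> < \<infinity>" using fin by (simp only: nn_integral_completion)
  finally have fin': "(\<integral>\<^sup>+x. ennreal (indicator K x * det (A x) powr s) \<partial>?M) < \<infinity>" .
  have "integrable ?M (\<lambda>x. indicator K x * det (A x) powr s)"
  proof (rule integrableI_nonneg)
    show "(\<lambda>x. indicator K x * det (A x) powr s) \<in> borel_measurable ?M"
      by (rule borel_measurable_times[OF KM borel_measurable_det_powr[OF mAM]])
  qed (use fin' in auto)
  then show ?thesis by (simp only: s_def)
qed

lemma det_Lq:
  fixes A :: "real^'n::finite \<Rightarrow> real^'n^'n"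
  assumes n2: "2 \<le> CARD('n)" and p: "1 \<le> p" and \<Omega>: "open \<Omega>" and K: "compact K" "K \<subseteq> \<Omega>"
    and A: "A \<in> Y_space p \<Omega> K Abar"
  defines "n \<equiv> real CARD('n)"
  defines "q \<equiv> 1 / (1 - max 0 ((p * (n - 1) - n) / (p * (n - 1))))"
  shows "Lp_on q \<Omega> (\<lambda>x. det (A x) powr (1 / (n - 1)))"
proof -
  let ?M = "lebesgue_on \<Omega>"
  have n: "n \<ge> 2" using n2 by (simp add: n_def)
  from A obtain g where AL: "Lp_on p \<Omega> A" and As: "AE x in ?M. A x \<in> Sym_plus"
    and g: "Lp_on p \<Omega> g" "is_weak_div \<Omega> A g" and AK: "AE x in ?M. x \<notin> K \<longrightarrow> A x = Abar"
    by (auto simp: Y_space_def)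
  have mA: "A \<in> borel_measurable ?M" and iA: "integrable ?M (\<lambda>x. norm (A x) powr p)" using AL by (auto simp: Lp_on_def)
  have m: "(\<lambda>x. det (A x) powr (1 / (n - 1))) \<in> borel_measurable ?M" by (rule borel_measurable_det_powr[OF mA])
  have pn: "p * (n - 1) > 0" using p n by simp
  have mq: "(\<lambda>x. norm (det (A x) powr (1 / (n - 1))) powr q) \<in> borel_measurable ?M"
    by (rule borel_measurable_powr_const[OF measurable_compose[OF m borel_measurable_norm]]) 
  have "integrable ?M (\<lambda>x. norm (det (A x) powr (1 / (n - 1))) powr q)"
  proof (cases "n \<le> p * (n - 1)")
    case True
    have q: "q = p * (n - 1) / n"
    proof -
      have "1 - (p * (n - 1) - n) / (p * (n - 1)) = n / (p * (n - 1))" using pn p n by (simp add: diff_divide_distrib)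
      moreover have "0 \<le> (p * (n - 1) - n) / (p * (n - 1))" using True pn by simp
      ultimately show ?thesis by (simp add: q_def max_absorb2)
    qed
    \<comment> \<open>For this \<open>q\<close> one has \<open>q / (n - 1) = p / n\<close>, so
      bounding the determinant by the n-th power of the norm yields exactly the p-th power; the
      factorial counts permutations.\<close>
    define C where "C = (fact CARD('n) :: real) powr (p / n)"
    show ?thesis
    proof (rule Bochner_Integration.integrable_bound[OF _ mq])
      show "integrable ?M (\<lambda>x. C * norm (A x) powr p)" using iA by simp
      show "AE x in ?M. norm (norm (det (A x) powr (1 / (n - 1))) powr q) \<le> norm (C * norm (A x) powr p)"
        using As
      proof eventually_elim
        fix x assume x: "A x \<in> Sym_plus"
        have d0: "0 \<le> det (A x)" by (rule det_Sym_plus_nonneg[OF x])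
        have "(det (A x) powr (1 / (n - 1))) powr q = det (A x) powr (p / n)"
          using n by (simp add: powr_powr q)
        also have "\<dots> \<le> (fact CARD('n) * norm (A x) ^ CARD('n)) powr (p / n)"
          using det_abs_le[of "A x"] d0 p n by (intro powr_mono2) auto
        also have "\<dots> = C * (norm (A x) ^ CARD('n)) powr (p / n)" by (simp add: powr_mult C_def)
        also have "(norm (A x) ^ CARD('n)) powr (p / n) = norm (A x) powr p"
        proof (cases "norm (A x) = 0")
          case False
          then have "0 < norm (A x)" by simp
          then have "(norm (A x) ^ CARD('n)) powr (p / n) = (norm (A x) powr n) powr (p / n)" by (simp add: n_def powr_realpow)
          also have "\<dots> = norm (A x) powr p" using n by (simp add: powr_powr)
          finally show ?thesis .
        qed simp
        finally show "norm (norm (det (A x) powr (1 / (n - 1))) powr q) \<le> norm (C * norm (A x) powr p)"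
          by (simp add: C_def)
      qed
    qed
  next
    case False
    then have "(p * (n - 1) - n) / (p * (n - 1)) < 0" using pn by (intro divide_neg_pos) auto
    then have q: "q = 1" by (simp add: q_def max_absorb1)
    define c where "c = det Abar powr (1 / (n - 1))"
    \<comment> \<open>Outside \<open>K\<close> the integrand is the constant \<open>c\<close>, while
      \<Omega> may have infinite measure. Hence \<open>c\<close> is dominated by a multiple of
      \<open>norm (A x) powr p\<close>; if \<open>Abar = 0\<close>, then \<open>c = 0\<close> and
      the quotient is 0 as well.\<close>
    define C where "C = c / norm Abar powr p"
    note iK = det_integrable_on_compact[OF n2 p \<Omega> K AL As g, folded n_def]
    show ?thesis
    proof (rule Bochner_Integration.integrable_bound[OF _ mq])
      show "integrable ?M (\<lambda>x. indicator K x * det (A x) powr (1 / (n - 1)) + C * norm (A x) powr p)"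
        using iK iA by simp
      have c0: "0 \<le> c" "0 \<le> C" by (simp_all add: c_def C_def)
      have cC: "c \<le> C * norm Abar powr p"
      proof (cases "Abar = 0")
        case True
        have "det (0 :: real^'n^'n) = 0" using det_abs_le[of "0 :: real^'n^'n"] by (simp add: power_0_left)
        then show ?thesis using True by (simp add: c_def)
      qed (simp add: C_def)
      show "AE x in ?M. norm (norm (det (A x) powr (1 / (n - 1))) powr q)
          \<le> norm (indicator K x * det (A x) powr (1 / (n - 1)) + C * norm (A x) powr p)"
        using AK
      proof eventually_elim
        fix x assume x: "x \<notin> K \<longrightarrow> A x = Abar"
        have "det (A x) powr (1 / (n - 1)) \<le> indicator K x * det (A x) powr (1 / (n - 1)) + C * norm (A x) powr p"
          using x cC c0 by (cases "x \<in> K") (auto simp: c_def)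
        then show "norm (norm (det (A x) powr (1 / (n - 1))) powr q)
          \<le> norm (indicator K x * det (A x) powr (1 / (n - 1)) + C * norm (A x) powr p)"
          unfolding q by simp
      qed
    qed
  qed
  with m show ?thesis by (simp add: Lp_on_def)
qed

section \<open>Fields with a point singularity\<close>

text \<open>A dyadic decomposition: on the shell between radii \<open>R / 2 ^ Suc k\<close> and
  \<open>R / 2 ^ k\<close> the integrand is at most the power at the inner radius, and summing
  against ball volumes gives a geometric series of ratio \<open>2 powr (b - DIM('a)) < 1\<close>.
  The term \<open>\<delta>^2\<close> can only lower the integrand, so the bound is uniform in
  \<delta>.\<close>

lemma power_singularity_integral:
  fixes x0 :: "'a::euclidean_space"
  assumes b: "0 \<le> b" "b < real DIM('a)" and R: "0 < R"
  obtains \<Lambda> where "0 \<le> \<Lambda>"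
    "\<And>\<delta>. (\<integral>\<^sup>+x. ennreal (indicator (cball x0 R) x * ((x - x0) \<bullet> (x - x0) + \<delta>\<^sup>2) powr (- b / 2)) \<partial>lborel) \<le> ennreal \<Lambda>"
proof -
  define V where "V = unit_ball_vol (real DIM('a))"
  have V: "V \<ge> 0" by (simp add: V_def)
  define a where "a k = (R / 2 ^ Suc k) powr (- b) * (V * (R / 2 ^ k) ^ DIM('a))" for k :: nat
  define C where "C = R powr (- b) * 2 powr b * V * R ^ DIM('a)"
  have a_eq: "a k = C * (2 powr (b - real DIM('a))) ^ k" for k
  proof -
    have "(R / 2 ^ Suc k) powr (- b) = R powr (- b) * (2 powr b * (2 powr b) ^ k)"
    proof -
      have "(R / 2 ^ Suc k) powr (- b) = R powr (- b) / (2 ^ Suc k) powr (- b)" using R by (simp add: powr_divide)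
      also have "(2 ^ Suc k :: real) powr (- b) = 2 powr (- b * real (Suc k))"
        by (simp only: powr_realpow[symmetric] powr_powr) (simp add: mult.commute)
      also have "R powr (- b) / 2 powr (- b * real (Suc k)) = R powr (- b) * 2 powr (b * real (Suc k))"
        by (simp add: powr_minus divide_inverse)
      also have "2 powr (b * real (Suc k)) = (2 powr b) ^ Suc k" by (simp only: powr_realpow[symmetric] powr_powr powr_gt_zero)
      finally show ?thesis by simp
    qed
    moreover have "(2 powr (b - real DIM('a))) ^ k = (2 powr b) ^ k / (2 ^ k) ^ DIM('a)"
      by (simp add: powr_diff powr_realpow power_divide power_mult[symmetric] mult.commute)
    ultimately show ?thesis by (simp add: a_def C_def power_divide)
  qed
  have a0: "0 \<le> a k" for k using V R by (simp add: a_def)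
  have "2 powr (b - real DIM('a)) < 1" using b by (simp add: powr_less_one)
  then have sum: "summable a" unfolding a_eq[abs_def] by (intro summable_mult summable_geometric) simp
  have bound: "(\<integral>\<^sup>+x. ennreal (indicator (cball x0 R) x * ((x - x0) \<bullet> (x - x0) + \<delta>\<^sup>2) powr (- b / 2)) \<partial>lborel)
      \<le> ennreal (suminf a)" for \<delta>
  proof -
    have "AE x in lborel. x \<noteq> x0" using AE_lborel_singleton by blast
    then have "AE x in lborel. ennreal (indicator (cball x0 R) x * ((x - x0) \<bullet> (x - x0) + \<delta>\<^sup>2) powr (- b / 2))
       \<le> (\<Sum>k. ennreal ((R / 2 ^ Suc k) powr (- b)) * indicator (cball x0 (R / 2 ^ k)) x)"
    proof eventually_elim
      fix x :: 'a assume x: "x \<noteq> x0"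
      show "ennreal (indicator (cball x0 R) x * ((x - x0) \<bullet> (x - x0) + \<delta>\<^sup>2) powr (- b / 2))
       \<le> (\<Sum>k. ennreal ((R / 2 ^ Suc k) powr (- b)) * indicator (cball x0 (R / 2 ^ k)) x)"
      proof (cases "x \<in> cball x0 R")
        case True
        define \<rho> where "\<rho> = norm (x - x0)"
        have \<rho>: "0 < \<rho>" "\<rho> \<le> R" using x True by (auto simp: \<rho>_def dist_norm norm_minus_commute)
        have "\<exists>k. R / 2 ^ Suc k < \<rho>"
        proof -
          obtain k where "(1/2) ^ k < \<rho> / R" using real_arch_pow_inv[of "\<rho> / R" "1/2"] \<rho> R by auto
          then have "R / 2 ^ k < \<rho>" using R by (simp add: power_divide field_simps)
          moreover have "R / 2 ^ Suc k \<le> R / 2 ^ k" using R by (intro divide_left_mono) auto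
          ultimately show ?thesis by (intro exI[of _ k]) linarith
        qed
        define k where "k = (LEAST k. R / 2 ^ Suc k < \<rho>)"
        have k: "R / 2 ^ Suc k < \<rho>" unfolding k_def by (rule LeastI_ex) fact
        have k': "\<rho> \<le> R / 2 ^ k"
        proof (cases k)
          case (Suc l)
          then have "\<not> R / 2 ^ Suc l < \<rho>" using not_less_Least[of l "\<lambda>k. R / 2 ^ Suc k < \<rho>"] by (simp add: k_def)
          then show ?thesis by (simp add: Suc)
        qed (use \<rho> in simp)
        have "((x - x0) \<bullet> (x - x0) + \<delta>\<^sup>2) powr (- b / 2) \<le> (\<rho>\<^sup>2) powr (- b / 2)"
          using \<rho> b by (intro powr_mono2') (auto simp: \<rho>_def power2_norm_eq_inner)
        also have "\<dots> = \<rho> powr (- b)" using \<rho> by (simp add: powr_realpow[symmetric] powr_powr del: powr_numeral)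
        also have "\<dots> \<le> (R / 2 ^ Suc k) powr (- b)" using k R b by (intro powr_mono2') auto
        finally have "ennreal (indicator (cball x0 R) x * ((x - x0) \<bullet> (x - x0) + \<delta>\<^sup>2) powr (- b / 2))
           \<le> ennreal ((R / 2 ^ Suc k) powr (- b)) * indicator (cball x0 (R / 2 ^ k)) x"
          using True k' by (simp add: \<rho>_def dist_norm norm_minus_commute ennreal_leI)
        also have "\<dots> \<le> (\<Sum>k. ennreal ((R / 2 ^ Suc k) powr (- b)) * indicator (cball x0 (R / 2 ^ k)) x)"
        proof -
          have "f k \<le> suminf f" for f :: "nat \<Rightarrow> ennreal" using sum_le_suminf[of f "{k}"] by simp
          then show ?thesis .
        qed
        finally show ?thesis .
      qed simp
    qed
    then have "(\<integral>\<^sup>+x. ennreal (indicator (cball x0 R) x * ((x - x0) \<bullet> (x - x0) + \<delta>\<^sup>2) powr (- b / 2)) \<partial>lborel)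
      \<le> (\<integral>\<^sup>+x. (\<Sum>k. ennreal ((R / 2 ^ Suc k) powr (- b)) * indicator (cball x0 (R / 2 ^ k)) x) \<partial>lborel)"
      by (rule nn_integral_mono_AE)
    also have "\<dots> = (\<Sum>k. ennreal ((R / 2 ^ Suc k) powr (- b)) * emeasure lborel (cball x0 (R / 2 ^ k)))"
    proof (subst nn_integral_suminf)
      show "(\<lambda>x. ennreal ((R / 2 ^ Suc k) powr (- b)) * indicator (cball x0 (R / 2 ^ k)) x) \<in> borel_measurable lborel" for k
        by (intro borel_measurable_times_ennreal borel_measurable_const borel_measurable_indicator) simp
      have "(\<integral>\<^sup>+x. c * indicator (cball x0 s) x \<partial>lborel) = c * emeasure lborel (cball x0 s)" for c s
        by (rule nn_integral_cmult_indicator) simp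
      then show "(\<Sum>k. \<integral>\<^sup>+x. ennreal ((R / 2 ^ Suc k) powr (- b)) * indicator (cball x0 (R / 2 ^ k)) x \<partial>lborel)
         = (\<Sum>k. ennreal ((R / 2 ^ Suc k) powr (- b)) * emeasure lborel (cball x0 (R / 2 ^ k)))" by (simp only:)
    qed
    also have "\<dots> = (\<Sum>k. ennreal (a k))"
    proof (rule suminf_cong)
      fix k
      have "emeasure lborel (cball x0 (R / 2 ^ k)) = ennreal (V * (R / 2 ^ k) ^ DIM('a))"
        unfolding V_def by (rule emeasure_cball) (use R in simp)
      then show "ennreal ((R / 2 ^ Suc k) powr (- b)) * emeasure lborel (cball x0 (R / 2 ^ k)) = ennreal (a k)"
        unfolding a_def using R V by (simp only:) (rule ennreal_mult[symmetric], simp_all)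
    qed
    also have "\<dots> = ennreal (suminf a)" by (rule suminf_ennreal2[OF a0 sum])
    finally show ?thesis .
  qed
  have "0 \<le> suminf a" using a0 sum by (simp add: suminf_nonneg)
  from that[OF this bound] show ?thesis .
qed

text \<open>Each entry times a test function has bounded support, so its partial derivative
  integrates to zero, and the product rule splits this into the weak identity. The C^1 setting suits
  the cutoff of the singular fields.\<close>

lemma is_weak_div_C1:
  fixes F :: "real^'n::finite \<Rightarrow> real^'n^'n"
  assumes \<Omega>: "open \<Omega>"
    and dF: "\<And>i j x t. ((\<lambda>t. F (x + t *\<^sub>R axis j 1) $ i $ j) has_real_derivative Fd i j (x + t *\<^sub>R axis j 1)) (at t)"
    and cF: "\<And>i j. continuous_on UNIV (\<lambda>x. F x $ i $ j)" "\<And>i j. continuous_on UNIV (Fd i j)"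
    and C: "bounded C" "C \<subseteq> \<Omega>" "\<And>x. x \<notin> C \<Longrightarrow> F x = 0" "\<And>i j x. x \<notin> C \<Longrightarrow> Fd i j x = 0"
  shows "is_weak_div \<Omega> F (\<lambda>x. \<chi> i. \<Sum>j\<in>UNIV. Fd i j x)"
  unfolding is_weak_div_def
proof (intro allI impI)
  fix \<psi> i assume t: "test_fun \<Omega> \<psi>"
  note T = test_fun_measurable[OF t]
  obtain \<rho>0 where "C \<subseteq> cball 0 \<rho>0" using C(1) by (meson bounded_subset_ballD ball_subset_cball order_trans)
  then have out: "x \<notin> C" if "\<rho>0 + 1 \<le> norm x" for x using that by auto
  have conv: "(\<integral>x. f x \<partial>lebesgue_on \<Omega>) = (\<integral>x. f x \<partial>lborel)"
    if f: "continuous_on UNIV f" "\<And>x. x \<notin> C \<Longrightarrow> f x = 0" for f :: "real^'n \<Rightarrow> real"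
  proof -
    have "(\<integral>x. f x \<partial>lebesgue_on \<Omega>) = (\<integral>x. indicator \<Omega> x *\<^sub>R f x \<partial>lebesgue)"
      using \<Omega> by (intro integral_restrict_space) auto
    also have "(\<lambda>x. indicator \<Omega> x *\<^sub>R f x) = f"
    proof
      fix x show "indicator \<Omega> x *\<^sub>R f x = f x" using f(2)[of x] C(2) by (cases "x \<in> C") auto
    qed
    also have "(\<integral>x. f x \<partial>lebesgue) = (\<integral>x. f x \<partial>lborel)"
      using borel_measurable_continuous_onI[OF f(1)] by (intro integral_completion) simp
    finally show ?thesis .
  qed
  have i1: "integrable lborel (\<lambda>x. F x $ i $ j * partial_deriv j \<psi> x)" for j
    using C(3)[OF out] by (intro integrable_compact_support[of _ "\<rho>0 + 1"] continuous_on_mult cF T) auto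
  have i2: "integrable lborel (\<lambda>x. Fd i j x * \<psi> x)" for j
    using C(4)[OF out] by (intro integrable_compact_support[of _ "\<rho>0 + 1"] continuous_on_mult cF T) auto
  have z: "(\<integral>x. Fd i j x * \<psi> x + F x $ i $ j * partial_deriv j \<psi> x \<partial>lborel) = 0" for j
  proof (rule integral_line_derivative_0)
    fix x t
    show "((\<lambda>t. F (x + t *\<^sub>R axis j 1) $ i $ j * \<psi> (x + t *\<^sub>R axis j 1)) has_real_derivative
      Fd i j (x + t *\<^sub>R axis j 1) * \<psi> (x + t *\<^sub>R axis j 1) + F (x + t *\<^sub>R axis j 1) $ i $ j * partial_deriv j \<psi> (x + t *\<^sub>R axis j 1)) (at t)"
      using DERIV_mult[OF dF[of x j i t] T(9)[of x j t]] by (simp add: mult.commute)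
  next
    fix x :: "real^'n" assume "\<rho>0 + 1 \<le> norm x"
    from C(3)[OF out[OF this]] C(4)[OF out[OF this]]
    show "F x $ i $ j * \<psi> x = 0" "Fd i j x * \<psi> x + F x $ i $ j * partial_deriv j \<psi> x = 0" by simp_all
  qed (intro continuous_on_add continuous_on_mult cF T)+
  have "(\<integral>x. (\<Sum>j\<in>UNIV. F x $ i $ j * partial_deriv j \<psi> x) \<partial>lebesgue_on \<Omega>)
     = (\<integral>x. (\<Sum>j\<in>UNIV. F x $ i $ j * partial_deriv j \<psi> x) \<partial>lborel)"
    using C(3) by (intro conv continuous_on_sum continuous_on_mult cF T) auto
  also have "\<dots> = (\<Sum>j\<in>UNIV. \<integral>x. F x $ i $ j * partial_deriv j \<psi> x \<partial>lborel)"
    by (intro Bochner_Integration.integral_sum i1)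
  also have "\<dots> = (\<Sum>j\<in>UNIV. - (\<integral>x. Fd i j x * \<psi> x \<partial>lborel))"
  proof (rule sum.cong[OF refl])
    fix j show "(\<integral>x. F x $ i $ j * partial_deriv j \<psi> x \<partial>lborel) = - (\<integral>x. Fd i j x * \<psi> x \<partial>lborel)"
      using z[of j] Bochner_Integration.integral_add[OF i2[of j] i1[of j]] by simp
  qed
  also have "\<dots> = - (\<integral>x. (\<Sum>j\<in>UNIV. Fd i j x * \<psi> x) \<partial>lborel)"
    using i2 by (simp add: sum_negf)
  also have "(\<lambda>x. \<Sum>j\<in>UNIV. Fd i j x * \<psi> x) = (\<lambda>x. (\<chi> i. \<Sum>j\<in>UNIV. Fd i j x) $ i * \<psi> x)"
    by (simp add: sum_distrib_right)
  also have "(\<integral>x. (\<chi> i. \<Sum>j\<in>UNIV. Fd i j x) $ i * \<psi> x \<partial>lborel) = (\<integral>x. (\<chi> i. \<Sum>j\<in>UNIV. Fd i j x) $ i * \<psi> x \<partial>lebesgue_on \<Omega>)"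
    using C(4) by (intro conv[symmetric] continuous_on_mult T) (auto intro!: continuous_on_sum cF)
  finally show "(\<integral>x. (\<Sum>j\<in>UNIV. F x $ i $ j * partial_deriv j \<psi> x) \<partial>lebesgue_on \<Omega>)
     = - (\<integral>x. (\<chi> i. \<Sum>j\<in>UNIV. Fd i j x) $ i * \<psi> x \<partial>lebesgue_on \<Omega>)" .
qed

text \<open>Profiles are functions of the squared distance, which is smooth at the centre. Along a
  coordinate line it is a nonnegative quadratic, so derivatives of \<open>U\<close> at nonnegative
  arguments suffice.\<close>

lemma radial_line_derivative:
  fixes x0 x :: "real^'n::finite"
  assumes U: "\<And>s. 0 \<le> s \<Longrightarrow> (U has_real_derivative U' s) (at s)"
  shows "((\<lambda>t. U ((x + t *\<^sub>R axis j 1 - x0) \<bullet> (x + t *\<^sub>R axis j 1 - x0))) has_real_derivative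
    2 * U' ((x + t *\<^sub>R axis j 1 - x0) \<bullet> (x + t *\<^sub>R axis j 1 - x0)) * (x + t *\<^sub>R axis j 1 - x0)$j) (at t)"
proof -
  define y where "y = x - x0"
  have e: "(x + t *\<^sub>R axis j 1 - x0) \<bullet> (x + t *\<^sub>R axis j 1 - x0) = y \<bullet> y + 2 * t * y$j + t^2" for t
  proof -
    have "x + t *\<^sub>R axis j 1 - x0 = y + t *\<^sub>R axis j 1" by (simp add: y_def)
    moreover have "y \<bullet> axis j 1 = y$j" "axis j 1 \<bullet> y = y$j" "axis j 1 \<bullet> (axis j 1 :: real^'n) = 1"
      by (simp_all add: inner_axis inner_axis')
    ultimately show ?thesis by (simp only: inner_add_left inner_add_right inner_scaleR_left inner_scaleR_right)
      (simp add: power2_eq_square distrib_left)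
  qed
  have d: "((\<lambda>t. y \<bullet> y + 2 * t * y$j + t^2) has_real_derivative (2 * y$j + 2 * t)) (at t)"
    by (auto intro!: derivative_eq_intros)
  have nn: "0 \<le> y \<bullet> y + 2 * t * y$j + t^2" unfolding e[symmetric] by simp
  have "((\<lambda>t. U (y \<bullet> y + 2 * t * y$j + t^2)) has_real_derivative U' (y \<bullet> y + 2 * t * y$j + t^2) * (2 * y$j + 2 * t)) (at t)"
    by (rule DERIV_chain2[where f = U, OF U[OF nn] d])
  moreover have "U' (y \<bullet> y + 2 * t * y$j + t^2) * (2 * y$j + 2 * t)
      = 2 * U' (y \<bullet> y + 2 * t * y$j + t^2) * (x + t *\<^sub>R axis j 1 - x0)$j"
  proof -
    have "(x + t *\<^sub>R axis j 1 - x0)$j = y$j + t" by (simp add: y_def axis_def)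
    then show ?thesis by (simp only:) (simp add: field_simps)
  qed
  ultimately show ?thesis unfolding e by (simp only:)
qed

lemma Lp_of_pointwise_bound:
  fixes f :: "'a::euclidean_space \<Rightarrow> 'b::euclidean_space"
  assumes \<Omega>: "\<Omega> \<in> sets lebesgue" and p: "1 \<le> p" and f: "continuous_on UNIV f"
    and b: "\<And>x. norm (f x) \<le> C * k x" "0 \<le> C" "k \<in> borel_measurable borel"
    and k: "(\<integral>\<^sup>+x. ennreal (k x powr p) \<partial>lborel) \<le> ennreal \<Lambda>" "0 \<le> \<Lambda>"
  shows "Lp_on p \<Omega> f" "Lp_norm p \<Omega> f \<le> (C powr p * \<Lambda>) powr (1 / p)"
proof -
  let ?M = "lebesgue_on \<Omega>"
  have km [measurable]: "k \<in> borel_measurable borel" by fact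
  have "f \<in> borel_measurable lborel" using borel_measurable_continuous_onI[OF f] by simp
  from measurable_restrict_space1[OF measurable_completion[OF this]]
  have m: "f \<in> borel_measurable ?M" .
  have m': "(\<lambda>x. norm (f x) powr p) \<in> borel_measurable ?M"
    using measurable_compose[OF m borel_measurable_norm] unfolding powr_def by measurable
  have "(\<integral>\<^sup>+x. ennreal (norm (f x) powr p) \<partial>?M) = (\<integral>\<^sup>+x. ennreal (norm (f x) powr p) * indicator \<Omega> x \<partial>lebesgue)"
    using \<Omega> by (intro nn_integral_restrict_space) simp
  also have "\<dots> \<le> (\<integral>\<^sup>+x. ennreal (norm (f x) powr p) \<partial>lebesgue)"
    by (intro nn_integral_mono) (auto simp: indicator_def)
  also have "\<dots> = (\<integral>\<^sup>+x. ennreal (norm (f x) powr p) \<partial>lborel)" by (rule nn_integral_completion)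
  also have "\<dots> \<le> (\<integral>\<^sup>+x. ennreal (C powr p) * ennreal (k x powr p) \<partial>lborel)"
  proof (rule nn_integral_mono)
    fix x
    have "norm (f x) powr p \<le> (C * k x) powr p" using b(1)[of x] p by (intro powr_mono2) auto
    then have "norm (f x) powr p \<le> C powr p * k x powr p" by (simp add: powr_mult)
    then show "ennreal (norm (f x) powr p) \<le> ennreal (C powr p) * ennreal (k x powr p)"
      by (simp add: ennreal_mult[symmetric] ennreal_leI)
  qed
  also have "\<dots> = ennreal (C powr p) * (\<integral>\<^sup>+x. ennreal (k x powr p) \<partial>lborel)"
    by (rule nn_integral_cmult) (use km in \<open>unfold powr_def, measurable\<close>)
  also have "\<dots> \<le> ennreal (C powr p) * ennreal \<Lambda>" by (intro mult_left_mono k) simp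
  finally have le: "(\<integral>\<^sup>+x. ennreal (norm (f x) powr p) \<partial>?M) \<le> ennreal (C powr p * \<Lambda>)"
    using k(2) by (simp add: ennreal_mult)
  have int: "integrable ?M (\<lambda>x. norm (f x) powr p)"
    by (rule integrableI_nonneg[OF m']) (use le in \<open>auto intro: le_less_trans\<close>)
  then show "Lp_on p \<Omega> f" using m by (simp add: Lp_on_def)
  have "ennreal (\<integral>x. norm (f x) powr p \<partial>?M) \<le> ennreal (C powr p * \<Lambda>)"
    using le nn_integral_eq_integral[OF int] by simp
  then have "(\<integral>x. norm (f x) powr p \<partial>?M) \<le> C powr p * \<Lambda>" using k(2) by (simp add: ennreal_le_iff)
  then show "Lp_norm p \<Omega> f \<le> (C powr p * \<Lambda>) powr (1 / p)"
    unfolding Lp_norm_def using p by (intro powr_mono2) auto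
qed

text \<open>The field \<open>w powr (- \<alpha>/2 - 1) ((\<kappa> w + \<alpha> \<delta>\<^sup>2) 1 + \<alpha> y y\<^sup>T)\<close> with \<open>w = |y|\<^sup>2 + \<delta>\<^sup>2\<close> and \<open>\<kappa> = n - 1 - \<alpha>\<close>
  is exactly divergence free, for every \<open>\<delta>\<close>; only the cutoff contributes to the divergence.\<close>
lemma singular_fields:
  fixes x0 :: "real^'n::finite"
  defines "n \<equiv> real CARD('n)"
  assumes p: "1 \<le> p" and \<alpha>: "0 < \<alpha>" "\<alpha> < n - 1" "\<alpha> * p < n"
    and R: "0 < R" and \<Omega>: "open \<Omega>" "cball x0 R \<subseteq> \<Omega>"
  obtains C c0 where "0 < C" "0 < c0"
    "\<And>\<delta>. 0 < \<delta> \<Longrightarrow> \<delta> < R / 2 \<Longrightarrow> \<exists>F h. Lp_on p \<Omega> F \<and> Lp_on p \<Omega> h \<and> is_weak_div \<Omega> F h \<and>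
       (\<forall>x. F x \<in> Sym_plus) \<and> (\<forall>x. x \<notin> cball x0 R \<longrightarrow> F x = 0) \<and> Lp_norm p \<Omega> F \<le> C \<and> Lp_norm p \<Omega> h \<le> C \<and>
       (\<forall>x v. dist x0 x \<le> \<delta> \<longrightarrow> c0 * \<delta> powr (- \<alpha>) * (norm v)\<^sup>2 \<le> v \<bullet> (F x *v v))"
proof -
  define \<kappa> where "\<kappa> = n - 1 - \<alpha>"
  have \<kappa>: "\<kappa> > 0" using \<alpha> by (simp add: \<kappa>_def)
  have n0: "n > 0" by (simp add: n_def)
  have ap: "0 \<le> \<alpha> * p" "\<alpha> * p < real DIM(real^'n)" using \<alpha> p by (auto simp: n_def)
  obtain \<Lambda> where \<Lambda>: "0 \<le> \<Lambda>" "\<And>\<delta>. (\<integral>\<^sup>+x. ennreal (indicator (cball x0 R) x * ((x - x0) \<bullet> (x - x0) + \<delta>\<^sup>2) powr (- (\<alpha> * p) / 2)) \<partial>lborel) \<le> ennreal \<Lambda>"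
    using power_singularity_integral[OF ap R, of x0] by blast
  \<comment> \<open>A sum of two bounds: \<open>n * n\<close> matrix entries of size
    \<open>R^4 * (\<kappa> + 2 * \<alpha>)\<close>, and \<open>n\<close> components of the
    divergence, built from the bounds \<open>R\<close> for the coordinates, \<open>2 * R^2\<close>
    for the derivative of the cutoff and the radial profile.\<close>
  define C1 where "C1 = n * (n * (R^4 * (\<kappa> + 2 * \<alpha>))) + n * (R * (2 * R\<^sup>2) * (2 * (\<kappa> + 2 * \<alpha>)))"
  have C1: "C1 \<ge> 0" using n0 R \<kappa> \<alpha> by (simp add: C1_def)
  define C where "C = (C1 powr p * \<Lambda>) powr (1 / p) + 1"
  \<comment> \<open>On the ball of radius \<delta> < R / 2 the cutoff is at least
    \<open>(3 * R^2 / 4)^2\<close>, and \<open>w \<le> 2 * \<delta>^2\<close> gives \<open>w powr (-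
    \<alpha> / 2) \<ge> 2 powr (- \<alpha> / 2) * \<delta> powr (- \<alpha>)\<close>.\<close>
  define c0 where "c0 = (3 * R\<^sup>2 / 4)\<^sup>2 * \<kappa> * 2 powr (- \<alpha> / 2)"
  show ?thesis
  proof (rule that[of C c0])
    show "0 < C" by (simp add: C_def add_nonneg_pos)
    show "0 < c0" using R \<kappa> by (simp add: c0_def)
    fix \<delta> :: real assume \<delta>: "0 < \<delta>" "\<delta> < R / 2"
    define e where "e = - \<alpha> / 2 - 1"
    define w where "w s = s + \<delta>\<^sup>2" for s
    define u where "u s = w s powr e * (\<kappa> * w s + \<alpha> * \<delta>\<^sup>2)" for s
    define u' where "u' s = e * w s powr (e - 1) * (\<kappa> * w s + \<alpha> * \<delta>\<^sup>2) + w s powr e * \<kappa>" for s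
    define v where "v s = \<alpha> * w s powr e" for s
    define v' where "v' s = \<alpha> * (e * w s powr (e - 1))" for s
    \<comment> \<open>A polynomial cutoff in the squared distance; the square makes it continuously
      differentiable across \<open>s = R^2\<close>.\<close>
    define c where "c s = (max 0 (R\<^sup>2 - s))\<^sup>2" for s
    define c' where "c' s = - 2 * max 0 (R\<^sup>2 - s)" for s
    define U where "U s = c s * u s" for s
    define U' where "U' s = c' s * u s + c s * u' s" for s
    define V where "V s = c s * v s" for s
    define V' where "V' s = c' s * v s + c s * v' s" for s
    have w0: "0 < w s" if "0 \<le> s" for s using that \<delta> by (simp add: w_def add_nonneg_pos)
    have dw: "((\<lambda>s. w s powr a) has_real_derivative a * w s powr (a - 1)) (at s)" if "0 \<le> s" for a s
    proof -
      have "(w has_real_derivative 1) (at s)" unfolding w_def[abs_def] by (auto intro!: derivative_eq_intros)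
      from DERIV_powr[OF this w0[OF that] DERIV_const, of a] show ?thesis
        using w0[OF that] by (simp add: powr_diff mult.commute)
    qed
    have dw1: "(w has_real_derivative 1) (at s)" for s unfolding w_def[abs_def] by (auto intro!: derivative_eq_intros)
    have du: "(u has_real_derivative u' s) (at s)" if "0 \<le> s" for s
    proof -
      have "((\<lambda>s. \<kappa> * w s + \<alpha> * \<delta>\<^sup>2) has_real_derivative \<kappa>) (at s)"
        using dw1[of s] by (auto intro!: derivative_eq_intros)
      from DERIV_mult[OF dw[OF that, of e] this] show ?thesis unfolding u_def[abs_def] u'_def by (simp add: mult.commute)
    qed
    have dv: "(v has_real_derivative v' s) (at s)" if "0 \<le> s" for s
      unfolding v_def[abs_def] v'_def by (intro DERIV_cmult dw that)
    have dc: "(c has_real_derivative c' s) (at s)" for s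
    proof -
      consider "s < R\<^sup>2" | "s > R\<^sup>2" | "s = R\<^sup>2" by linarith
      then show ?thesis
      proof cases
        case 1
        have "((\<lambda>s. (R\<^sup>2 - s)\<^sup>2) has_real_derivative - 2 * (R\<^sup>2 - s)) (at s)" by (auto intro!: derivative_eq_intros)
        then have "(c has_real_derivative - 2 * (R\<^sup>2 - s)) (at s)"
          by (rule has_field_derivative_transform_within_open[of _ _ _ "{..<R\<^sup>2}"]) (use 1 in \<open>auto simp: c_def\<close>)
        then show ?thesis using 1 by (simp add: c'_def)
      next
        case 2
        have "((\<lambda>s. 0) has_real_derivative 0) (at s)" by simp
        then have "(c has_real_derivative 0) (at s)"
          by (rule has_field_derivative_transform_within_open[of _ _ _ "{R\<^sup>2<..}"]) (use 2 in \<open>auto simp: c_def\<close>)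
        then show ?thesis using 2 by (simp add: c'_def)
      next
        case 3
        have "(c has_real_derivative 0) (at s)"
        proof (rule has_derivative_0_of_quadratic_bound[where C = 1])
          fix r
          have "(max 0 (R\<^sup>2 - r))\<^sup>2 \<le> (r - R\<^sup>2)\<^sup>2"
            by (cases "r \<le> R\<^sup>2") (auto simp: power2_commute)
          then show "\<bar>c r - c s\<bar> \<le> 1 * (r - s)\<^sup>2" using 3 by (simp add: c_def)
        qed
        then show ?thesis using 3 by (simp add: c'_def)
      qed
    qed
    have dU: "(U has_real_derivative U' s) (at s)" and dV: "(V has_real_derivative V' s) (at s)" if "0 \<le> s" for s
      using DERIV_mult[OF dc[of s] du[OF that]] DERIV_mult[OF dc[of s] dv[OF that]]
      unfolding U_def[abs_def] U'_def V_def[abs_def] V'_def by (simp_all add: mult.commute)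
    \<comment> \<open>The left-hand side times \<open>y\<close> is the divergence of
      \<open>U\<close> times the identity plus \<open>V\<close> times the matrix
      \<open>y$i * y$j\<close>. The terms without \<open>c'\<close> cancel, so the divergence is no
      more singular than the field itself.\<close>
    have ident: "2 * U' s + 2 * s * V' s + (n + 1) * V s = c' s * (2 * (u s + s * v s))" if "0 \<le> s" for s
    proof -
      define P where "P = w s powr (e - 1)"
      have we: "w s powr e = w s * P" using w0[OF that] by (simp add: P_def powr_diff)
      have "2 * u' s + 2 * s * v' s + (n + 1) * v s = P * w s * (2 * \<kappa> * (e + 1) + 2 * e * \<alpha> + (n + 1) * \<alpha>)"
      proof -
        have d2: "\<delta>\<^sup>2 = w s - s" by (simp add: w_def)
        show ?thesis unfolding u'_def v'_def v_def we P_def[symmetric] d2 by (simp add: algebra_simps)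
      qed
      \<comment> \<open>With \<open>e = - \<alpha> / 2 - 1\<close> the sum is
        \<open>\<alpha> * (n - 1 - \<alpha> - \<kappa>)\<close>, which dictates the value of
        \<kappa>; positivity of \<kappa> is then the condition
        \<open>\<alpha> < n - 1\<close>.\<close>
      also have "2 * \<kappa> * (e + 1) + 2 * e * \<alpha> + (n + 1) * \<alpha> = 0" unfolding e_def \<kappa>_def by (simp add: algebra_simps)
      finally have z: "2 * u' s + 2 * s * v' s + (n + 1) * v s = 0" by simp
      have "2 * U' s + 2 * s * V' s + (n + 1) * V s
         = c' s * (2 * (u s + s * v s)) + c s * (2 * u' s + 2 * s * v' s + (n + 1) * v s)"
        unfolding U'_def V'_def V_def by (simp add: algebra_simps)
      then show ?thesis unfolding z by simp
    qed
    define sq where "sq x = (x - x0) \<bullet> (x - x0)" for x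
    have sq0: "0 \<le> sq x" for x by (simp add: sq_def)
    define I where "I i j = (if i = j then 1 else 0 :: real)" for i j :: 'n
    define F where "F x = (\<chi> i j. U (sq x) * I i j + V (sq x) * (x - x0)$i * (x - x0)$j)" for x
    define Fd where "Fd i j x = 2 * U' (sq x) * (x - x0)$j * I i j + 2 * V' (sq x) * (x - x0)$j * (x - x0)$i * (x - x0)$j
        + V (sq x) * (I i j * (x - x0)$j + (x - x0)$i)" for i j x
    define h where "h x = (\<chi> i. \<Sum>j\<in>UNIV. Fd i j x)" for x
    have dF: "((\<lambda>t. F (x + t *\<^sub>R axis j 1) $ i $ j) has_real_derivative Fd i j (x + t *\<^sub>R axis j 1)) (at t)" for i j x t
    proof -
      have dy: "((\<lambda>t. (x + t *\<^sub>R axis j 1 - x0)$k) has_real_derivative I k j) (at t)" for k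
        by (auto simp: I_def axis_def intro!: derivative_eq_intros)
      have "I j j = 1" by (simp add: I_def)
      with DERIV_add[OF DERIV_mult[OF radial_line_derivative[OF dU, of x j x0 t] DERIV_const[of "I i j"]]
        DERIV_mult[OF DERIV_mult[OF radial_line_derivative[OF dV, of x j x0 t] dy[of i]] dy[of j]]]
      show ?thesis unfolding F_def Fd_def sq_def by (simp add: algebra_simps)
    qed
    have csq: "continuous_on UNIV sq" unfolding sq_def[abs_def] by (intro continuous_intros)
    have wsq: "continuous_on UNIV (\<lambda>x. w (sq x) powr a)" for a
      unfolding w_def using w0[OF sq0] csq by (intro continuous_on_powr continuous_intros) (auto simp: w_def less_le)
    have cw: "continuous_on UNIV (\<lambda>x. w (sq x))" unfolding w_def by (intro continuous_intros csq)
    have cu: "continuous_on UNIV (\<lambda>x. u (sq x))" "continuous_on UNIV (\<lambda>x. u' (sq x))"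
      "continuous_on UNIV (\<lambda>x. v (sq x))" "continuous_on UNIV (\<lambda>x. v' (sq x))"
      "continuous_on UNIV (\<lambda>x. c (sq x))" "continuous_on UNIV (\<lambda>x. c' (sq x))"
      unfolding u_def u'_def v_def v'_def c_def c'_def by (intro continuous_intros wsq cw csq)+
    have cU: "continuous_on UNIV (\<lambda>x. U (sq x))" "continuous_on UNIV (\<lambda>x. U' (sq x))"
      "continuous_on UNIV (\<lambda>x. V (sq x))" "continuous_on UNIV (\<lambda>x. V' (sq x))"
      unfolding U_def U'_def V_def V'_def by (intro continuous_intros cu)+
    have cF: "continuous_on UNIV (\<lambda>x. F x $ i $ j)" "continuous_on UNIV (Fd i j)" for i j
      unfolding F_def Fd_def[abs_def] by (auto intro!: continuous_intros cU)
    have out: "c (sq x) = 0" "c' (sq x) = 0" if "x \<notin> cball x0 R" for x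
    proof -
      have "R \<le> norm (x - x0)" using that by (simp add: dist_norm norm_minus_commute)
      then have "R\<^sup>2 \<le> sq x" using R by (simp add: sq_def power2_norm_eq_inner[symmetric])
      then show "c (sq x) = 0" "c' (sq x) = 0" by (simp_all add: c_def c'_def)
    qed
    have F0: "F x = 0" "Fd i j x = 0" if "x \<notin> cball x0 R" for i j x
      using out[OF that] by (simp_all add: F_def Fd_def U_def V_def U'_def V'_def vec_eq_iff)
    have wd: "is_weak_div \<Omega> F h"
      unfolding h_def by (rule is_weak_div_C1[OF \<Omega>(1) dF cF bounded_cball \<Omega>(2) F0])
    have hx: "h x $ i = (x - x0)$i * (c' (sq x) * (2 * (u (sq x) + sq x * v (sq x))))" for x i
    proof -
      define y where "y = x - x0"
      have s1: "(\<Sum>j\<in>UNIV. f j * I i j) = f i" for f by (simp add: I_def if_distrib cong: if_cong)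
      have s2: "(\<Sum>j\<in>UNIV. y$j * y$j) = sq x" by (simp add: sq_def y_def inner_vec_def)
      have "Fd i j x = (2 * U' (sq x) * y$j) * I i j + 2 * V' (sq x) * y$i * (y$j * y$j) + (V (sq x) * y$j) * I i j + V (sq x) * y$i" for j
        unfolding Fd_def y_def[symmetric] by (simp add: algebra_simps)
      then have "h x $ i = (\<Sum>j\<in>UNIV. (2 * U' (sq x) * y$j) * I i j) + (\<Sum>j\<in>UNIV. 2 * V' (sq x) * y$i * (y$j * y$j))
         + (\<Sum>j\<in>UNIV. (V (sq x) * y$j) * I i j) + (\<Sum>j\<in>(UNIV::'n set). V (sq x) * y$i)"
        unfolding h_def by (simp only: vec_lambda_beta sum.distrib)
      also have "\<dots> = y$i * (2 * U' (sq x) + 2 * sq x * V' (sq x) + (n + 1) * V (sq x))"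
        unfolding s1 sum_distrib_left[symmetric] s2 by (simp add: n_def algebra_simps)
      also have "y$i = (x - x0)$i" by (simp add: y_def)
      finally show ?thesis unfolding ident[OF sq0] .
    qed
    \<comment> \<open>The common size of all profiles. It dominates both the field and its
      divergence, so one radial integral serves for both norms.\<close>
    define W where "W x = w (sq x) powr (- \<alpha> / 2)" for x
    have W0: "0 \<le> W x" for x by (simp add: W_def)
    have we: "w s powr e * w s = w s powr (- \<alpha> / 2)" if "0 \<le> s" for s
      using w0[OF that] by (simp add: e_def powr_diff)
    have ub: "0 \<le> u (sq x)" "u (sq x) \<le> (\<kappa> + \<alpha>) * W x" "\<kappa> * W x \<le> u (sq x)"
      "0 \<le> v (sq x)" "sq x * v (sq x) \<le> \<alpha> * W x" for x
    proof -
      have d: "\<delta>\<^sup>2 \<le> w (sq x)" "sq x \<le> w (sq x)" using sq0[of x] by (auto simp: w_def)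
      show "0 \<le> u (sq x)" "0 \<le> v (sq x)" using w0[OF sq0[of x]] \<kappa> \<alpha> by (simp_all add: u_def v_def)
      have "\<kappa> * w (sq x) + \<alpha> * \<delta>\<^sup>2 \<le> (\<kappa> + \<alpha>) * w (sq x)" using mult_left_mono[OF d(1), of \<alpha>] \<alpha> by (simp add: algebra_simps)
      then have "u (sq x) \<le> w (sq x) powr e * ((\<kappa> + \<alpha>) * w (sq x))" unfolding u_def by (intro mult_left_mono) auto
      also have "\<dots> = (\<kappa> + \<alpha>) * W x" unfolding W_def we[OF sq0, symmetric] by (simp add: mult_ac)
      finally show "u (sq x) \<le> (\<kappa> + \<alpha>) * W x" .
      have "\<kappa> * W x = w (sq x) powr e * (\<kappa> * w (sq x))" unfolding W_def we[OF sq0, symmetric] by (simp add: mult_ac)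
      also have "\<dots> \<le> u (sq x)" unfolding u_def using \<alpha> by (intro mult_left_mono) auto
      finally show "\<kappa> * W x \<le> u (sq x)" .
      have "sq x * v (sq x) \<le> w (sq x) * v (sq x)" using d(2) \<alpha> by (intro mult_right_mono) (auto simp: v_def)
      also have "\<dots> = \<alpha> * W x" unfolding W_def we[OF sq0, symmetric] v_def by (simp add: mult_ac)
      finally show "sq x * v (sq x) \<le> \<alpha> * W x" .
    qed
    have cb: "0 \<le> c s" "\<bar>c' s\<bar> \<le> 2 * R\<^sup>2" "c s \<le> R^4" if "0 \<le> s" for s
    proof -
      have m: "max 0 (R\<^sup>2 - s) \<le> R\<^sup>2" using that by simp
      show "0 \<le> c s" by (simp add: c_def)
      show "\<bar>c' s\<bar> \<le> 2 * R\<^sup>2" using m by (simp add: c'_def abs_mult)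
      have "c s \<le> (R\<^sup>2)\<^sup>2" unfolding c_def using m by (intro power_mono) auto
      then show "c s \<le> R^4" by simp
    qed
    have yy: "\<bar>(x - x0)$i * (x - x0)$j\<bar> \<le> sq x" for x i j
    proof -
      have "\<bar>(x - x0)$i\<bar> * \<bar>(x - x0)$j\<bar> \<le> norm (x - x0) * norm (x - x0)"
        by (intro mult_mono component_le_norm_cart) auto
      then show ?thesis by (simp add: abs_mult sq_def power2_norm_eq_inner[symmetric] power2_eq_square)
    qed
    define k where "k x = indicator (cball x0 R) x * W x" for x
    have km: "k \<in> borel_measurable borel"
    proof -
      have "W \<in> borel_measurable borel" unfolding W_def[abs_def] by (rule borel_measurable_continuous_onI[OF wsq])
      moreover have "(indicator (cball x0 R) :: real^'n \<Rightarrow> real) \<in> borel_measurable borel"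
        by (rule borel_measurable_indicator) simp
      ultimately show ?thesis unfolding k_def[abs_def] by (intro borel_measurable_times)
    qed
    have Fk: "norm (F x) \<le> C1 * k x" and hk: "norm (h x) \<le> C1 * k x" for x
    proof -
      show "norm (F x) \<le> C1 * k x"
      proof (cases "x \<in> cball x0 R")
        case True
        have Fe: "\<bar>F x $ i $ j\<bar> \<le> R^4 * (\<kappa> + 2 * \<alpha>) * W x" for i j
        proof -
          have "F x $ i $ j = c (sq x) * (u (sq x) * I i j + v (sq x) * ((x - x0)$i * (x - x0)$j))"
            by (simp add: F_def U_def V_def algebra_simps)
          then have "\<bar>F x $ i $ j\<bar> = c (sq x) * \<bar>u (sq x) * I i j + v (sq x) * ((x - x0)$i * (x - x0)$j)\<bar>"
            using cb(1)[OF sq0[of x]] by (simp add: abs_mult)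
          also have "\<bar>u (sq x) * I i j + v (sq x) * ((x - x0)$i * (x - x0)$j)\<bar> \<le> u (sq x) + v (sq x) * sq x"
          proof (rule order_trans[OF abs_triangle_ineq add_mono])
            show "\<bar>u (sq x) * I i j\<bar> \<le> u (sq x)" using ub(1)[of x] by (simp add: I_def)
            show "\<bar>v (sq x) * ((x - x0)$i * (x - x0)$j)\<bar> \<le> v (sq x) * sq x"
              using ub(4)[of x] yy[of x i j] unfolding abs_mult[of "v (sq x)"] by (simp add: mult_left_mono)
          qed
          also have "u (sq x) + v (sq x) * sq x \<le> (\<kappa> + 2 * \<alpha>) * W x" using ub(2,5)[of x] by (simp add: algebra_simps)
          finally have "\<bar>F x $ i $ j\<bar> \<le> c (sq x) * ((\<kappa> + 2 * \<alpha>) * W x)" using cb(1)[OF sq0[of x]] by (simp add: mult_left_mono)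
          also have "\<dots> \<le> R^4 * ((\<kappa> + 2 * \<alpha>) * W x)" using cb(3)[OF sq0[of x]] \<kappa> \<alpha> W0[of x] by (intro mult_right_mono) auto
          finally show ?thesis by (simp add: mult.assoc)
        qed
        have "norm (F x) \<le> (\<Sum>i\<in>(UNIV::'n set). \<Sum>j\<in>(UNIV::'n set). R^4 * (\<kappa> + 2 * \<alpha>) * W x)"
          by (rule order_trans[OF norm_matrix_le_sum]) (intro sum_mono Fe)
        also have "\<dots> = n * (n * (R^4 * (\<kappa> + 2 * \<alpha>))) * W x" by (simp add: n_def)
        also have "\<dots> \<le> C1 * W x" unfolding C1_def using n0 R \<kappa> \<alpha> W0[of x] by (intro mult_right_mono) auto
        finally show ?thesis using True by (simp add: k_def)
      qed (simp add: F0 k_def)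
      show "norm (h x) \<le> C1 * k x"
      proof (cases "x \<in> cball x0 R")
        case True
        have he: "\<bar>h x $ i\<bar> \<le> R * (2 * R\<^sup>2) * (2 * (\<kappa> + 2 * \<alpha>)) * W x" for i
        proof -
          have y: "\<bar>(x - x0)$i\<bar> \<le> R" using True component_le_norm_cart[of "x - x0" i] by (simp add: dist_norm norm_minus_commute)
          have s: "0 \<le> u (sq x) + sq x * v (sq x)" "u (sq x) + sq x * v (sq x) \<le> (\<kappa> + 2 * \<alpha>) * W x"
            using ub[of x] sq0[of x] by (simp_all add: algebra_simps)
          have "\<bar>h x $ i\<bar> = \<bar>(x - x0)$i\<bar> * (\<bar>c' (sq x)\<bar> * (2 * (u (sq x) + sq x * v (sq x))))"
            unfolding hx using s(1) by (simp add: abs_mult)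
          also have "\<dots> \<le> R * (2 * R\<^sup>2 * (2 * ((\<kappa> + 2 * \<alpha>) * W x)))"
            using y cb(2)[OF sq0[of x]] s R by (intro mult_mono) auto
          finally show ?thesis by (simp add: mult_ac)
        qed
        have "norm (h x) \<le> (\<Sum>i\<in>(UNIV::'n set). R * (2 * R\<^sup>2) * (2 * (\<kappa> + 2 * \<alpha>)) * W x)"
          by (rule order_trans[OF norm_le_l1_cart]) (intro sum_mono he)
        also have "\<dots> = n * (R * (2 * R\<^sup>2) * (2 * (\<kappa> + 2 * \<alpha>))) * W x" by (simp add: n_def)
        also have "\<dots> \<le> C1 * W x" unfolding C1_def using n0 R \<kappa> \<alpha> W0[of x] by (intro mult_right_mono) auto
        finally show ?thesis using True by (simp add: k_def)
      next
        case False
        then have "h x = 0" by (simp add: h_def F0 vec_eq_iff)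
        then show ?thesis using False by (simp add: k_def)
      qed
    qed
    have kint: "(\<integral>\<^sup>+x. ennreal (k x powr p) \<partial>lborel) \<le> ennreal \<Lambda>"
    proof -
      have "k x powr p = indicator (cball x0 R) x * ((x - x0) \<bullet> (x - x0) + \<delta>\<^sup>2) powr (- (\<alpha> * p) / 2)" for x
        using p by (cases "x \<in> cball x0 R") (simp_all add: k_def W_def w_def sq_def powr_powr)
      then show ?thesis using \<Lambda>(2)[of \<delta>] by (simp only:)
    qed
    have \<Omega>m: "\<Omega> \<in> sets lebesgue" using \<Omega> by auto
    have cFm: "continuous_on UNIV F" by (rule continuous_on_matrix[OF cF(1)])
    have chm: "continuous_on UNIV h" unfolding h_def[abs_def] by (intro continuous_on_vec_lambda continuous_on_sum cF(2))
    note LF = Lp_of_pointwise_bound[OF \<Omega>m p cFm Fk C1 km kint \<Lambda>(1)]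
    note Lh = Lp_of_pointwise_bound[OF \<Omega>m p chm hk C1 km kint \<Lambda>(1)]
    have form: "a \<bullet> (F x *v a) = U (sq x) * (norm a)\<^sup>2 + V (sq x) * ((x - x0) \<bullet> a)\<^sup>2" for a x
    proof -
      define y where "y = x - x0"
      have s1: "(\<Sum>j\<in>UNIV. f j * I i j) = f i" for f and i by (simp add: I_def if_distrib cong: if_cong)
      have "F x $ i $ j * a$i * a$j = (U (sq x) * a$i * a$j) * I i j + V (sq x) * ((y$i * a$i) * (y$j * a$j))" for i j
        unfolding F_def y_def[symmetric] by (simp add: algebra_simps)
      then have "a \<bullet> (F x *v a) = (\<Sum>i\<in>UNIV. (\<Sum>j\<in>UNIV. (U (sq x) * a$i * a$j) * I i j) + (\<Sum>j\<in>UNIV. V (sq x) * ((y$i * a$i) * (y$j * a$j))))"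
        unfolding quadratic_form_sum by (simp only: sum.distrib)
      also have "\<dots> = U (sq x) * (\<Sum>i\<in>UNIV. a$i * a$i) + V (sq x) * ((\<Sum>i\<in>UNIV. y$i * a$i) * (\<Sum>j\<in>UNIV. y$j * a$j))"
        unfolding s1 sum_product by (simp add: sum.distrib sum_distrib_left mult.assoc)
      also have "(\<Sum>i\<in>UNIV. y$i * a$i) = (x - x0) \<bullet> a" by (simp add: y_def inner_vec_def)
      finally have eq: "a \<bullet> (F x *v a) = U (sq x) * (\<Sum>i\<in>UNIV. a$i * a$i) + V (sq x) * (((x - x0) \<bullet> a) * ((x - x0) \<bullet> a))" .
      have nn: "(\<Sum>i\<in>UNIV. a$i * a$i) = (norm a)\<^sup>2" by (simp add: power2_norm_eq_inner inner_vec_def)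
      show ?thesis unfolding eq nn power2_eq_square[of "(x - x0) \<bullet> a"] ..
    qed
    have UV0: "0 \<le> U (sq x)" "0 \<le> V (sq x)" for x using cb(1)[OF sq0[of x]] ub[of x] by (simp_all add: U_def V_def)
    have psd: "F x \<in> Sym_plus" for x
    proof (rule Sym_plusI)
      show "F x $ i $ j = F x $ j $ i" for i j by (simp add: F_def I_def mult_ac)
      show "0 \<le> a \<bullet> (F x *v a)" for a unfolding form using UV0[of x] by (intro add_nonneg_nonneg mult_nonneg_nonneg) auto
    qed
    have low: "c0 * \<delta> powr (- \<alpha>) * (norm a)\<^sup>2 \<le> a \<bullet> (F x *v a)" if x: "dist x0 x \<le> \<delta>" for x a
    proof -
      have "norm (x - x0) \<le> \<delta>" using x by (simp add: dist_norm norm_minus_commute)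
      then have s: "sq x \<le> \<delta>\<^sup>2" by (simp add: sq_def power2_norm_eq_inner[symmetric] power_mono)
      have "\<delta>\<^sup>2 \<le> (R / 2)\<^sup>2" using \<delta> by (intro power_mono) auto
      then have "3 * R\<^sup>2 / 4 \<le> R\<^sup>2 - sq x" using s by (simp add: power_divide)
      then have "(3 * R\<^sup>2 / 4)\<^sup>2 \<le> c (sq x)" unfolding c_def by (intro power_mono order_trans[OF _ max.cobounded2] order_trans[OF _ max.cobounded1]) auto
      moreover have "\<kappa> * (2 powr (- \<alpha> / 2) * \<delta> powr (- \<alpha>)) \<le> u (sq x)"
      proof -
        have "(\<delta>\<^sup>2) powr (- \<alpha> / 2) = \<delta> powr (- \<alpha>)" using \<delta> by (simp add: powr_realpow[symmetric] powr_powr del: powr_numeral)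
        then have "2 powr (- \<alpha> / 2) * \<delta> powr (- \<alpha>) = (2 * \<delta>\<^sup>2) powr (- \<alpha> / 2)" by (simp add: powr_mult)
        also have "\<dots> \<le> W x" unfolding W_def using s w0[OF sq0[of x]] \<alpha> by (intro powr_mono2') (auto simp: w_def)
        finally show ?thesis using ub(3)[of x] \<kappa> by (meson mult_left_mono less_imp_le order_trans)
      qed
      ultimately have "(3 * R\<^sup>2 / 4)\<^sup>2 * (\<kappa> * (2 powr (- \<alpha> / 2) * \<delta> powr (- \<alpha>))) \<le> U (sq x)"
        unfolding U_def using \<kappa> cb(1)[OF sq0[of x]] by (intro mult_mono) auto
      then have "c0 * \<delta> powr (- \<alpha>) \<le> U (sq x)" by (simp add: c0_def mult_ac)
      then have "c0 * \<delta> powr (- \<alpha>) * (norm a)\<^sup>2 \<le> U (sq x) * (norm a)\<^sup>2" by (rule mult_right_mono) simp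
      then show ?thesis unfolding form using UV0[of x] by (simp add: add_increasing2)
    qed
    show "\<exists>F h. Lp_on p \<Omega> F \<and> Lp_on p \<Omega> h \<and> is_weak_div \<Omega> F h \<and>
       (\<forall>x. F x \<in> Sym_plus) \<and> (\<forall>x. x \<notin> cball x0 R \<longrightarrow> F x = 0) \<and> Lp_norm p \<Omega> F \<le> C \<and> Lp_norm p \<Omega> h \<le> C \<and>
       (\<forall>x v. dist x0 x \<le> \<delta> \<longrightarrow> c0 * \<delta> powr (- \<alpha>) * (norm v)\<^sup>2 \<le> v \<bullet> (F x *v v))"
      using LF Lh wd psd F0(1) low unfolding C_def
      by (intro exI[of _ F] exI[of _ h] conjI allI impI) (auto intro: order_trans)
  qed
qed

section \<open>The space of fields and its distance\<close>

lemma Lp_test_integrable: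
  fixes f :: "'a::euclidean_space \<Rightarrow> 'b::euclidean_space" and c :: "'b \<Rightarrow> real"
  assumes f: "Lp_on p \<Omega> f" "1 \<le> p" and \<Omega>: "\<Omega> \<in> sets lebesgue"
    and c: "c \<in> borel_measurable borel" "\<And>v. \<bar>c v\<bar> \<le> norm v"
    and \<psi>: "\<psi> \<in> borel_measurable borel" "\<And>x. \<bar>\<psi> x\<bar> \<le> b" "\<And>x. x \<notin> C \<Longrightarrow> \<psi> x = 0" "compact C"
  shows "integrable (lebesgue_on \<Omega>) (\<lambda>x. c (f x) * \<psi> x)"
proof -
  let ?M = "lebesgue_on \<Omega>"
  have loc: "integrable ?M (\<lambda>x. indicator C x * c (f x))"
    by (rule Lp_on_locally_integrable[where c = c, OF f borel_closed[OF compact_imp_closed[OF \<psi>(4)]] compact_imp_bounded[OF \<psi>(4)] \<Omega> c])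
  have "integrable ?M (\<lambda>x. (indicator C x * c (f x)) * \<psi> x)"
  proof (rule Bochner_Integration.integrable_bound)
    show "integrable ?M (\<lambda>x. b * \<bar>indicator C x * c (f x)\<bar>)" using loc by (intro integrable_mult_right integrable_abs)
    have "\<psi> \<in> borel_measurable ?M"
      using measurable_completion[of \<psi> lborel borel] \<psi>(1) by (intro measurable_restrict_space1) simp
    from borel_measurable_times[OF borel_measurable_integrable[OF loc] this]
    show "(\<lambda>x. (indicator C x * c (f x)) * \<psi> x) \<in> borel_measurable ?M" .
    have "\<bar>a * \<psi> x\<bar> \<le> b * \<bar>a\<bar>" for a x using mult_right_mono[OF \<psi>(2)[of x] abs_ge_zero[of a]] by (simp add: abs_mult mult.commute)
    moreover have "b * \<bar>a\<bar> \<le> norm (b * \<bar>a\<bar>)" for a by simp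
    ultimately show "AE x in ?M. norm ((indicator C x * c (f x)) * \<psi> x) \<le> norm (b * \<bar>indicator C x * c (f x)\<bar>)"
      unfolding real_norm_def by (intro AE_I2) (meson order_trans)
  qed
  moreover have "(\<lambda>x. (indicator C x * c (f x)) * \<psi> x) = (\<lambda>x. c (f x) * \<psi> x)"
  proof
    fix x show "(indicator C x * c (f x)) * \<psi> x = c (f x) * \<psi> x" using \<psi>(3)[of x] by (cases "x \<in> C") auto
  qed
  ultimately show ?thesis by simp
qed

lemma component_measurable:
  "(\<lambda>M::real^'n::finite^'m::finite. M $ i $ j) \<in> borel_measurable borel" "(\<lambda>v::real^'n::finite. v $ k) \<in> borel_measurable borel"
  by (intro borel_measurable_continuous_onI continuous_intros)+

lemma test_integrable:
  fixes A :: "real^'n::finite \<Rightarrow> real^'n^'n" and g :: "real^'n \<Rightarrow> real^'n"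
  assumes \<Omega>: "open \<Omega>" and p: "1 \<le> p" and t: "test_fun \<Omega> \<psi>"
  shows "Lp_on p \<Omega> A \<Longrightarrow> integrable (lebesgue_on \<Omega>) (\<lambda>x. A x $ i $ j * partial_deriv j \<psi> x)"
    "Lp_on p \<Omega> g \<Longrightarrow> integrable (lebesgue_on \<Omega>) (\<lambda>x. g x $ i * \<psi> x)"
proof -
  note T = test_fun_measurable[OF t]
  have \<Omega>m: "\<Omega> \<in> sets lebesgue" using \<Omega> by auto
  obtain b where b: "\<And>x. \<bar>\<psi> x\<bar> \<le> b" using T(3) by blast
  obtain b' where b': "\<And>x. \<bar>partial_deriv j \<psi> x\<bar> \<le> b'" using T(4) by blast
  show "integrable (lebesgue_on \<Omega>) (\<lambda>x. A x $ i $ j * partial_deriv j \<psi> x)" if "Lp_on p \<Omega> A"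
    by (rule Lp_test_integrable[where c = "\<lambda>M::real^'n^'n. M $ i $ j",
      OF that p \<Omega>m component_measurable(1) matrix_entry_le_norm T(2) b' T(6) T(7)])
  show "integrable (lebesgue_on \<Omega>) (\<lambda>x. g x $ i * \<psi> x)" if "Lp_on p \<Omega> g"
    by (rule Lp_test_integrable[where c = "\<lambda>v::real^'n. v $ i",
      OF that p \<Omega>m component_measurable(2) component_le_norm_cart T(1) b T(5) T(7)])
qed

text \<open>Reduces to \<open>weak_null_AE_zero\<close> in each component. It gives meaning to
  \<open>weak_div\<close>, which is an arbitrary choice among almost everywhere equal
  functions.\<close>

lemma weak_div_unique:
  fixes g g' :: "real^'n::finite \<Rightarrow> real^'n"
  assumes \<Omega>: "open \<Omega>" and p: "1 \<le> p" and g: "Lp_on p \<Omega> g" "is_weak_div \<Omega> A g" and g': "Lp_on p \<Omega> g'" "is_weak_div \<Omega> A g'"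
  shows "AE x in lebesgue_on \<Omega>. g x = g' x"
proof -
  have \<Omega>m: "\<Omega> \<in> sets lebesgue" using \<Omega> by auto
  have "AE x in lebesgue_on \<Omega>. g x $ i - g' x $ i = 0" for i
  proof (rule weak_null_AE_zero[OF \<Omega>])
    fix U :: "(real^'n) set" assume U: "U \<in> sets borel" "bounded U"
    have "integrable (lebesgue_on \<Omega>) (\<lambda>x. indicator U x * f x $ i)" if "Lp_on p \<Omega> f" for f :: "real^'n \<Rightarrow> real^'n"
      by (rule Lp_on_locally_integrable[where c = "\<lambda>v::real^'n. v $ i", OF that p U \<Omega>m component_measurable(2) component_le_norm_cart])
    from Bochner_Integration.integrable_diff[OF this[OF g(1)] this[OF g'(1)]]
    show "integrable (lebesgue_on \<Omega>) (\<lambda>x. indicator U x * (g x $ i - g' x $ i))" by (simp add: right_diff_distrib)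
  next
    fix \<psi> assume t: "test_fun \<Omega> \<psi>"
    have "(\<integral>x. (\<Sum>j\<in>UNIV. A x $ i $ j * partial_deriv j \<psi> x) \<partial>lebesgue_on \<Omega>) = - (\<integral>x. g x $ i * \<psi> x \<partial>lebesgue_on \<Omega>)"
      "(\<integral>x. (\<Sum>j\<in>UNIV. A x $ i $ j * partial_deriv j \<psi> x) \<partial>lebesgue_on \<Omega>) = - (\<integral>x. g' x $ i * \<psi> x \<partial>lebesgue_on \<Omega>)"
      using g(2) g'(2) t unfolding is_weak_div_def by blast+
    then have "(\<integral>x. g x $ i * \<psi> x \<partial>lebesgue_on \<Omega>) = (\<integral>x. g' x $ i * \<psi> x \<partial>lebesgue_on \<Omega>)" by linarith
    then show "(\<integral>x. (g x $ i - g' x $ i) * \<psi> x \<partial>lebesgue_on \<Omega>) = 0"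
      unfolding left_diff_distrib
      by (subst Bochner_Integration.integral_diff[OF test_integrable(2)[OF \<Omega> p t g(1)] test_integrable(2)[OF \<Omega> p t g'(1)]]) simp
  qed
  then have "AE x in lebesgue_on \<Omega>. \<forall>i\<in>UNIV. g x $ i - g' x $ i = 0" by (intro AE_finite_allI) auto
  then show ?thesis by eventually_elim (simp add: vec_eq_iff)
qed

lemma Lp_on_add_scale:
  fixes f g :: "'a::euclidean_space \<Rightarrow> 'b::euclidean_space"
  assumes f: "Lp_on p \<Omega> f" and g: "Lp_on p \<Omega> g" and p: "1 \<le> p"
  shows "Lp_on p \<Omega> (\<lambda>x. f x + t *\<^sub>R g x)"
proof -
  let ?M = "lebesgue_on \<Omega>"
  have m: "f \<in> borel_measurable ?M" "g \<in> borel_measurable ?M" using f g by (auto simp: Lp_on_def)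
  have ms: "(\<lambda>x. f x + t *\<^sub>R g x) \<in> borel_measurable ?M" using m by measurable
  have "integrable ?M (\<lambda>x. norm (f x + t *\<^sub>R g x) powr p)"
  proof (rule Bochner_Integration.integrable_bound)
    show "integrable ?M (\<lambda>x. 2 powr p * (norm (f x) powr p + \<bar>t\<bar> powr p * norm (g x) powr p))"
      using f g by (auto simp: Lp_on_def)
    show "(\<lambda>x. norm (f x + t *\<^sub>R g x) powr p) \<in> borel_measurable ?M"
      by (rule borel_measurable_powr_const[OF measurable_compose[OF ms borel_measurable_norm]])
    show "AE x in ?M. norm (norm (f x + t *\<^sub>R g x) powr p) \<le> norm (2 powr p * (norm (f x) powr p + \<bar>t\<bar> powr p * norm (g x) powr p))"
    proof (rule AE_I2)
      fix x
      have mx: "(max a b) powr p \<le> a powr p + b powr p" for a b :: real by (simp add: max_def)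
      have "norm (f x + t *\<^sub>R g x) \<le> norm (f x) + \<bar>t\<bar> * norm (g x)" by (metis norm_scaleR norm_triangle_ineq)
      also have "\<dots> \<le> 2 * max (norm (f x)) (\<bar>t\<bar> * norm (g x))" by simp
      finally have "norm (f x + t *\<^sub>R g x) powr p \<le> (2 * max (norm (f x)) (\<bar>t\<bar> * norm (g x))) powr p"
        using p by (intro powr_mono2) auto
      also have "\<dots> = 2 powr p * (max (norm (f x)) (\<bar>t\<bar> * norm (g x))) powr p" by (rule powr_mult)
      also have "\<dots> \<le> 2 powr p * (norm (f x) powr p + (\<bar>t\<bar> * norm (g x)) powr p)" by (intro mult_left_mono mx) simp
      finally show "norm (norm (f x + t *\<^sub>R g x) powr p) \<le> norm (2 powr p * (norm (f x) powr p + \<bar>t\<bar> powr p * norm (g x) powr p))"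
        by (simp add: powr_mult)
    qed
  qed
  with ms show ?thesis by (simp add: Lp_on_def)
qed

lemma is_weak_div_add_scale:
  fixes A F :: "real^'n::finite \<Rightarrow> real^'n^'n"
  assumes \<Omega>: "open \<Omega>" and p: "1 \<le> p" and L: "Lp_on p \<Omega> A" "Lp_on p \<Omega> F" "Lp_on p \<Omega> g" "Lp_on p \<Omega> h"
    and w: "is_weak_div \<Omega> A g" "is_weak_div \<Omega> F h"
  shows "is_weak_div \<Omega> (\<lambda>x. A x + t *\<^sub>R F x) (\<lambda>x. g x + t *\<^sub>R h x)"
  unfolding is_weak_div_def
proof (intro allI impI)
  fix \<psi> i assume T: "test_fun \<Omega> \<psi>"
  let ?M = "lebesgue_on \<Omega>"
  note I = test_integrable[OF \<Omega> p T]
  have iA: "integrable ?M (\<lambda>x. \<Sum>j\<in>UNIV. A x $ i $ j * partial_deriv j \<psi> x)" and iF: "integrable ?M (\<lambda>x. \<Sum>j\<in>UNIV. F x $ i $ j * partial_deriv j \<psi> x)"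
    using I(1)[OF L(1)] I(1)[OF L(2)] by auto
  have e1: "(\<integral>x. (\<Sum>j\<in>UNIV. A x $ i $ j * partial_deriv j \<psi> x) \<partial>?M) = - (\<integral>x. g x $ i * \<psi> x \<partial>?M)"
    "(\<integral>x. (\<Sum>j\<in>UNIV. F x $ i $ j * partial_deriv j \<psi> x) \<partial>?M) = - (\<integral>x. h x $ i * \<psi> x \<partial>?M)"
    using w T unfolding is_weak_div_def by blast+
  have "(\<integral>x. (\<Sum>j\<in>UNIV. (A x + t *\<^sub>R F x) $ i $ j * partial_deriv j \<psi> x) \<partial>?M)
     = (\<integral>x. (\<Sum>j\<in>UNIV. A x $ i $ j * partial_deriv j \<psi> x) + t * (\<Sum>j\<in>UNIV. F x $ i $ j * partial_deriv j \<psi> x) \<partial>?M)"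
    by (simp add: distrib_right sum.distrib sum_distrib_left mult.assoc)
  also have "\<dots> = (\<integral>x. (\<Sum>j\<in>UNIV. A x $ i $ j * partial_deriv j \<psi> x) \<partial>?M) + t * (\<integral>x. (\<Sum>j\<in>UNIV. F x $ i $ j * partial_deriv j \<psi> x) \<partial>?M)"
    using Bochner_Integration.integral_add[OF iA integrable_mult_right[OF iF, of t]] by simp
  also have "\<dots> = - ((\<integral>x. g x $ i * \<psi> x \<partial>?M) + t * (\<integral>x. h x $ i * \<psi> x \<partial>?M))" unfolding e1 by simp
  also have "(\<integral>x. g x $ i * \<psi> x \<partial>?M) + t * (\<integral>x. h x $ i * \<psi> x \<partial>?M) = (\<integral>x. g x $ i * \<psi> x + t * (h x $ i * \<psi> x) \<partial>?M)"
    using Bochner_Integration.integral_add[OF I(2)[OF L(3)] integrable_mult_right[OF I(2)[OF L(4)], of t]] by simp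
  also have "(\<integral>x. g x $ i * \<psi> x + t * (h x $ i * \<psi> x) \<partial>?M) = (\<integral>x. (g x + t *\<^sub>R h x) $ i * \<psi> x \<partial>?M)"
    by (simp add: distrib_right mult.assoc)
  finally show "(\<integral>x. (\<Sum>j\<in>UNIV. (A x + t *\<^sub>R F x) $ i $ j * partial_deriv j \<psi> x) \<partial>?M) = - (\<integral>x. (g x + t *\<^sub>R h x) $ i * \<psi> x \<partial>?M)" .
qed

lemma Lp_norm_scale:
  assumes "1 \<le> p" shows "Lp_norm p \<Omega> (\<lambda>x. t *\<^sub>R f x) = \<bar>t\<bar> * Lp_norm p \<Omega> f"
proof -
  have "(\<bar>t\<bar> powr p * a) powr (1 / p) = \<bar>t\<bar> * a powr (1 / p)" if "0 \<le> a" for a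
    using assms by (simp add: powr_mult powr_powr)
  then show ?thesis by (simp add: Lp_norm_def powr_mult)
qed

lemma Lp_norm_nonneg: "0 \<le> Lp_norm p \<Omega> f" by (simp add: Lp_norm_def)

text \<open>The divergence in \<open>Y_dist\<close> is selected by \<open>SOME\<close>; almost
  everywhere uniqueness identifies its norm with that of the explicit divergence
  \<open>(- t) *\<^sub>R h\<close>.\<close>

lemma Y_dist_perturbation:
  fixes A F :: "real^'n::finite \<Rightarrow> real^'n^'n"
  assumes \<Omega>: "open \<Omega>" and p: "1 \<le> p" and L: "Lp_on p \<Omega> F" "Lp_on p \<Omega> h" and w: "is_weak_div \<Omega> F h"
  shows "Y_dist p \<Omega> A (\<lambda>x. A x + t *\<^sub>R F x) = \<bar>t\<bar> * (Lp_norm p \<Omega> F + Lp_norm p \<Omega> h)"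
proof -
  have e: "(\<lambda>x. A x - (A x + t *\<^sub>R F x)) = (\<lambda>x. (- t) *\<^sub>R F x)" by simp
  have "Lp_on p \<Omega> (\<lambda>x. 0 :: real^'n)" using p by (simp add: Lp_on_def)
  from Lp_on_add_scale[OF this L(2) p, of "- t"] have Lh: "Lp_on p \<Omega> (\<lambda>x. (- t) *\<^sub>R h x)" by simp
  have wh: "is_weak_div \<Omega> (\<lambda>x. (- t) *\<^sub>R F x) (\<lambda>x. (- t) *\<^sub>R h x)"
    unfolding is_weak_div_def
  proof (intro allI impI)
    fix \<psi> i assume "test_fun \<Omega> \<psi>"
    then have "(\<integral>x. (\<Sum>j\<in>UNIV. F x $ i $ j * partial_deriv j \<psi> x) \<partial>lebesgue_on \<Omega>) = - (\<integral>x. h x $ i * \<psi> x \<partial>lebesgue_on \<Omega>)"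
      using w unfolding is_weak_div_def by blast
    then have "(\<integral>x. - t * (\<Sum>j\<in>UNIV. F x $ i $ j * partial_deriv j \<psi> x) \<partial>lebesgue_on \<Omega>) = - (\<integral>x. - t * (h x $ i * \<psi> x) \<partial>lebesgue_on \<Omega>)"
      unfolding integral_mult_right_zero by simp
    then show "(\<integral>x. (\<Sum>j\<in>UNIV. ((- t) *\<^sub>R F x) $ i $ j * partial_deriv j \<psi> x) \<partial>lebesgue_on \<Omega>)
       = - (\<integral>x. ((- t) *\<^sub>R h x) $ i * \<psi> x \<partial>lebesgue_on \<Omega>)"
      by (simp add: sum_distrib_left mult.assoc)
  qed
  define g where "g = weak_div p \<Omega> (\<lambda>x. (- t) *\<^sub>R F x)"
  have g: "Lp_on p \<Omega> g \<and> is_weak_div \<Omega> (\<lambda>x. (- t) *\<^sub>R F x) g"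
    unfolding g_def weak_div_def by (rule someI[of _ "\<lambda>x. (- t) *\<^sub>R h x"]) (use Lh wh in blast)
  then have ae: "AE x in lebesgue_on \<Omega>. g x = (- t) *\<^sub>R h x" using weak_div_unique[OF \<Omega> p _ _ Lh wh] by blast
  have "Lp_norm p \<Omega> g = Lp_norm p \<Omega> (\<lambda>x. (- t) *\<^sub>R h x)"
  proof -
    have "(\<integral>x. norm (g x) powr p \<partial>lebesgue_on \<Omega>) = (\<integral>x. norm ((- t) *\<^sub>R h x) powr p \<partial>lebesgue_on \<Omega>)"
    proof (rule integral_cong_AE)
      show "(\<lambda>x. norm (g x) powr p) \<in> borel_measurable (lebesgue_on \<Omega>)" "(\<lambda>x. norm ((- t) *\<^sub>R h x) powr p) \<in> borel_measurable (lebesgue_on \<Omega>)"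
        using g Lh unfolding Lp_on_def by (auto dest: borel_measurable_integrable)
      show "AE x in lebesgue_on \<Omega>. norm (g x) powr p = norm ((- t) *\<^sub>R h x) powr p" using ae by eventually_elim simp
    qed
    then show ?thesis unfolding Lp_norm_def by simp
  qed
  then show ?thesis
    unfolding Y_dist_def e g_def[symmetric] by (simp only: Lp_norm_scale[OF p] abs_minus_cancel distrib_left)
qed

text \<open>Convergence in L^p is L1 convergence of the p-th powers of the differences, from which a
  subsequence converges almost everywhere. Since the rate \<open>1 / (k + 1)\<close> is at most 1,
  it also bounds its own p-th power.\<close>

lemma Y_dist_AE_subseq:
  fixes A :: "real^'n::finite \<Rightarrow> real^'n^'n"
  assumes p: "1 \<le> p" and A: "Lp_on p \<Omega> A" and B: "\<And>k. Lp_on p \<Omega> (B k)" "\<And>k. Y_dist p \<Omega> A (B k) < 1 / (real k + 1)"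
  obtains r :: "nat \<Rightarrow> nat" where "AE x in lebesgue_on \<Omega>. (\<lambda>k. B (r k) x) \<longlonglongrightarrow> A x"
proof -
  let ?M = "lebesgue_on \<Omega>"
  define u where "u k x = norm (A x - B k x) powr p" for k x
  have iu: "integrable ?M (u k)" for k
    using Lp_on_add_scale[OF A B(1) p, of "- 1" k] by (simp add: u_def[abs_def] Lp_on_def)
  have le: "(\<integral>x. norm (u k x) \<partial>?M) \<le> 1 / (real k + 1)" for k
  proof -
    define J where "J = (\<integral>x. u k x \<partial>?M)"
    have J0: "0 \<le> J" unfolding J_def by (intro integral_nonneg_AE AE_I2) (simp add: u_def)
    have "J powr (1 / p) = Lp_norm p \<Omega> (\<lambda>x. A x - B k x)" by (simp add: J_def u_def Lp_norm_def)
    also have "\<dots> \<le> Y_dist p \<Omega> A (B k)" unfolding Y_dist_def by (simp add: Lp_norm_nonneg)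
    also have "\<dots> < 1 / (real k + 1)" by (rule B(2))
    finally have a: "J powr (1 / p) \<le> 1 / (real k + 1)" by simp
    have "J = (J powr (1 / p)) powr p" using J0 p by (simp add: powr_powr)
    also have "\<dots> \<le> (1 / (real k + 1)) powr p" using a p by (intro powr_mono2) auto
    also have "\<dots> \<le> (1 / (real k + 1)) powr 1" using p by (intro powr_mono') auto
    finally show ?thesis by (simp add: J_def u_def)
  qed
  have "(\<lambda>k. \<integral>x. norm (u k x) \<partial>?M) \<longlonglongrightarrow> 0"
  proof (rule tendsto_sandwich[OF _ _ tendsto_const])
    have "(\<lambda>k. 1 / real (Suc k)) \<longlonglongrightarrow> 0" by (rule LIMSEQ_Suc[OF lim_1_over_n])
    moreover have "(\<lambda>k. 1 / real (Suc k)) = (\<lambda>k. 1 / (real k + 1))" by (simp add: fun_eq_iff add.commute)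
    ultimately show "(\<lambda>k. 1 / (real k + 1)) \<longlonglongrightarrow> 0" by simp
  qed (use le in \<open>auto intro!: always_eventually\<close>)
  from tendsto_L1_AE_subseq[OF iu this] obtain r :: "nat \<Rightarrow> nat" where r: "AE x in ?M. (\<lambda>k. u (r k) x) \<longlonglongrightarrow> 0" by auto
  have "AE x in ?M. (\<lambda>k. B (r k) x) \<longlonglongrightarrow> A x"
    using r
  proof eventually_elim
    case (elim x)
    have "(\<lambda>k. u (r k) x powr (1 / p)) \<longlonglongrightarrow> 0 powr (1 / p)"
      using p elim by (intro tendsto_powr'[OF elim tendsto_const]) (auto simp: u_def)
    moreover have "u (r k) x powr (1 / p) = norm (B (r k) x - A x)" for k
      using p by (simp add: u_def powr_powr norm_minus_commute)
    ultimately have "(\<lambda>k. norm (B (r k) x - A x)) \<longlonglongrightarrow> 0" by simp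
    then have "(\<lambda>k. B (r k) x - A x) \<longlonglongrightarrow> 0" by (rule tendsto_norm_zero_cancel)
    then show ?case by (simp add: LIM_zero_iff)
  qed
  then show ?thesis by (rule that)
qed

section \<open>Sublevel sets of the determinant integral\<close>

text \<open>Valued in \<open>ennreal\<close>, so that a divergent integral counts as infinite energy
  and sublevel sets are meaningful for all members of the space.\<close>

definition det_energy :: "(real^'n::finite) set \<Rightarrow> real \<Rightarrow> real \<Rightarrow> (real^'n \<Rightarrow> real^'n^'n) \<Rightarrow> ennreal" where
  "det_energy \<Omega> a s A = (\<integral>\<^sup>+x. ennreal (norm (det (A x) powr a) powr s) \<partial>lebesgue_on \<Omega>)"

lemma Lp_on_iff_nn_integral:
  "Lp_on s \<Omega> f \<longleftrightarrow> f \<in> borel_measurable (lebesgue_on \<Omega>) \<and> (\<integral>\<^sup>+x. ennreal (norm (f x) powr s) \<partial>lebesgue_on \<Omega>) < \<infinity>"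
proof (cases "f \<in> borel_measurable (lebesgue_on \<Omega>)")
  case True
  have "(\<lambda>x. norm (f x) powr s) \<in> borel_measurable (lebesgue_on \<Omega>)"
    by (rule borel_measurable_powr_const[OF measurable_compose[OF True borel_measurable_norm]])
  with True show ?thesis by (simp add: Lp_on_def integrable_iff_bounded)
qed (simp add: Lp_on_def)

text \<open>From \<open>y powr s \<le> y powr q + y powr q'\<close>. It allows an arbitrary excess
  over the critical exponent to be lowered to some \<open>1 / (m + 1)\<close>, which keeps the union
  of exceptional sets countable.\<close>

lemma Lp_on_interpolate:
  assumes "Lp_on q \<Omega> f" "Lp_on q' \<Omega> f" "q \<le> s" "s \<le> q'"
  shows "Lp_on s \<Omega> f"
proof -
  let ?M = "lebesgue_on \<Omega>"
  have m: "f \<in> borel_measurable ?M" using assms by (simp add: Lp_on_def)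
  have "integrable ?M (\<lambda>x. norm (f x) powr s)"
  proof (rule Bochner_Integration.integrable_bound)
    show "integrable ?M (\<lambda>x. norm (f x) powr q + norm (f x) powr q')" using assms by (simp add: Lp_on_def)
    show "(\<lambda>x. norm (f x) powr s) \<in> borel_measurable ?M"
      by (rule borel_measurable_powr_const[OF measurable_compose[OF m borel_measurable_norm]])
    have "y powr s \<le> y powr q + y powr q'" if "0 \<le> y" for y :: real
    proof (cases "y \<le> 1")
      case True
      then have "y powr s \<le> y powr q" using that assms(3) by (intro powr_mono') auto
      then show ?thesis by (simp add: add_increasing2)
    next
      case False
      then have "y powr s \<le> y powr q'" using assms(4) by (intro powr_mono) auto
      then show ?thesis by (simp add: add_increasing)
    qed
    then show "AE x in ?M. norm (norm (f x) powr s) \<le> norm (norm (f x) powr q + norm (f x) powr q')" by (intro AE_I2) simp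
  qed
  with m show ?thesis by (simp add: Lp_on_def)
qed

lemma det_energy_finite_iff:
  assumes "Lp_on p \<Omega> A"
  shows "Lp_on s \<Omega> (\<lambda>x. det (A x) powr a) \<longleftrightarrow> (\<exists>l::nat. det_energy \<Omega> a s A \<le> ennreal (real l))"
proof -
  have m: "(\<lambda>x. det (A x) powr a) \<in> borel_measurable (lebesgue_on \<Omega>)"
    using assms by (intro borel_measurable_det_powr) (simp add: Lp_on_def)
  have "e < \<infinity> \<longleftrightarrow> (\<exists>l::nat. e \<le> ennreal (real l))" for e :: ennreal
  proof
    assume "e < \<infinity>"
    then obtain r where r: "e = ennreal r" by (cases e) auto
    obtain l :: nat where "r \<le> real l" using real_arch_simple by blast
    then show "\<exists>l::nat. e \<le> ennreal (real l)" using r by (auto intro!: exI[of _ l] ennreal_leI)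
  qed (auto intro: le_less_trans)
  from this[of "det_energy \<Omega> a s A"] show ?thesis using m unfolding Lp_on_iff_nn_integral det_energy_def by simp
qed

lemma det_energy_sublevel_closed:
  fixes \<Omega> K :: "(real^'n::finite) set"
  assumes p: "1 \<le> p" and a: "0 < a" and s: "0 < s"
  shows "closed_wrt (Y_space p \<Omega> K Abar) (Y_dist p \<Omega>) {A \<in> Y_space p \<Omega> K Abar. det_energy \<Omega> a s A \<le> L}"
  unfolding closed_wrt_def
proof (intro conjI ballI impI)
  let ?M = "lebesgue_on \<Omega>"
  let ?Y = "Y_space p \<Omega> K Abar"
  let ?F = "{A \<in> ?Y. det_energy \<Omega> a s A \<le> L}"
  show "?F \<subseteq> ?Y" by blast
  fix A assume A: "A \<in> ?Y" and ap: "\<forall>e>0. \<exists>B\<in>?F. Y_dist p \<Omega> A B < e"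
  have "\<exists>B. B \<in> ?F \<and> Y_dist p \<Omega> A B < 1 / (real k + 1)" for k
    using ap[rule_format, of "1 / (real k + 1)"] by fastforce
  then have "\<forall>k. \<exists>B. B \<in> ?F \<and> Y_dist p \<Omega> A B < 1 / (real k + 1)" by (rule allI)
  from choice[OF this] obtain B where BB: "\<forall>k. B k \<in> ?F \<and> Y_dist p \<Omega> A (B k) < 1 / (real k + 1)" ..
  have B: "B k \<in> ?F" "Y_dist p \<Omega> A (B k) < 1 / (real k + 1)" for k using spec[OF BB, of k] by blast+
  have BL: "Lp_on p \<Omega> (B k)" and BS: "AE x in ?M. B k x \<in> Sym_plus" and BE: "det_energy \<Omega> a s (B k) \<le> L" for k
    using B(1)[of k] by (simp_all add: Y_space_def)
  have AL: "Lp_on p \<Omega> A" using A by (simp add: Y_space_def)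
  obtain r :: "nat \<Rightarrow> nat" where r: "AE x in ?M. (\<lambda>k. B (r k) x) \<longlonglongrightarrow> A x"
    using Y_dist_AE_subseq[where A = A and B = B, OF p AL BL B(2)] by blast
  have S: "AE x in ?M. \<forall>k. B (r k) x \<in> Sym_plus" unfolding AE_all_countable using BS by blast
  define g where "g k x = ennreal (norm (det (B (r k) x) powr a) powr s)" for k x
  have mg: "g k \<in> borel_measurable ?M" for k
  proof -
    have "B (r k) \<in> borel_measurable ?M" using BL[of "r k"] by (simp add: Lp_on_def)
    from borel_measurable_powr_const[OF measurable_compose[OF borel_measurable_det_powr[OF this, of a] borel_measurable_norm], of s]
    show ?thesis unfolding g_def[abs_def] by (rule measurable_compose[OF _ measurable_ennreal])
  qed
  have "det_energy \<Omega> a s A \<le> (\<integral>\<^sup>+x. liminf (\<lambda>k. g k x) \<partial>?M)"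
    unfolding det_energy_def
  proof (rule nn_integral_mono_AE)
    show "AE x in ?M. ennreal (norm (det (A x) powr a) powr s) \<le> liminf (\<lambda>k. g k x)"
      using r S
    proof eventually_elim
      fix x assume x: "(\<lambda>k. B (r k) x) \<longlonglongrightarrow> A x" and S: "\<forall>k. B (r k) x \<in> Sym_plus"
      \<comment> \<open>Nonnegative determinants make \<open>powr\<close> continuous along the
        sequence, also where the limit is 0.\<close>
      have "(\<lambda>k. det (B (r k) x) powr a) \<longlonglongrightarrow> det (A x) powr a"
        using S a by (intro tendsto_powr'[OF tendsto_det[OF x] tendsto_const]) (auto intro!: always_eventually det_Sym_plus_nonneg)
      then have "(\<lambda>k. norm (det (B (r k) x) powr a) powr s) \<longlonglongrightarrow> norm (det (A x) powr a) powr s"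
        using s by (intro tendsto_powr'[OF tendsto_norm tendsto_const]) auto
      then have "(\<lambda>k. g k x) \<longlonglongrightarrow> ennreal (norm (det (A x) powr a) powr s)" unfolding g_def by (rule tendsto_ennrealI)
      from lim_imp_Liminf[OF trivial_limit_sequentially this]
      show "ennreal (norm (det (A x) powr a) powr s) \<le> liminf (\<lambda>k. g k x)" by simp
    qed
  qed
  also have "\<dots> \<le> liminf (\<lambda>k. \<integral>\<^sup>+x. g k x \<partial>?M)" by (rule nn_integral_liminf[OF mg])
  also have "\<dots> \<le> liminf (\<lambda>_::nat. L)"
    using BE by (intro Liminf_mono always_eventually allI) (simp add: g_def det_energy_def)
  also have "\<dots> = L" by (simp add: Liminf_const)
  finally show "A \<in> ?F" using A by simp
qed

text \<open>The exponent \<open>\<alpha>\<close> measures the strength of the added point singularity; its mass in the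
  \<open>s\<close>-energy diverges as the regularisation radius \<open>\<delta>\<close> tends to zero because \<open>\<alpha> * s > n - 1\<close>.\<close>
lemma det_energy_perturbation:
  fixes \<Omega> K :: "(real^'n::finite) set"
  defines "n \<equiv> real CARD('n)"
  assumes p: "1 \<le> p" and \<Omega>: "open \<Omega>" and K: "K \<subseteq> \<Omega>" "interior K \<noteq> {}"
    and \<alpha>: "0 < \<alpha>" "\<alpha> < n - 1" "\<alpha> * p < n" "n - 1 < \<alpha> * s"
    and A: "A \<in> Y_space p \<Omega> K Abar" and e: "0 < e" and l: "0 \<le> l"
  obtains B where "B \<in> Y_space p \<Omega> K Abar" "Y_dist p \<Omega> A B < e" "ennreal l < det_energy \<Omega> (1 / (n - 1)) s B"
proof -
  note result = that
  let ?M = "lebesgue_on \<Omega>"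
  obtain x0 R where R: "0 < R" "cball x0 R \<subseteq> interior K"
  proof -
    obtain x0 where "x0 \<in> interior K" using K(2) by blast
    then show ?thesis using that open_contains_cball[of "interior K"] by auto
  qed
  have RK: "cball x0 R \<subseteq> K" "cball x0 R \<subseteq> \<Omega>" using R(2) interior_subset[of K] K(1) by blast+
  obtain C c0 where C: "0 < C" "0 < c0" and sf:
    "\<And>\<delta>. 0 < \<delta> \<Longrightarrow> \<delta> < R / 2 \<Longrightarrow> \<exists>F h. Lp_on p \<Omega> F \<and> Lp_on p \<Omega> h \<and> is_weak_div \<Omega> F h \<and>
       (\<forall>x. F x \<in> Sym_plus) \<and> (\<forall>x. x \<notin> cball x0 R \<longrightarrow> F x = 0) \<and> Lp_norm p \<Omega> F \<le> C \<and> Lp_norm p \<Omega> h \<le> C \<and>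
       (\<forall>x v. dist x0 x \<le> \<delta> \<longrightarrow> c0 * \<delta> powr (- \<alpha>) * (norm v)\<^sup>2 \<le> v \<bullet> (F x *v v))"
    using singular_fields[OF p \<alpha>(1) \<alpha>(2)[unfolded n_def] \<alpha>(3)[unfolded n_def] R(1) \<Omega> RK(2)] by blast
  have n1: "n - 1 > 0" using \<alpha> by linarith
  have s0: "s > 0" using \<alpha>(1,4) n1 by (smt (verit) mult_nonneg_nonpos)
  \<comment> \<open>Field and divergence have norm at most \<open>C\<close>, so the perturbation has
    size at most \<open>2 * C * t = e / 2\<close>, whatever \<delta> is; this leaves \<delta> free
    for the energy.\<close>
  define t where "t = e / (4 * C)"
  have t: "t > 0" using e C by (simp add: t_def)
  \<comment> \<open>On the ball of radius \<delta> the perturbed form is at least a multiple of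
    \<open>\<delta> powr (- \<alpha>)\<close>, hence the energy density at least a multiple of
    \<open>\<delta> powr (- \<alpha> * \<beta>)\<close>. The volume of the ball leaves
    \<open>\<delta> powr (- \<gamma>)\<close>, and \<open>\<gamma> > 0\<close> is the condition
    \<open>\<alpha> * s > n - 1\<close>.\<close>
  define \<beta> where "\<beta> = n * (1 / (n - 1)) * s"
  define \<gamma> where "\<gamma> = \<alpha> * \<beta> - n"
  have "n * (n - 1) < n * (\<alpha> * s)" using \<alpha>(4) n1 by (intro mult_strict_left_mono) auto
  then have \<gamma>: "\<gamma> > 0" using n1 by (simp add: \<gamma>_def \<beta>_def field_simps)
  define V where "V = unit_ball_vol n"
  have V: "V > 0" using n1 by (simp add: V_def)
  define X where "X = (t * c0) powr \<beta> * V"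
  have X: "X > 0" using t C V by (simp add: X_def)
  \<comment> \<open>Chosen so that \<open>X * \<delta> powr (- \<gamma>) \<ge> l + 1\<close>; the
    minimum with \<open>R / 4\<close> meets the condition \<delta> < R / 2.\<close>
  define \<delta> where "\<delta> = min (R / 4) (((l + 1) / X) powr (- 1 / \<gamma>))"
  have \<delta>: "0 < \<delta>" "\<delta> < R / 2" using R X l by (auto simp: \<delta>_def min_def)
  have big: "l + 1 \<le> X * \<delta> powr (- \<gamma>)"
  proof -
    have "(l + 1) / X = (((l + 1) / X) powr (- 1 / \<gamma>)) powr (- \<gamma>)" using \<gamma> X l by (simp add: powr_powr)
    also have "\<dots> \<le> \<delta> powr (- \<gamma>)" using \<gamma> \<delta> by (intro powr_mono2') (auto simp: \<delta>_def)
    finally show ?thesis using X by (simp add: field_simps)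
  qed
  obtain F h where F: "Lp_on p \<Omega> F" "Lp_on p \<Omega> h" "is_weak_div \<Omega> F h" "\<And>x. F x \<in> Sym_plus" "\<And>x. x \<notin> cball x0 R \<Longrightarrow> F x = 0"
    "Lp_norm p \<Omega> F \<le> C" "Lp_norm p \<Omega> h \<le> C" "\<And>x v. dist x0 x \<le> \<delta> \<Longrightarrow> c0 * \<delta> powr (- \<alpha>) * (norm v)\<^sup>2 \<le> v \<bullet> (F x *v v)"
    using sf[OF \<delta>] by blast
  define B where "B x = A x + t *\<^sub>R F x" for x
  from A obtain g where AL: "Lp_on p \<Omega> A" and AS: "AE x in ?M. A x \<in> Sym_plus"
    and g: "Lp_on p \<Omega> g" "is_weak_div \<Omega> A g" and AK: "AE x in ?M. x \<notin> K \<longrightarrow> A x = Abar"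
    unfolding Y_space_def by blast
  have "B \<in> Y_space p \<Omega> K Abar"
    unfolding Y_space_def mem_Collect_eq
  proof (intro conjI)
    show "Lp_on p \<Omega> B" unfolding B_def[abs_def] by (rule Lp_on_add_scale[OF AL F(1) p])
    show "AE x in ?M. B x \<in> Sym_plus"
      using AS by eventually_elim (use F(4) t in \<open>simp add: B_def Sym_plus_add Sym_plus_scaleR\<close>)
    show "\<exists>g. Lp_on p \<Omega> g \<and> is_weak_div \<Omega> B g"
      unfolding B_def[abs_def]
      using Lp_on_add_scale[OF g(1) F(2) p] is_weak_div_add_scale[OF \<Omega> p AL F(1) g(1) F(2) g(2) F(3)] by blast
    show "AE x in ?M. x \<notin> K \<longrightarrow> B x = Abar"
      using AK
    proof eventually_elim
      case (elim x)
      show ?case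
      proof
        assume x: "x \<notin> K"
        then have "F x = 0" using F(5) RK(1) by blast
        then show "B x = Abar" using elim x by (simp add: B_def)
      qed
    qed
  qed
  moreover have "Y_dist p \<Omega> A B < e"
  proof -
    have "Y_dist p \<Omega> A B = t * (Lp_norm p \<Omega> F + Lp_norm p \<Omega> h)"
      using Y_dist_perturbation[OF \<Omega> p F(1,2,3), of A t] t unfolding B_def[abs_def] by simp
    also have "\<dots> \<le> t * (C + C)" using F(6,7) t by (intro mult_left_mono add_mono) auto
    also have "\<dots> < e" using e C by (simp add: t_def)
    finally show ?thesis .
  qed
  moreover have "ennreal l < det_energy \<Omega> (1 / (n - 1)) s B"
  proof -
    define c where "c = t * (c0 * \<delta> powr (- \<alpha>))"
    have c: "c > 0" using t C \<delta> by (simp add: c_def)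
    have cb: "cball x0 \<delta> \<subseteq> \<Omega>" using RK(2) \<delta> by auto
    have \<Omega>m: "\<Omega> \<in> sets lebesgue" using \<Omega> by auto
    have em: "emeasure ?M (cball x0 \<delta>) = ennreal (V * \<delta> powr n)"
    proof -
      have "emeasure ?M (cball x0 \<delta>) = emeasure lborel (cball x0 \<delta>)"
        using cb \<Omega>m by (subst emeasure_restrict_space) auto
      also have "\<dots> = ennreal (V * \<delta> powr n)"
        using \<delta> by (subst emeasure_cball) (auto simp: V_def n_def powr_realpow)
      finally show ?thesis .
    qed
    have sm: "cball x0 \<delta> \<in> sets ?M" using cb \<Omega>m by (simp add: sets_restrict_space_iff)
    have "l < X * \<delta> powr (- \<gamma>)" using big by simp
    also have "\<dots> = c powr \<beta> * (V * \<delta> powr n)"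
    proof -
      have "c powr \<beta> = (t * c0) powr \<beta> * \<delta> powr (- \<alpha> * \<beta>)" using t C \<delta>
        by (simp add: c_def powr_mult powr_powr)
      moreover have "\<delta> powr (- \<gamma>) = \<delta> powr (- \<alpha> * \<beta>) * \<delta> powr n" unfolding powr_add[symmetric] by (simp add: \<gamma>_def)
      ultimately show ?thesis by (simp add: X_def)
    qed
    finally have "ennreal l < ennreal (c powr \<beta> * (V * \<delta> powr n))" using l by (intro ennreal_lessI) auto
    also have "\<dots> = (\<integral>\<^sup>+x. ennreal (c powr \<beta>) * indicator (cball x0 \<delta>) x \<partial>?M)"
      using V by (subst nn_integral_cmult_indicator[OF sm]) (simp add: em ennreal_mult)
    also have "\<dots> \<le> det_energy \<Omega> (1 / (n - 1)) s B"
      unfolding det_energy_def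
    proof (rule nn_integral_mono_AE)
      show "AE x in ?M. ennreal (c powr \<beta>) * indicator (cball x0 \<delta>) x \<le> ennreal (norm (det (B x) powr (1 / (n - 1))) powr s)"
        using AS
      proof eventually_elim
        fix x assume x: "A x \<in> Sym_plus"
        show "ennreal (c powr \<beta>) * indicator (cball x0 \<delta>) x \<le> ennreal (norm (det (B x) powr (1 / (n - 1))) powr s)"
        proof (cases "x \<in> cball x0 \<delta>")
          case True
          have BS: "B x \<in> Sym_plus" using x F(4) t by (simp add: B_def Sym_plus_add Sym_plus_scaleR)
          have "c * (norm v)\<^sup>2 \<le> v \<bullet> (B x *v v)" for v
          proof -
            have "c0 * \<delta> powr (- \<alpha>) * (norm v)\<^sup>2 \<le> v \<bullet> (F x *v v)" using F(8) True by simp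
            from mult_left_mono[OF this, of t] have "c * (norm v)\<^sup>2 \<le> t * (v \<bullet> (F x *v v))" using t by (simp add: c_def mult.assoc)
            \<comment> \<open>\<open>A x\<close> can only raise the form, so the lower bound
              persists where \<open>A\<close> degenerates.\<close>
            also have "\<dots> \<le> v \<bullet> (A x *v v) + t * (v \<bullet> (F x *v v))" using x by (simp add: Sym_plus_def)
            also have "\<dots> = v \<bullet> (B x *v v)"
              by (simp add: B_def matrix_vector_mult_add_rdistrib inner_add_right scaleR_matrix_vector_assoc[symmetric])
            finally show ?thesis .
          qed
          from det_ge_power[OF BS less_imp_le[OF c] this] have d: "c powr n \<le> det (B x)"
            using c by (simp add: n_def powr_realpow)
          have "c powr \<beta> = ((c powr n) powr (1 / (n - 1))) powr s" by (simp add: powr_powr \<beta>_def)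
          also have "\<dots> \<le> (det (B x) powr (1 / (n - 1))) powr s" using d n1 s0 by (intro powr_mono2) auto
          finally show ?thesis using True by (simp add: ennreal_leI)
        qed simp
      qed
    qed
    finally show ?thesis .
  qed
  ultimately show ?thesis by (rule result)
qed

theorem theorem2p1:
  fixes p :: real and \<Omega> K :: "(real^'n::finite) set" and Abar :: "real^'n^'n"
  assumes "CARD('n) \<ge> 2"
    and "1 \<le> p"
    and "open \<Omega>"
    and "compact K" and "K \<subseteq> \<Omega>" and "closure (interior K) = K" and "K \<noteq> {}"
    and "Abar \<in> Sym_plus"
  shows "let n = real CARD('n);
             pstar = max 0 ((p * (n - 1) - n) / (p * (n - 1)));
             q = 1 / (1 - pstar);
             Y = Y_space p \<Omega> K Abar
         in residual_wrt Y (Y_dist p \<Omega>)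
              {A \<in> Y. Lp_on q \<Omega> (\<lambda>x. det (A x) powr (1 / (n - 1)))
                   \<and> (\<forall>\<epsilon>>0. \<not> Lp_on (q + \<epsilon>) \<Omega> (\<lambda>x. det (A x) powr (1 / (n - 1))))}"
proof -
  define n where "n = real CARD('n)"
  define ps where "ps = max 0 ((p * (n - 1) - n) / (p * (n - 1)))"
  define q where "q = 1 / (1 - ps)"
  define Y where "Y = Y_space p \<Omega> K Abar"
  define D where "D = {A \<in> Y. Lp_on q \<Omega> (\<lambda>x. det (A x) powr (1 / (n - 1)))
                   \<and> (\<forall>\<epsilon>>0. \<not> Lp_on (q + \<epsilon>) \<Omega> (\<lambda>x. det (A x) powr (1 / (n - 1))))}"
  \<comment> \<open>One natural number encodes the pair of excess exponent
    \<open>1 / (m + 1)\<close> and energy level \<open>l\<close>.\<close>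
  define F where "F k = (case prod_decode k of (m, l) \<Rightarrow>
     {A \<in> Y. det_energy \<Omega> (1 / (n - 1)) (q + 1 / (real m + 1)) A \<le> ennreal (real l)})" for k
  have n: "n \<ge> 2" using assms(1) by (simp add: n_def)
  have pn: "p * (n - 1) > 0" using n assms(2) by simp
  have ps: "0 \<le> ps" "ps < 1" "(p * (n - 1) - n) / (p * (n - 1)) \<le> ps"
    using pn n by (auto simp: ps_def)
  have q1: "1 \<le> q" using ps by (simp add: q_def)
  \<comment> \<open>Equivalently \<open>q \<ge> p * (n - 1) / n\<close>: for every
    \<open>b > q\<close> a singularity of order \<open>(n - 1) / b\<close> is integrable to the
    power \<open>p\<close>.\<close>
  have qp: "p * (n - 1) \<le> q * n"
  proof -
    have "p * (n - 1) - n \<le> ps * (p * (n - 1))" using ps(3) pn by (simp add: pos_divide_le_eq)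
    moreover have "p * (n - 1) * (1 - ps) = p * (n - 1) - ps * (p * (n - 1))" by (simp add: algebra_simps)
    ultimately have "p * (n - 1) * (1 - ps) \<le> n" by linarith
    then show ?thesis using ps(2) by (simp add: q_def pos_le_divide_eq)
  qed
  have iK: "interior K \<noteq> {}" using assms(6,7) by force
  have YL: "Lp_on p \<Omega> A" if "A \<in> Y" for A using that by (simp add: Y_def Y_space_def)
  have Dq: "Lp_on q \<Omega> (\<lambda>x. det (A x) powr (1 / (n - 1)))" if "A \<in> Y" for A
    using det_Lq[OF assms(1-5) that[unfolded Y_def]] unfolding q_def ps_def n_def .
  have U: "Y - D = (\<Union>k. F k)"
  proof (intro equalityI subsetI)
    fix A assume "A \<in> Y - D"
    then have A: "A \<in> Y" "A \<notin> D" by auto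
    then obtain \<epsilon> where \<epsilon>: "\<epsilon> > 0" "Lp_on (q + \<epsilon>) \<Omega> (\<lambda>x. det (A x) powr (1 / (n - 1)))"
      using Dq unfolding D_def by blast
    obtain m where m: "1 / (real m + 1) < \<epsilon>" using nat_approx_posE[OF \<epsilon>(1)] by (metis of_nat_Suc add.commute)
    have "Lp_on (q + 1 / (real m + 1)) \<Omega> (\<lambda>x. det (A x) powr (1 / (n - 1)))"
      using m by (intro Lp_on_interpolate[OF Dq[OF A(1)] \<epsilon>(2)]) auto
    then obtain l :: nat where "det_energy \<Omega> (1 / (n - 1)) (q + 1 / (real m + 1)) A \<le> ennreal (real l)"
      unfolding det_energy_finite_iff[OF YL[OF A(1)]] by blast
    then have "A \<in> F (prod_encode (m, l))" using A(1) by (simp add: F_def)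
    then show "A \<in> (\<Union>k. F k)" by blast
  next
    fix A assume "A \<in> (\<Union>k. F k)"
    then obtain k where "A \<in> F k" by blast
    then obtain m l where A: "A \<in> Y" "det_energy \<Omega> (1 / (n - 1)) (q + 1 / (real m + 1)) A \<le> ennreal (real l)"
      by (auto simp: F_def split: prod.splits)
    from A have "Lp_on (q + 1 / (real m + 1)) \<Omega> (\<lambda>x. det (A x) powr (1 / (n - 1)))"
      using det_energy_finite_iff[OF YL[OF A(1)]] by blast
    moreover have "1 / (real m + 1) > 0" by simp
    ultimately have "A \<notin> D" unfolding D_def by blast
    with A(1) show "A \<in> Y - D" by blast
  qed
  have cl: "closed_wrt Y (Y_dist p \<Omega>) (F k)" for k
  proof -
    obtain m l where k: "prod_decode k = (m, l)" by (cases "prod_decode k")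
    have "0 < 1 / (n - 1)" "0 < q + 1 / (real m + 1)" using n q1 by (simp_all add: add_pos_pos)
    from det_energy_sublevel_closed[OF assms(2) this] show ?thesis by (simp add: F_def k Y_def)
  qed
  have ei: "empty_interior_wrt Y (Y_dist p \<Omega>) (F k)" for k
    unfolding empty_interior_wrt_def
  proof (intro ballI allI impI)
    fix A and e :: real assume A: "A \<in> F k" and e: "0 < e"
    obtain m l where k: "prod_decode k = (m, l)" by (cases "prod_decode k")
    have AY: "A \<in> Y" using A by (simp add: F_def k)
    define s where "s = q + 1 / (real m + 1)"
    \<comment> \<open>The midpoint of \<open>q\<close> and \<open>s\<close>. With
      \<open>\<alpha> = (n - 1) / b\<close> the upper bounds on \<alpha> follow from
      \<open>b > q\<close> and the divergence of the energy from \<open>b < s\<close>.\<close>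
    define b where "b = q + 1 / (2 * (real m + 1))"
    have b: "q < b" "b < s" by (auto simp: s_def b_def divide_strict_left_mono)
    define \<alpha> where "\<alpha> = (n - 1) / b"
    have b0: "b > 1" using b q1 by linarith
    have \<alpha>: "0 < \<alpha>" "\<alpha> < n - 1" "\<alpha> * p < n" "n - 1 < \<alpha> * s"
    proof -
      show "0 < \<alpha>" using n b0 by (simp add: \<alpha>_def)
      show "\<alpha> < n - 1" using n b0 by (simp add: \<alpha>_def pos_divide_less_eq)
      have "p * (n - 1) < b * n" using qp b n by (smt (verit) mult_strict_right_mono)
      then show "\<alpha> * p < n" using b0 by (simp add: \<alpha>_def pos_divide_less_eq mult.commute)
      have "(n - 1) * b < (n - 1) * s" using n b by (intro mult_strict_left_mono) auto
      then show "n - 1 < \<alpha> * s" using b0 by (simp add: \<alpha>_def pos_less_divide_eq)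
    qed
    obtain B where B: "B \<in> Y" "Y_dist p \<Omega> A B < e" "ennreal (real l) < det_energy \<Omega> (1 / (n - 1)) s B"
      using det_energy_perturbation[OF assms(2,3,5) iK \<alpha>[unfolded n_def] AY[unfolded Y_def] e, of "real l"]
      unfolding Y_def[symmetric] n_def[symmetric] by (metis of_nat_0_le_iff)
    then have "B \<in> Y - F k" by (simp add: F_def k s_def[symmetric] not_le)
    with B(2) show "\<exists>B\<in>Y - F k. Y_dist p \<Omega> A B < e" by blast
  qed
  have "residual_wrt Y (Y_dist p \<Omega>) D"
    unfolding residual_wrt_def
  proof (intro conjI exI[of _ F] allI)
    show "D \<subseteq> Y" unfolding D_def by (rule Collect_restrict)
  qed (fact U cl ei)+
  then show ?thesis unfolding Let_def D_def Y_def q_def ps_def n_def .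
qed

end
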